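(* The algebra $\mathcal{Y}_{r,n}(q)$ is a free $R$-module with basis $$\mathcal{B}_{r,n}=\{m_{\mathfrak{s}\mathfrak{t}}\mid \mathfrak{s},\mathfrak{t}\in\mathrm{Std}(\boldsymbol\lambda)\text{ for some }r\text{-multipartition }\boldsymbol\lambda\text{ of }n\}.$$ Moreover, $(\mathcal{B}_{r,n},\mathrm{Par}_{r,n})$ is a cellular basis of $\mathcal{Y}_{r,n}(q)$, where $\mathrm{Par}_{r,n}$ is the poset of $r$-multipartitions of $n$ under the dominance order $\unrhd$, the index set attached to $\boldsymbol\lambda$ is $\mathrm{Std}(\boldsymbol\lambda)$, and the anti-automorphism is $*$.
   Context: **Algebra.** Let $n,r\ge 1$ be integers, $\xi=e^{2\pi i/r}\in\mathbb{C}$, $\Delta=\prod_{0\le i<j\le r-1}(\xi^i-\xi^j)$, $q$ an indeterminate and $R=\mathbb{Z}[q,q^{-1},\xi,r^{-1},\Delta^{-1}]$. The symmetric group $\mathfrak{S}_n$ acts on the right on $\{1,\dots,n\}$ (products composed left to right), $s_i=(i,i+1)$, $\ell$ is the length function. The Yokonuma-Hecke algebra $\mathcal{Y}_{r,n}(q)$ is the associative unital $R$-algebra generated by $g_1,\dots,g_{n-1},t_1,\dots,t_n$ with relations: $t_i^r=1$; $t_it_j=t_jt_i$; $t_jg_i=g_it_{js_i}$; $g_ig_j=g_jg_i$ for $|i-j|>1$; $g_ig_{i+1}g_i=g_{i+1}g_ig_{i+1}$; $g_i^2=1+(q-q^{-1})e_ig_i$, where $e_i=\frac1r\sum_{s=0}^{r-1}t_i^st_{i+1}^{-s}$.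 For $w=s_{i_1}\cdots s_{i_k}$ reduced put $g_w=g_{i_1}\cdots g_{i_k}$ (well defined). $*$ is the $R$-linear anti-automorphism with $g_i^*=g_i$, $t_k^*=t_k$. Put $e_{ij}=\frac1r\sum_{s=0}^{r-1}t_i^st_j^{-s}$; for $\emptyset\ne I\subseteq\{1,\dots,n\}$ put $E_I=\prod_{i<j,\,i,j\in I}e_{ij}$, and for a set partition $A=\{I_1,\dots,I_k\}$ of $\{1,\dots,n\}$ put $E_A=\prod_jE_{I_j}$. **Combinatorics.** A composition is a finite sequence of nonnegative integers; a partition is a nonincreasing one. For compositions, $\mu\unrhd\nu$ means $\sum_{j\le i}\mu_j\ge\sum_{j\le i}\nu_j$ for all $i\ge1$ (padding with zeros). An $r$-multicomposition (resp. $r$-multipartition) of $n$ is an $r$-tuple $\boldsymbol\lambda=(\lambda^{(1)},\dots,\lambda^{(r)})$ of compositions (resp. partitions), possibly empty, of total size $n$; $\boldsymbol\lambda\unrhd\boldsymbol\mu$ means $\lambda^{(i)}\unrhd\mu^{(i)}$ for all $1\le i\le r$. $\mathrm{Par}_{r,n}$ is the set of $r$-multipartitions of $n$. A $\boldsymbol\lambda$-multitableau is a bijective filling of the $r$-tuple of Young diagrams of $\boldsymbol\lambda$ by $1,\dots,n$; it is row standard if entries increase along rows in each component, standard if they also increase down columns in each component. $\mathrm{Std}(\boldsymbol\lambda)$ is the set of standard $\boldsymbol\lambda$-multitableaux. $\mathfrak{t}^{\boldsymbol\lambda}$ is the multitableau with $1,\dots,n$ entered in order along the rows of the first component, then the second,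 and so on; $\mathfrak{S}_{\boldsymbol\lambda}$ is its row stabilizer; $\mathfrak{S}_n$ acts on the right on multitableaux by permuting entries and $d(\mathfrak{s})\in\mathfrak{S}_n$ is defined by $\mathfrak{s}=\mathfrak{t}^{\boldsymbol\lambda}d(\mathfrak{s})$. **Elements $m_{\mathfrak{s}\mathfrak{t}}$.** Let $A_{\boldsymbol\lambda}$ be the set partition whose blocks are the sets of entries of the nonempty components of $\mathfrak{t}^{\boldsymbol\lambda}$, and $E_{\boldsymbol\lambda}=E_{A_{\boldsymbol\lambda}}$. Put $u_{ik}=\frac1r\sum_{j=0}^{r-1}\xi^{-jk}t_i^j$ and $U_{\boldsymbol\lambda}=\prod_{j=1}^ru_{i_j,j}$, where $i_j$ is any entry of the $j$-th component of $\mathfrak{t}^{\boldsymbol\lambda}$ (the factor is $1$ if that component is empty); the product $U_{\boldsymbol\lambda}E_{\boldsymbol\lambda}$ does not depend on the choices. Put $x_{\boldsymbol\lambda}=\sum_{w\in\mathfrak{S}_{\boldsymbol\lambda}}q^{\ell(w)}g_w$, $m_{\boldsymbol\lambda}=U_{\boldsymbol\lambda}E_{\boldsymbol\lambda}x_{\boldsymbol\lambda}$, and $m_{\mathfrak{s}\mathfrak{t}}=g_{d(\mathfrak{s})}^*m_{\boldsymbol\lambda}g_{d(\mathfrak{t})}$ for row standard $\boldsymbol\lambda$-multitableaux $\mathfrak{s},\mathfrak{t}$. **Cellular basis.** Let $A$ be an algebra over an integral domain $\mathcal{R}$, free as a module, $(\Lambda,\ge)$ a poset and $T(\lambda)$ a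 finite set for each $\lambda\in\Lambda$, and suppose $\mathcal{C}=\{c^\lambda_{st}\mid\lambda\in\Lambda,\ s,t\in T(\lambda)\}$ is an $\mathcal{R}$-basis of $A$. $(\mathcal{C},\Lambda)$ is a cellular basis if (i) the linear map $*$ with $(c^\lambda_{st})^*=c^\lambda_{ts}$ is an algebra anti-automorphism; (ii) for all $\lambda\in\Lambda$, $t\in T(\lambda)$, $a\in A$ there are $r_v\in\mathcal{R}$ such that for all $s\in T(\lambda)$, $c^\lambda_{st}a\equiv\sum_{v\in T(\lambda)}r_vc^\lambda_{sv}\bmod A^\lambda$, where $A^\lambda$ is the span of all $c^\mu_{uv}$ with $\mu>\lambda$. *)

theory Defs
  imports
    Complex_Main
    "HOL-Library.Poly_Mapping"
    "HOL-Combinatorics.Permutations"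
    "HOL-Computational_Algebra.Fraction_Field"
    "HOL-Algebra.Algebra"
    "HOL-Algebra.Algebraic_Closure_Type"
begin

section \<open>Algebras, bases and cellular bases\<close>

text \<open>
  The library locale \<open>algebra\<close> is for commutative algebras only, hence the following predicate.
\<close>

definition assoc_algebra :: "('a, 'm) ring_scheme \<Rightarrow> ('a, 'b, 'k) module_scheme \<Rightarrow> bool" where
  "assoc_algebra R A \<longleftrightarrow> Module.module R A \<and> Ring.ring A \<and>
     (\<forall>a\<in>carrier R. \<forall>x\<in>carrier A. \<forall>y\<in>carrier A.
        a \<odot>\<^bsub>A\<^esub> (x \<otimes>\<^bsub>A\<^esub> y) = (a \<odot>\<^bsub>A\<^esub> x) \<otimes>\<^bsub>A\<^esub> y \<and>
        a \<odot>\<^bsub>A\<^esub> (x \<otimes>\<^bsub>A\<^esub> y) = x \<otimes>\<^bsub>A\<^esub> (a \<odot>\<^bsub>A\<^esub> y))"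

definition anti_automorphism ::
    "('a, 'm) ring_scheme \<Rightarrow> ('a, 'b, 'k) module_scheme \<Rightarrow> ('b \<Rightarrow> 'b) \<Rightarrow> bool" where
  "anti_automorphism R A \<phi> \<longleftrightarrow>
     bij_betw \<phi> (carrier A) (carrier A) \<and>
     (\<forall>x\<in>carrier A. \<forall>y\<in>carrier A. \<phi> (x \<oplus>\<^bsub>A\<^esub> y) = \<phi> x \<oplus>\<^bsub>A\<^esub> \<phi> y) \<and>
     (\<forall>a\<in>carrier R. \<forall>x\<in>carrier A. \<phi> (a \<odot>\<^bsub>A\<^esub> x) = a \<odot>\<^bsub>A\<^esub> \<phi> x) \<and>
     \<phi> \<one>\<^bsub>A\<^esub> = \<one>\<^bsub>A\<^esub> \<and>
     (\<forall>x\<in>carrier A. \<forall>y\<in>carrier A. \<phi> (x \<otimes>\<^bsub>A\<^esub> y) = \<phi> y \<otimes>\<^bsub>A\<^esub> \<phi> x)"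

text \<open>
  \<open>B\<close> is a basis of the \<open>R\<close>-module \<open>M\<close>: every element is a linear combination of finitely many
  elements of \<open>B\<close> with unique coefficients.
\<close>

definition module_basis ::
    "('a, 'm) ring_scheme \<Rightarrow> ('a, 'b, 'k) module_scheme \<Rightarrow> 'b set \<Rightarrow> bool" where
  "module_basis R M B \<longleftrightarrow> Module.module R M \<and> B \<subseteq> carrier M \<and>
     (\<forall>x\<in>carrier M. \<exists>!a. a \<in> B \<rightarrow>\<^sub>E carrier R \<and> finite {b\<in>B. a b \<noteq> \<zero>\<^bsub>R\<^esub>} \<and>
        x = (\<Oplus>\<^bsub>M\<^esub>b\<in>{b\<in>B. a b \<noteq> \<zero>\<^bsub>R\<^esub>}. a b \<odot>\<^bsub>M\<^esub> b))"

definition module_span ::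
    "('a, 'm) ring_scheme \<Rightarrow> ('a, 'b, 'k) module_scheme \<Rightarrow> 'b set \<Rightarrow> 'b set" where
  "module_span R M S = \<Inter>{N. submodule N R M \<and> S \<subseteq> N}"

text \<open>
  In a cellular basis the indexed family \<open>c\<close> is a basis, that is, it is injective on its index set
  and its range is a basis. Since \<open>c\<close> spans \<open>A\<close>, the linear map \<open>star\<close> is determined on \<open>A\<close> by its
  values on the family.
\<close>

definition cellular_basis ::
    "('a, 'm) ring_scheme \<Rightarrow> ('a, 'b, 'k) module_scheme \<Rightarrow>
     'l set \<Rightarrow> ('l \<Rightarrow> 'l \<Rightarrow> bool) \<Rightarrow> ('l \<Rightarrow> 't set) \<Rightarrow> ('l \<Rightarrow> 't \<Rightarrow> 't \<Rightarrow> 'b) \<Rightarrow> ('b \<Rightarrow> 'b) \<Rightarrow> bool" where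
  "cellular_basis R A \<Lambda> ge T c star \<longleftrightarrow>
     domain R \<and> assoc_algebra R A \<and>
     partial_order_on \<Lambda> {(l, m). l \<in> \<Lambda> \<and> m \<in> \<Lambda> \<and> ge m l} \<and>
     (\<forall>l\<in>\<Lambda>. finite (T l)) \<and>
     inj_on (\<lambda>(l, s, t). c l s t) (SIGMA l:\<Lambda>. T l \<times> T l) \<and>
     module_basis R A {c l s t | l s t. l \<in> \<Lambda> \<and> s \<in> T l \<and> t \<in> T l} \<and>
     anti_automorphism R A star \<and>
     (\<forall>l\<in>\<Lambda>. \<forall>s\<in>T l. \<forall>t\<in>T l. star (c l s t) = c l t s) \<and>
     (\<forall>l\<in>\<Lambda>. \<forall>t\<in>T l. \<forall>a\<in>carrier A. \<exists>\<rho>\<in>T l \<rightarrow> carrier R. \<forall>s\<in>T l.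
        (c l s t \<otimes>\<^bsub>A\<^esub> a) \<ominus>\<^bsub>A\<^esub> (\<Oplus>\<^bsub>A\<^esub>v\<in>T l. \<rho> v \<odot>\<^bsub>A\<^esub> c l s v)
          \<in> module_span R A
               {c m u v | m u v. m \<in> \<Lambda> \<and> ge m l \<and> m \<noteq> l \<and> u \<in> T m \<and> v \<in> T m})"


section \<open>The coefficient ring\<close>

text \<open>
  All scalars live in the field \<open>\<complex>(q)\<close>; the ring \<open>\<int>[q, q\<inverse>, \<xi>, r\<inverse>, \<Delta>\<inverse>]\<close> is the subring
  generated by the indicated elements.
\<close>

type_synonym scalar = "complex poly fract"

definition const_scalar :: "complex \<Rightarrow> scalar" where
  "const_scalar c = Fract [:c:] 1"

definition q_indet :: scalar where
  "q_indet = Fract [:0, 1:] 1"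

definition \<xi> :: "nat \<Rightarrow> scalar" where
  "\<xi> r = const_scalar (exp (2 * complex_of_real pi * \<i> / of_nat r))"

definition \<Delta> :: "nat \<Rightarrow> scalar" where
  "\<Delta> r = (\<Prod>(i, j)\<in>{(i, j). i < j \<and> j < r}. \<xi> r ^ i - \<xi> r ^ j)"

definition coeff_ring :: "nat \<Rightarrow> scalar ring" where
  "coeff_ring r = (ring_of_type_algebra :: scalar ring)
     \<lparr>carrier := generate_ring ring_of_type_algebra
        {q_indet, inverse q_indet, \<xi> r, inverse (of_nat r), inverse (\<Delta> r)}\<rparr>"


section \<open>The symmetric group\<close>

text \<open>
  Permutations act on the right, so the product \<open>s\<^sub>i s\<^sub>j \<cdots>\<close> applies \<open>s\<^sub>i\<close> first: it is the function
  \<open>\<cdots> \<circ> s\<^sub>j \<circ> s\<^sub>i\<close>.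
\<close>

abbreviation s_transp :: "nat \<Rightarrow> nat \<Rightarrow> nat" where
  "s_transp i \<equiv> transpose i (Suc i)"

definition perm_of_word :: "nat list \<Rightarrow> nat \<Rightarrow> nat" where
  "perm_of_word is = fold (\<lambda>i w. s_transp i \<circ> w) is id"

definition perm_length :: "nat \<Rightarrow> (nat \<Rightarrow> nat) \<Rightarrow> nat" where
  "perm_length n w = (LEAST k. \<exists>is\<in>lists {1..<n}. length is = k \<and> perm_of_word is = w)"

definition reduced_word :: "nat \<Rightarrow> (nat \<Rightarrow> nat) \<Rightarrow> nat list \<Rightarrow> bool" where
  "reduced_word n w is \<longleftrightarrow>
     is \<in> lists {1..<n} \<and> perm_of_word is = w \<and> length is = perm_length n w"


section \<open>The Yokonuma--Hecke algebra\<close>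

text \<open>
  With lists as free monoid, \<open>gen list \<Rightarrow>\<^sub>0 scalar\<close> with its convolution product is the free
  associative algebra over \<open>\<complex>(q)\<close> on \<open>gen\<close>. We restrict it to the generators occurring in the
  presentation and to coefficients in \<open>coeff_ring\<close>.
\<close>

instantiation list :: (type) monoid_add
begin

definition zero_list :: "'a list" where "0 = []"

definition plus_list :: "'a list \<Rightarrow> 'a list \<Rightarrow> 'a list" where "xs + ys = xs @ ys"

instance by standard (simp_all add: zero_list_def plus_list_def)

end

datatype gen = Gen_g nat | Gen_t nat

type_synonym free = "gen list \<Rightarrow>\<^sub>0 scalar"

definition gens :: "nat \<Rightarrow> gen set" where
  "gens n = Gen_g ` {1..<n} \<union> Gen_t ` {1..n}"

definition sc :: "scalar \<Rightarrow> free" where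
  "sc a = Poly_Mapping.single [] a"

definition free_algebra :: "nat \<Rightarrow> nat \<Rightarrow> (scalar, free) module" where
  "free_algebra r n =
     \<lparr>carrier = {x. Poly_Mapping.keys x \<subseteq> lists (gens n) \<and> range (Poly_Mapping.lookup x) \<subseteq> carrier (coeff_ring r)},
      monoid.mult = (*), one = 1, ring.zero = 0, add = (+), module.smult = (\<lambda>a x. sc a * x)\<rparr>"

abbreviation fg :: "nat \<Rightarrow> free" where
  "fg i \<equiv> Poly_Mapping.single [Gen_g i] 1"

abbreviation ft :: "nat \<Rightarrow> free" where
  "ft i \<equiv> Poly_Mapping.single [Gen_t i] 1"

text \<open>
  In the free algebra \<open>t\<^sub>j\<close> has no inverse; \<open>t\<^sub>j\<^sup>r\<^sup>-\<^sup>m\<close> stands for \<open>t\<^sub>j\<^sup>-\<^sup>m\<close>, to which it becomes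
  equal once \<open>t\<^sub>j\<^sup>r = 1\<close>.
\<close>

definition fe :: "nat \<Rightarrow> nat \<Rightarrow> nat \<Rightarrow> free" where
  "fe r i j = sc (inverse (of_nat r)) * (\<Sum>m<r. ft i ^ m * ft j ^ (r - m))"

definition fu :: "nat \<Rightarrow> nat \<Rightarrow> nat \<Rightarrow> free" where
  "fu r i k = sc (inverse (of_nat r)) * (\<Sum>j<r. sc (\<xi> r powi (- int (j * k))) * ft i ^ j)"

text \<open>A relation \<open>x = y\<close> of the presentation is recorded as the element \<open>x - y\<close>.\<close>

definition relations :: "nat \<Rightarrow> nat \<Rightarrow> free set" where
  "relations r n =
     {ft i ^ r - 1 | i. i \<in> {1..n}} \<union>
     {ft i * ft j - ft j * ft i | i j. i \<in> {1..n} \<and> j \<in> {1..n}} \<union>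
     {ft j * fg i - fg i * ft (s_transp i j) | i j. i \<in> {1..<n} \<and> j \<in> {1..n}} \<union>
     {fg i * fg j - fg j * fg i | i j. i \<in> {1..<n} \<and> j \<in> {1..<n} \<and> \<bar>int i - int j\<bar> > 1} \<union>
     {fg i * fg (Suc i) * fg i - fg (Suc i) * fg i * fg (Suc i) | i. i \<in> {1..<n} \<and> Suc i \<in> {1..<n}} \<union>
     {fg i ^ 2 - (1 + sc (q_indet - inverse q_indet) * fe r i (Suc i) * fg i) | i. i \<in> {1..<n}}"

definition yh_ideal :: "nat \<Rightarrow> nat \<Rightarrow> free set" where
  "yh_ideal r n = Idl\<^bsub>free_algebra r n\<^esub> (relations r n)"

text \<open>The class in the quotient of an element of the free algebra.\<close>

definition yh_class :: "nat \<Rightarrow> nat \<Rightarrow> free \<Rightarrow> free set" where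
  "yh_class r n x = yh_ideal r n +>\<^bsub>free_algebra r n\<^esub> x"

text \<open>
  The quotient ring of the library, extended by the scalar multiplication on cosets (written
  just like the multiplication of cosets, see \<^const>\<open>rcoset_mult\<close>).
\<close>

definition yokonuma_hecke :: "nat \<Rightarrow> nat \<Rightarrow> (scalar, free set) module" where
  "yokonuma_hecke r n =
     ring.extend (free_algebra r n Quot yh_ideal r n)
       (module.fields (\<lambda>a C. \<Union>x\<in>C. yh_class r n (a \<odot>\<^bsub>free_algebra r n\<^esub> x)))"

definition yh_g :: "nat \<Rightarrow> nat \<Rightarrow> nat \<Rightarrow> free set" where
  "yh_g r n i = yh_class r n (fg i)"

definition yh_t :: "nat \<Rightarrow> nat \<Rightarrow> nat \<Rightarrow> free set" where
  "yh_t r n i = yh_class r n (ft i)"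

definition yh_e :: "nat \<Rightarrow> nat \<Rightarrow> nat \<Rightarrow> nat \<Rightarrow> free set" where
  "yh_e r n i j = yh_class r n (fe r i j)"

definition yh_u :: "nat \<Rightarrow> nat \<Rightarrow> nat \<Rightarrow> nat \<Rightarrow> free set" where
  "yh_u r n i k = yh_class r n (fu r i k)"

definition yh_gw :: "nat \<Rightarrow> nat \<Rightarrow> (nat \<Rightarrow> nat) \<Rightarrow> free set" where
  "yh_gw r n w = foldr (\<lambda>i x. yh_g r n i \<otimes>\<^bsub>yokonuma_hecke r n\<^esub> x)
     (SOME is. reduced_word n w is) \<one>\<^bsub>yokonuma_hecke r n\<^esub>"

definition yh_star :: "nat \<Rightarrow> nat \<Rightarrow> free set \<Rightarrow> free set" where
  "yh_star r n = (THE \<phi>. \<phi> \<in> extensional (carrier (yokonuma_hecke r n)) \<and>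
     anti_automorphism (coeff_ring r) (yokonuma_hecke r n) \<phi> \<and>
     (\<forall>i\<in>{1..<n}. \<phi> (yh_g r n i) = yh_g r n i) \<and>
     (\<forall>k\<in>{1..n}. \<phi> (yh_t r n k) = yh_t r n k))"

text \<open>
  The factors of the following two products, and of the one in \<open>U_elem\<close> below, commute pairwise, so
  that \<^const>\<open>finprod\<close>, whose definition does not presuppose commutativity of the whole ring, is
  the product in any order.
\<close>

definition E_block :: "nat \<Rightarrow> nat \<Rightarrow> nat set \<Rightarrow> free set" where
  "E_block r n I = finprod (yokonuma_hecke r n) (\<lambda>(i, j). yh_e r n i j)
     {(i, j). i \<in> I \<and> j \<in> I \<and> i < j}"

definition E_partition :: "nat \<Rightarrow> nat \<Rightarrow> nat set set \<Rightarrow> free set" where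
  "E_partition r n A = finprod (yokonuma_hecke r n) (E_block r n) A"


section \<open>Multipartitions and multitableaux\<close>

text \<open>
  Compositions are lists of naturals. Partitions are regarded up to trailing zeros and represented
  by their list of positive parts; otherwise dominance would not be antisymmetric.
\<close>

definition is_partition :: "nat list \<Rightarrow> bool" where
  "is_partition \<mu> \<longleftrightarrow> sorted_wrt (\<ge>) \<mu> \<and> 0 \<notin> set \<mu>"

definition dominates :: "nat list \<Rightarrow> nat list \<Rightarrow> bool" where
  "dominates \<mu> \<nu> \<longleftrightarrow> (\<forall>i\<ge>1. sum_list (take i \<mu>) \<ge> sum_list (take i \<nu>))"

definition multicompositions :: "nat \<Rightarrow> nat \<Rightarrow> nat list list set" where
  "multicompositions r n = {\<Lambda>s. length \<Lambda>s = r \<and> sum_list (map sum_list \<Lambda>s) = n}"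

definition multipartitions :: "nat \<Rightarrow> nat \<Rightarrow> nat list list set" where
  "multipartitions r n = {\<Lambda>s \<in> multicompositions r n. \<forall>\<mu>\<in>set \<Lambda>s. is_partition \<mu>}"

definition multidominates :: "nat list list \<Rightarrow> nat list list \<Rightarrow> bool" where
  "multidominates = list_all2 dominates"

text \<open>
  The box \<open>(k, i, j)\<close> is in component \<open>k\<close>, row \<open>i\<close> and column \<open>j\<close>, all counted from zero.
\<close>

type_synonym box = "nat \<times> nat \<times> nat"
type_synonym tableau = "box \<Rightarrow> nat"

definition diagram :: "nat list list \<Rightarrow> box set" where
  "diagram \<Lambda>s = {(k, i, j). k < length \<Lambda>s \<and> i < length (\<Lambda>s ! k) \<and> j < \<Lambda>s ! k ! i}"

definition size_of :: "nat list list \<Rightarrow> nat" where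
  "size_of \<Lambda>s = sum_list (map sum_list \<Lambda>s)"

definition multitableaux :: "nat list list \<Rightarrow> tableau set" where
  "multitableaux \<Lambda>s =
     {\<tt> \<in> extensional (diagram \<Lambda>s). bij_betw \<tt> (diagram \<Lambda>s) {1..size_of \<Lambda>s}}"

definition row_standard :: "nat list list \<Rightarrow> tableau set" where
  "row_standard \<Lambda>s = {\<tt> \<in> multitableaux \<Lambda>s.
     \<forall>k i j j'. (k, i, j) \<in> diagram \<Lambda>s \<and> (k, i, j') \<in> diagram \<Lambda>s \<and> j < j' \<longrightarrow>
       \<tt> (k, i, j) < \<tt> (k, i, j')}"

definition Std :: "nat list list \<Rightarrow> tableau set" where
  "Std \<Lambda>s = {\<tt> \<in> row_standard \<Lambda>s.
     \<forall>k i i' j. (k, i, j) \<in> diagram \<Lambda>s \<and> (k, i', j) \<in> diagram \<Lambda>s \<and> i < i' \<longrightarrow>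
       \<tt> (k, i, j) < \<tt> (k, i', j)}"

definition initial_tableau :: "nat list list \<Rightarrow> tableau" where
  "initial_tableau \<Lambda>s = restrict (\<lambda>(k, i, j).
     sum_list (map sum_list (take k \<Lambda>s)) + sum_list (take i (\<Lambda>s ! k)) + Suc j) (diagram \<Lambda>s)"

definition tableau_act :: "nat list list \<Rightarrow> tableau \<Rightarrow> (nat \<Rightarrow> nat) \<Rightarrow> tableau" where
  "tableau_act \<Lambda>s \<tt> w = restrict (w \<circ> \<tt>) (diagram \<Lambda>s)"

definition d_perm :: "nat list list \<Rightarrow> tableau \<Rightarrow> nat \<Rightarrow> nat" where
  "d_perm \<Lambda>s \<ss> = (THE w. w permutes {1..size_of \<Lambda>s} \<and> \<ss> = tableau_act \<Lambda>s (initial_tableau \<Lambda>s) w)"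

definition row_entries :: "nat list list \<Rightarrow> nat \<Rightarrow> nat \<Rightarrow> nat set" where
  "row_entries \<Lambda>s k i = {initial_tableau \<Lambda>s (k, i, j) | j. (k, i, j) \<in> diagram \<Lambda>s}"

definition component_entries :: "nat list list \<Rightarrow> nat \<Rightarrow> nat set" where
  "component_entries \<Lambda>s k = {initial_tableau \<Lambda>s (k, i, j) | i j. (k, i, j) \<in> diagram \<Lambda>s}"

definition row_stabilizer :: "nat list list \<Rightarrow> (nat \<Rightarrow> nat) set" where
  "row_stabilizer \<Lambda>s =
     {w. w permutes {1..size_of \<Lambda>s} \<and> (\<forall>k i. w ` row_entries \<Lambda>s k i = row_entries \<Lambda>s k i)}"


section \<open>The elements \<open>m\<^sub>\<ss>\<^sub>\<tt>\<close>\<close>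

definition A_blocks :: "nat list list \<Rightarrow> nat set set" where
  "A_blocks \<Lambda>s = component_entries \<Lambda>s ` {k. k < length \<Lambda>s} - {{}}"

definition E_elem :: "nat \<Rightarrow> nat \<Rightarrow> nat list list \<Rightarrow> free set" where
  "E_elem r n \<Lambda>s = E_partition r n (A_blocks \<Lambda>s)"

text \<open>The component with index \<open>k\<close> is the \<open>(k+1)\<close>-st one.\<close>

definition U_elem :: "nat \<Rightarrow> nat \<Rightarrow> nat list list \<Rightarrow> free set" where
  "U_elem r n \<Lambda>s = finprod (yokonuma_hecke r n)
     (\<lambda>k. if component_entries \<Lambda>s k = {} then \<one>\<^bsub>yokonuma_hecke r n\<^esub>
          else yh_u r n (SOME i. i \<in> component_entries \<Lambda>s k) (Suc k)) {..<r}"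

definition x_elem :: "nat \<Rightarrow> nat \<Rightarrow> nat list list \<Rightarrow> free set" where
  "x_elem r n \<Lambda>s = (\<Oplus>\<^bsub>yokonuma_hecke r n\<^esub>w\<in>row_stabilizer \<Lambda>s.
     q_indet ^ perm_length n w \<odot>\<^bsub>yokonuma_hecke r n\<^esub> yh_gw r n w)"

definition m_elem :: "nat \<Rightarrow> nat \<Rightarrow> nat list list \<Rightarrow> free set" where
  "m_elem r n \<Lambda>s = U_elem r n \<Lambda>s \<otimes>\<^bsub>yokonuma_hecke r n\<^esub> E_elem r n \<Lambda>s
     \<otimes>\<^bsub>yokonuma_hecke r n\<^esub> x_elem r n \<Lambda>s"

definition murphy :: "nat \<Rightarrow> nat \<Rightarrow> nat list list \<Rightarrow> tableau \<Rightarrow> tableau \<Rightarrow> free set" where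
  "murphy r n \<Lambda>s \<ss> \<tt> = yh_star r n (yh_gw r n (d_perm \<Lambda>s \<ss>))
     \<otimes>\<^bsub>yokonuma_hecke r n\<^esub> m_elem r n \<Lambda>s
     \<otimes>\<^bsub>yokonuma_hecke r n\<^esub> yh_gw r n (d_perm \<Lambda>s \<tt>)"

definition murphy_basis :: "nat \<Rightarrow> nat \<Rightarrow> free set set" where
  "murphy_basis r n = {murphy r n \<Lambda>s \<ss> \<tt> | \<Lambda>s \<ss> \<tt>.
     \<Lambda>s \<in> multipartitions r n \<and> \<ss> \<in> Std \<Lambda>s \<and> \<tt> \<in> Std \<Lambda>s}"

end

theory Submission
  imports Defs
begin

text \<open>
  The algebra is studied through its faithful representation by operators on functions of words in
  coloured letters. There the elements \<open>u\<^sub>\<chi> g\<^sub>w\<close>, with \<open>u\<^sub>\<chi>\<close> the idempotent of a character \<open>\<chi>\<close> of the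
  group generated by the \<open>t\<^sub>i\<close>, are independent over \<open>\<complex>(q)\<close>, because their rows at suitable words are
  distinct coordinate functions; as the presentation yields a spanning set of the same size
  \<open>r\<^sup>n n!\<close>, the representation is faithful. The product \<open>U\<^sub>\<lambda> E\<^sub>\<lambda>\<close> is the idempotent of the
  character that is constant on the components of the initial tableau.

  The elements \<open>m\<^sub>s\<^sub>t\<close> span: \<open>m\<^sub>\<lambda> Y\<close> is spanned by the \<open>m\<^sub>\<lambda> g\<^sub>d\<close> with \<open>d\<close> increasing on the rows of
  \<open>\<lambda>\<close>. If the tableau of \<open>d\<close> violates the order in some column, a Garnir relation rewrites
  \<open>m\<^sub>\<lambda> g\<^sub>d\<close> in terms of shorter \<open>d\<close> modulo the two-sided ideal of the strictly dominating shapes. Every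
  idempotent \<open>u\<^sub>\<chi>\<close> lies in the two-sided ideal generated by \<open>m\<^sub>\<lambda>\<close> for a multipartition all of whose
  components are columns.

  Multipartitions form an \<open>r\<close>-differential poset, hence there are at most \<open>r\<^sup>n n!\<close> pairs of standard
  multitableaux of the same shape, and a spanning family of that size is a basis over \<open>\<complex>(q)\<close>. Since
  the coefficients of the spanning relations lie in the coefficient ring, it is a basis over that
  ring.
\<close>

section \<open>Permutations, length and intervals of positions\<close>

text \<open>On the idempotent of a character, \<open>e_i\<close> acts as 1 if the colours at
  \<open>i\<close> and \<open>i + 1\<close> agree and as 0 otherwise. Within a component
  \<open>g_i\<close> therefore satisfies the quadratic relation of the Iwahori-Hecke algebra with
  eigenvalues \<open>q\<close> and \<open>-1/q\<close>, while between positions of different colours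
  it squares to 1. This reduces the theory to that of type A in each component:
  \<open>x_\<lambda>\<close> absorbs \<open>g_w\<close> for \<open>w\<close> in the row stabilizer
  with factor \<open>q\<close> to the length of \<open>w\<close>, and the Garnir relations move
  boxes only inside a component, so that shapes need to be compared only component by component.

  The presentation hides three things: that \<open>*\<close> exists, that \<open>g_w\<close> does
  not depend on the reduced word, and whether two expressions are equal. Once the operators are
  known to be faithful, the first follows by reversing the words in the relations, and the other two
  are decided by evaluating rows. Hence the whole calculation takes place among operators, and only
  its results are carried back to the quotient.\<close>

abbreviation pinv :: "('a \<Rightarrow> 'b) \<Rightarrow> 'b \<Rightarrow> 'a" where
  "pinv \<equiv> inv_into UNIV"

definition inversions :: "nat \<Rightarrow> (nat \<Rightarrow> nat) \<Rightarrow> (nat \<times> nat) set" where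
  "inversions n w = {(a, b). 1 \<le> a \<and> a < b \<and> b \<le> n \<and> w b < w a}"

text \<open>A count that can be computed, unlike the minimum over words in
  \<open>perm_length\<close>; the two agree by \<open>perm_length_eq\<close>.\<close>

definition len :: "nat \<Rightarrow> (nat \<Rightarrow> nat) \<Rightarrow> nat" where
  "len n w = card (inversions n w)"

abbreviation perms :: "nat \<Rightarrow> (nat \<Rightarrow> nat) set" where
  "perms n \<equiv> {w. w permutes {1..n}}"

lemma finite_inversions [simp]: "finite (inversions n w)"
  by (rule finite_subset[of _ "{1..n} \<times> {1..n}"]) (auto simp: inversions_def)

lemma permutes_le_iff: "w permutes {1..n} \<Longrightarrow> (1 \<le> w a \<and> w a \<le> n) \<longleftrightarrow> (1 \<le> a \<and> a \<le> n)"
  using permutes_in_image[of w "{1..n}" a] by auto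

lemma permutes_neq: "w permutes S \<Longrightarrow> a \<noteq> b \<Longrightarrow> w a \<noteq> w b"
  by (meson injD permutes_inj)

lemma s_transp_permutes: "1 \<le> i \<Longrightarrow> i < n \<Longrightarrow> s_transp i permutes {1..n}"
  by (rule permutes_swap_id) auto

lemma inv_s_transp_comp:
  assumes "w permutes {1..n}" "1 \<le> i" "i < n"
  shows "pinv (s_transp i \<circ> w) = pinv w \<circ> s_transp i" "pinv (w \<circ> s_transp i) = s_transp i \<circ> pinv w"
  using assms s_transp_permutes[OF assms(2,3)]
  by (simp_all add: permutes_bij o_inv_distrib inv_equality)

lemma s_transp_idem: "s_transp i \<circ> s_transp i = id" "(w \<circ> s_transp i) \<circ> s_transp i = w"
    "s_transp i \<circ> (s_transp i \<circ> w) = w"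
  by (auto simp: fun_eq_iff)

text \<open>Applying the transposition to both positions carries the inversions of \<open>w\<close>
  injectively to inversions of the product; the only further inversion is the pair of swapped
  positions itself.\<close>

lemma len_ascent:
  assumes w: "w permutes {1..n}" and i: "1 \<le> i" "i < n" and asc: "w i < w (Suc i)"
  shows "len n (w \<circ> s_transp i) = Suc (len n w)"
proof -
  let ?s = "s_transp i"
  \<comment> \<open>The transposition reverses the order of no pair other than
    \<open>(i, Suc i)\<close>.\<close>
  have ij: "?s a < ?s b" if "a < b" "(a, b) \<noteq> (i, Suc i)" for a b
    using that by (auto simp: transpose_def)
  have rng: "1 \<le> ?s a \<and> ?s a \<le> n \<longleftrightarrow> 1 \<le> a \<and> a \<le> n" for a
    using permutes_le_iff[OF s_transp_permutes[OF i]] .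
  have notin: "(i, Suc i) \<notin> inversions n w"
    using asc by (auto simp: inversions_def)
  have eq: "inversions n (w \<circ> ?s) = insert (i, Suc i) (map_prod ?s ?s ` inversions n w)"
  proof (rule Set.set_eqI, rule iffI)
    fix x assume "x \<in> inversions n (w \<circ> ?s)"
    then obtain a b where x: "x = (a, b)" and ab: "1 \<le> a" "a < b" "b \<le> n" "w (?s b) < w (?s a)"
      by (auto simp: inversions_def)
    show "x \<in> insert (i, Suc i) (map_prod ?s ?s ` inversions n w)"
    proof (cases "(a, b) = (i, Suc i)")
      case False
      then have "(?s a, ?s b) \<in> inversions n w"
        using ij[of a b] ab rng[of a] rng[of b] by (auto simp: inversions_def)
      moreover have "x = map_prod ?s ?s (?s a, ?s b)"
        by (simp add: x)
      ultimately show ?thesis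
        by blast
    qed (simp add: x)
  next
    fix x assume "x \<in> insert (i, Suc i) (map_prod ?s ?s ` inversions n w)"
    then consider "x = (i, Suc i)" | a b where "x = (?s a, ?s b)" "(a, b) \<in> inversions n w"
      by auto
    then show "x \<in> inversions n (w \<circ> ?s)"
    proof cases
      case 2
      then have "(a, b) \<noteq> (i, Suc i)" "a < b"
        using notin by (auto simp: inversions_def)
      then show ?thesis
        using 2 ij[of a b] rng[of a] rng[of b] by (auto simp: inversions_def)
    qed (use asc i in \<open>auto simp: inversions_def\<close>)
  qed
  have inj: "inj_on (map_prod ?s ?s) (inversions n w)"
    by (intro inj_onI) (auto dest: injD[OF inj_transpose])
  have "(i, Suc i) \<notin> map_prod ?s ?s ` inversions n w"
    by (auto simp: inversions_def transpose_def split: if_splits)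
  then show ?thesis
    by (simp add: len_def eq card_image[OF inj])
qed

lemma len_descent:
  assumes w: "w permutes {1..n}" and i: "1 \<le> i" "i < n" and desc: "w (Suc i) < w i"
  shows "len n w = Suc (len n (w \<circ> s_transp i))"
  using len_ascent[OF permutes_compose[OF s_transp_permutes[OF i] w] i] desc
  by (simp add: s_transp_idem)

lemma len_inv:
  assumes w: "w permutes {1..n}"
  shows "len n (pinv w) = len n w"
proof -
  have 1: "(\<lambda>(a, b). (w b, w a)) ` inversions n w \<subseteq> inversions n (pinv w)"
    using permutes_le_iff[OF w] by (fastforce simp: inversions_def permutes_inverses(2)[OF w])
  have 2: "(\<lambda>(a, b). (pinv w b, pinv w a)) ` inversions n (pinv w) \<subseteq> inversions n w"
    using permutes_le_iff[OF permutes_inv[OF w]]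
    by (fastforce simp: inversions_def permutes_inverses(1)[OF w])
  have "bij_betw (\<lambda>(a, b). (w b, w a)) (inversions n w) (inversions n (pinv w))"
    by (rule bij_betw_byWitness[where f' = "\<lambda>(a, b). (pinv w b, pinv w a)"])
      (use 1 2 in \<open>auto simp: permutes_inverses[OF w]\<close>)
  then show ?thesis
    by (simp add: len_def bij_betw_same_card)
qed

text \<open>Composition on the other side exchanges values instead of positions. Passing to
  inverses, which have the same length, reduces this to \<open>len_ascent\<close>.\<close>

lemma len_left_ascent:
  assumes w: "w permutes {1..n}" and i: "1 \<le> i" "i < n" and asc: "pinv w i < pinv w (Suc i)"
  shows "len n (s_transp i \<circ> w) = Suc (len n w)"
  using len_ascent[OF permutes_inv[OF w] i asc] len_inv[OF w]
    len_inv[OF permutes_compose[OF w s_transp_permutes[OF i]]]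
  by (simp add: inv_s_transp_comp[OF w i])

lemma len_left_descent:
  assumes w: "w permutes {1..n}" and i: "1 \<le> i" "i < n" and desc: "pinv w (Suc i) < pinv w i"
  shows "len n w = Suc (len n (s_transp i \<circ> w))"
  using len_descent[OF permutes_inv[OF w] i desc] len_inv[OF w]
    len_inv[OF permutes_compose[OF w s_transp_permutes[OF i]]]
  by (simp add: inv_s_transp_comp[OF w i])

lemma len_id [simp]: "len n id = 0"
  by (auto simp: len_def inversions_def card_eq_0_iff)

text \<open>Growth by at least one per step gives \<open>i \<le> w i\<close> upwards from 1 and
  \<open>w i \<le> i\<close> downwards from \<open>n\<close>.\<close>

lemma increasing_perm_id:
  assumes w: "w permutes {1..n}" and inc: "\<And>i. 1 \<le> i \<Longrightarrow> i < n \<Longrightarrow> w i < w (Suc i)"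
  shows "w = id"
proof -
  have lo: "i \<le> w i" if "1 \<le> i" "i \<le> n" for i
    using that
  proof (induction i rule: dec_induct)
    case base
    then show ?case using permutes_le_iff[OF w, of 1] by auto
  next
    case (step i)
    then show ?case using inc[of i] by auto
  qed
  have hi: "w i \<le> i" if "i \<le> n" "1 \<le> i" for i
    using that
  proof (induction i rule: inc_induct)
    case base
    then show ?case using permutes_le_iff[OF w, of n] by auto
  next
    case (step i)
    then show ?case using inc[of i] by auto
  qed
  show ?thesis
  proof
    fix i show "w i = id i"
      using lo[of i] hi[of i] permutes_not_in[OF w, of i] by (cases "1 \<le> i \<and> i \<le> n") force+
  qed
qed

lemma len_0_id: "w permutes {1..n} \<Longrightarrow> len n w = 0 \<Longrightarrow> w = id"
proof (rule increasing_perm_id)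
  fix i assume a: "w permutes {1..n}" "len n w = 0" "1 \<le> i" "i < n"
  then show "w i < w (Suc i)"
    using len_descent[of w n i] permutes_neq[OF a(1), of i "Suc i"] by (cases "w i < w (Suc i)") auto
qed

lemma exists_descent:
  assumes w: "w permutes {1..n}" and "w \<noteq> id"
  obtains i where "1 \<le> i" "i < n" "w (Suc i) < w i"
proof -
  obtain i where "1 \<le> i" "i < n" "\<not> w i < w (Suc i)"
    using increasing_perm_id[OF w] assms(2) by blast
  then show thesis
    using that[of i] permutes_neq[OF w, of i "Suc i"] by auto
qed

lemma perm_of_word_simps [simp]:
  "perm_of_word [] = id"
  "perm_of_word (is @ [i]) = s_transp i \<circ> perm_of_word is"
  by (simp_all add: perm_of_word_def)

text \<open>Words are read from left to right and permutations act on the right, so concatenation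
  reverses the order of composition of functions. The same reversal appears in
  \<open>gw_comp\<close>.\<close>

lemma perm_of_word_append: "perm_of_word (is @ js) = perm_of_word js \<circ> perm_of_word is"
proof (induction js rule: rev_induct)
  case (snoc j js)
  show ?case
    using snoc perm_of_word_simps(2)[of "is @ js" j] by (simp add: comp_assoc)
qed simp

lemma perm_of_word_Cons: "perm_of_word (i # is) = perm_of_word is \<circ> s_transp i"
  using perm_of_word_append[of "[i]" "is"] perm_of_word_simps(2)[of "[]" i] by simp

lemma perm_of_word_permutes: "is \<in> lists {1..<n} \<Longrightarrow> perm_of_word is permutes {1..n}"
proof (induction "is" rule: rev_induct)
  case (snoc i "is")
  then have "perm_of_word is permutes {1..n}" "1 \<le> i" "i < n"
    by auto
  then show ?case
    unfolding perm_of_word_simps by (intro permutes_compose s_transp_permutes)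
qed (simp add: permutes_id)

lemma len_perm_of_word: "is \<in> lists {1..<n} \<Longrightarrow> len n (perm_of_word is) \<le> length is"
proof (induction "is")
  case (Cons i "is")
  then have w: "perm_of_word is permutes {1..n}" and i: "1 \<le> i" "i < n"
    using perm_of_word_permutes by auto
  have "len n (perm_of_word is \<circ> s_transp i) \<le> Suc (len n (perm_of_word is))"
    using len_ascent[OF w i] len_descent[OF w i] permutes_neq[OF w, of i "Suc i"]
    by (cases "perm_of_word is i < perm_of_word is (Suc i)") simp_all
  moreover have "len n (perm_of_word is) \<le> length is"
    using Cons by simp
  ultimately show ?case
    unfolding perm_of_word_Cons list.size by linarith
qed (simp only: perm_of_word_simps len_id)

text \<open>Bubble sort: each descent that is removed costs one inversion and one letter.\<close>

lemma exists_word: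
  assumes "w permutes {1..n}"
  shows "\<exists>is\<in>lists {1..<n}. length is = len n w \<and> perm_of_word is = w"
  using assms
proof (induction "len n w" arbitrary: w)
  case 0
  then have "w = id" using len_0_id[of w n] by simp
  then show ?case using len_id[of n] by (intro bexI[of _ "[]"] conjI) (simp_all only: list.size perm_of_word_simps lists.Nil)
next
  case (Suc k)
  then have "w \<noteq> id" by auto
  then obtain i where i: "1 \<le> i" "i < n" "w (Suc i) < w i"
    using exists_descent[OF Suc.prems] by blast
  have "k = len n (w \<circ> s_transp i)"
    using len_descent[OF Suc.prems i] Suc.hyps(2) by simp
  from Suc.hyps(1)[OF this permutes_compose[OF s_transp_permutes[OF i(1,2)] Suc.prems]]
  obtain js where "js \<in> lists {1..<n}" "length js = len n (w \<circ> s_transp i)"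
      "perm_of_word js = w \<circ> s_transp i"
    by (elim bexE conjE)
  then show ?case
    using i len_descent[OF Suc.prems i]
    by (intro bexI[of _ "i # js"]) (auto simp: perm_of_word_Cons s_transp_idem)
qed

lemma perm_length_eq: "w permutes {1..n} \<Longrightarrow> perm_length n w = len n w"
  unfolding perm_length_def
proof (rule Least_equality)
  fix k assume "\<exists>is\<in>lists {1..<n}. length is = k \<and> perm_of_word is = w"
  then show "len n w \<le> k"
    using len_perm_of_word by blast
qed (rule exists_word)

lemma reduced_word_iff:
  "w permutes {1..n} \<Longrightarrow> reduced_word n w is \<longleftrightarrow>
    is \<in> lists {1..<n} \<and> perm_of_word is = w \<and> length is = len n w"
  by (auto simp: reduced_word_def perm_length_eq)

lemma exists_reduced_word:
  assumes "w permutes {1..n}"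
  obtains "is" where "reduced_word n w is"
  using exists_word[OF assms] reduced_word_iff[OF assms] by auto

text \<open>The last letter acts on the values, so it belongs to a descent of the inverse. This form
  serves inductions that strip off the last factor, as in \<open>gword_row\<close>.\<close>

lemma reduced_word_snoc:
  assumes w: "w permutes {1..n}" and i: "1 \<le> i" "i < n" and r: "reduced_word n w (is @ [i])"
  shows "reduced_word n (s_transp i \<circ> w) is" "pinv w (Suc i) < pinv w i"
proof -
  have p: "perm_of_word is = s_transp i \<circ> w" and l: "length is < len n w" "is \<in> lists {1..<n}"
      "len n w = Suc (length is)"
    using r by (auto simp: reduced_word_iff[OF w] s_transp_idem)
  have pw: "s_transp i \<circ> w permutes {1..n}"
    using permutes_compose[OF w s_transp_permutes[OF i]] .
  have "len n (s_transp i \<circ> w) \<le> length is"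
    using len_perm_of_word[OF l(2)] p by simp
  then have "\<not> pinv w i < pinv w (Suc i)"
    using len_left_ascent[OF w i] l by auto
  then show d: "pinv w (Suc i) < pinv w i"
    using permutes_neq[OF permutes_inv[OF w], of i "Suc i"] by auto
  show "reduced_word n (s_transp i \<circ> w) is"
    using len_left_descent[OF w i d] l p by (simp add: reduced_word_iff[OF pw])
qed

section \<open>Young subgroups and distinguished coset representatives\<close>

definition blk_stab :: "nat \<Rightarrow> (nat \<Rightarrow> 'l) \<Rightarrow> (nat \<Rightarrow> nat) set" where
  "blk_stab n blk = {w. w permutes {1..n} \<and> (\<forall>p\<in>{1..n}. blk (w p) = blk p)}"

text \<open>A labelling \<open>blk\<close> of the positions stands for its partition into level
  sets. Its Young subgroup is \<open>blk_stab\<close>, and these are the distinguished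
  representatives of the cosets: they have minimal length by \<open>len_blk_comp\<close>. Rows, cut
  rows and merged rows are all described by labellings.\<close>

definition blk_incr :: "nat \<Rightarrow> (nat \<Rightarrow> 'l) \<Rightarrow> (nat \<Rightarrow> nat) set" where
  "blk_incr n blk = {d. d permutes {1..n} \<and>
     (\<forall>a b. 1 \<le> a \<and> a < b \<and> b \<le> n \<and> blk a = blk b \<longrightarrow> d a < d b)}"

text \<open>Blocks are intervals of positions, as the rows of an initial tableau are. Then the Young
  subgroup is generated by the adjacent transpositions that it contains, and lengths add up.\<close>

definition convex_blk :: "nat \<Rightarrow> (nat \<Rightarrow> 'l) \<Rightarrow> bool" where
  "convex_blk n blk \<longleftrightarrow>
     (\<forall>a b c. 1 \<le> a \<and> a < b \<and> b < c \<and> c \<le> n \<and> blk a = blk c \<longrightarrow> blk b = blk a)"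

lemma blk_stab_permutes: "w \<in> blk_stab n blk \<Longrightarrow> w permutes {1..n}"
  by (simp add: blk_stab_def)

lemma blk_incr_permutes: "w \<in> blk_incr n blk \<Longrightarrow> w permutes {1..n}"
  by (simp add: blk_incr_def)

lemma blk_incrD: "d \<in> blk_incr n blk \<Longrightarrow> 1 \<le> a \<Longrightarrow> a < b \<Longrightarrow> b \<le> n \<Longrightarrow> blk a = blk b \<Longrightarrow> d a < d b"
  by (auto simp: blk_incr_def)

lemma finite_blk_stab [simp]: "finite (blk_stab n blk)"
  by (rule finite_subset[of _ "perms n"]) (auto simp: blk_stab_def finite_permutations)

lemma finite_blk_incr [simp]: "finite (blk_incr n blk)"
  by (rule finite_subset[of _ "perms n"]) (auto simp: blk_incr_def finite_permutations)

lemma id_in_blk_stab [simp]: "id \<in> blk_stab n blk"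
  by (simp add: blk_stab_def permutes_id)

lemma blk_stab_comp:
  assumes "v \<in> blk_stab n blk" "w \<in> blk_stab n blk"
  shows "v \<circ> w \<in> blk_stab n blk"
  using assms permutes_compose[of w "{1..n}" v] permutes_in_image[of w "{1..n}"]
  by (simp add: blk_stab_def del: atLeastAtMost_iff)

lemma blk_stab_inv:
  assumes "v \<in> blk_stab n blk"
  shows "pinv v \<in> blk_stab n blk"
proof -
  have v: "v permutes {1..n}" and *: "\<And>p. p \<in> {1..n} \<Longrightarrow> blk (v p) = blk p"
    using assms by (auto simp: blk_stab_def)
  have "blk (pinv v p) = blk p" if "p \<in> {1..n}" for p
    using *[of "pinv v p"] that permutes_in_image[OF permutes_inv[OF v]]
    by (simp add: permutes_inverses[OF v] del: atLeastAtMost_iff)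
  then show ?thesis
    using permutes_inv[OF v] by (simp add: blk_stab_def)
qed

lemma s_transp_in_blk_stab:
  "1 \<le> i \<Longrightarrow> i < n \<Longrightarrow> blk i = blk (Suc i) \<Longrightarrow> s_transp i \<in> blk_stab n blk"
  using s_transp_permutes[of i n] by (auto simp: blk_stab_def transpose_def)

text \<open>An element of the Young subgroup permutes each interval within itself. If it reversed
  two positions of different blocks, one of these blocks would have a gap occupied by the
  other.\<close>

lemma blk_stab_less:
  assumes c: "convex_blk n blk" and v: "v \<in> blk_stab n blk"
    and ab: "1 \<le> a" "a < b" "b \<le> n" "blk a \<noteq> blk b"
  shows "v a < v b"
proof (rule ccontr)
  assume "\<not> v a < v b"
  then have lt: "v b < v a"
    using permutes_neq[OF blk_stab_permutes[OF v], of a b] ab by auto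
  have eq: "blk (v a) = blk a" "blk (v b) = blk b" and r: "1 \<le> v b" "v a \<le> n"
    using v ab permutes_le_iff[OF blk_stab_permutes[OF v], of a] permutes_le_iff[OF blk_stab_permutes[OF v], of b]
    by (simp_all add: blk_stab_def)
  have C: "\<And>a b c. 1 \<le> a \<Longrightarrow> a < b \<Longrightarrow> b < c \<Longrightarrow> c \<le> n \<Longrightarrow> blk a = blk c \<Longrightarrow> blk b = blk a"
    using c unfolding convex_blk_def by blast
  consider "v b = a" | "v a = b" | "v b < a" | "a < v b" "v a < b" | "b < v a"
    by linarith
  then show False
  proof cases
    case 3
    then show ?thesis using C[of "v b" a b] eq r ab by simp
  next
    case 4
    then show ?thesis using C[of a "v b" "v a"] eq r ab lt by simp
  next
    case 5
    then show ?thesis using C[of a b "v a"] eq r ab by simp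
  qed (use eq ab in simp_all)
qed

text \<open>The inversions of the product split into two disjoint kinds. Inside a block
  \<open>d\<close> keeps the order, so they are those of \<open>v\<close>; between blocks
  \<open>v\<close> keeps the order, so they come from those of \<open>d\<close>.\<close>

lemma len_blk_comp:
  assumes c: "convex_blk n blk" and v: "v \<in> blk_stab n blk" and d: "d \<in> blk_incr n blk"
  shows "len n (d \<circ> v) = len n d + len n v"
proof -
  have pv: "v permutes {1..n}" and pd: "d permutes {1..n}"
    using v d by (auto simp: blk_stab_def blk_incr_def)
  have piv: "pinv v \<in> blk_stab n blk" and pv': "pinv v permutes {1..n}"
    using blk_stab_inv[OF v] permutes_inv[OF pv] by auto
  have blk: "blk (v p) = blk p" if "1 \<le> p" "p \<le> n" for p
    using v that by (auto simp: blk_stab_def)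
  have blk': "blk (pinv v p) = blk p" if "1 \<le> p" "p \<le> n" for p
    using piv that by (auto simp: blk_stab_def)
  have same: "d (v b) < d (v a) \<longleftrightarrow> v b < v a" if "1 \<le> a" "a < b" "b \<le> n" "blk a = blk b" for a b
  proof -
    have r: "1 \<le> v a" "v a \<le> n" "1 \<le> v b" "v b \<le> n" "blk (v a) = blk (v b)" "v a \<noteq> v b"
      using that blk[of a] blk[of b] permutes_le_iff[OF pv, of a] permutes_le_iff[OF pv, of b]
        permutes_neq[OF pv, of a b] by simp_all
    then show ?thesis
      using blk_incrD[OF d, of "v a" "v b"] blk_incrD[OF d, of "v b" "v a"]
      by (cases "v a < v b") (simp_all add: not_less_iff_gr_or_eq)
  qed
  have eq: "inversions n (d \<circ> v) = inversions n v \<union> map_prod (pinv v) (pinv v) ` inversions n d"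
  proof (rule Set.set_eqI, rule iffI)
    fix x assume "x \<in> inversions n (d \<circ> v)"
    then obtain a b where x: "x = (a, b)" and ab: "1 \<le> a" "a < b" "b \<le> n" "d (v b) < d (v a)"
      by (auto simp: inversions_def)
    show "x \<in> inversions n v \<union> map_prod (pinv v) (pinv v) ` inversions n d"
    proof (cases "blk a = blk b")
      case True
      then show ?thesis using ab same[OF ab(1-3)] x by (auto simp: inversions_def)
    next
      case False
      then have "(v a, v b) \<in> inversions n d"
        using ab blk_stab_less[OF c v ab(1-3)] permutes_le_iff[OF pv, of a] permutes_le_iff[OF pv, of b]
        by (auto simp: inversions_def)
      moreover have "x = map_prod (pinv v) (pinv v) (v a, v b)"
        by (simp add: x permutes_inverses[OF pv])
      ultimately show ?thesis by blast
    qed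
  next
    fix x assume "x \<in> inversions n v \<union> map_prod (pinv v) (pinv v) ` inversions n d"
    then consider "x \<in> inversions n v" |
        a b where "x = (pinv v a, pinv v b)" "1 \<le> a" "a < b" "b \<le> n" "d b < d a"
      by (auto simp: inversions_def)
    then show "x \<in> inversions n (d \<circ> v)"
    proof cases
      case 1
      then obtain a b where x: "x = (a, b)" and ab: "1 \<le> a" "a < b" "b \<le> n" "v b < v a"
        by (auto simp: inversions_def)
      then have "blk a = blk b"
        using blk_stab_less[OF c v ab(1-3)] by force
      then show ?thesis
        using same[OF ab(1-3)] ab x by (auto simp: inversions_def)
    next
      case 2
      then have "blk a \<noteq> blk b"
        using blk_incrD[OF d, of a b] by force
      then have "pinv v a < pinv v b"
        using blk_stab_less[OF c piv 2(2-4)] by simp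
      then show ?thesis
        using 2 permutes_le_iff[OF pv', of a] permutes_le_iff[OF pv', of b]
        by (auto simp: inversions_def permutes_inverses[OF pv])
    qed
  qed
  have disj: "inversions n v \<inter> map_prod (pinv v) (pinv v) ` inversions n d = {}"
    using permutes_inverses[OF pv] by (auto simp: inversions_def)
  have "inj_on (map_prod (pinv v) (pinv v)) (inversions n d)"
    using prod.inj_map[OF permutes_inj[OF pv'] permutes_inj[OF pv']] inj_on_subset by blast
  then show ?thesis
    unfolding len_def eq by (subst card_Un_disjoint) (auto simp: disj card_image)
qed

text \<open>By convexity two positions of a block are joined by neighbours of the same block, so
  comparing neighbours suffices.\<close>

lemma blk_incrI:
  assumes c: "convex_blk n blk" and w: "w permutes {1..n}"
    and inc: "\<And>i. 1 \<le> i \<Longrightarrow> i < n \<Longrightarrow> blk i = blk (Suc i) \<Longrightarrow> w i < w (Suc i)"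
  shows "w \<in> blk_incr n blk"
proof -
  have "w a < w b" if "a < b" "1 \<le> a" "b \<le> n" "blk a = blk b" for a b
    using that
  proof (induction b)
    case (Suc b)
    show ?case
    proof (cases "a = b")
      case False
      then have "blk b = blk a"
        using Suc.prems c unfolding convex_blk_def by (metis Suc_lessI le_simps(3) lessI less_Suc_eq)
      then show ?thesis
        using Suc False inc[of b] by force
    qed (use Suc inc in auto)
  qed simp
  then show ?thesis
    using w by (auto simp: blk_incr_def)
qed

text \<open>As long as there is a descent inside a block, the corresponding adjacent transposition
  is split off and the length drops.\<close>

lemma blk_factorization:
  assumes c: "convex_blk n blk" and w: "w permutes {1..n}"
  obtains v d where "v \<in> blk_stab n blk" "d \<in> blk_incr n blk" "w = d \<circ> v"
proof -
  have "\<exists>v d. v \<in> blk_stab n blk \<and> d \<in> blk_incr n blk \<and> w = d \<circ> v"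
    using w
  proof (induction "len n w" arbitrary: w rule: less_induct)
    case less
    show ?case
    proof (cases "w \<in> blk_incr n blk")
      case True
      then show ?thesis by (intro exI[of _ id] exI[of _ w] conjI) simp_all
    next
      case False
      then obtain i where i: "1 \<le> i" "i < n" "blk i = blk (Suc i)" "\<not> w i < w (Suc i)"
        using blk_incrI[OF c less.prems] by blast
      then have "w (Suc i) < w i"
        using permutes_neq[OF less.prems, of i "Suc i"] by auto
      then have "len n (w \<circ> s_transp i) < len n w"
        using len_descent[OF less.prems i(1,2)] by simp
      from less.hyps[OF this permutes_compose[OF s_transp_permutes[OF i(1,2)] less.prems]]
      obtain v d where vd: "v \<in> blk_stab n blk" "d \<in> blk_incr n blk" "w \<circ> s_transp i = d \<circ> v"
        by (elim exE conjE)
      have "w = (w \<circ> s_transp i) \<circ> s_transp i"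
        by (simp add: s_transp_idem)
      also have "\<dots> = d \<circ> (v \<circ> s_transp i)"
        unfolding vd(3) by (simp add: comp_assoc)
      finally show ?thesis
        using blk_stab_comp[OF vd(1) s_transp_in_blk_stab[OF i(1-3)]] vd(2)
        by (intro exI[of _ "v \<circ> s_transp i"] exI[of _ d] conjI)
    qed
  qed
  then show thesis by (elim exE conjE) (rule that)
qed

text \<open>With \<open>u\<close> the composition of \<open>v'\<close> with the inverse of
  \<open>v\<close>, one has \<open>d = d' \<circ> u\<close> and
  \<open>d' = d \<circ> pinv u\<close>. Adding lengths in both directions forces \<open>u\<close> to
  have length 0.\<close>

lemma blk_factorization_unique:
  assumes c: "convex_blk n blk" and v: "v \<in> blk_stab n blk" "v' \<in> blk_stab n blk"
    and d: "d \<in> blk_incr n blk" "d' \<in> blk_incr n blk" and eq: "d \<circ> v = d' \<circ> v'"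
  shows "d = d'" "v = v'"
proof -
  note pv = blk_stab_permutes[OF v(1)] blk_stab_permutes[OF v(2)]
  define u where "u = v' \<circ> pinv v"
  have u: "u \<in> blk_stab n blk"
    unfolding u_def by (intro blk_stab_comp blk_stab_inv v)
  have d1: "d = d' \<circ> u"
  proof
    fix x show "d x = (d' \<circ> u) x"
      using fun_cong[OF eq, of "pinv v x"] permutes_inverses(1)[OF pv(1), of x] by (simp add: u_def)
  qed
  have d2: "d' = d \<circ> pinv u"
    unfolding d1 by (simp add: comp_assoc permutes_inv_o(1)[OF blk_stab_permutes[OF u]])
  have "len n d = len n d' + len n u" "len n d' = len n d + len n (pinv u)"
    using len_blk_comp[OF c u d(2)] len_blk_comp[OF c blk_stab_inv[OF u] d(1)]
    by (simp_all only: d1[symmetric] d2[symmetric])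
  then have ui: "u = id"
    using len_0_id[OF blk_stab_permutes[OF u]] by simp
  then show "d = d'"
    using d1 by simp
  show "v = v'"
  proof
    fix x show "v x = v' x"
      using fun_cong[OF ui, of "v x"] permutes_inverses(2)[OF pv(1), of x] by (simp add: u_def)
  qed
qed

text \<open>The elements of the larger Young subgroup that increase on the finer blocks represent
  its cosets by the smaller one. This is what lets sums over Young subgroups factor.\<close>

lemma bij_blk_factorization:
  assumes c: "convex_blk n blk'" and ref: "\<And>a b. a \<in> {1..n} \<Longrightarrow> b \<in> {1..n} \<Longrightarrow> blk' a = blk' b \<Longrightarrow> blk a = blk b"
  shows "bij_betw (\<lambda>(v, d). d \<circ> v) (blk_stab n blk' \<times> (blk_stab n blk \<inter> blk_incr n blk')) (blk_stab n blk)"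
proof -
  have sub: "blk_stab n blk' \<subseteq> blk_stab n blk"
  proof
    fix v assume v: "v \<in> blk_stab n blk'"
    show "v \<in> blk_stab n blk"
      unfolding blk_stab_def
    proof (intro CollectI conjI ballI blk_stab_permutes[OF v])
      fix p assume p: "p \<in> {1..n}"
      then have "v p \<in> {1..n}"
        using permutes_in_image[OF blk_stab_permutes[OF v]] by blast
      then show "blk (v p) = blk p"
        using ref[of "v p" p] p v by (simp add: blk_stab_def)
    qed
  qed
  have "inj_on (\<lambda>(v, d). d \<circ> v) (blk_stab n blk' \<times> (blk_stab n blk \<inter> blk_incr n blk'))"
  proof (rule inj_onI, clarify)
    fix v d v' d'
    assume "v \<in> blk_stab n blk'" "v' \<in> blk_stab n blk'" "d \<in> blk_incr n blk'" "d' \<in> blk_incr n blk'"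
      and eq: "d \<circ> v = d' \<circ> v'"
    from blk_factorization_unique[OF c this] show "v = v' \<and> d = d'"
      by blast
  qed
  moreover have "(\<lambda>(v, d). d \<circ> v) ` (blk_stab n blk' \<times> (blk_stab n blk \<inter> blk_incr n blk')) = blk_stab n blk"
    (is "?f ` ?A = _")
  proof (rule subset_antisym; rule subsetI)
    fix w assume w: "w \<in> blk_stab n blk"
    obtain v d where v: "v \<in> blk_stab n blk'" and d: "d \<in> blk_incr n blk'" and wd: "w = d \<circ> v"
      using blk_factorization[OF c blk_stab_permutes[OF w]] .
    have "d = w \<circ> pinv v"
      unfolding wd by (simp add: comp_assoc permutes_inv_o(1)[OF blk_stab_permutes[OF v]])
    then have "d \<in> blk_stab n blk"
      using blk_stab_comp[OF w blk_stab_inv, of v] v sub by (simp only: subsetD)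
    then have "?f (v, d) \<in> ?f ` ?A"
      using v d by (intro imageI SigmaI IntI)
    then show "w \<in> ?f ` ?A"
      unfolding wd prod.case .
  next
    fix w assume "w \<in> ?f ` ?A"
    then obtain v d where v: "v \<in> blk_stab n blk'" and d: "d \<in> blk_stab n blk" and w: "w = d \<circ> v"
      by auto
    show "w \<in> blk_stab n blk"
      unfolding w using blk_stab_comp[OF d, of v] v sub by (simp only: subsetD)
  qed
  ultimately show ?thesis
    unfolding bij_betw_def by blast
qed

section \<open>A ring of linear operators carrying the relations\<close>

text \<open>Acting on all scalar functions makes composition the product of a ring and allows one to
  study an operator \<open>F\<close> row by row, the row at \<open>v\<close> being the functional
  \<open>\<lambda>f. app F f v\<close>.\<close>

typedef 'v linop = "{F :: ('v \<Rightarrow> scalar) \<Rightarrow> ('v \<Rightarrow> scalar).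
    (\<forall>f g v. F (\<lambda>v. f v + g v) v = F f v + F g v) \<and> (\<forall>c f v. F (\<lambda>v. c * f v) v = c * F f v)}"
  morphisms app Abs_linop
  by (rule exI[of _ id]) simp

setup_lifting type_definition_linop

lemma app_add: "app F (\<lambda>v. f v + g v) v = app F f v + app F g v"
  and app_scale: "app F (\<lambda>v. c * f v) v = c * app F f v"
  using app[of F] by auto

instantiation linop :: (type) ring_1
begin

lift_definition zero_linop :: "'a linop" is "\<lambda>f v. 0" by simp
lift_definition one_linop :: "'a linop" is "\<lambda>f. f" by simp
lift_definition plus_linop :: "'a linop \<Rightarrow> 'a linop \<Rightarrow> 'a linop" is "\<lambda>F G f v. F f v + G f v"
  by (simp add: algebra_simps)
lift_definition minus_linop :: "'a linop \<Rightarrow> 'a linop \<Rightarrow> 'a linop" is "\<lambda>F G f v. F f v - G f v"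
  by (simp add: algebra_simps)
lift_definition uminus_linop :: "'a linop \<Rightarrow> 'a linop" is "\<lambda>F f v. - F f v"
  by simp
lift_definition times_linop :: "'a linop \<Rightarrow> 'a linop \<Rightarrow> 'a linop" is "\<lambda>F G f. F (G f)"
proof -
  fix F G :: "('a \<Rightarrow> scalar) \<Rightarrow> 'a \<Rightarrow> scalar"
  assume F: "(\<forall>f g v. F (\<lambda>v. f v + g v) v = F f v + F g v) \<and> (\<forall>c f v. F (\<lambda>v. c * f v) v = c * F f v)"
    and G: "(\<forall>f g v. G (\<lambda>v. f v + g v) v = G f v + G g v) \<and> (\<forall>c f v. G (\<lambda>v. c * f v) v = c * G f v)"
  have 1: "G (\<lambda>v. f v + g v) = (\<lambda>v. G f v + G g v)" "G (\<lambda>v. c * f v) = (\<lambda>v. c * G f v)" for f g c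
    using G by (auto simp: fun_eq_iff)
  show "(\<forall>f g v. F (G (\<lambda>v. f v + g v)) v = F (G f) v + F (G g) v) \<and>
      (\<forall>c f v. F (G (\<lambda>v. c * f v)) v = c * F (G f) v)"
    unfolding 1 using F by blast
qed

instance
proof
  fix a b c :: "'a linop"
  have F: "app a (\<lambda>v. f v + g v) = (\<lambda>v. app a f v + app a g v)" for f g
    by (simp add: fun_eq_iff app_add)
  show "a * (b + c) = a * b + a * c"
    unfolding app_inject[symmetric] plus_linop.rep_eq times_linop.rep_eq by (simp add: F)
  show "(0 :: 'a linop) \<noteq> 1"
    by transfer (metis (mono_tags) zero_neq_one)
qed (transfer; simp add: algebra_simps)+

end

lemma app_simps [simp]:
  "app 0 f v = 0" "app 1 f = f" "app (F + G) f v = app F f v + app G f v"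
  "app (F - G) f v = app F f v - app G f v" "app (- F) f v = - app F f v"
  "app (F * G) f = app F (app G f)"
  by (transfer; simp)+

lemma linop_eqI: "(\<And>f v. app F f v = app G f v) \<Longrightarrow> F = G"
  by (simp add: app_inject[symmetric] fun_eq_iff)

lemma app_sum: "app (\<Sum>i\<in>I. F i) f v = (\<Sum>i\<in>I. app (F i) f v)"
  by (induction I rule: infinite_finite_induct) auto

definition diag :: "('v \<Rightarrow> scalar) \<Rightarrow> 'v linop" where
  "diag F = Abs_linop (\<lambda>f v. F v * f v)"

lemma app_diag [simp]: "app (diag F) f v = F v * f v"
  unfolding diag_def by (subst Abs_linop_inverse) (simp_all add: algebra_simps)

lemma diag_mult: "diag F * diag G = diag (\<lambda>v. F v * G v)"
  and diag_add: "diag F + diag G = diag (\<lambda>v. F v + G v)"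
  and diag_diff: "diag F - diag G = diag (\<lambda>v. F v - G v)"
  by (rule linop_eqI; simp add: algebra_simps)+

lemma diag_one: "diag (\<lambda>v. 1) = 1" and diag_zero: "diag (\<lambda>v. 0) = 0"
  by (rule linop_eqI; simp)+

lemma diag_sum: "(\<Sum>i\<in>I. diag (F i)) = diag (\<lambda>v. \<Sum>i\<in>I. F i v)"
  by (induction I rule: infinite_finite_induct) (auto simp: diag_zero diag_add)

lemma diag_power: "diag F ^ k = diag (\<lambda>v. F v ^ k)"
  by (induction k) (auto simp: diag_one diag_mult)

text \<open>Scalar multiplication is expressed as multiplication by a central operator, so that it
  becomes part of the ring arithmetic.\<close>

definition C :: "scalar \<Rightarrow> 'v linop" where "C c = diag (\<lambda>v. c)"

lemma app_C [simp]: "app (C c) f v = c * f v"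
  by (simp add: C_def)

lemma C_central: "F * C c = C c * F"
proof (rule linop_eqI)
  fix f :: "'a \<Rightarrow> scalar" and v
  have "app (C c) f = (\<lambda>v. c * f v)" by (simp add: fun_eq_iff)
  then show "app (F * C c) f v = app (C c * F) f v" by (simp add: app_scale)
qed

lemma C_left_commute: "F * (C c * G) = C c * (F * G)"
  by (metis C_central mult.assoc)

lemma C_simps: "C a + C b = C (a + b)" "C a * C b = C (a * b)" "C a - C b = C (a - b)"
    "C 0 = 0" "C 1 = 1" "- C a = C (- a)"
  by (rule linop_eqI; simp add: C_def algebra_simps)+

lemma C_assoc: "C a * (C b * F) = C (a * b) * F"
  by (metis C_simps(2) mult.assoc)

text \<open>
  A letter is a pair of a colour, taken modulo \<open>r\<close>, and a value. The operators act on functions of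
  words \<open>v\<close> (the letter at position \<open>p\<close> is \<open>v p\<close>); they are dual to the action on tensor space,
  in which \<open>g\<^sub>i\<close> interchanges the letters at positions \<open>i\<close> and \<open>i + 1\<close>, corrected on letters of
  equal colour.
\<close>

type_synonym word = "nat \<Rightarrow> nat \<times> nat"
type_synonym oper = "word linop"

definition qq :: scalar where "qq = q_indet - inverse q_indet"

text \<open>Letters of equal colour carry the R-matrix of the Hecke algebra, with eigenvalues
  \<open>q\<close> and \<open>-1/q\<close>. Letters of different colours are merely interchanged, in
  accordance with \<open>e_i = 0\<close> there.\<close>

definition stay_coeff :: "nat \<Rightarrow> nat \<times> nat \<Rightarrow> nat \<times> nat \<Rightarrow> scalar" where
  "stay_coeff r x y = (if fst x mod r = fst y mod r then
     (if snd x = snd y then q_indet else if snd y < snd x then qq else 0) else 0)"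

definition swap_coeff :: "nat \<Rightarrow> nat \<times> nat \<Rightarrow> nat \<times> nat \<Rightarrow> scalar" where
  "swap_coeff r x y = (if fst x mod r = fst y mod r \<and> snd x = snd y then 0 else 1)"

definition opG :: "nat \<Rightarrow> nat \<Rightarrow> oper" where
  "opG r i = Abs_linop (\<lambda>f v. stay_coeff r (v i) (v (Suc i)) * f v +
     swap_coeff r (v i) (v (Suc i)) * f (v \<circ> s_transp i))"

lemma app_opG [simp]: "app (opG r i) f v = stay_coeff r (v i) (v (Suc i)) * f v +
     swap_coeff r (v i) (v (Suc i)) * f (v \<circ> s_transp i)"
  unfolding opG_def by (subst Abs_linop_inverse) (simp_all add: algebra_simps)

definition colours :: "nat \<Rightarrow> word \<Rightarrow> nat \<Rightarrow> nat" where
  "colours r v p = fst (v p) mod r"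

text \<open>The operators that depend only on the colours form a commutative algebra containing all
  \<open>t_i\<close>, \<open>e_ij\<close> and \<open>u_ik\<close>. Calculations with these
  idempotents become calculations with functions of the colours.\<close>

definition dg :: "nat \<Rightarrow> ((nat \<Rightarrow> nat) \<Rightarrow> scalar) \<Rightarrow> oper" where
  "dg r F = diag (\<lambda>v. F (colours r v))"

lemma app_dg [simp]: "app (dg r F) f v = F (colours r v) * f v"
  by (simp add: dg_def)

lemma dg_simps: "dg r F * dg r H = dg r (\<lambda>c. F c * H c)" "dg r F + dg r H = dg r (\<lambda>c. F c + H c)"
    "dg r F - dg r H = dg r (\<lambda>c. F c - H c)" "dg r (\<lambda>c. a) = C a" "dg r F ^ k = dg r (\<lambda>c. F c ^ k)"
    "C a * dg r F = dg r (\<lambda>c. a * F c)"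
  by (simp_all add: dg_def diag_mult diag_add diag_diff C_def diag_power)

lemma dg_sum: "(\<Sum>i\<in>I. dg r (F i)) = dg r (\<lambda>c. \<Sum>i\<in>I. F i c)"
  by (simp add: dg_def diag_sum)

definition opT :: "nat \<Rightarrow> nat \<Rightarrow> oper" where "opT r j = dg r (\<lambda>c. \<xi> r ^ c j)"

definition opE :: "nat \<Rightarrow> nat \<Rightarrow> nat \<Rightarrow> oper" where
  "opE r i j = dg r (\<lambda>c. of_bool (c i = c j))"

lemma q_indet_neq_0 [simp]: "q_indet \<noteq> 0"
  by (simp add: q_indet_def Zero_fract_def eq_fract)

lemma q_indet_inverse [simp]: "q_indet * inverse q_indet = 1" "inverse q_indet * q_indet = 1"
  by simp_all

lemma q_indet_cancel [simp]: "q_indet * (inverse q_indet * x) = x" "inverse q_indet * (q_indet * x) = x"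
  by (simp_all add: mult.assoc[symmetric])

lemma opG_quadratic: "opG r i * opG r i = 1 + C qq * opE r i (Suc i) * opG r i"
proof (rule linop_eqI)
  fix f and v :: word
  let ?a = "stay_coeff r (v i) (v (Suc i))" and ?b = "swap_coeff r (v i) (v (Suc i))"
    and ?a' = "stay_coeff r (v (Suc i)) (v i)" and ?b' = "swap_coeff r (v (Suc i)) (v i)"
    and ?e = "of_bool (colours r v i = colours r v (Suc i)) :: scalar"
  have 1: "?a * ?a + ?b * ?b' = 1 + qq * ?e * ?a"
    by (auto simp: stay_coeff_def swap_coeff_def colours_def qq_def algebra_simps)
  have 2: "?a * ?b + ?b * ?a' = qq * ?e * ?b"
    by (auto simp: stay_coeff_def swap_coeff_def colours_def algebra_simps)
  have "app (opG r i * opG r i) f v = (?a * ?a + ?b * ?b') * f v + (?a * ?b + ?b * ?a') * f (v \<circ> s_transp i)"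
    by (simp add: comp_assoc[of v] s_transp_idem algebra_simps)
  also have "\<dots> = app (1 + C qq * opE r i (Suc i) * opG r i) f v"
    unfolding 1 2 by (simp add: opE_def algebra_simps)
  finally show "app (opG r i * opG r i) f v = app (1 + C qq * opE r i (Suc i) * opG r i) f v" .
qed

lemma opG_commute:
  assumes "Suc i < j"
  shows "opG r i * opG r j = opG r j * opG r i"
proof (rule linop_eqI)
  fix f and v :: word
  have "v \<circ> s_transp i \<circ> s_transp j = v \<circ> s_transp j \<circ> s_transp i"
    using assms by (auto simp: fun_eq_iff transpose_def)
  then show "app (opG r i * opG r j) f v = app (opG r j * opG r i) f v"
    using assms by (simp add: algebra_simps)
qed

lemma opG_braid: "opG r i * opG r (Suc i) * opG r i = opG r (Suc i) * opG r i * opG r (Suc i)"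
proof (rule linop_eqI)
  fix f and v :: word
  define x y z where "x = v i" and "y = v (Suc i)" and "z = v (Suc (Suc i))"
  let ?s = "s_transp i" and ?t = "s_transp (Suc i)"
  have st: "v \<circ> ?s \<circ> ?t \<circ> ?s = v \<circ> ?t \<circ> ?s \<circ> ?t"
    by (auto simp: fun_eq_iff transpose_def)
  let ?a = "stay_coeff r" and ?b = "swap_coeff r"
  \<comment> \<open>Both sides combine the values of \<open>f\<close> at the six rearrangements of
    three letters; the six equations compare the coefficients.\<close>
  have 1: "?a x y * ?a y z * ?a x y + ?b x y * ?a x z * ?b y x
      = ?a y z * ?a x y * ?a y z + ?b y z * ?a x z * ?b z y"
    by (auto simp: stay_coeff_def swap_coeff_def qq_def algebra_simps split: if_splits)
  have 2: "?a x y * ?a y z * ?b x y + ?b x y * ?a x z * ?a y x = ?a y z * ?b x y * ?a x z"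
    by (auto simp: stay_coeff_def swap_coeff_def qq_def algebra_simps split: if_splits)
  have 3: "?a x y * ?b y z * ?a x z = ?a y z * ?a x y * ?b y z + ?b y z * ?a x z * ?a z y"
    by (auto simp: stay_coeff_def swap_coeff_def qq_def algebra_simps split: if_splits)
  have 4: "?a x y * ?b y z * ?b x z = ?b y z * ?b x z * ?a x y"
    by simp
  have 5: "?b x y * ?b x z * ?a y z = ?a y z * ?b x y * ?b x z"
    by simp
  have 6: "?b x y * ?b x z * ?b y z = ?b y z * ?b x z * ?b x y"
    by simp
  have "app (opG r i * opG r (Suc i) * opG r i) f v =
      (?a x y * ?a y z * ?a x y + ?b x y * ?a x z * ?b y x) * f v
    + (?a x y * ?a y z * ?b x y + ?b x y * ?a x z * ?a y x) * f (v \<circ> ?s)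
    + (?a x y * ?b y z * ?a x z) * f (v \<circ> ?t) + (?a x y * ?b y z * ?b x z) * f (v \<circ> ?t \<circ> ?s)
    + (?b x y * ?b x z * ?a y z) * f (v \<circ> ?s \<circ> ?t) + (?b x y * ?b x z * ?b y z) * f (v \<circ> ?s \<circ> ?t \<circ> ?s)"
    by (simp add: comp_assoc[of v ?s ?s] s_transp_idem algebra_simps x_def y_def z_def)
  moreover have "app (opG r (Suc i) * opG r i * opG r (Suc i)) f v =
      (?a y z * ?a x y * ?a y z + ?b y z * ?a x z * ?b z y) * f v
    + (?a y z * ?b x y * ?a x z) * f (v \<circ> ?s)
    + (?a y z * ?a x y * ?b y z + ?b y z * ?a x z * ?a z y) * f (v \<circ> ?t)
    + (?b y z * ?b x z * ?a x y) * f (v \<circ> ?t \<circ> ?s)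
    + (?a y z * ?b x y * ?b x z) * f (v \<circ> ?s \<circ> ?t) + (?b y z * ?b x z * ?b x y) * f (v \<circ> ?t \<circ> ?s \<circ> ?t)"
    by (simp add: comp_assoc[of v ?t ?t] s_transp_idem algebra_simps x_def y_def z_def)
  ultimately show "app (opG r i * opG r (Suc i) * opG r i) f v
      = app (opG r (Suc i) * opG r i * opG r (Suc i)) f v"
    unfolding 1 2 3 4 5 6 st by simp
qed

lemma opG_dg: "opG r i * dg r F = dg r (\<lambda>c. F (c \<circ> s_transp i)) * opG r i"
proof (rule linop_eqI)
  fix f and v :: word
  have 1: "colours r (v \<circ> s_transp i) = colours r v \<circ> s_transp i"
    by (simp add: colours_def fun_eq_iff)
  \<comment> \<open>A letter can stay only next to one of the same colour, and then the
    transposition does not change the colours.\<close>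
  have 2: "colours r v \<circ> s_transp i = colours r v" if "stay_coeff r (v i) (v (Suc i)) \<noteq> 0"
    using that by (auto simp: colours_def fun_eq_iff stay_coeff_def transpose_def split: if_splits)
  show "app (opG r i * dg r F) f v = app (dg r (\<lambda>c. F (c \<circ> s_transp i)) * opG r i) f v"
  proof (cases "stay_coeff r (v i) (v (Suc i)) = 0")
    case False
    show ?thesis
      using 2[OF False] by (simp add: 1 algebra_simps)
  qed (simp add: 1 algebra_simps)
qed

lemma opT_opG: "opT r j * opG r i = opG r i * opT r (s_transp i j)"
  by (simp add: opT_def opG_dg)

lemma opE_mult_left: "opE r i (Suc i) * opG r i = opG r i * opE r i (Suc i)"
  by (simp add: opE_def opG_dg eq_commute)

section \<open>Scalars and linear spans\<close>

lemma coeff_ring_simps [simp]: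
  "monoid.mult (coeff_ring r) = (*)" "one (coeff_ring r) = 1" "ring.zero (coeff_ring r) = 0"
  "add (coeff_ring r) = (+)"
  by (simp_all add: coeff_ring_def ring_of_type_algebra_def)

abbreviation scalars :: "nat \<Rightarrow> scalar set" where "scalars r \<equiv> carrier (coeff_ring r)"

lemma coeff_ring_domain: "domain (coeff_ring r)"
proof -
  let ?G = "generate_ring ring_of_type_algebra
    {q_indet, inverse q_indet, \<xi> r, inverse (of_nat r), inverse (\<Delta> r)}"
  have "subring ?G (ring_of_type_algebra :: scalar ring)"
    by (rule ring.generate_ring_is_subring[OF ring_from_type_algebra]) (simp add: ring_of_type_algebra_def)
  then show ?thesis
    unfolding coeff_ring_def
    by (intro domain.subring_is_domain[OF field.axioms(1)[OF field_from_type_algebra]])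
qed

lemma coeffs_closed [simp, intro]:
  "0 \<in> scalars r" "1 \<in> scalars r" "a \<in> scalars r \<Longrightarrow> b \<in> scalars r \<Longrightarrow> a + b \<in> scalars r"
  "a \<in> scalars r \<Longrightarrow> b \<in> scalars r \<Longrightarrow> a * b \<in> scalars r"
  "a \<in> scalars r \<Longrightarrow> - a \<in> scalars r"
proof -
  interpret cR: domain "coeff_ring r"
    by (rule coeff_ring_domain)
  show 0: "0 \<in> scalars r" and "1 \<in> scalars r" and
    *: "a \<in> scalars r \<Longrightarrow> b \<in> scalars r \<Longrightarrow> a + b \<in> scalars r" for a b
    using cR.zero_closed cR.one_closed cR.a_closed by simp_all
  show "a \<in> scalars r \<Longrightarrow> b \<in> scalars r \<Longrightarrow> a * b \<in> scalars r"
    using cR.m_closed by simp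
  show "- a \<in> scalars r" if "a \<in> scalars r"
    using cR.r_neg[OF that] cR.a_inv_closed[OF that] by (simp add: add_eq_0_iff)
qed

lemma coeffs_diff [simp, intro]: "a \<in> scalars r \<Longrightarrow> b \<in> scalars r \<Longrightarrow> a - b \<in> scalars r"
  using coeffs_closed(3)[of a r "- b"] by simp

lemma coeffs_power [simp, intro]: "a \<in> scalars r \<Longrightarrow> a ^ k \<in> scalars r"
  by (induction k) auto

lemma coeffs_of_nat [simp, intro]: "of_nat k \<in> scalars r"
  by (induction k) auto

lemma coeffs_gens [simp, intro]:
  "q_indet \<in> scalars r" "inverse q_indet \<in> scalars r" "\<xi> r \<in> scalars r" "inverse (of_nat r) \<in> scalars r"
  "qq \<in> scalars r"
proof -
  show *: "q_indet \<in> scalars r" "inverse q_indet \<in> scalars r" "\<xi> r \<in> scalars r" "inverse (of_nat r) \<in> scalars r"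
    by (simp_all add: coeff_ring_def generate_ring.incl)
  show "qq \<in> scalars r"
    unfolding qq_def using * by blast
qed

lemma const_scalar_simps:
  "const_scalar a * const_scalar b = const_scalar (a * b)" "const_scalar 1 = 1"
  "const_scalar a ^ k = const_scalar (a ^ k)" "const_scalar a = const_scalar b \<longleftrightarrow> a = b"
proof -
  show 1: "const_scalar a * const_scalar b = const_scalar (a * b)" "const_scalar 1 = 1" for a b
    by (simp_all add: const_scalar_def One_fract_def one_pCons mult.commute)
  show "const_scalar a ^ k = const_scalar (a ^ k)"
    by (induction k) (simp_all add: 1)
  show "const_scalar a = const_scalar b \<longleftrightarrow> a = b"
    by (simp add: const_scalar_def eq_fract)
qed

lemma xi_eq: "\<xi> r = const_scalar (cis (2 * pi / real r))"
  by (simp add: \<xi>_def cis_conv_exp algebra_simps)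

lemma xi_power: "\<xi> r ^ k = const_scalar (cis (2 * pi * real k / real r))"
  by (simp add: xi_eq const_scalar_simps DeMoivre algebra_simps)

lemma xi_power_r [simp]: "1 \<le> r \<Longrightarrow> \<xi> r ^ r = 1"
  by (simp add: xi_power const_scalar_simps)

lemma xi_power_mod: "1 \<le> r \<Longrightarrow> \<xi> r ^ (k mod r) = \<xi> r ^ k"
proof -
  assume "1 \<le> r"
  have "\<xi> r ^ k = \<xi> r ^ (r * (k div r) + k mod r)"
    by simp
  also have "\<dots> = \<xi> r ^ (k mod r)"
    unfolding power_add power_mult using \<open>1 \<le> r\<close> by simp
  finally show ?thesis by simp
qed

lemma xi_neq_0 [simp]: "1 \<le> r \<Longrightarrow> \<xi> r \<noteq> 0"
  using xi_power_r[of r] by (metis power_0_left zero_neq_one not_one_le_zero)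

lemma xi_power_eq_iff:
  assumes "1 \<le> r"
  shows "\<xi> r ^ a = \<xi> r ^ b \<longleftrightarrow> a mod r = b mod r"
proof
  assume "\<xi> r ^ a = \<xi> r ^ b"
  then have "\<xi> r ^ (a mod r) = \<xi> r ^ (b mod r)"
    using assms by (simp add: xi_power_mod)
  moreover have "inj_on (\<lambda>k. cis (2 * pi * real k / real r)) {..<r}"
    using bij_betw_roots_unity[of r] assms by (simp add: bij_betw_def)
  ultimately show "a mod r = b mod r"
    using assms by (auto simp: xi_power const_scalar_simps dest: inj_onD)
qed (metis xi_power_mod[OF assms])

lemma of_nat_scalar_neq_0 [simp]: "1 \<le> r \<Longrightarrow> (of_nat r :: scalar) \<noteq> 0"
proof -
  assume r: "1 \<le> r"
  have "(of_nat r :: complex poly) \<noteq> 0"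
    using r by (simp add: of_nat_poly)
  then show ?thesis
    by (simp add: of_nat_fract Zero_fract_def eq_fract)
qed

lemma sum_roots_of_unity:
  fixes x :: scalar
  assumes r: "1 \<le> r" and x: "x ^ r = 1"
  shows "inverse (of_nat r) * (\<Sum>m<r. x ^ m) = of_bool (x = 1)"
proof (cases "x = 1")
  case False
  have "(x - 1) * (\<Sum>m<r. x ^ m) = 0"
    using x by (simp add: power_diff_1_eq[symmetric])
  then show ?thesis using False by simp
qed (use r in simp)

text \<open>Orthogonality of the characters of the cyclic group of order \<open>r\<close>, with the
  exponent \<open>r - m\<close> standing for \<open>-m\<close>. It makes \<open>opE\<close> the
  projection to words with equal colours at two positions.\<close>

lemma xi_character_sum:
  assumes r: "1 \<le> r"
  shows "inverse (of_nat r) * (\<Sum>m<r. (\<xi> r ^ a) ^ m * (\<xi> r ^ b) ^ (r - m)) = of_bool (a mod r = b mod r)"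
proof -
  have "(\<xi> r ^ a) ^ m * (\<xi> r ^ b) ^ (r - m) = (\<xi> r ^ a * inverse (\<xi> r ^ b)) ^ m" if "m < r" for m
  proof -
    have "(\<xi> r ^ b) ^ (r - m) * (\<xi> r ^ b) ^ m = (\<xi> r ^ r) ^ b"
      using that by (simp only: power_add[symmetric] power_mult[symmetric])
        (simp add: mult.commute add_mult_distrib2[symmetric])
    then have "(\<xi> r ^ b) ^ (r - m) = inverse ((\<xi> r ^ b) ^ m)"
      using r by (intro inverse_unique[symmetric]) (simp_all add: mult.commute)
    then show ?thesis
      by (simp only: power_mult_distrib power_inverse)
  qed
  then have "(\<Sum>m<r. (\<xi> r ^ a) ^ m * (\<xi> r ^ b) ^ (r - m)) = (\<Sum>m<r. (\<xi> r ^ a * inverse (\<xi> r ^ b)) ^ m)"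
    by simp
  moreover have "(\<xi> r ^ a * inverse (\<xi> r ^ b)) ^ r = 1"
  proof -
    have "(\<xi> r ^ a * inverse (\<xi> r ^ b)) ^ r = (\<xi> r ^ r) ^ a * inverse ((\<xi> r ^ r) ^ b)"
      by (simp only: power_mult_distrib power_inverse power_mult[symmetric] mult.commute)
    then show ?thesis using r by simp
  qed
  moreover have "\<xi> r ^ a * inverse (\<xi> r ^ b) = 1 \<longleftrightarrow> a mod r = b mod r"
    using r by (simp add: xi_power_eq_iff[symmetric] field_simps)
  ultimately show ?thesis
    using sum_roots_of_unity[OF r, of "\<xi> r ^ a * inverse (\<xi> r ^ b)"] by simp
qed

text \<open>The inverse of \<open>\<xi> r\<close> is not among the generators of the coefficient
  ring. Writing its powers as nonnegative powers of \<open>\<xi> r\<close> shows that the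
  coefficients of \<open>fu\<close> lie in that ring.\<close>

lemma xi_powi_eq:
  assumes r: "1 \<le> r"
  shows "\<xi> r powi (- int (j * k)) = (\<xi> r ^ (k mod r)) ^ (r * j - j)"
proof -
  have "(\<xi> r ^ (k mod r)) ^ (r * j - j) * (\<xi> r ^ (k mod r)) ^ j = (\<xi> r ^ r) ^ (j * (k mod r))"
    using r by (simp only: power_add[symmetric] power_mult[symmetric]) (simp add: algebra_simps)
  then have "(\<xi> r ^ (k mod r)) ^ (r * j - j) = inverse ((\<xi> r ^ (k mod r)) ^ j)"
    using r by (intro inverse_unique[symmetric]) (simp_all add: mult.commute)
  also have "\<dots> = \<xi> r powi (- int (j * k))"
    using r by (simp add: power_int_minus xi_power_mod power_mult[symmetric] mult.commute
        del: of_nat_mult)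
  finally show ?thesis ..
qed

lemma coeffs_xi_powi: "1 \<le> r \<Longrightarrow> \<xi> r powi (- int (j * k)) \<in> scalars r"
  by (simp only: xi_powi_eq) (intro coeffs_power coeffs_gens)

lemma xi_character_sum':
  assumes r: "1 \<le> r"
  shows "inverse (of_nat r) * (\<Sum>j<r. \<xi> r powi (- int (j * k)) * (\<xi> r ^ a) ^ j) = of_bool (a mod r = k mod r)"
proof -
  have "\<xi> r powi (- int (j * k)) * (\<xi> r ^ a) ^ j = (\<xi> r ^ a) ^ j * (\<xi> r ^ k) ^ (r - j)" if "j < r" for j
  proof -
    have "(\<xi> r ^ k) ^ (r - j) * (\<xi> r ^ k) ^ j = (\<xi> r ^ r) ^ k"
      using that by (simp only: power_add[symmetric] power_mult[symmetric])
        (simp add: mult.commute[of _ k] mult.commute[of j] add_mult_distrib2[symmetric])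
    then have "(\<xi> r ^ k) ^ (r - j) = inverse ((\<xi> r ^ k) ^ j)"
      using r by (intro inverse_unique[symmetric]) (simp_all add: mult.commute)
    also have "\<dots> = \<xi> r powi (- int (j * k))"
      using r by (simp add: power_int_minus power_mult[symmetric] mult.commute del: of_nat_mult)
    finally show ?thesis by simp
  qed
  then have "(\<Sum>j<r. \<xi> r powi (- int (j * k)) * (\<xi> r ^ a) ^ j)
      = (\<Sum>j<r. (\<xi> r ^ a) ^ j * (\<xi> r ^ k) ^ (r - j))"
    by (intro sum.cong refl) simp
  then show ?thesis
    using xi_character_sum[OF r, of a k] by (simp only:)
qed

lemma xi_power_colour_r: "1 \<le> r \<Longrightarrow> (\<xi> r ^ k) ^ r = 1"
  by (metis mult.commute power_mult power_one xi_power_r)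

lemma opT_power_r: "1 \<le> r \<Longrightarrow> opT r i ^ r = 1"
  unfolding opT_def dg_simps by (simp add: xi_power_colour_r dg_def diag_one)

lemma opE_eq:
  assumes "1 \<le> r"
  shows "C (inverse (of_nat r)) * (\<Sum>m<r. opT r i ^ m * opT r j ^ (r - m)) = opE r i j"
  unfolding opT_def opE_def dg_simps dg_sum using xi_character_sum[OF assms]
  by (simp add: dg_def colours_def)

definition opU1 :: "nat \<Rightarrow> nat \<Rightarrow> nat \<Rightarrow> oper" where
  "opU1 r i k = dg r (\<lambda>c. of_bool (c i = k mod r))"

lemma opU1_eq:
  assumes "1 \<le> r"
  shows "C (inverse (of_nat r)) * (\<Sum>j<r. C (\<xi> r powi (- int (j * k))) * opT r i ^ j) = opU1 r i k"
  unfolding opT_def opU1_def dg_simps dg_sum using xi_character_sum'[OF assms]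
  by (simp add: dg_def colours_def)

section \<open>Spans over the coefficient ring and over the field\<close>

inductive_set rspan :: "nat \<Rightarrow> 'v linop set \<Rightarrow> 'v linop set" for r S where
  rspan_0 [simp, intro]: "0 \<in> rspan r S"
| rspan_step: "a \<in> scalars r \<Longrightarrow> s \<in> S \<Longrightarrow> x \<in> rspan r S \<Longrightarrow> C a * s + x \<in> rspan r S"

lemma rspan_base: "s \<in> S \<Longrightarrow> s \<in> rspan r S"
  using rspan_step[of 1 r s S 0] by (simp add: C_simps)

lemma rspan_add: "x \<in> rspan r S \<Longrightarrow> y \<in> rspan r S \<Longrightarrow> x + y \<in> rspan r S"
  by (induction rule: rspan.induct) (auto simp: add.assoc intro: rspan_step)

lemma rspan_scale: "x \<in> rspan r S \<Longrightarrow> a \<in> scalars r \<Longrightarrow> C a * x \<in> rspan r S"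
  by (induction rule: rspan.induct) (auto simp: distrib_left C_assoc intro: rspan_step)

lemma rspan_diff: "x \<in> rspan r S \<Longrightarrow> y \<in> rspan r S \<Longrightarrow> x - y \<in> rspan r S"
  using rspan_add[OF _ rspan_scale[of y r S "- 1"], of x] by (simp add: C_simps(6)[symmetric] C_simps)

lemma rspan_sum: "(\<And>i. i \<in> I \<Longrightarrow> f i \<in> rspan r S) \<Longrightarrow> sum f I \<in> rspan r S"
  by (induction I rule: infinite_finite_induct) (auto intro: rspan_add)

text \<open>Linearity of \<open>h\<close> is demanded only at the steps that build up the span,
  because the anti-involution \<open>st\<close> is known to be additive only on the algebra.\<close>

lemma rspan_map:
  assumes x: "x \<in> rspan r S" and S: "\<And>s. s \<in> S \<Longrightarrow> h s \<in> rspan r T"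
    and h: "h 0 = 0" "\<And>a s x. a \<in> scalars r \<Longrightarrow> s \<in> S \<Longrightarrow> x \<in> rspan r S \<Longrightarrow> h (C a * s + x) = C a * h s + h x"
  shows "h x \<in> rspan r T"
  using x by induction (auto simp: h intro: rspan_add rspan_scale S)

lemma rspan_subset: "x \<in> rspan r S \<Longrightarrow> (\<And>s. s \<in> S \<Longrightarrow> s \<in> rspan r T) \<Longrightarrow> x \<in> rspan r T"
  using rspan_map[of x r S "\<lambda>x. x" T] by simp

lemma rspan_mono: "x \<in> rspan r S \<Longrightarrow> S \<subseteq> T \<Longrightarrow> x \<in> rspan r T"
  by (erule rspan_subset) (auto intro: rspan_base)

lemma rspan_mult_left:
  "x \<in> rspan r S \<Longrightarrow> (\<And>s. s \<in> S \<Longrightarrow> y * s \<in> rspan r T) \<Longrightarrow> y * x \<in> rspan r T"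
  using rspan_map[of x r S "\<lambda>x. y * x" T] by (simp add: distrib_left C_left_commute)

lemma rspan_mult_right:
  "x \<in> rspan r S \<Longrightarrow> (\<And>s. s \<in> S \<Longrightarrow> s * y \<in> rspan r T) \<Longrightarrow> x * y \<in> rspan r T"
  using rspan_map[of x r S "\<lambda>x. x * y" T] by (simp add: distrib_right mult.assoc)

lemma rspan_finite:
  assumes "x \<in> rspan r (f ` I)" "finite I"
  obtains a where "\<And>i. a i \<in> scalars r" "x = (\<Sum>i\<in>I. C (a i) * f i)"
proof -
  have "\<exists>a. (\<forall>i. a i \<in> scalars r) \<and> x = (\<Sum>i\<in>I. C (a i) * f i)"
    using assms(1)
  proof induction
    case rspan_0
    show ?case by (intro exI[of _ "\<lambda>i. 0"]) (simp add: C_simps)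
  next
    case (rspan_step c s x)
    then obtain a i where a: "\<And>i. a i \<in> scalars r" "x = (\<Sum>i\<in>I. C (a i) * f i)" "i \<in> I" "s = f i"
      by auto
    let ?b = "a(i := a i + c)"
    have "(\<Sum>j\<in>I. C (?b j) * f j) = C (a i + c) * f i + (\<Sum>j\<in>I - {i}. C (a j) * f j)"
      using assms(2) a(3) by (simp add: sum.remove)
    also have "\<dots> = C c * s + x"
      using assms(2) a(3) by (simp add: a(2,4) sum.remove[of I i] C_simps(1)[symmetric] distrib_right)
    finally show ?case
      using a(1) rspan_step(1) by (intro exI[of _ ?b]) auto
  qed
  then show thesis using that by auto
qed

text \<open>\<open>rspan\<close> has coefficients in the coefficient ring, \<open>vs.span\<close> in
  all of \<open>\<complex>(q)\<close>. Spanning is proved for the former and independence for the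
  latter; together they give a basis over the ring.\<close>

interpretation vs: vector_space "\<lambda>c (x :: 'v linop). C c * x"
  by unfold_locales
    (simp_all add: C_simps(4,5) C_assoc distrib_left C_simps(1)[symmetric] distrib_right)

lemma rspan_subset_span: "x \<in> rspan r S \<Longrightarrow> x \<in> vs.span S"
  by (induction rule: rspan.induct) (auto intro: vs.span_add vs.span_scale vs.span_base vs.span_zero)

text \<open>The exchange argument behind both dimension counts: first for the normal form words of
  the presentation, later for the elements \<open>m_st\<close>. In both cases \<open>B\<close> is
  the family of the \<open>u_\<chi> g_w\<close>.\<close>

lemma spanning_family_independent:
  fixes f :: "'i \<Rightarrow> 'v linop"
  assumes I: "finite I" and B: "vs.independent B" "B \<subseteq> vs.span (f ` I)" "card I \<le> card B"
  shows "inj_on f I" "vs.independent (f ` I)" "f ` I \<subseteq> vs.span B"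
proof -
  have fin: "finite B" "card B \<le> card (f ` I)"
    using vs.independent_span_bound[OF finite_imageI[OF I] B(1,2)] by simp_all
  have c: "card (f ` I) = card I" "card I = card B"
    using fin(2) B(3) card_image_le[OF I, of f] by simp_all
  show "inj_on f I"
    using eq_card_imp_inj_on[OF I c(1)] .
  \<comment> \<open>\<open>B'\<close> spans the same space as the whole family, so it has at least
    \<open>card B\<close> elements and must be all of it.\<close>
  obtain B' where B': "B' \<subseteq> f ` I" "vs.independent B'" "f ` I \<subseteq> vs.span B'"
    by (rule vs.maximal_independent_subset)
  have finB': "finite B'"
    using B'(1) I finite_subset by blast
  have "B \<subseteq> vs.span B'"
    using B(2) vs.span_minimal[OF B'(3) vs.subspace_span] by blast
  then have "card B \<le> card B'"
    using vs.independent_span_bound[OF finB' B(1)] by simp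
  then have "B' = f ` I"
    using card_subset_eq[OF finite_imageI[OF I] B'(1)] c card_mono[OF finite_imageI[OF I] B'(1)] by simp
  then show "vs.independent (f ` I)"
    using B'(2) by simp
  show "f ` I \<subseteq> vs.span B"
  \<comment> \<open>Otherwise \<open>B\<close> could be enlarged to an independent set that is too
    big for the spanning family.\<close>
  proof (rule ccontr)
    assume "\<not> f ` I \<subseteq> vs.span B"
    then obtain x where x: "x \<in> f ` I" "x \<notin> vs.span B" by blast
    have xB: "x \<notin> B"
      using x(2) vs.span_base[of x B] by blast
    have "vs.independent (insert x B)"
      unfolding vs.independent_insert using B(1) x(2) xB by simp
    moreover have "insert x B \<subseteq> vs.span (f ` I)"
      using B(2) vs.span_base[OF x(1)] by blast
    ultimately have "card (insert x B) \<le> card (f ` I)"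
      using vs.independent_span_bound[of "f ` I" "insert x B"] I by blast
    then show False
      using xB c fin by simp
  qed
qed

section \<open>Evaluation of the free algebra\<close>

fun genop :: "nat \<Rightarrow> gen \<Rightarrow> oper" where
  "genop r (Gen_g i) = opG r i"
| "genop r (Gen_t i) = opT r i"

definition wordop :: "nat \<Rightarrow> gen list \<Rightarrow> oper" where
  "wordop r w = prod_list (map (genop r) w)"

definition phi :: "nat \<Rightarrow> free \<Rightarrow> oper" where
  "phi r x = (\<Sum>w\<in>Poly_Mapping.keys x. C (Poly_Mapping.lookup x w) * wordop r w)"

lemma wordop_simps [simp]:
  "wordop r [] = 1" "wordop r (a # w) = genop r a * wordop r w" "wordop r (v @ w) = wordop r v * wordop r w"
  by (simp_all add: wordop_def)

lemma phi_superset: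
  assumes "finite S" "Poly_Mapping.keys x \<subseteq> S"
  shows "phi r x = (\<Sum>w\<in>S. C (Poly_Mapping.lookup x w) * wordop r w)"
  unfolding phi_def using assms
  by (intro sum.mono_neutral_left) (auto simp: in_keys_iff C_simps)

lemma phi_add [simp]: "phi r (x + y) = phi r x + phi r y"
proof -
  let ?S = "Poly_Mapping.keys x \<union> Poly_Mapping.keys y"
  show ?thesis
    using phi_superset[of ?S x r] phi_superset[of ?S y r] phi_superset[of ?S "x + y" r] keys_add[of x y]
    by (simp add: lookup_add C_simps(1)[symmetric] distrib_right sum.distrib)
qed

lemma phi_0 [simp]: "phi r 0 = 0"
  by (simp add: phi_def)

lemma phi_single [simp]: "phi r (Poly_Mapping.single w a) = C a * wordop r w"
  by (simp add: phi_def C_simps)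

lemma phi_uminus [simp]: "phi r (- x) = - phi r x"
  by (metis add.right_inverse minus_unique phi_0 phi_add)

lemma phi_diff [simp]: "phi r (x - y) = phi r x - phi r y"
  using phi_add[of r x "- y"] by simp

lemma free_as_sum: "x = (\<Sum>w\<in>Poly_Mapping.keys x. Poly_Mapping.single w (Poly_Mapping.lookup x w))"
  by (rule poly_mapping_eqI)
    (simp add: lookup_sum lookup_single when_def in_keys_iff cong: if_cong)

lemma free_induct [case_names zero add]:
  fixes x :: free
  assumes "P 0" "\<And>w a x. P x \<Longrightarrow> P (Poly_Mapping.single w a + x)"
  shows "P x"
proof -
  have "P (\<Sum>w\<in>S. Poly_Mapping.single w (Poly_Mapping.lookup x w))" if "finite S" for S
    using that by induction (auto intro: assms)
  from this[OF finite_keys[of x]] show ?thesis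
    by (simp only: free_as_sum[symmetric])
qed

lemma phi_mult [simp]: "phi r (x * y) = phi r x * phi r y"
proof (induction x rule: free_induct)
  case (add w a x)
  have "phi r (Poly_Mapping.single w a * y) = C a * wordop r w * phi r y"
  proof (induction y rule: free_induct)
    case (add v b y)
    then show ?case
      by (simp add: distrib_left mult_single plus_list_def mult.assoc C_left_commute[of "wordop r w"] C_assoc)
  qed simp
  with add show ?case by (simp add: distrib_right)
qed simp

lemma phi_one [simp]: "phi r 1 = 1"
proof -
  have "phi r (Poly_Mapping.single 0 1) = 1"
    unfolding zero_list_def by (simp add: C_simps)
  then show ?thesis by (simp only: single_one)
qed

lemma phi_sum [simp]: "phi r (sum f I) = (\<Sum>i\<in>I. phi r (f i))"
  by (induction I rule: infinite_finite_induct) auto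

lemma phi_power [simp]: "phi r (x ^ k) = phi r x ^ k"
  by (induction k) auto

lemma phi_sc [simp]: "phi r (sc a) = C a"
  by (simp add: sc_def)

lemma phi_fe: "1 \<le> r \<Longrightarrow> phi r (fe r i j) = opE r i j"
  by (simp add: fe_def opE_eq[symmetric] C_simps)

lemma phi_fu: "1 \<le> r \<Longrightarrow> phi r (fu r i k) = opU1 r i k"
  by (simp add: fu_def opU1_eq[symmetric] C_simps)

lemma phi_relations:
  assumes "1 \<le> r" "x \<in> relations r n"
  shows "phi r x = 0"
proof -
  have *: "opT r i * opT r j = opT r j * opT r i" for i j
    by (simp add: opT_def dg_simps mult.commute)
  have **: "opG r i * opG r j = opG r j * opG r i" if "\<bar>int i - int j\<bar> > 1" for i j
  proof -
    from that have "Suc i < j \<or> Suc j < i" by linarith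
    then show ?thesis using opG_commute[of i j r] opG_commute[of j i r] by auto
  qed
  show ?thesis
    using assms(2) unfolding relations_def
    by (elim UnE CollectE exE conjE)
      (simp_all add: phi_fe[OF assms(1)] opT_power_r[OF assms(1)] * ** opT_opG opG_braid C_simps
        power2_eq_square opG_quadratic qq_def)
qed

subsection \<open>Reduced words and independent elements\<close>

definition gword :: "nat \<Rightarrow> nat list \<Rightarrow> oper" where
  "gword r is = wordop r (map Gen_g is)"

lemma gword_simps [simp]:
  "gword r [] = 1" "gword r (i # is) = opG r i * gword r is" "gword r (is @ js) = gword r is * gword r js"
  by (simp_all add: gword_def)

text \<open>The idempotent of the character that sends \<open>t_p\<close> to the power of
  \<open>\<xi> r\<close> with exponent \<open>\<chi> p\<close>; only the positions from 1 to
  \<open>n\<close> are restricted.\<close>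

definition opU :: "nat \<Rightarrow> nat \<Rightarrow> (nat \<Rightarrow> nat) \<Rightarrow> oper" where
  "opU r n \<chi> = dg r (\<lambda>c. of_bool (\<forall>p\<in>{1..n}. c p = \<chi> p))"

text \<open>The value \<open>p\<close> at position \<open>p\<close> makes the letters distinct and
  increasing, so that \<open>stay_coeff\<close> vanishes along every reduced word.\<close>

definition base :: "(nat \<Rightarrow> nat) \<Rightarrow> word" where
  "base \<chi> p = (\<chi> p, p)"

lemma bij_perm_of_word: "bij (perm_of_word is)"
proof (induction "is" rule: rev_induct)
  case Nil
  show "bij (perm_of_word [])" by simp
next
  case (snoc i "is")
  show "bij (perm_of_word (is @ [i]))"
    unfolding perm_of_word_simps by (rule bij_comp[OF snoc]) simp
qed

lemma gword_dg: "gword r is * dg r F = dg r (\<lambda>c. F (c \<circ> pinv (perm_of_word is))) * gword r is"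
proof (induction "is" arbitrary: F)
  case (Cons i "is")
  have "bij (perm_of_word is)"
    by (rule bij_perm_of_word)
  then have "pinv (perm_of_word (i # is)) = s_transp i \<circ> pinv (perm_of_word is)"
    unfolding perm_of_word_Cons by (simp add: o_inv_distrib)
  then have *: "c \<circ> s_transp i \<circ> pinv (perm_of_word is) = c \<circ> pinv (perm_of_word (i # is))" for c :: "nat \<Rightarrow> nat"
    by (simp add: comp_assoc)
  have IH: "gword r is * dg r F = dg r (\<lambda>c. F (c \<circ> pinv (perm_of_word is))) * gword r is"
    by (rule Cons)
  have "gword r (i # is) * dg r F = opG r i * dg r (\<lambda>c. F (c \<circ> pinv (perm_of_word is))) * gword r is"
    unfolding gword_simps mult.assoc IH ..
  also have "\<dots> = dg r (\<lambda>c. F (c \<circ> pinv (perm_of_word (i # is)))) * gword r (i # is)"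
    by (simp only: opG_dg * gword_simps mult.assoc)
  finally show "gword r (i # is) * dg r F = dg r (\<lambda>c. F (c \<circ> pinv (perm_of_word (i # is)))) * gword r (i # is)" .
next
  case Nil
  show "gword r [] * dg r F = dg r (\<lambda>c. F (c \<circ> pinv (perm_of_word []))) * gword r []"
    by simp
qed

text \<open>At each letter of a reduced word the two neighbouring values are still in increasing
  order, hence the generator only interchanges them. So the row at \<open>base \<chi>\<close> is a
  single coordinate function, which depends on \<open>w\<close> alone and not on the word.\<close>

lemma gword_row:
  assumes "reduced_word n w is" "w permutes {1..n}"
  shows "app (gword r is) f (base \<chi>) = f (base \<chi> \<circ> pinv w)"
  using assms
proof (induction "is" arbitrary: w f rule: rev_induct)
  case Nil
  then have "w = id" by (simp add: reduced_word_def)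
  then show ?case by simp
next
  case (snoc i "is")
  have i: "1 \<le> i" "i < n"
    using snoc.prems(1) by (auto simp: reduced_word_def)
  let ?w = "s_transp i \<circ> w"
  have pw: "?w permutes {1..n}"
    using permutes_compose[OF snoc.prems(2) s_transp_permutes[OF i]] .
  note r = reduced_word_snoc[OF snoc.prems(2) i snoc.prems(1)]
  have iw: "pinv ?w = pinv w \<circ> s_transp i"
    using inv_s_transp_comp(1)[OF snoc.prems(2) i] .
  have lt: "pinv ?w i < pinv ?w (Suc i)"
    using r(2) by (simp add: iw)
  have "app (gword r is) (app (opG r i) f) (base \<chi>) = app (opG r i) f (base \<chi> \<circ> pinv ?w)"
    by (rule snoc.IH[OF r(1) pw])
  then have "app (gword r (is @ [i])) f (base \<chi>) = app (opG r i) f (base \<chi> \<circ> pinv ?w)"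
    by simp
  also have "\<dots> = f (base \<chi> \<circ> pinv ?w \<circ> s_transp i)"
    using lt by (auto simp: base_def stay_coeff_def swap_coeff_def)
  also have "base \<chi> \<circ> pinv ?w \<circ> s_transp i = base \<chi> \<circ> pinv w"
    unfolding iw by (simp add: comp_assoc s_transp_idem)
  finally show ?case .
qed

definition characters :: "nat \<Rightarrow> nat \<Rightarrow> (nat \<Rightarrow> nat) set" where
  "characters r n = ({1..n} \<rightarrow>\<^sub>E {..<r})"

lemma finite_characters [simp]: "finite (characters r n)"
  by (simp add: characters_def finite_PiE)

lemma card_characters: "card (characters r n) = r ^ n"
  by (simp add: characters_def card_PiE)

lemma characters_eqI:
  "\<chi> \<in> characters r n \<Longrightarrow> \<psi> \<in> characters r n \<Longrightarrow> (\<And>p. p \<in> {1..n} \<Longrightarrow> \<chi> p = \<psi> p) \<Longrightarrow> \<chi> = \<psi>"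
  unfolding characters_def by (rule PiE_ext)

lemma opU_row:
  assumes "\<chi> \<in> characters r n" "\<psi> \<in> characters r n"
  shows "app (opU r n \<chi> * F) f (base \<psi>) = of_bool (\<chi> = \<psi>) * app F f (base \<psi>)"
proof -
  have *: "colours r (base \<psi>) p = \<psi> p" if "p \<in> {1..n}" for p
    using PiE_mem[OF assms(2)[unfolded characters_def] that] by (simp add: colours_def base_def)
  have "(\<forall>p\<in>{1..n}. colours r (base \<psi>) p = \<chi> p) \<longleftrightarrow> \<chi> = \<psi>"
  proof
    assume "\<forall>p\<in>{1..n}. colours r (base \<psi>) p = \<chi> p"
    then show "\<chi> = \<psi>"
      by (intro characters_eqI[OF assms]) (simp add: * del: atLeastAtMost_iff)
  qed (use * in blast)
  then show ?thesis by (simp add: opU_def)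
qed

definition red_word :: "nat \<Rightarrow> (nat \<Rightarrow> nat) \<Rightarrow> nat list" where
  "red_word n w = (SOME is. reduced_word n w is)"

lemma reduced_red_word: "w permutes {1..n} \<Longrightarrow> reduced_word n w (red_word n w)"
  unfolding red_word_def using exists_reduced_word[of w n] by (metis someI_ex)

definition gw :: "nat \<Rightarrow> nat \<Rightarrow> (nat \<Rightarrow> nat) \<Rightarrow> oper" where
  "gw r n w = gword r (red_word n w)"

definition std_index :: "nat \<Rightarrow> nat \<Rightarrow> ((nat \<Rightarrow> nat) \<times> (nat \<Rightarrow> nat)) set" where
  "std_index r n = characters r n \<times> perms n"

definition std_elem :: "nat \<Rightarrow> nat \<Rightarrow> (nat \<Rightarrow> nat) \<times> (nat \<Rightarrow> nat) \<Rightarrow> oper" where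
  "std_elem r n = (\<lambda>(\<chi>, w). opU r n \<chi> * gw r n w)"

lemma finite_std_index [simp]: "finite (std_index r n)"
  by (simp add: std_index_def finite_permutations)

lemma card_std_index: "card (std_index r n) = r ^ n * fact n"
  by (simp add: std_index_def card_cartesian_product card_characters card_permutations[OF refl])

lemma std_elem_row:
  assumes "(\<chi>, w) \<in> std_index r n" "\<psi> \<in> characters r n"
  shows "app (std_elem r n (\<chi>, w)) f (base \<psi>) = of_bool (\<chi> = \<psi>) * f (base \<psi> \<circ> pinv w)"
  using assms opU_row[of \<chi> r n \<psi>] gword_row[OF reduced_red_word, of w n]
  by (simp add: std_elem_def std_index_def gw_def)

lemma base_comp_inj: "base \<chi> \<circ> v = base \<chi> \<circ> w \<Longrightarrow> v = w"
  by (auto simp: fun_eq_iff base_def)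

text \<open>The indicator functions of the rearranged base words, evaluated at the base words, are
  dual to the elements \<open>u_\<chi> g_w\<close>.\<close>

lemma std_elem_dual:
  assumes "(\<chi>, w) \<in> std_index r n" "(\<psi>, v) \<in> std_index r n"
  shows "app (std_elem r n (\<chi>, w)) (\<lambda>x. of_bool (x = base \<psi> \<circ> pinv v)) (base \<psi>)
    = of_bool ((\<chi>, w) = (\<psi>, v))"
proof -
  have w: "w permutes {1..n}" "v permutes {1..n}" "\<psi> \<in> characters r n"
    using assms by (auto simp: std_index_def)
  have "base \<psi> \<circ> pinv w = base \<psi> \<circ> pinv v \<longleftrightarrow> w = v"
  proof
    assume "base \<psi> \<circ> pinv w = base \<psi> \<circ> pinv v"
    then have "pinv (pinv w) = pinv (pinv v)"
      by (simp only: base_comp_inj[of \<psi> "pinv w" "pinv v"])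
    then show "w = v"
      by (simp only: permutes_inv_inv[OF w(1)] permutes_inv_inv[OF w(2)])
  qed simp
  then show ?thesis
    using std_elem_row[OF assms(1) w(3)] by simp
qed

lemma dual_family_independent:
  fixes f :: "'i \<Rightarrow> 'v linop"
  assumes "finite I" and dual: "\<And>i j. i \<in> I \<Longrightarrow> j \<in> I \<Longrightarrow> app (f i) (h j) (x j) = of_bool (i = j)"
  shows "inj_on f I" "vs.independent (f ` I)"
proof -
  show inj: "inj_on f I"
  proof (rule inj_onI)
    fix i j assume ij: "i \<in> I" "j \<in> I" "f i = f j"
    then show "i = j"
      using dual[of i j] dual[of j j] by (auto split: if_splits)
  qed
  show "vs.independent (f ` I)"
  proof (rule vs.independent_if_scalars_zero)
    fix c y assume *: "(\<Sum>y\<in>f ` I. C (c y) * y) = 0" and "y \<in> f ` I"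
    then obtain j where j: "j \<in> I" "y = f j" by auto
    have "0 = app (\<Sum>i\<in>I. C (c (f i)) * f i) (h j) (x j)"
      using * by (simp add: sum.reindex[OF inj])
    also have "\<dots> = (\<Sum>i\<in>I. c (f i) * of_bool (i = j))"
      unfolding app_sum using dual[OF _ j(1)] by (intro sum.cong) simp_all
    also have "\<dots> = c (f j)"
      using j(1) assms(1) by (simp add: of_bool_def if_distrib cong: if_cong)
    finally show "c y = 0" using j by simp
  qed (use assms in simp)
qed

lemma std_elem_independent:
  "inj_on (std_elem r n) (std_index r n)" "vs.independent (std_elem r n ` std_index r n)"
proof -
  note * = dual_family_independent[OF finite_std_index, of r n "std_elem r n"
      "\<lambda>(\<psi>, v) x. of_bool (x = base \<psi> \<circ> pinv v)" "\<lambda>(\<psi>, v). base \<psi>"]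
  have **: "app (std_elem r n i) (case j of (\<psi>, v) \<Rightarrow> \<lambda>x. of_bool (x = base \<psi> \<circ> pinv v)) (case j of (\<psi>, v) \<Rightarrow> base \<psi>)
      = of_bool (i = j)" if "i \<in> std_index r n" "j \<in> std_index r n" for i j
    using std_elem_dual[of "fst i" "snd i" r n "fst j" "snd j"] that by (simp add: split_beta)
  show "inj_on (std_elem r n) (std_index r n)" "vs.independent (std_elem r n ` std_index r n)"
    using * ** by blast+
qed

text \<open>The dual functionals read only the rows at base words, so these rows determine an
  element of the span.\<close>

lemma std_span_eq_0:
  assumes "x \<in> vs.span (std_elem r n ` std_index r n)"
    and "\<And>\<psi> f. \<psi> \<in> characters r n \<Longrightarrow> app x f (base \<psi>) = 0"
  shows "x = 0"
proof -
  let ?I = "std_index r n"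
  obtain c where x: "x = (\<Sum>y\<in>std_elem r n ` ?I. C (c y) * y)"
    using assms(1) vs.span_finite[of "std_elem r n ` ?I"] by auto
  have x': "x = (\<Sum>i\<in>?I. C (c (std_elem r n i)) * std_elem r n i)"
    unfolding x by (simp add: sum.reindex[OF std_elem_independent(1)])
  have "c (std_elem r n j) = 0" if j: "j \<in> ?I" for j
  proof -
    obtain \<psi> v where jv: "j = (\<psi>, v)" by (cases j)
    let ?f = "\<lambda>x. of_bool (x = base \<psi> \<circ> pinv v)"
    have "0 = app x ?f (base \<psi>)"
      using assms(2)[of \<psi>] j by (simp add: jv std_index_def)
    also have "\<dots> = (\<Sum>i\<in>?I. c (std_elem r n i) * of_bool (i = j))"
      unfolding x' app_sum
    proof (intro sum.cong refl)
      fix i assume i: "i \<in> ?I"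
      obtain \<chi> w where iw: "i = (\<chi>, w)" by (cases i)
      show "app (C (c (std_elem r n i)) * std_elem r n i) ?f (base \<psi>) = c (std_elem r n i) * of_bool (i = j)"
        using std_elem_dual[of \<chi> w r n \<psi> v] i j by (simp add: iw jv)
    qed
    also have "\<dots> = c (std_elem r n j)"
      using j by (simp add: of_bool_def if_distrib cong: if_cong)
    finally show ?thesis ..
  qed
  then show ?thesis
    unfolding x' by (simp add: C_simps)
qed

section \<open>Normal forms and the kernel of the evaluation\<close>

abbreviation mon :: "gen list \<Rightarrow> scalar \<Rightarrow> free" where
  "mon \<equiv> Poly_Mapping.single"

abbreviation FA :: "nat \<Rightarrow> nat \<Rightarrow> free set" where
  "FA r n \<equiv> carrier (free_algebra r n)"

lemma free_algebra_simps [simp]: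
  "monoid.mult (free_algebra r n) = (*)" "one (free_algebra r n) = 1" "ring.zero (free_algebra r n) = 0"
  "add (free_algebra r n) = (+)" "module.smult (free_algebra r n) = (\<lambda>a x. sc a * x)"
  by (simp_all add: free_algebra_def)

lemma FA_iff: "x \<in> FA r n \<longleftrightarrow>
    Poly_Mapping.keys x \<subseteq> lists (gens n) \<and> (\<forall>w. Poly_Mapping.lookup x w \<in> scalars r)"
  by (auto simp: free_algebra_def)

lemma FA_add [simp, intro]: "x \<in> FA r n \<Longrightarrow> y \<in> FA r n \<Longrightarrow> x + y \<in> FA r n"
  unfolding FA_iff lookup_add using keys_add[of x y] by (intro conjI allI; blast)

lemma FA_0 [simp, intro]: "0 \<in> FA r n"
  by (simp add: FA_iff)

lemma FA_uminus [simp, intro]: "x \<in> FA r n \<Longrightarrow> - x \<in> FA r n"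
  unfolding FA_iff by (auto simp: in_keys_iff subset_iff)

lemma FA_diff [simp, intro]: "x \<in> FA r n \<Longrightarrow> y \<in> FA r n \<Longrightarrow> x - y \<in> FA r n"
  using FA_add[of x r n "- y"] by simp

lemma FA_mono [simp, intro]: "w \<in> lists (gens n) \<Longrightarrow> a \<in> scalars r \<Longrightarrow> mon w a \<in> FA r n"
  by (auto simp: FA_iff lookup_single when_def)

lemma FA_induct [consumes 1, case_names zero add]:
  assumes x: "x \<in> FA r n" and "P 0"
    and step: "\<And>w a x. w \<in> lists (gens n) \<Longrightarrow> a \<in> scalars r \<Longrightarrow> x \<in> FA r n \<Longrightarrow> P x \<Longrightarrow> P (mon w a + x)"
  shows "P x"
proof -
  let ?f = "\<lambda>S. \<Sum>w\<in>S. mon w (Poly_Mapping.lookup x w)"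
  have "?f S \<in> FA r n \<and> P (?f S)" if "finite S" "S \<subseteq> Poly_Mapping.keys x" for S
    using that
  proof induction
    case (insert w S)
    have "w \<in> lists (gens n)" "Poly_Mapping.lookup x w \<in> scalars r"
      using x insert.prems by (auto simp: FA_iff)
    then show ?case
      using insert step[of w "Poly_Mapping.lookup x w" "?f S"] by simp
  qed (simp add: assms)
  from this[OF finite_keys order_refl] show ?thesis
    by (simp only: free_as_sum[symmetric])
qed

lemma mono_mult: "mon v a * mon w b = mon (v @ w) (a * b)"
  by (simp add: mult_single plus_list_def)

lemma FA_mult [simp, intro]:
  assumes x: "x \<in> FA r n" and y: "y \<in> FA r n"
  shows "x * y \<in> FA r n"
  using x
proof (induction rule: FA_induct)
  case (add v a x)
  have "mon v a * y \<in> FA r n"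
    using y
  proof (induction rule: FA_induct)
    case (add w b y)
    then show ?case
      using \<open>v \<in> _\<close> \<open>a \<in> _\<close> by (simp add: distrib_left mono_mult)
  qed simp
  with add show ?case by (simp add: distrib_right)
qed simp

lemma FA_sc [simp, intro]: "a \<in> scalars r \<Longrightarrow> sc a \<in> FA r n"
  by (simp add: sc_def)

lemma one_eq_mono: "(1 :: free) = mon [] 1"
  using single_one[where 'a = "gen list" and 'b = scalar] by (simp only: zero_list_def)

lemma FA_1 [simp, intro]: "1 \<in> FA r n"
  unfolding one_eq_mono by (rule FA_mono) simp_all

lemma FA_power [simp, intro]: "x \<in> FA r n \<Longrightarrow> x ^ k \<in> FA r n"
  by (induction k) auto

lemma FA_sum [intro]: "(\<And>i. i \<in> I \<Longrightarrow> f i \<in> FA r n) \<Longrightarrow> sum f I \<in> FA r n"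
  by (induction I rule: infinite_finite_induct) auto

lemma FA_fg [simp, intro]: "1 \<le> i \<Longrightarrow> i < n \<Longrightarrow> fg i \<in> FA r n"
  and FA_ft [simp, intro]: "1 \<le> i \<Longrightarrow> i \<le> n \<Longrightarrow> ft i \<in> FA r n"
  by (auto simp: gens_def)

lemma FA_fe [simp, intro]: "1 \<le> i \<Longrightarrow> i \<le> n \<Longrightarrow> 1 \<le> j \<Longrightarrow> j \<le> n \<Longrightarrow> fe r i j \<in> FA r n"
  unfolding fe_def by (intro FA_mult FA_sc FA_sum FA_power coeffs_gens FA_ft)

lemma FA_fu [simp, intro]: "1 \<le> r \<Longrightarrow> 1 \<le> i \<Longrightarrow> i \<le> n \<Longrightarrow> fu r i k \<in> FA r n"
  unfolding fu_def by (intro FA_mult FA_sc FA_sum FA_power coeffs_gens FA_ft coeffs_xi_powi)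

lemma s_transp_le: "1 \<le> i \<Longrightarrow> i < n \<Longrightarrow> 1 \<le> j \<Longrightarrow> j \<le> n \<Longrightarrow> 1 \<le> s_transp i j \<and> s_transp i j \<le> n"
  by (auto simp: transpose_def)

lemma FA_ft_s_transp [simp, intro]:
  "1 \<le> i \<Longrightarrow> i < n \<Longrightarrow> 1 \<le> j \<Longrightarrow> j \<le> n \<Longrightarrow> ft (s_transp i j) \<in> FA r n"
  using s_transp_le[of i n j] by (intro FA_ft) auto

lemma relations_FA: "relations r n \<subseteq> FA r n"
  unfolding relations_def power2_eq_square
  by (intro subsetI) (elim UnE CollectE exE conjE; simp)

lemma free_algebra_ring: "ring (free_algebra r n)"
proof (rule ringI)
  show "abelian_group (free_algebra r n)"
  proof (rule abelian_groupI)
    fix x assume "x \<in> FA r n"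
    then show "\<exists>y\<in>FA r n. y \<oplus>\<^bsub>free_algebra r n\<^esub> x = \<zero>\<^bsub>free_algebra r n\<^esub>"
      by (intro bexI[of _ "- x"]) auto
  qed (auto simp: add.assoc add.commute)
  show "monoid (free_algebra r n)"
    by (rule monoidI) (auto simp: mult.assoc)
qed (auto simp: distrib_left distrib_right)

lemma FA_a_inv: "x \<in> FA r n \<Longrightarrow> \<ominus>\<^bsub>free_algebra r n\<^esub> x = - x"
proof -
  interpret ring "free_algebra r n" by (rule free_algebra_ring)
  assume x: "x \<in> FA r n"
  show ?thesis
    using minus_equality[of "- x" x] x by simp
qed

lemma yh_ideal_ideal: "ideal (yh_ideal r n) (free_algebra r n)"
  unfolding yh_ideal_def by (rule ring.genideal_ideal[OF free_algebra_ring relations_FA])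

lemma yh_ideal_FA: "x \<in> yh_ideal r n \<Longrightarrow> x \<in> FA r n"
  using additive_subgroup.a_Hcarr[OF ideal.axioms(1)[OF yh_ideal_ideal]] .

lemma yh_ideal_0 [simp, intro]: "0 \<in> yh_ideal r n"
  using additive_subgroup.zero_closed[OF ideal.axioms(1)[OF yh_ideal_ideal]] by simp

lemma yh_ideal_add: "x \<in> yh_ideal r n \<Longrightarrow> y \<in> yh_ideal r n \<Longrightarrow> x + y \<in> yh_ideal r n"
  using additive_subgroup.a_closed[OF ideal.axioms(1)[OF yh_ideal_ideal], of x r n y] by simp

lemma yh_ideal_mult: "x \<in> yh_ideal r n \<Longrightarrow> y \<in> FA r n \<Longrightarrow> x * y \<in> yh_ideal r n"
    "x \<in> yh_ideal r n \<Longrightarrow> y \<in> FA r n \<Longrightarrow> y * x \<in> yh_ideal r n"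
  using ideal.I_r_closed[OF yh_ideal_ideal, of x r n y] ideal.I_l_closed[OF yh_ideal_ideal, of x r n y]
  by simp_all

lemma yh_ideal_uminus: "x \<in> yh_ideal r n \<Longrightarrow> - x \<in> yh_ideal r n"
  using yh_ideal_mult(2)[of x r n "- 1"] by simp

lemma yh_ideal_minimal:
  assumes "ideal J (free_algebra r n)" "relations r n \<subseteq> J"
  shows "yh_ideal r n \<subseteq> J"
  unfolding yh_ideal_def using ring.genideal_minimal[OF free_algebra_ring assms] .

text \<open>Only a two-sided kernel is asked of \<open>h\<close>, so the lemma covers both
  \<open>phi\<close> and the anti-homomorphism \<open>phi\<close> after \<open>frev\<close>.\<close>

lemma yh_ideal_hom_zero:
  fixes h :: "free \<Rightarrow> oper"
  assumes "\<And>x y. h (x + y) = h x + h y" "h 0 = 0"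
    and "\<And>x y. h x = 0 \<Longrightarrow> h (x * y) = 0" "\<And>x y. h y = 0 \<Longrightarrow> h (x * y) = 0"
    and rel: "\<And>x. x \<in> relations r n \<Longrightarrow> h x = 0" and x: "x \<in> yh_ideal r n"
  shows "h x = 0"
proof -
  have um: "h (- x) = 0" if "h x = 0" for x
    using assms(1)[of x "- x"] assms(2) that by simp
  have "ideal {x \<in> FA r n. h x = 0} (free_algebra r n)"
  proof (rule idealI[OF free_algebra_ring])
    show "subgroup {x \<in> FA r n. h x = 0} (add_monoid (free_algebra r n))"
      by (rule subgroup.intro)
        (use um FA_a_inv[unfolded a_inv_def, of _ r n] in \<open>auto simp: assms\<close>)
  qed (auto simp: assms)
  then have "yh_ideal r n \<subseteq> {x \<in> FA r n. h x = 0}"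
    using rel relations_FA[of r n] by (intro yh_ideal_minimal) auto
  with x show ?thesis by blast
qed

lemma phi_yh_ideal: "1 \<le> r \<Longrightarrow> x \<in> yh_ideal r n \<Longrightarrow> phi r x = 0"
  by (rule yh_ideal_hom_zero[of "phi r" r n]) (auto simp: phi_relations)

definition cong_yh :: "nat \<Rightarrow> nat \<Rightarrow> free \<Rightarrow> free \<Rightarrow> bool" where
  "cong_yh r n x y \<longleftrightarrow> x - y \<in> yh_ideal r n"

lemma cong_yh_refl [simp]: "cong_yh r n x x"
  by (simp add: cong_yh_def)

lemma cong_yh_sym: "cong_yh r n x y \<Longrightarrow> cong_yh r n y x"
  unfolding cong_yh_def using yh_ideal_uminus[of "x - y" r n] by simp

lemma cong_yh_trans [trans]: "cong_yh r n x y \<Longrightarrow> cong_yh r n y z \<Longrightarrow> cong_yh r n x z"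
  unfolding cong_yh_def using yh_ideal_add[of "x - y" r n "y - z"] by simp

lemma cong_yh_mult:
  assumes "cong_yh r n x y" "u \<in> FA r n" "v \<in> FA r n"
  shows "cong_yh r n (u * x * v) (u * y * v)"
proof -
  have "u * x * v - u * y * v = u * (x - y) * v"
    by (simp add: left_diff_distrib right_diff_distrib)
  then show ?thesis
    using assms yh_ideal_mult unfolding cong_yh_def by metis
qed

lemma cong_yh_mult_left: "cong_yh r n x y \<Longrightarrow> u \<in> FA r n \<Longrightarrow> cong_yh r n (u * x) (u * y)"
  using cong_yh_mult[of r n x y u 1] by simp

lemma cong_yh_mult_right: "cong_yh r n x y \<Longrightarrow> v \<in> FA r n \<Longrightarrow> cong_yh r n (x * v) (y * v)"
  using cong_yh_mult[of r n x y 1 v] by simp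

lemma cong_yh_relation: "x - y \<in> relations r n \<Longrightarrow> cong_yh r n x y"
  unfolding cong_yh_def yh_ideal_def
  using ring.genideal_self[OF free_algebra_ring relations_FA] by blast

lemma cong_yh_rels:
  "1 \<le> i \<Longrightarrow> i \<le> n \<Longrightarrow> cong_yh r n (ft i ^ r) 1"
  "1 \<le> i \<Longrightarrow> i \<le> n \<Longrightarrow> 1 \<le> j \<Longrightarrow> j \<le> n \<Longrightarrow> cong_yh r n (ft i * ft j) (ft j * ft i)"
  "1 \<le> i \<Longrightarrow> i < n \<Longrightarrow> 1 \<le> j \<Longrightarrow> j \<le> n \<Longrightarrow> cong_yh r n (ft j * fg i) (fg i * ft (s_transp i j))"
  "1 \<le> i \<Longrightarrow> i < n \<Longrightarrow> 1 \<le> j \<Longrightarrow> j < n \<Longrightarrow> Suc i < j \<or> Suc j < i \<Longrightarrow> cong_yh r n (fg i * fg j) (fg j * fg i)"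
  "1 \<le> i \<Longrightarrow> Suc i < n \<Longrightarrow> cong_yh r n (fg i * fg (Suc i) * fg i) (fg (Suc i) * fg i * fg (Suc i))"
  "1 \<le> i \<Longrightarrow> i < n \<Longrightarrow> cong_yh r n (fg i * fg i) (1 + sc qq * fe r i (Suc i) * fg i)"
proof -
  have *: "\<bar>int i - int j\<bar> > 1" if "Suc i < j \<or> Suc j < i"
    using that by linarith
  show "1 \<le> i \<Longrightarrow> i \<le> n \<Longrightarrow> cong_yh r n (ft i ^ r) 1"
    by (rule cong_yh_relation) (unfold relations_def atLeastLessThan_iff atLeastAtMost_iff, blast)
  show "1 \<le> i \<Longrightarrow> i \<le> n \<Longrightarrow> 1 \<le> j \<Longrightarrow> j \<le> n \<Longrightarrow> cong_yh r n (ft i * ft j) (ft j * ft i)"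
    by (rule cong_yh_relation) (unfold relations_def atLeastLessThan_iff atLeastAtMost_iff, blast)
  show "1 \<le> i \<Longrightarrow> i < n \<Longrightarrow> 1 \<le> j \<Longrightarrow> j \<le> n \<Longrightarrow> cong_yh r n (ft j * fg i) (fg i * ft (s_transp i j))"
    by (rule cong_yh_relation) (unfold relations_def atLeastLessThan_iff atLeastAtMost_iff, blast)
  show "1 \<le> i \<Longrightarrow> i < n \<Longrightarrow> 1 \<le> j \<Longrightarrow> j < n \<Longrightarrow> Suc i < j \<or> Suc j < i \<Longrightarrow> cong_yh r n (fg i * fg j) (fg j * fg i)"
    using * by (intro cong_yh_relation) (unfold relations_def atLeastLessThan_iff atLeastAtMost_iff, blast)
  show "1 \<le> i \<Longrightarrow> Suc i < n \<Longrightarrow> cong_yh r n (fg i * fg (Suc i) * fg i) (fg (Suc i) * fg i * fg (Suc i))"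
    using le_add1[of 1 i, unfolded plus_1_eq_Suc] Suc_lessD[of i n]
    by (intro cong_yh_relation) (unfold relations_def atLeastLessThan_iff atLeastAtMost_iff, blast)
  show "1 \<le> i \<Longrightarrow> i < n \<Longrightarrow> cong_yh r n (fg i * fg i) (1 + sc qq * fe r i (Suc i) * fg i)"
    by (rule cong_yh_relation) (unfold relations_def atLeastLessThan_iff atLeastAtMost_iff qq_def
        power2_eq_square[symmetric], blast)
qed

section \<open>Normal form words span modulo the relations\<close>

inductive_set nspan :: "nat \<Rightarrow> nat \<Rightarrow> gen list set \<Rightarrow> free set" for r n S where
  nspan_ideal: "x \<in> yh_ideal r n \<Longrightarrow> x \<in> nspan r n S"
| nspan_step: "a \<in> scalars r \<Longrightarrow> w \<in> S \<Longrightarrow> x \<in> nspan r n S \<Longrightarrow> mon w a + x \<in> nspan r n S"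

lemma nspan_base: "w \<in> S \<Longrightarrow> mon w 1 \<in> nspan r n S"
  using nspan_step[of 1 r w S 0 n] nspan_ideal[of 0 r n S] by simp

lemma nspan_add: "x \<in> nspan r n S \<Longrightarrow> y \<in> nspan r n S \<Longrightarrow> x + y \<in> nspan r n S"
proof (induction rule: nspan.induct)
  case (nspan_ideal x)
  from nspan_ideal(2,1) show ?case
  proof (induction rule: nspan.induct)
    case (nspan_ideal y)
    then show ?case by (intro nspan.nspan_ideal yh_ideal_add)
  next
    case (nspan_step a w y)
    then show ?case
      using nspan.nspan_step[of a r w S "x + y" n] by (simp add: ac_simps)
  qed
next
  case (nspan_step a w x)
  then show ?case
    using nspan.nspan_step[of a r w S "x + y" n] by (simp add: ac_simps)
qed

lemma nspan_cong: "cong_yh r n x y \<Longrightarrow> y \<in> nspan r n S \<Longrightarrow> x \<in> nspan r n S"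
  using nspan_add[OF nspan_ideal[of "x - y" r n S], of y] by (simp add: cong_yh_def)

lemma sc_mono: "sc a * mon w b = mon w (a * b)" "mon w b * sc a = mon w (a * b)"
  by (simp_all add: sc_def mono_mult mult.commute)

lemma sc_commute: "x * sc a = sc a * x"
  by (induction x rule: free_induct) (simp_all add: distrib_left distrib_right sc_mono)

lemma nspan_scale: "x \<in> nspan r n S \<Longrightarrow> a \<in> scalars r \<Longrightarrow> sc a * x \<in> nspan r n S"
proof (induction rule: nspan.induct)
  case (nspan_ideal x)
  then show ?case by (intro nspan.nspan_ideal yh_ideal_mult FA_sc)
next
  case (nspan_step b w x)
  then show ?case by (simp add: distrib_left sc_mono nspan.nspan_step)
qed

lemma nspan_sum: "(\<And>i. i \<in> I \<Longrightarrow> f i \<in> nspan r n S) \<Longrightarrow> sum f I \<in> nspan r n S"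
  by (induction I rule: infinite_finite_induct) (auto intro: nspan_add nspan_ideal)

lemma mono_scale: "mon w a = sc a * mon w 1"
  by (simp add: sc_mono)

lemma nspan_mult_right:
  assumes "x \<in> nspan r n S" "y \<in> FA r n" "\<And>w. w \<in> S \<Longrightarrow> mon w 1 * y \<in> nspan r n T"
  shows "x * y \<in> nspan r n T"
  using assms(1)
proof induction
  case (nspan_ideal x)
  then show ?case by (intro nspan.nspan_ideal yh_ideal_mult assms)
next
  case (nspan_step a w x)
  then show ?case
    using nspan_scale[OF assms(3)[of w], of a] by (subst mono_scale) (simp add: distrib_right mult.assoc nspan_add)
qed

lemma nspan_mult_left:
  assumes "x \<in> nspan r n S" "y \<in> FA r n" "\<And>w. w \<in> S \<Longrightarrow> y * mon w 1 \<in> nspan r n T"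
  shows "y * x \<in> nspan r n T"
  using assms(1)
proof induction
  case (nspan_ideal x)
  then show ?case by (intro nspan.nspan_ideal yh_ideal_mult assms)
next
  case (nspan_step a w x)
  have "y * mon w a = sc a * (y * mon w 1)"
    unfolding mono_scale[of w a] by (simp add: mult.assoc[symmetric] sc_commute)
  then show ?case
    using nspan_scale[OF assms(3)[of w], of a] nspan_step by (simp add: distrib_left nspan_add)
qed

text \<open>Monomials in the \<open>t_i\<close> with exponents below \<open>r\<close>, in decreasing
  order of the indices.\<close>

fun t_words :: "nat \<Rightarrow> nat \<Rightarrow> gen list set" where
  "t_words r 0 = {[]}"
| "t_words r (Suc m) = (\<lambda>(k, w). replicate k (Gen_t (Suc m)) @ w) ` ({..<r} \<times> t_words r m)"

lemma card_t_words: "finite (t_words r m) \<and> card (t_words r m) \<le> r ^ m"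
proof (induction m)
  case (Suc m)
  then have "card (t_words r (Suc m)) \<le> card ({..<r} \<times> t_words r m)"
    unfolding t_words.simps by (intro card_image_le) auto
  also have "\<dots> \<le> r ^ Suc m"
    using Suc by (simp add: card_cartesian_product)
  finally show ?case using Suc by simp
qed simp

lemma t_words_gens: "w \<in> t_words r m \<Longrightarrow> w \<in> lists (Gen_t ` {1..m})"
proof (induction m arbitrary: w)
  case (Suc m)
  then obtain k w' where w: "w = replicate k (Gen_t (Suc m)) @ w'" "w' \<in> t_words r m"
    by auto
  show ?case
    using Suc.IH[OF w(2)] unfolding w(1) by (auto simp: image_iff)
qed simp

lemma lists_gens_mono: "w \<in> lists (Gen_t ` {1..m}) \<Longrightarrow> m \<le> n \<Longrightarrow> w \<in> lists (gens n)"
  by (auto simp: gens_def)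

lemma t_word_commute:
  "w \<in> lists (Gen_t ` {1..m}) \<Longrightarrow> m \<le> n \<Longrightarrow> 1 \<le> j \<Longrightarrow> j \<le> n \<Longrightarrow>
    cong_yh r n (mon w 1 * ft j) (ft j * mon w 1)"
proof (induction w)
  case Nil
  then show ?case by (simp add: one_eq_mono[symmetric])
next
  case (Cons a w)
  then obtain i where i: "a = Gen_t i" "1 \<le> i" "i \<le> n" and w: "w \<in> lists (Gen_t ` {1..m})"
    by auto
  have wn: "mon w 1 \<in> FA r n"
    using lists_gens_mono[OF w Cons.prems(2)] by simp
  have e: "mon (a # w) 1 = ft i * mon w 1"
    by (simp add: mono_mult i)
  have "cong_yh r n (ft i * (mon w 1 * ft j)) (ft i * (ft j * mon w 1))"
    using Cons.IH[OF w Cons.prems(2-4)] i by (intro cong_yh_mult_left) auto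
  also have "cong_yh r n (ft i * (ft j * mon w 1)) (ft j * ft i * mon w 1)"
    unfolding mult.assoc[symmetric] using i Cons.prems wn by (intro cong_yh_mult_right cong_yh_rels) auto
  finally show ?case
    unfolding e by (simp add: mult.assoc)
qed

lemma replicate_mono: "mon (replicate k a) 1 = mon [a] 1 ^ k"
proof (induction k)
  case (Suc k)
  have "mon (replicate (Suc k) a) 1 = mon [a] 1 * mon (replicate k a) 1"
    by (simp add: mono_mult)
  with Suc show ?case by simp
qed (simp add: one_eq_mono)

text \<open>The new factor is moved to the letters equal to it. If their exponent reaches
  \<open>r\<close>, they disappear by \<open>t_j ^ r = 1\<close>.\<close>

lemma t_words_closed:
  assumes r: "1 \<le> r"
  shows "m \<le> n \<Longrightarrow> w \<in> t_words r m \<Longrightarrow> 1 \<le> j \<Longrightarrow> j \<le> m \<Longrightarrow> mon w 1 * ft j \<in> nspan r n (t_words r m)"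
proof (induction m arbitrary: w)
  case (Suc m)
  then obtain k w' where k: "k < r" and w: "w = replicate k (Gen_t (Suc m)) @ w'" "w' \<in> t_words r m"
    by auto
  have e: "mon w 1 = ft (Suc m) ^ k * mon w' 1"
    by (simp add: w mono_mult replicate_mono[symmetric])
  have w'n: "mon w' 1 \<in> FA r n"
    using lists_gens_mono[OF t_words_gens[OF w(2)]] Suc.prems by simp
  show ?case
  proof (cases "j = Suc m")
    case True
    have "cong_yh r n (mon w 1 * ft j) (ft (Suc m) ^ k * (ft j * mon w' 1))"
      unfolding e mult.assoc using Suc.prems t_words_gens[OF w(2)]
      by (intro cong_yh_mult_left t_word_commute) auto
    also have "ft (Suc m) ^ k * (ft j * mon w' 1) = ft (Suc m) ^ Suc k * mon w' 1"
      by (simp only: True mult.assoc[symmetric] power_Suc2)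
    finally have 1: "cong_yh r n (mon w 1 * ft j) (ft (Suc m) ^ Suc k * mon w' 1)" .
    show ?thesis
    proof (cases "Suc k < r")
      case True
      have "ft (Suc m) ^ Suc k * mon w' 1 = mon (replicate (Suc k) (Gen_t (Suc m)) @ w') 1"
        by (simp only: replicate_mono[symmetric] mono_mult mult_1)
      moreover have "replicate (Suc k) (Gen_t (Suc m)) @ w' \<in> t_words r (Suc m)"
        unfolding t_words.simps using True w(2) by (intro image_eqI[where x = "(Suc k, w')"]) auto
      ultimately show ?thesis
        using nspan_cong[OF 1] nspan_base by metis
    next
      case False
      then have "Suc k = r" using k by simp
      then have 2: "cong_yh r n (ft (Suc m) ^ Suc k * mon w' 1) (1 * mon w' 1)"
        using Suc.prems w'n by (intro cong_yh_mult_right) (auto intro: cong_yh_rels)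
      have "w' \<in> t_words r (Suc m)"
        unfolding t_words.simps using r w(2) by (intro image_eqI[where x = "(0, w')"]) auto
      then show ?thesis
        using nspan_cong[OF cong_yh_trans[OF 1 2]] nspan_base[of w' "t_words r (Suc m)"] by simp
    qed
  next
    case False
    then have "mon w' 1 * ft j \<in> nspan r n (t_words r m)"
      using Suc.IH[of w'] Suc.prems w(2) by auto
    then have "ft (Suc m) ^ k * (mon w' 1 * ft j) \<in> nspan r n (t_words r (Suc m))"
    proof (rule nspan_mult_left)
      fix v assume v: "v \<in> t_words r m"
      have "ft (Suc m) ^ k * mon v 1 = mon (replicate k (Gen_t (Suc m)) @ v) 1"
        by (simp only: replicate_mono[symmetric] mono_mult mult_1)
      moreover have "replicate k (Gen_t (Suc m)) @ v \<in> t_words r (Suc m)"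
        unfolding t_words.simps using k v by (intro image_eqI[where x = "(k, v)"]) auto
      ultimately show "ft (Suc m) ^ k * mon v 1 \<in> nspan r n (t_words r (Suc m))"
        using nspan_base by metis
    qed (use Suc.prems in auto)
    then show ?thesis
      by (simp add: e mult.assoc)
  qed
qed simp

lemma nspan_mono: "x \<in> nspan r n S \<Longrightarrow> S \<subseteq> T \<Longrightarrow> x \<in> nspan r n T"
  by (induction rule: nspan.induct) (auto intro: nspan.intros)

abbreviation gmon :: "nat list \<Rightarrow> free" where
  "gmon u \<equiv> mon (map Gen_g u) 1"

lemma gmon_append: "gmon (u @ v) = gmon u * gmon v"
  by (simp add: mono_mult)

lemma gmon_Cons: "gmon (i # u) = fg i * gmon u"
  by (simp add: mono_mult)

lemma gens_g: "u \<in> lists {1..<n} \<Longrightarrow> map Gen_g u \<in> lists (gens n)"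
  by (auto simp: gens_def)

lemma gmon_commute:
  assumes "1 \<le> i" "i < n"
  shows "u \<in> lists {1..<n} \<Longrightarrow> (\<And>k. k \<in> set u \<Longrightarrow> Suc i < k \<or> Suc k < i) \<Longrightarrow>
    cong_yh r n (gmon u * fg i) (fg i * gmon u)"
proof (induction u)
  case Nil
  then show ?case by (simp add: one_eq_mono[symmetric])
next
  case (Cons k u)
  then have k: "1 \<le> k" "k < n" "Suc i < k \<or> Suc k < i" and u: "u \<in> lists {1..<n}"
    by auto
  have "cong_yh r n (fg k * (gmon u * fg i)) (fg k * (fg i * gmon u))"
    using Cons.IH[OF u] Cons.prems(2) k by (intro cong_yh_mult_left) auto
  also have "cong_yh r n (fg k * (fg i * gmon u)) (fg i * fg k * gmon u)"
    unfolding mult.assoc[symmetric] using k assms FA_mono[OF gens_g[OF u]]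
    by (intro cong_yh_mult_right cong_yh_rels) auto
  finally show ?case
    unfolding gmon_Cons mult.assoc .
qed

lemma gmon_ft:
  "u \<in> lists {1..<n} \<Longrightarrow> 1 \<le> j \<Longrightarrow> j \<le> n \<Longrightarrow>
    \<exists>j'. 1 \<le> j' \<and> j' \<le> n \<and> cong_yh r n (gmon u * ft j) (ft j' * gmon u)"
proof (induction u)
  case Nil
  then show ?case by (intro exI[of _ j]) (simp add: one_eq_mono[symmetric])
next
  case (Cons k u)
  then have k: "1 \<le> k" "k < n" and u: "u \<in> lists {1..<n}"
    by auto
  obtain j' where j': "1 \<le> j'" "j' \<le> n" "cong_yh r n (gmon u * ft j) (ft j' * gmon u)"
    using Cons.IH[OF u Cons.prems(2,3)] by blast
  let ?j = "s_transp k j'"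
  have r: "1 \<le> ?j" "?j \<le> n"
    using s_transp_le[OF k j'(1,2)] by auto
  have "cong_yh r n (ft ?j * fg k) (fg k * ft (s_transp k ?j))"
    using k r by (intro cong_yh_rels) auto
  then have "cong_yh r n (ft ?j * fg k) (fg k * ft j')"
    by simp
  then have tk: "cong_yh r n (fg k * ft j') (ft ?j * fg k)"
    by (rule cong_yh_sym)
  have "cong_yh r n (fg k * (gmon u * ft j)) (fg k * (ft j' * gmon u))"
    using j' k by (intro cong_yh_mult_left) auto
  also have "cong_yh r n (fg k * (ft j' * gmon u)) (ft ?j * fg k * gmon u)"
    unfolding mult.assoc[symmetric] using FA_mono[OF gens_g[OF u]] by (intro cong_yh_mult_right tk) auto
  finally show ?case
    unfolding gmon_Cons mult.assoc using r by blast
qed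

definition t_closed :: "nat \<Rightarrow> nat \<Rightarrow> gen list set \<Rightarrow> bool" where
  "t_closed r n S \<longleftrightarrow> S \<subseteq> lists (gens n) \<and>
     (\<forall>w\<in>S. \<forall>j. 1 \<le> j \<and> j \<le> n \<longrightarrow> mon w 1 * ft j \<in> nspan r n S)"

text \<open>Moving \<open>t_j\<close> to the left through a word in the \<open>g_i\<close> only
  changes its index, so closure under the \<open>t_j\<close> survives appending such a word.\<close>

lemma t_closed_append:
  assumes S: "t_closed r n S" and u: "u \<in> lists {1..<n}"
  shows "t_closed r n ((\<lambda>w. w @ map Gen_g u) ` S)"
  unfolding t_closed_def
proof (intro conjI ballI allI impI)
  show "(\<lambda>w. w @ map Gen_g u) ` S \<subseteq> lists (gens n)"
    using S gens_g[OF u] unfolding t_closed_def by (intro image_subsetI) (simp del: in_lists_conv_set add: subset_iff)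
  fix v j assume "v \<in> (\<lambda>w. w @ map Gen_g u) ` S" and j: "1 \<le> j \<and> j \<le> n"
  then obtain w where w: "w \<in> S" "v = w @ map Gen_g u" by auto
  have wn: "mon w 1 \<in> FA r n"
    using S w unfolding t_closed_def by (intro FA_mono) auto
  have ve: "mon v 1 = mon w 1 * gmon u"
    by (simp only: w(2) mono_mult mult_1)
  obtain j' where j': "1 \<le> j'" "j' \<le> n" "cong_yh r n (gmon u * ft j) (ft j' * gmon u)"
    using gmon_ft[OF u] j by blast
  have "cong_yh r n (mon w 1 * (gmon u * ft j)) (mon w 1 * (ft j' * gmon u))"
    by (intro cong_yh_mult_left j' wn)
  moreover have "mon w 1 * ft j' * gmon u \<in> nspan r n ((\<lambda>w. w @ map Gen_g u) ` S)"
  proof (rule nspan_mult_right[of _ r n S])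
    show "mon w 1 * ft j' \<in> nspan r n S"
      using S w j' unfolding t_closed_def by blast
  next
    fix w' assume "w' \<in> S"
    then show "mon w' 1 * gmon u \<in> nspan r n ((\<lambda>w. w @ map Gen_g u) ` S)"
      unfolding mono_mult mult_1 by (intro nspan_base) auto
  qed (intro FA_mono gens_g u, simp)
  ultimately show "mon v 1 * ft j \<in> nspan r n ((\<lambda>w. w @ map Gen_g u) ` S)"
    using nspan_cong by (simp only: ve mult.assoc)
qed

lemma t_closed_mult_ft:
  assumes "t_closed r n S" "x \<in> nspan r n S" "1 \<le> j" "j \<le> n"
  shows "x * ft j \<in> nspan r n S"
  using assms by (intro nspan_mult_right[of x r n S "ft j"]) (auto simp: t_closed_def)

lemma t_closed_mult_ft_power:
  assumes "t_closed r n S" "x \<in> nspan r n S" "1 \<le> j" "j \<le> n"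
  shows "x * ft j ^ k \<in> nspan r n S"
proof (induction k)
  case (Suc k)
  then show ?case
    using t_closed_mult_ft[OF assms(1) Suc assms(3,4)] by (simp add: power_Suc2 mult.assoc del: power_Suc)
qed (use assms in simp)

lemma t_closed_mult_fe:
  assumes "t_closed r n S" "x \<in> nspan r n S" "1 \<le> i" "i \<le> n" "1 \<le> j" "j \<le> n"
  shows "x * fe r i j \<in> nspan r n S"
proof -
  have "x * fe r i j = sc (inverse (of_nat r)) * (\<Sum>m<r. x * ft i ^ m * ft j ^ (r - m))"
    unfolding fe_def by (simp add: mult.assoc[symmetric] sc_commute) (simp add: mult.assoc sum_distrib_left)
  also have "\<dots> \<in> nspan r n S"
    using assms by (intro nspan_scale nspan_sum t_closed_mult_ft_power) auto
  finally show ?thesis .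
qed

text \<open>In step \<open>m\<close> a descending run \<open>g_m ... g_j\<close> is appended, empty
  for \<open>j = m + 1\<close>. The runs correspond to the coset representatives of one symmetric
  group in the next, and the number of choices in all steps is at most
  \<open>r^n m!\<close>.\<close>

fun g_words :: "nat \<Rightarrow> nat \<Rightarrow> nat \<Rightarrow> gen list set" where
  "g_words r n 0 = t_words r n"
| "g_words r n (Suc m) = (\<lambda>(w, j). w @ map Gen_g (rev [j..<Suc m])) ` (g_words r n m \<times> {1..Suc m})"

lemma card_g_words: "finite (g_words r n m) \<and> card (g_words r n m) \<le> r ^ n * fact m"
proof (induction m)
  case (Suc m)
  then have "card (g_words r n (Suc m)) \<le> card (g_words r n m \<times> {1..Suc m})"
    unfolding g_words.simps by (intro card_image_le) auto
  also have "\<dots> = card (g_words r n m) * Suc m"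
    by (simp add: card_cartesian_product)
  also have "\<dots> \<le> (r ^ n * fact m) * Suc m"
    using Suc by (intro mult_le_mono1) simp
  also have "\<dots> = r ^ n * fact (Suc m)"
    by (simp add: algebra_simps)
  finally show ?case using Suc by simp
qed (simp add: card_t_words)

lemma g_words_Suc_UN:
  "g_words r n (Suc m) = (\<Union>j\<in>{1..Suc m}. (\<lambda>w. w @ map Gen_g (rev [j..<Suc m])) ` g_words r n m)"
  by auto

lemma rev_upt_lists: "1 \<le> j \<Longrightarrow> m < n \<Longrightarrow> rev [j..<Suc m] \<in> lists {1..<n}"
  by auto

lemma g_words_t_closed:
  assumes r: "1 \<le> r"
  shows "m \<le> n \<Longrightarrow> t_closed r n (g_words r n m)"
proof (induction m)
  case 0
  show ?case
    using t_words_closed[OF r, of n n] lists_gens_mono[OF t_words_gens, of _ r n n]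
    unfolding t_closed_def g_words.simps(1) by blast
next
  case (Suc m)
  have *: "t_closed r n ((\<lambda>w. w @ map Gen_g (rev [j..<Suc m])) ` g_words r n m)" if "j \<in> {1..Suc m}" for j
    using Suc that by (intro t_closed_append rev_upt_lists) auto
  show ?case
    unfolding t_closed_def
  proof (intro conjI ballI allI impI)
    show "g_words r n (Suc m) \<subseteq> lists (gens n)"
      unfolding g_words_Suc_UN using * unfolding t_closed_def by blast
    fix w k assume "w \<in> g_words r n (Suc m)" and k: "1 \<le> k \<and> k \<le> n"
    then obtain j where j: "j \<in> {1..Suc m}" "w \<in> (\<lambda>w. w @ map Gen_g (rev [j..<Suc m])) ` g_words r n m"
      unfolding g_words_Suc_UN by blast
    have "mon w 1 * ft k \<in> nspan r n ((\<lambda>w. w @ map Gen_g (rev [j..<Suc m])) ` g_words r n m)"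
      using *[OF j(1)] j(2) k unfolding t_closed_def by blast
    then show "mon w 1 * ft k \<in> nspan r n (g_words r n (Suc m))"
      by (rule nspan_mono) (unfold g_words_Suc_UN, use j(1) in blast)
  qed
qed

lemma rev_upt_Suc_last: "j \<le> m \<Longrightarrow> rev [j..<Suc m] = rev [Suc j..<Suc m] @ [j]"
  by (simp add: upt_rec[of j])

text \<open>The factor \<open>g_i\<close> commutes with the end of the run until it meets
  \<open>g_i g_(i-1)\<close>; the braid relation turns it into \<open>g_(i-1)\<close>, which
  commutes with the rest.\<close>

lemma descending_shift:
  "1 \<le> j \<Longrightarrow> j < i \<Longrightarrow> i \<le> m \<Longrightarrow> m < n \<Longrightarrow>
    cong_yh r n (gmon (rev [j..<Suc m]) * fg i) (fg (i - 1) * gmon (rev [j..<Suc m]))"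
proof (induction m)
  case (Suc m)
  have N: "gmon (rev [j..<Suc (Suc m)]) = fg (Suc m) * gmon (rev [j..<Suc m])"
    using Suc.prems by (simp add: mono_mult)
  have NF: "gmon (rev [j..<Suc m]) \<in> FA r n"
    using Suc.prems by (intro FA_mono gens_g rev_upt_lists) auto
  show ?case
  proof (cases "i = Suc m")
    case False
    have "cong_yh r n (fg (Suc m) * (gmon (rev [j..<Suc m]) * fg i))
        (fg (Suc m) * (fg (i - 1) * gmon (rev [j..<Suc m])))"
      using Suc False by (intro cong_yh_mult_left) auto
    also have "cong_yh r n (fg (Suc m) * (fg (i - 1) * gmon (rev [j..<Suc m])))
        (fg (i - 1) * fg (Suc m) * gmon (rev [j..<Suc m]))"
      unfolding mult.assoc[symmetric] using Suc.prems False NF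
      by (intro cong_yh_mult_right cong_yh_rels) auto
    finally show ?thesis
      unfolding N mult.assoc .
  next
    case True
    then obtain l where l: "m = Suc l" "j \<le> Suc l"
      using Suc.prems by (cases m) auto
    let ?N = "gmon (rev [j..<Suc l])"
    have NF: "?N \<in> FA r n"
      using Suc.prems l by (intro FA_mono gens_g rev_upt_lists) auto
    have N': "gmon (rev [j..<Suc (Suc m)]) = fg (Suc m) * (fg m * ?N)"
      unfolding N using l by (simp add: mono_mult)
    have "cong_yh r n (?N * fg i) (fg i * ?N)"
      using Suc.prems True l by (intro gmon_commute rev_upt_lists) auto
    then have "cong_yh r n (fg (Suc m) * (fg m * (?N * fg i))) (fg (Suc m) * (fg m * (fg i * ?N)))"
      using Suc.prems l by (intro cong_yh_mult_left) auto
    also have "fg (Suc m) * (fg m * (fg i * ?N)) = fg (Suc m) * fg m * fg (Suc m) * ?N"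
      by (simp add: True mult.assoc)
    also have "cong_yh r n (fg (Suc m) * fg m * fg (Suc m) * ?N) (fg m * fg (Suc m) * fg m * ?N)"
      using Suc.prems l NF by (intro cong_yh_mult_right cong_yh_sym[OF cong_yh_rels(5)]) auto
    finally show ?thesis
      unfolding N' by (simp add: True mult.assoc)
  qed
qed simp

text \<open>Four positions of \<open>g_i\<close> relative to the last run
  \<open>g_m ... g_j\<close>: below \<open>j - 1\<close> it commutes to the left, at
  \<open>j - 1\<close> it lengthens the run, at \<open>j\<close> the quadratic relation applies, and
  above \<open>j\<close> it passes to the left as \<open>g_(i-1)\<close>. What arrives on the left
  is handled by induction.\<close>

lemma g_words_closed:
  assumes r: "1 \<le> r"
  shows "m \<le> n \<Longrightarrow> w \<in> g_words r n m \<Longrightarrow> 1 \<le> i \<Longrightarrow> i < m \<Longrightarrow> mon w 1 * fg i \<in> nspan r n (g_words r n m)"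
proof (induction m arbitrary: w i)
  case (Suc m)
  let ?W = "g_words r n m"
  obtain v j where v: "v \<in> ?W" "1 \<le> j" "j \<le> Suc m" "w = v @ map Gen_g (rev [j..<Suc m])"
    using Suc.prems(2) by auto
  have tW: "t_closed r n ?W"
    using g_words_t_closed[OF r, of m n] Suc.prems by simp
  then have vF: "mon v 1 \<in> FA r n"
    using v(1) unfolding t_closed_def by (intro FA_mono) auto
  have w: "mon w 1 = mon v 1 * gmon (rev [j..<Suc m])"
    by (simp only: v(4) mono_mult mult_1)
  have base: "mon v' 1 * gmon (rev [j'..<Suc m]) \<in> nspan r n (g_words r n (Suc m))"
    if "v' \<in> ?W" "1 \<le> j'" "j' \<le> Suc m" for v' j'
    unfolding mono_mult mult_1 g_words.simps using that
    by (intro nspan_base image_eqI[where x = "(v', j')"]) auto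
  have NF: "gmon (rev [j'..<Suc m]) \<in> FA r n" if "1 \<le> j'" for j'
    using Suc.prems that by (intro FA_mono gens_g rev_upt_lists) auto
  have left: "mon v 1 * fg i' * gmon (rev [j..<Suc m]) \<in> nspan r n (g_words r n (Suc m))"
    if "1 \<le> i'" "i' < m" for i'
  proof (rule nspan_mult_right[of _ r n ?W])
    show "mon v 1 * fg i' \<in> nspan r n ?W"
      using Suc.prems(1) by (intro Suc.IH v that) simp
  qed (rule NF[OF v(2)] base[OF _ v(2,3)], assumption?)+
  consider "Suc i < j" | "Suc i = j" | "i = j" | "j < i" by linarith
  then show ?case
  proof cases
    case 1
    have "cong_yh r n (mon w 1 * fg i) (mon v 1 * fg i * gmon (rev [j..<Suc m]))"
      unfolding w mult.assoc using 1 Suc.prems v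
      by (intro cong_yh_mult_left vF gmon_commute rev_upt_lists) auto
    then show ?thesis
      by (rule nspan_cong[OF _ left]) (use Suc.prems 1 v(3) in linarith)+
  next
    case 2
    then have "mon w 1 * fg i = mon v 1 * gmon (rev [i..<Suc m])"
      using Suc.prems by (simp only: w mult.assoc rev_upt_Suc_last[of i m]) (simp add: mono_mult)
    then show ?thesis
      using base[OF v(1), of i] Suc.prems by simp
  next
    case 3
    let ?N = "gmon (rev [Suc j..<Suc m])"
    have e: "mon w 1 * fg i = mon v 1 * ?N * (fg j * fg j)"
      using Suc.prems 3 unfolding w rev_upt_Suc_last[of j m, OF \<open>i < Suc m\<close>[unfolded 3 less_Suc_eq_le]] gmon_append
      by (simp add: mult.assoc)
    have "cong_yh r n (mon v 1 * ?N * (fg j * fg j)) (mon v 1 * ?N * (1 + sc qq * fe r j (Suc j) * fg j))"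
      using Suc.prems 3 vF NF[of "Suc j"] by (intro cong_yh_mult_left cong_yh_rels) auto
    also have "mon v 1 * ?N * (1 + sc qq * fe r j (Suc j) * fg j)
        = mon v 1 * ?N + sc qq * (mon v 1 * ?N * fe r j (Suc j) * fg j)"
      by (simp add: distrib_left mult.assoc[symmetric] sc_commute)
    finally have 2: "cong_yh r n (mon w 1 * fg i) (mon v 1 * ?N + sc qq * (mon v 1 * ?N * fe r j (Suc j) * fg j))"
      unfolding e .
    \<comment> \<open>The factor \<open>e_j\<close> created by the quadratic relation is absorbed by
      the words with the shortened run, which are closed under the \<open>t_i\<close>; then
      \<open>g_j\<close> restores the run.\<close>
    have 1: "mon v 1 * ?N * fe r j (Suc j) * fg j \<in> nspan r n (g_words r n (Suc m))"
    proof (rule nspan_mult_right)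
      let ?S = "(\<lambda>w. w @ map Gen_g (rev [Suc j..<Suc m])) ` ?W"
      have "t_closed r n ?S"
        using Suc.prems by (intro t_closed_append tW rev_upt_lists) auto
      moreover have "mon v 1 * ?N \<in> nspan r n ?S"
        unfolding mono_mult mult_1 using v(1) by (intro nspan_base imageI)
      ultimately show "mon v 1 * ?N * fe r j (Suc j) \<in> nspan r n ?S"
        using v Suc.prems 3 by (intro t_closed_mult_fe) auto
      fix u assume "u \<in> ?S"
      then obtain v' where v': "v' \<in> ?W" "u = v' @ map Gen_g (rev [Suc j..<Suc m])"
        by blast
      have "mon u 1 * fg j = mon v' 1 * gmon (rev [j..<Suc m])"
        using Suc.prems 3 unfolding v'(2) by (simp only: rev_upt_Suc_last[of j m]) (simp add: mono_mult)
      then show "mon u 1 * fg j \<in> nspan r n (g_words r n (Suc m))"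
        using base[OF v'(1) v(2,3)] by simp
    qed (use Suc.prems 3 in auto)
    have "mon v 1 * ?N \<in> nspan r n (g_words r n (Suc m))"
      using Suc.prems 3 by (intro base v) auto
    then show ?thesis
      by (rule nspan_cong[OF 2 nspan_add[OF _ nspan_scale[OF 1 coeffs_gens(5)]]])
  next
    case 4
    have "cong_yh r n (mon w 1 * fg i) (mon v 1 * fg (i - 1) * gmon (rev [j..<Suc m]))"
      unfolding w mult.assoc using 4 Suc.prems v
      by (intro cong_yh_mult_left vF descending_shift) auto
    then show ?thesis
      by (rule nspan_cong[OF _ left]) (use Suc.prems 4 v(2) in linarith)+
  qed
qed simp

lemma FA_nspan:
  assumes r: "1 \<le> r" and x: "x \<in> FA r n"
  shows "x \<in> nspan r n (g_words r n n)"
proof -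
  let ?S = "g_words r n n"
  have t: "t_closed r n ?S"
    using g_words_t_closed[OF r, of n n] by simp
  have nil: "[] \<in> t_words r m" for m
  proof (induction m)
    case (Suc m)
    then show ?case
      unfolding t_words.simps using r by (intro image_eqI[where x = "(0, [])"]) auto
  qed simp
  have "[] \<in> g_words r n m" for m
  proof (induction m)
    case (Suc m)
    then show ?case
      unfolding g_words.simps by (intro image_eqI[where x = "([], Suc m)"]) auto
  qed (simp add: nil)
  then have 1: "1 \<in> nspan r n ?S"
    unfolding one_eq_mono by (intro nspan_base)
  have words: "mon w 1 \<in> nspan r n ?S" if "w \<in> lists (gens n)" for w
    using that
  proof (induction w rule: rev_induct)
    case (snoc a w)
    then have IH: "mon w 1 \<in> nspan r n ?S" and a: "a \<in> gens n"
      by auto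
    have e: "mon (w @ [a]) 1 = mon w 1 * mon [a] 1"
      by (simp add: mono_mult)
    show ?case
    proof (cases a)
      case (Gen_g i)
      then have i: "1 \<le> i" "i < n" using a by (auto simp: gens_def)
      show ?thesis
        unfolding e unfolding Gen_g
        by (rule nspan_mult_right[OF IH FA_fg[OF i] g_words_closed[OF r order_refl _ i]])
    next
      case (Gen_t i)
      then have i: "1 \<le> i" "i \<le> n" using a by (auto simp: gens_def)
      show ?thesis
        unfolding e unfolding Gen_t by (rule t_closed_mult_ft[OF t IH i])
    qed
  qed (use 1 in \<open>simp add: one_eq_mono\<close>)
  show ?thesis
    using x
  proof (induction rule: FA_induct)
    case (add w a x)
    then show ?case
      using words[OF add(1)] by (subst mono_scale) (intro nspan_add nspan_scale)
  qed (intro nspan_ideal yh_ideal_0)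
qed

section \<open>The algebra as a ring of operators\<close>

lemma nspan_finite:
  assumes "x \<in> nspan r n S" "finite S"
  obtains i c where "i \<in> yh_ideal r n" "x = i + (\<Sum>w\<in>S. mon w (c w))"
proof -
  have "\<exists>i c. i \<in> yh_ideal r n \<and> x = i + (\<Sum>w\<in>S. mon w (c w))"
    using assms(1)
  proof induction
    case (nspan_ideal x)
    then show ?case by (intro exI[of _ x] exI[of _ "\<lambda>w. 0"]) simp
  next
    case (nspan_step a v x)
    then obtain i c where ic: "i \<in> yh_ideal r n" "x = i + (\<Sum>w\<in>S. mon w (c w))"
      by blast
    have "(\<Sum>w\<in>S. mon w ((c(v := a + c v)) w)) = mon v (a + c v) + (\<Sum>w\<in>S - {v}. mon w (c w))"
      using assms(2) nspan_step(2) by (simp add: sum.remove)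
    also have "\<dots> = mon v a + (\<Sum>w\<in>S. mon w (c w))"
      using assms(2) nspan_step(2) by (simp add: sum.remove[of S v] single_add)
    finally have "mon v a + x = i + (\<Sum>w\<in>S. mon w ((c(v := a + c v)) w))"
      by (simp only: ic(2) add.left_commute)
    with ic(1) show ?case by blast
  qed
  then show thesis using that by blast
qed

section \<open>Reversal of words\<close>

lemma frev_aux: "inj (rev :: 'a list \<Rightarrow> 'a list)"
  by simp

definition frev :: "free \<Rightarrow> free" where
  "frev = Poly_Mapping.map_key rev"

lemma frev_simps [simp]:
  "frev 0 = 0" "frev (x + y) = frev x + frev y" "frev (mon w a) = mon (rev w) a"
proof -
  show "frev 0 = 0" "frev (x + y) = frev x + frev y"
    by (simp_all add: frev_def map_key_plus)
  show "frev (mon w a) = mon (rev w) a"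
    using map_key_single[OF frev_aux, of "rev w" a] by (simp add: frev_def)
qed

lemma frev_frev [simp]: "frev (frev x) = x"
  by (induction x rule: free_induct) simp_all

lemma frev_mult [simp]: "frev (x * y) = frev y * frev x"
proof (induction x rule: free_induct)
  case (add v a x)
  have "frev (mon v a * y) = frev y * mon (rev v) a"
    by (induction y rule: free_induct) (simp_all add: distrib_left distrib_right mono_mult mult.commute)
  with add show ?case by (simp add: distrib_left distrib_right)
qed simp

lemma frev_uminus [simp]: "frev (- x) = - frev x"
  by (metis add.right_inverse minus_unique frev_simps(1,2))

lemma frev_diff [simp]: "frev (x - y) = frev x - frev y"
  using frev_simps(2)[of x "- y"] by simp

lemma frev_1 [simp]: "frev 1 = 1"
  by (simp add: one_eq_mono)

lemma frev_power [simp]: "frev (x ^ k) = frev x ^ k"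
  by (induction k) (simp_all add: power_commutes)

lemma frev_sum [simp]: "frev (sum f I) = (\<Sum>i\<in>I. frev (f i))"
  by (induction I rule: infinite_finite_induct) auto

lemma frev_sc [simp]: "frev (sc a) = sc a"
  by (simp add: sc_def)

lemma frev_FA: "x \<in> FA r n \<Longrightarrow> frev x \<in> FA r n"
proof (induction rule: FA_induct)
  case (add w a x)
  then have "rev w \<in> lists (gens n)" by auto
  then show ?case
    using add by (simp only: frev_simps FA_add FA_mono)
qed simp

lemma phi_frev_fe: "1 \<le> r \<Longrightarrow> phi r (frev (fe r i j)) = opE r i j"
proof -
  assume r: "1 \<le> r"
  have "phi r (frev (fe r i j)) = C (inverse (of_nat r)) * (\<Sum>m<r. opT r i ^ m * opT r j ^ (r - m))"
    by (simp add: fe_def C_central C_simps opT_def dg_simps mult.commute)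
  then show ?thesis using opE_eq[OF r] by simp
qed

lemma phi_frev_fu: "1 \<le> r \<Longrightarrow> phi r (frev (fu r i k)) = opU1 r i k"
proof -
  assume r: "1 \<le> r"
  have "phi r (frev (fu r i k)) =
      C (inverse (of_nat r)) * (\<Sum>j<r. C (\<xi> r powi (- int (j * k))) * opT r i ^ j)"
    by (simp add: fu_def C_central C_simps)
  then show ?thesis using opU1_eq[OF r] by simp
qed

text \<open>Together with faithfulness this makes \<open>*\<close> well defined: the reversed
  relations hold for the operators because all relations are symmetric up to the commutation of
  \<open>e_i\<close> with \<open>g_i\<close> and of the \<open>t_i\<close> with each other.\<close>

lemma phi_frev_relations:
  assumes "1 \<le> r" "x \<in> relations r n"
  shows "phi r (frev x) = 0"
proof -
  have *: "opT r i * opT r j = opT r j * opT r i" for i j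
    by (simp add: opT_def dg_simps mult.commute)
  have **: "opG r i * opG r j = opG r j * opG r i" if "\<bar>int i - int j\<bar> > 1" for i j
  proof -
    from that have "Suc i < j \<or> Suc j < i" by linarith
    then show ?thesis using opG_commute[of i j r] opG_commute[of j i r] by auto
  qed
  have ***: "opG r i * opT r j = opT r (s_transp i j) * opG r i" for i j
    using opT_opG[of r "s_transp i j" i] by simp
  have q: "opG r i * (opE r i (Suc i) * C (q_indet - inverse q_indet)) = C qq * opE r i (Suc i) * opG r i" for i
    by (simp only: C_central[of "opE r i (Suc i)"] C_left_commute[of "opG r i"] opE_mult_left mult.assoc qq_def)
  from assms(2) show ?thesis
    unfolding relations_def
  proof (elim UnE CollectE exE conjE, goal_cases)
    case (4 i j)
    then show ?case by (simp add: C_simps **)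
  next
    case (5 i)
    then show ?case
      using opG_braid[of r i] by (simp add: C_simps mult.assoc)
  next
    case (6 i)
    have "phi r (frev x) = opG r i * opG r i - (1 + opG r i * (opE r i (Suc i) * C (q_indet - inverse q_indet)))"
      unfolding 6(1) by (simp add: C_simps phi_frev_fe[OF assms(1)] power2_eq_square mult.assoc)
    then show ?case
      by (simp only: q opG_quadratic diff_self)
  next
    case (1 i)
    then show ?case by (simp add: C_simps opT_power_r[OF assms(1)])
  next
    case (2 i j)
    then show ?case using *[of i j] by (simp add: C_simps)
  next
    case (3 i j)
    then show ?case using ***[of i j] by (simp add: C_simps)
  qed
qed

section \<open>The operator algebra and its faithfulness\<close>

locale yokonuma =
  fixes r n :: nat
  assumes r1: "1 \<le> r"
begin

text \<open>By \<open>phi_eq_0_iff\<close> this is a copy of the Yokonuma-Hecke algebra, with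
  coefficients in the coefficient ring. The Murphy elements are studied here.\<close>

definition YY :: "oper set" where "YY = phi r ` FA r n"

lemma YY_I: "x \<in> FA r n \<Longrightarrow> phi r x \<in> YY"
  by (simp add: YY_def)

lemma YY_closed [simp, intro]:
  "0 \<in> YY" "1 \<in> YY" "x \<in> YY \<Longrightarrow> y \<in> YY \<Longrightarrow> x + y \<in> YY" "x \<in> YY \<Longrightarrow> y \<in> YY \<Longrightarrow> x - y \<in> YY"
  "x \<in> YY \<Longrightarrow> y \<in> YY \<Longrightarrow> x * y \<in> YY" "a \<in> scalars r \<Longrightarrow> C a \<in> YY"
proof -
  show "0 \<in> YY" "1 \<in> YY" using YY_I[of 0] YY_I[of 1] by simp_all
  show "C a \<in> YY" if "a \<in> scalars r" using YY_I[OF FA_sc[OF that]] by simp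
  assume "x \<in> YY" "y \<in> YY"
  then obtain a b where "a \<in> FA r n" "b \<in> FA r n" "x = phi r a" "y = phi r b"
    by (auto simp: YY_def)
  then show "x + y \<in> YY" "x - y \<in> YY" "x * y \<in> YY"
    using YY_I[of "a + b"] YY_I[of "a - b"] YY_I[of "a * b"] by simp_all
qed

lemma YY_sum: "(\<And>i. i \<in> I \<Longrightarrow> f i \<in> YY) \<Longrightarrow> sum f I \<in> YY"
  by (induction I rule: infinite_finite_induct) auto

lemma YY_gens [simp, intro]:
  "1 \<le> i \<Longrightarrow> i < n \<Longrightarrow> opG r i \<in> YY" "1 \<le> i \<Longrightarrow> i \<le> n \<Longrightarrow> opT r i \<in> YY"
  "1 \<le> i \<Longrightarrow> i \<le> n \<Longrightarrow> 1 \<le> j \<Longrightarrow> j \<le> n \<Longrightarrow> opE r i j \<in> YY"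
  "1 \<le> i \<Longrightarrow> i \<le> n \<Longrightarrow> opU1 r i k \<in> YY"
  using YY_I[OF FA_fg[of i n r]] YY_I[OF FA_ft[of i n r]] YY_I[OF FA_fe[of i n j r]]
    YY_I[OF FA_fu[OF r1, of i n k]]
  by (simp_all add: phi_fe[OF r1] phi_fu[OF r1] C_simps)

lemma opU_Suc: "\<chi> \<in> characters r n \<Longrightarrow> m < n \<Longrightarrow>
    opU r (Suc m) \<chi> = opU r m \<chi> * opU1 r (Suc m) (\<chi> (Suc m))"
proof -
  assume "\<chi> \<in> characters r n" "m < n"
  then have "\<chi> (Suc m) < r" by (auto simp: characters_def)
  then have "(\<forall>p\<in>{1..Suc m}. c p = \<chi> p) \<longleftrightarrow> (\<forall>p\<in>{1..m}. c p = \<chi> p) \<and> c (Suc m) = \<chi> (Suc m) mod r" for c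
    by (auto simp: le_Suc_eq)
  then show ?thesis
    unfolding opU_def opU1_def dg_simps by (simp only: of_bool_conj)
qed

lemma opU_0: "opU r 0 \<chi> = 1"
  by (simp add: opU_def dg_def diag_one)

lemma opU_YY [simp, intro]: "\<chi> \<in> characters r n \<Longrightarrow> opU r n \<chi> \<in> YY"
proof -
  assume \<chi>: "\<chi> \<in> characters r n"
  have "m \<le> n \<Longrightarrow> opU r m \<chi> \<in> YY" for m
  proof (induction m)
    case (Suc m)
    then show ?case by (simp add: opU_Suc[OF \<chi>] YY_closed YY_gens)
  qed (simp add: opU_0)
  then show ?thesis by simp
qed

lemma gword_YY: "is \<in> lists {1..<n} \<Longrightarrow> gword r is \<in> YY"
proof (induction "is")
  case (Cons i "is")
  then have "opG r i \<in> YY" "gword r is \<in> YY" by auto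
  then show ?case by simp
qed simp

lemma gw_YY [simp, intro]: "w permutes {1..n} \<Longrightarrow> gw r n w \<in> YY"
  unfolding gw_def using reduced_red_word[of w n] by (intro gword_YY) (simp add: reduced_word_def)

lemma std_elem_YY: "i \<in> std_index r n \<Longrightarrow> std_elem r n i \<in> YY"
  unfolding std_index_def std_elem_def by (cases i) (auto intro!: YY_closed)

lemma phi_nspan: "x \<in> nspan r n S \<Longrightarrow> phi r x \<in> vs.span (wordop r ` S)"
proof (induction rule: nspan.induct)
  case (nspan_ideal x)
  then show ?case using phi_yh_ideal[OF r1] by (simp add: vs.span_zero)
next
  case (nspan_step a w x)
  have "C a * wordop r w \<in> vs.span (wordop r ` S)"
    by (intro vs.span_scale vs.span_base imageI nspan_step)
  from vs.span_add[OF this nspan_step(4)] show ?case by simp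
qed

lemma YY_span_words: "x \<in> YY \<Longrightarrow> x \<in> vs.span (wordop r ` g_words r n n)"
  unfolding YY_def using phi_nspan FA_nspan[OF r1] by auto

text \<open>The independent elements \<open>u_\<chi> g_w\<close> lie in the span of the normal form
  words, of which there are at most as many. Hence the words are independent as well and span the
  same space.\<close>

lemma words_independent:
  "inj_on (wordop r) (g_words r n n)" "vs.independent (wordop r ` g_words r n n)"
  "wordop r ` g_words r n n \<subseteq> vs.span (std_elem r n ` std_index r n)"
proof -
  have B: "std_elem r n ` std_index r n \<subseteq> vs.span (wordop r ` g_words r n n)"
    using std_elem_YY YY_span_words by blast
  have c: "card (g_words r n n) \<le> card (std_elem r n ` std_index r n)"
    using card_g_words[of r n n] card_image[OF std_elem_independent(1)[of r n]]
    by (simp add: card_std_index)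
  note * = spanning_family_independent[OF conjunct1[OF card_g_words] std_elem_independent(2) B c]
  show "inj_on (wordop r) (g_words r n n)" "vs.independent (wordop r ` g_words r n n)"
    "wordop r ` g_words r n n \<subseteq> vs.span (std_elem r n ` std_index r n)"
    using * by blast+
qed

lemma YY_span_std: "x \<in> YY \<Longrightarrow> x \<in> vs.span (std_elem r n ` std_index r n)"
  using YY_span_words[of x] words_independent(3) vs.span_mono[OF words_independent(3)]
  by (auto simp: vs.span_span)

text \<open>Modulo the ideal an element is a combination of normal form words; their images are
  independent, so a zero image forces all coefficients to vanish.\<close>

lemma phi_eq_0_iff:
  assumes x: "x \<in> FA r n"
  shows "phi r x = 0 \<longleftrightarrow> x \<in> yh_ideal r n"
proof
  assume 0: "phi r x = 0"
  let ?S = "g_words r n n"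
  have fin: "finite ?S" using card_g_words by blast
  obtain i c where ic: "i \<in> yh_ideal r n" "x = i + (\<Sum>w\<in>?S. mon w (c w))"
    using nspan_finite[OF FA_nspan[OF r1 x] fin] .
  let ?c = "\<lambda>y. c (the_inv_into ?S (wordop r) y)"
  have inv: "the_inv_into ?S (wordop r) (wordop r w) = w" if "w \<in> ?S" for w
    using that by (rule the_inv_into_f_f[OF words_independent(1)])
  have "(\<Sum>y\<in>wordop r ` ?S. C (?c y) * y) = (\<Sum>w\<in>?S. C (c w) * wordop r w)"
    by (simp add: sum.reindex[OF words_independent(1)] inv)
  also have "\<dots> = phi r x"
    by (simp add: ic(2) phi_yh_ideal[OF r1 ic(1)])
  finally have "(\<Sum>y\<in>wordop r ` ?S. C (?c y) * y) = 0"
    using 0 by simp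
  from vs.independentD[OF words_independent(2) finite_imageI[OF fin] order_refl this]
  have "c w = 0" if "w \<in> ?S" for w
    using inv[OF that] imageI[OF that, of "wordop r"] by fastforce
  then have "(\<Sum>w\<in>?S. mon w (c w)) = 0"
    by (intro sum.neutral) simp
  then show "x \<in> yh_ideal r n"
    using ic by simp
qed (rule phi_yh_ideal[OF r1])

text \<open>From here on an identity in the algebra can be verified on the rows at the base
  words.\<close>

lemma YY_eqI:
  assumes "x \<in> YY" "y \<in> YY"
    and "\<And>\<psi> f. \<psi> \<in> characters r n \<Longrightarrow> app x f (base \<psi>) = app y f (base \<psi>)"
  shows "x = y"
proof -
  have "x - y = 0"
    using assms by (intro std_span_eq_0[of "x - y" r n] YY_span_std) simp_all
  then show ?thesis by simp
qed

text \<open>Matsumoto's theorem comes for free, since both sides have the same rows.\<close>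

lemma gword_reduced: "w permutes {1..n} \<Longrightarrow> reduced_word n w is \<Longrightarrow> gword r is = gw r n w"
  unfolding gw_def using reduced_red_word[of w n]
  by (intro YY_eqI gword_YY) (simp_all add: gword_row, simp_all add: reduced_word_def)

lemma gw_comp:
  assumes v: "v permutes {1..n}" and d: "d permutes {1..n}" and len: "len n (d \<circ> v) = len n d + len n v"
  shows "gw r n (d \<circ> v) = gw r n v * gw r n d"
proof -
  have "reduced_word n (d \<circ> v) (red_word n v @ red_word n d)"
    using reduced_red_word[OF v] reduced_red_word[OF d] len
    by (simp add: reduced_word_iff[OF v] reduced_word_iff[OF d] reduced_word_iff[OF permutes_compose[OF v d]]
        perm_of_word_append)
  from gword_reduced[OF permutes_compose[OF v d] this] show ?thesis
    by (simp add: gw_def)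
qed

lemma gw_id [simp]: "gw r n id = 1"
proof -
  have "reduced_word n id []"
    using reduced_word_iff[OF permutes_id, of n "[]"] by simp
  from gword_reduced[OF permutes_id this] show ?thesis by simp
qed

lemma gw_s_transp: "1 \<le> i \<Longrightarrow> i < n \<Longrightarrow> gw r n (s_transp i) = opG r i"
proof -
  assume i: "1 \<le> i" "i < n"
  have "len n (id \<circ> s_transp i) = 1"
    using len_ascent[OF permutes_id i] by simp
  then have "reduced_word n (s_transp i) [i]"
    using reduced_word_iff[OF s_transp_permutes[OF i], of "[i]"] i perm_of_word_simps(2)[of "[]" i] by simp
  from gword_reduced[OF s_transp_permutes[OF i] this] show ?thesis by simp
qed

lemma gw_dg: "w permutes {1..n} \<Longrightarrow> gw r n w * dg r F = dg r (\<lambda>c. F (c \<circ> pinv w)) * gw r n w"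
  unfolding gw_def using gword_dg[of r "red_word n w" F] reduced_red_word[of w n] by (simp add: reduced_word_def)

lemma gw_opG_ascent:
  assumes w: "w permutes {1..n}" and i: "1 \<le> i" "i < n" and asc: "pinv w i < pinv w (Suc i)"
  shows "gw r n w * opG r i = gw r n (s_transp i \<circ> w)"
proof -
  have "len n (id \<circ> s_transp i) = 1"
    using len_ascent[OF permutes_id i] by simp
  then show ?thesis
    using gw_comp[OF w s_transp_permutes[OF i]] len_left_ascent[OF w i asc] gw_s_transp[OF i] by simp
qed

text \<open>The last factor \<open>g_i\<close> of \<open>g_w\<close> meets a second one, and the
  quadratic relation applies. The resulting \<open>e_i\<close> is moved to the front, where the
  idempotent of a character can evaluate it.\<close>

lemma gw_opG_descent:
  assumes w: "w permutes {1..n}" and i: "1 \<le> i" "i < n" and desc: "pinv w (Suc i) < pinv w i"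
  shows "gw r n w * opG r i =
    gw r n (s_transp i \<circ> w) + C qq * opE r (pinv w i) (pinv w (Suc i)) * gw r n w"
proof -
  let ?w = "s_transp i \<circ> w"
  have pw: "?w permutes {1..n}"
    using permutes_compose[OF w s_transp_permutes[OF i]] .
  have asc: "pinv ?w i < pinv ?w (Suc i)"
    using desc by (simp add: inv_s_transp_comp[OF w i])
  have e: "gw r n ?w * opG r i = gw r n w"
    using gw_opG_ascent[OF pw i asc] by (simp add: s_transp_idem)
  have E: "gw r n ?w * opE r i (Suc i) = opE r (pinv w i) (pinv w (Suc i)) * gw r n ?w"
    unfolding opE_def gw_dg[OF pw] by (simp add: inv_s_transp_comp[OF w i] eq_commute)
  have "gw r n w * opG r i = gw r n ?w * (1 + C qq * opE r i (Suc i) * opG r i)"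
    by (simp only: e[symmetric] mult.assoc opG_quadratic)
  also have "\<dots> = gw r n ?w + C qq * ((gw r n ?w * opE r i (Suc i)) * opG r i)"
    by (simp only: distrib_left mult_1_right mult.assoc C_left_commute[of "gw r n ?w"])
  also have "\<dots> = gw r n ?w + C qq * opE r (pinv w i) (pinv w (Suc i)) * gw r n w"
    by (simp only: E mult.assoc e)
  finally show ?thesis .
qed

lemma opU_dg:
  assumes F: "\<And>c c'. (\<And>p. p \<in> {1..n} \<Longrightarrow> c p = c' p) \<Longrightarrow> F c = F c'"
  shows "opU r n \<chi> * dg r F = C (F \<chi>) * opU r n \<chi>" "dg r F * opU r n \<chi> = C (F \<chi>) * opU r n \<chi>"
proof -
  have "of_bool (\<forall>p\<in>{1..n}. c p = \<chi> p) * F c = F \<chi> * of_bool (\<forall>p\<in>{1..n}. c p = \<chi> p)" for c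
  proof (cases "\<forall>p\<in>{1..n}. c p = \<chi> p")
    case True
    then have "F c = F \<chi>" by (intro F) blast
    with True show ?thesis by (simp del: atLeastAtMost_iff)
  qed (simp only: of_bool_def if_False mult_zero_left mult_zero_right)
  note eq = this
  have eq2: "F c * of_bool (\<forall>p\<in>{1..n}. c p = \<chi> p) = F \<chi> * of_bool (\<forall>p\<in>{1..n}. c p = \<chi> p)" for c
    unfolding eq[symmetric] by (rule mult.commute)
  show "opU r n \<chi> * dg r F = C (F \<chi>) * opU r n \<chi>" "dg r F * opU r n \<chi> = C (F \<chi>) * opU r n \<chi>"
    unfolding opU_def dg_simps by (simp_all only: eq eq2)
qed

lemma opU_opE: "a \<in> {1..n} \<Longrightarrow> b \<in> {1..n} \<Longrightarrow>
    opU r n \<chi> * opE r a b = C (of_bool (\<chi> a = \<chi> b)) * opU r n \<chi>"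
  unfolding opE_def by (rule opU_dg) simp

lemma opU_opU:
  assumes "\<chi> \<in> characters r n" "\<psi> \<in> characters r n"
  shows "opU r n \<chi> * opU r n \<psi> = C (of_bool (\<chi> = \<psi>)) * opU r n \<chi>"
proof -
  have "opU r n \<chi> * opU r n \<psi> = C (of_bool (\<forall>p\<in>{1..n}. \<chi> p = \<psi> p)) * opU r n \<chi>"
    unfolding opU_def[of r n \<psi>] by (rule opU_dg) auto
  moreover have "(\<forall>p\<in>{1..n}. \<chi> p = \<psi> p) \<longleftrightarrow> \<chi> = \<psi>"
    using characters_eqI[OF assms] by blast
  ultimately show ?thesis by simp
qed

lemma sum_opU: "(\<Sum>\<chi>\<in>characters r n. opU r n \<chi>) = 1"
proof -
  have "(\<Sum>\<chi>\<in>characters r n. of_bool (\<forall>p\<in>{1..n}. colours r v p = \<chi> p)) = (1 :: scalar)" for v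
  proof -
    let ?\<psi> = "restrict (colours r v) {1..n}"
    have \<psi>: "?\<psi> \<in> characters r n"
      using r1 by (auto simp: characters_def colours_def)
    have "(\<forall>p\<in>{1..n}. colours r v p = \<chi> p) \<longleftrightarrow> \<chi> = ?\<psi>" if "\<chi> \<in> characters r n" for \<chi>
    proof
      assume "\<forall>p\<in>{1..n}. colours r v p = \<chi> p"
      then show "\<chi> = ?\<psi>"
        by (intro characters_eqI[OF that \<psi>]) simp
    qed simp
    then have "(\<Sum>\<chi>\<in>characters r n. of_bool (\<forall>p\<in>{1..n}. colours r v p = \<chi> p)) =
        (\<Sum>\<chi>\<in>characters r n. of_bool (\<chi> = ?\<psi>) :: scalar)"
      by (intro sum.cong refl) simp
    also have "\<dots> = 1"
      using \<psi> by (simp add: of_bool_def)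
    finally show ?thesis .
  qed
  then show ?thesis
    unfolding opU_def dg_sum by (simp add: dg_def diag_one)
qed

section \<open>The elements \<open>u_\<chi> g_w\<close> filtered by length\<close>

definition SB :: "nat \<Rightarrow> oper set" where
  "SB L = {opU r n \<chi> * gw r n w | \<chi> w. \<chi> \<in> characters r n \<and> w permutes {1..n} \<and> len n w \<le> L}"

lemma SB_opG:
  assumes x: "x \<in> rspan r (SB L)" and i: "1 \<le> i" "i < n"
  shows "x * opG r i \<in> rspan r (SB (Suc L))"
  using x
proof (rule rspan_mult_right)
  fix s assume "s \<in> SB L"
  then obtain \<chi> w where \<chi>: "\<chi> \<in> characters r n" and w: "w permutes {1..n}" "len n w \<le> L"
    and s: "s = opU r n \<chi> * gw r n w"
    by (auto simp: SB_def)
  have pw: "s_transp i \<circ> w permutes {1..n}"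
    using permutes_compose[OF w(1) s_transp_permutes[OF i]] .
  have in1: "opU r n \<chi> * gw r n (s_transp i \<circ> w) \<in> rspan r (SB (Suc L))" if "len n (s_transp i \<circ> w) \<le> Suc L"
    using \<chi> pw that unfolding SB_def by (intro rspan_base) blast
  have in2: "s \<in> rspan r (SB (Suc L))"
    using \<chi> w unfolding SB_def s by (intro rspan_base) (use le_SucI in blast)
  show "s * opG r i \<in> rspan r (SB (Suc L))"
  proof (cases "pinv w i < pinv w (Suc i)")
    case True
    then show ?thesis
      using in1 len_left_ascent[OF w(1) i True] w(2) by (simp add: s mult.assoc gw_opG_ascent[OF w(1) i])
  next
    case False
    then have d: "pinv w (Suc i) < pinv w i"
      using permutes_neq[OF permutes_inv[OF w(1)], of i "Suc i"] by auto
    have ab: "pinv w i \<in> {1..n}" "pinv w (Suc i) \<in> {1..n}"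
      using permutes_in_image[OF permutes_inv[OF w(1)]] i by simp_all
    \<comment> \<open>The factor \<open>e\<close> in front acts on the idempotent as 0 or 1, so the
      correction term is a scalar multiple of \<open>s\<close> itself.\<close>
    have "s * opG r i = opU r n \<chi> * gw r n (s_transp i \<circ> w) + C (qq * of_bool (\<chi> (pinv w i) = \<chi> (pinv w (Suc i)))) * s"
      unfolding s mult.assoc gw_opG_descent[OF w(1) i d] distrib_left C_left_commute[of "opU r n \<chi>"]
      by (simp only: mult.assoc[symmetric] opU_opE[OF ab]) (simp only: mult.assoc C_assoc)
    moreover have "len n (s_transp i \<circ> w) \<le> Suc L"
      using len_left_descent[OF w(1) i d] w(2) by simp
    ultimately show ?thesis
      using in1 in2 by (auto intro!: rspan_add rspan_scale)
  qed
qed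

lemma SB_gword: "x \<in> rspan r (SB L) \<Longrightarrow> is \<in> lists {1..<n} \<Longrightarrow> x * gword r is \<in> rspan r (SB (L + length is))"
proof (induction "is" rule: rev_induct)
  case (snoc i "is")
  then have i: "1 \<le> i" "i < n" and "x * gword r is \<in> rspan r (SB (L + length is))"
    by auto
  from SB_opG[OF this(3) i] show "x * gword r (is @ [i]) \<in> rspan r (SB (L + length (is @ [i])))"
    by (simp add: mult.assoc)
qed simp

lemma SB_gw: "x \<in> rspan r (SB L) \<Longrightarrow> y permutes {1..n} \<Longrightarrow> x * gw r n y \<in> rspan r (SB (L + len n y))"
  using SB_gword[of x L "red_word n y"] reduced_red_word[of y n] unfolding gw_def by (simp add: reduced_word_iff)

lemma YY_rspan:
  assumes "x \<in> YY"
  shows "x \<in> rspan r {opU r n \<chi> * gw r n w | \<chi> w. \<chi> \<in> characters r n \<and> w permutes {1..n}}" (is "_ \<in> rspan r ?B")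
proof -
  have SBB: "y \<in> rspan r ?B" if "y \<in> rspan r (SB L)" for y L
    using that by (rule rspan_mono) (auto simp: SB_def)
  have BSB: "\<exists>L. b \<in> rspan r (SB L)" if "b \<in> ?B" for b
    using that unfolding SB_def by (blast intro: rspan_base order_refl)
  have g: "b * opG r i \<in> rspan r ?B" if "b \<in> ?B" "1 \<le> i" "i < n" for b i
    using BSB[OF that(1)] SB_opG[OF _ that(2,3)] SBB by blast
  have t: "b * opT r j \<in> rspan r ?B" if b: "b \<in> ?B" and j: "1 \<le> j" "j \<le> n" for b j
  proof -
    obtain \<chi> w where \<chi>: "\<chi> \<in> characters r n" "w permutes {1..n}" "b = opU r n \<chi> * gw r n w"
      using b by blast
    have "pinv w j \<in> {1..n}"
      using permutes_in_image[OF permutes_inv[OF \<chi>(2)]] j by simp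
    \<comment> \<open>After passing \<open>g_w\<close>, the factor \<open>t_j\<close> acts on the
      idempotent as a power of \<open>\<xi> r\<close>.\<close>
    then have *: "opU r n \<chi> * dg r (\<lambda>c. \<xi> r ^ (c \<circ> pinv w) j) = C (\<xi> r ^ \<chi> (pinv w j)) * opU r n \<chi>"
      using opU_dg(1)[of "\<lambda>c. \<xi> r ^ (c \<circ> pinv w) j" \<chi>] by simp
    have "b * opT r j = opU r n \<chi> * dg r (\<lambda>c. \<xi> r ^ (c \<circ> pinv w) j) * gw r n w"
      unfolding \<chi>(3) opT_def by (simp only: mult.assoc gw_dg[OF \<chi>(2)])
    also have "\<dots> = C (\<xi> r ^ \<chi> (pinv w j)) * b"
      unfolding * \<chi>(3) by (simp only: mult.assoc)
    finally have eq: "b * opT r j = C (\<xi> r ^ \<chi> (pinv w j)) * b" .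
    show ?thesis
      unfolding eq by (intro rspan_scale rspan_base b coeffs_power coeffs_gens)
  qed
  have one: "1 \<in> rspan r ?B"
    unfolding sum_opU[symmetric]
  proof (rule rspan_sum)
    fix \<chi> assume "\<chi> \<in> characters r n"
    then have "opU r n \<chi> * gw r n id \<in> ?B"
      using permutes_id by blast
    then show "opU r n \<chi> \<in> rspan r ?B"
      using rspan_base[of _ ?B] by simp
  qed
  have words: "wordop r w \<in> rspan r ?B" if "w \<in> lists (gens n)" for w
    using that
  proof (induction w rule: rev_induct)
    case (snoc a w)
    then have IH: "wordop r w \<in> rspan r ?B" and a: "a \<in> gens n"
      by auto
    show ?case
    proof (cases a)
      case (Gen_g i)
      then have "1 \<le> i" "i < n" using a by (auto simp: gens_def)
      from rspan_mult_right[OF IH g[OF _ this]] show ?thesis by (simp add: Gen_g)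
    next
      case (Gen_t i)
      then have "1 \<le> i" "i \<le> n" using a by (auto simp: gens_def)
      from rspan_mult_right[OF IH t[OF _ this]] show ?thesis by (simp add: Gen_t)
    qed
  qed (use one in simp)
  obtain y where y: "y \<in> FA r n" "x = phi r y"
    using assms by (auto simp: YY_def)
  show ?thesis
    unfolding y(2) using y(1)
  proof (induction rule: FA_induct)
    case (add w a x)
    have "C a * wordop r w \<in> rspan r ?B"
      by (intro rspan_scale words add)
    from rspan_add[OF this add(4)] show ?case
      by (simp only: phi_add phi_single)
  qed simp
qed

lemma opG_inverse:
  "opG r i * (opG r i - C qq * opE r i (Suc i)) = 1" "(opG r i - C qq * opE r i (Suc i)) * opG r i = 1"
proof -
  have "opG r i * (C qq * opE r i (Suc i)) = C qq * opE r i (Suc i) * opG r i"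
    by (simp only: C_left_commute opE_mult_left mult.assoc)
  then show "opG r i * (opG r i - C qq * opE r i (Suc i)) = 1"
    by (simp add: right_diff_distrib opG_quadratic)
  show "(opG r i - C qq * opE r i (Suc i)) * opG r i = 1"
    by (simp add: left_diff_distrib opG_quadratic)
qed

lemma gword_invertible:
  "is \<in> lists {1..<n} \<Longrightarrow> \<exists>y\<in>YY. gword r is * y = 1 \<and> y * gword r is = 1"
proof (induction "is")
  case (Cons i "is")
  then obtain y where y: "y \<in> YY" "gword r is * y = 1" "y * gword r is = 1" and i: "1 \<le> i" "i < n"
    by auto
  let ?z = "opG r i - C qq * opE r i (Suc i)"
  have z: "?z \<in> YY"
    using i by (intro YY_closed YY_gens coeffs_gens) auto
  have "opG r i * gword r is * (y * ?z) = opG r i * (gword r is * y) * ?z"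
    "y * ?z * (opG r i * gword r is) = y * (?z * opG r i) * gword r is"
    by (simp_all only: mult.assoc)
  then show ?case
    using y opG_inverse[of i] z by (intro bexI[of _ "y * ?z"]) auto
qed (auto intro: bexI[of _ 1])

lemma gw_invertible:
  assumes "w permutes {1..n}"
  obtains y where "y \<in> YY" "gw r n w * y = 1" "y * gw r n w = 1"
  using gword_invertible[of "red_word n w"] reduced_red_word[OF assms] that
  by (auto simp: gw_def reduced_word_def)

section \<open>The anti-involution on operators\<close>

definition st :: "oper \<Rightarrow> oper" where
  "st y = phi r (frev (SOME x. x \<in> FA r n \<and> phi r x = y))"

text \<open>Two preimages of an operator differ by an element of the ideal, by faithfulness, and
  reversal sends the ideal into the kernel of \<open>phi\<close>. So the choice in \<open>st\<close>
  does not matter.\<close>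

lemma st_phi: "x \<in> FA r n \<Longrightarrow> st (phi r x) = phi r (frev x)"
proof -
  assume x: "x \<in> FA r n"
  let ?z = "SOME z. z \<in> FA r n \<and> phi r z = phi r x"
  have z: "?z \<in> FA r n \<and> phi r ?z = phi r x"
    by (rule someI[of _ x]) (simp add: x)
  then have "?z - x \<in> yh_ideal r n"
    using phi_eq_0_iff[of "?z - x"] x by simp
  then have "phi r (frev (?z - x)) = 0"
    by (rule yh_ideal_hom_zero[of "\<lambda>x. phi r (frev x)", rotated -1])
      (simp_all add: phi_frev_relations[OF r1])
  then show ?thesis
    by (simp add: st_def)
qed

lemma YY_cases: assumes "y \<in> YY" obtains x where "x \<in> FA r n" "y = phi r x"
  using assms by (auto simp: YY_def)

lemma st_closed [simp, intro]: "y \<in> YY \<Longrightarrow> st y \<in> YY"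
  by (erule YY_cases) (simp add: st_phi YY_I frev_FA)

lemma st_st [simp]: "y \<in> YY \<Longrightarrow> st (st y) = y"
  by (erule YY_cases) (simp add: st_phi frev_FA)

lemma st_add: "x \<in> YY \<Longrightarrow> y \<in> YY \<Longrightarrow> st (x + y) = st x + st y"
  by (elim YY_cases) (simp add: st_phi frev_FA flip: phi_add)

lemma st_mult: "x \<in> YY \<Longrightarrow> y \<in> YY \<Longrightarrow> st (x * y) = st y * st x"
  by (elim YY_cases) (simp add: st_phi frev_FA flip: phi_mult)

lemma st_C: "a \<in> scalars r \<Longrightarrow> st (C a) = C a"
  using st_phi[OF FA_sc, of a] by simp

lemma st_scale: "a \<in> scalars r \<Longrightarrow> x \<in> YY \<Longrightarrow> st (C a * x) = C a * st x"
  by (simp add: st_mult st_C C_central)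

lemma st_0 [simp]: "st 0 = 0" and st_1 [simp]: "st 1 = 1"
  using st_phi[OF FA_0] st_phi[OF FA_1] by simp_all

lemma st_sum: "(\<And>i. i \<in> I \<Longrightarrow> f i \<in> YY) \<Longrightarrow> st (sum f I) = (\<Sum>i\<in>I. st (f i))"
  by (induction I rule: infinite_finite_induct) (auto simp: st_add YY_sum)

lemma st_opG: "1 \<le> i \<Longrightarrow> i < n \<Longrightarrow> st (opG r i) = opG r i"
  using st_phi[OF FA_fg, of i] by (simp add: C_simps)

lemma st_opT: "1 \<le> i \<Longrightarrow> i \<le> n \<Longrightarrow> st (opT r i) = opT r i"
  using st_phi[OF FA_ft, of i] by (simp add: C_simps)

lemma st_gword: "is \<in> lists {1..<n} \<Longrightarrow> st (gword r is) = gword r (rev is)"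
proof (induction "is")
  case (Cons i "is")
  then have "1 \<le> i" "i < n" "is \<in> lists {1..<n}" by auto
  with Cons show ?case
    by (simp add: st_mult gword_YY st_opG)
qed simp

lemma perm_of_word_rev: "perm_of_word (rev is) = pinv (perm_of_word is)"
proof (induction "is")
  case (Cons i "is")
  have "perm_of_word (rev (i # is)) = s_transp i \<circ> pinv (perm_of_word is)"
    using Cons by simp
  also have "\<dots> = pinv (perm_of_word (i # is))"
    unfolding perm_of_word_Cons using bij_perm_of_word by (simp add: o_inv_distrib)
  finally show "perm_of_word (rev (i # is)) = pinv (perm_of_word (i # is))" .
next
  case Nil
  show "perm_of_word (rev []) = pinv (perm_of_word [])" by simp
qed

lemma st_gw: "w permutes {1..n} \<Longrightarrow> st (gw r n w) = gw r n (pinv w)"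
proof -
  assume w: "w permutes {1..n}"
  have red: "red_word n w \<in> lists {1..<n}" "perm_of_word (red_word n w) = w" "length (red_word n w) = len n w"
    using reduced_red_word[OF w] by (simp_all add: reduced_word_iff[OF w])
  have "rev (red_word n w) \<in> lists {1..<n}"
    using red(1) by auto
  then have "reduced_word n (pinv w) (rev (red_word n w))"
    using red by (simp add: reduced_word_iff[OF permutes_inv[OF w]] perm_of_word_rev len_inv[OF w])
  from gword_reduced[OF permutes_inv[OF w] this] show ?thesis
    using st_gword[OF red(1)] by (simp add: gw_def)
qed

lemma st_opU: "\<chi> \<in> characters r n \<Longrightarrow> st (opU r n \<chi>) = opU r n \<chi>"
proof -
  assume \<chi>: "\<chi> \<in> characters r n"
  have "m \<le> n \<Longrightarrow> opU r m \<chi> \<in> YY \<and> st (opU r m \<chi>) = opU r m \<chi>" for m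
  proof (induction m)
    case (Suc m)
    have 1: "st (opU1 r (Suc m) (\<chi> (Suc m))) = opU1 r (Suc m) (\<chi> (Suc m))"
      using st_phi[OF FA_fu[OF r1, of "Suc m" n "\<chi> (Suc m)"]] Suc.prems
      by (simp add: phi_fu[OF r1] phi_frev_fu[OF r1])
    have 2: "opU1 r (Suc m) k * opU r m \<chi> = opU r m \<chi> * opU1 r (Suc m) k" for k
      by (simp add: opU_def opU1_def dg_simps mult.commute)
    show ?case
      using Suc 1 2 by (simp add: opU_Suc[OF \<chi>] st_mult YY_gens YY_closed)
  qed (simp add: opU_0)
  then show ?thesis by simp
qed

end

section \<open>Sums over Young subgroups\<close>

text \<open>Then the idempotent of \<open>\<chi>\<close> commutes with \<open>g_w\<close> for
  \<open>w\<close> in the Young subgroup, and \<open>e_ij\<close> acts as 1 on it for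
  \<open>i\<close> and \<open>j\<close> in one block.\<close>

definition compat :: "nat \<Rightarrow> (nat \<Rightarrow> nat) \<Rightarrow> (nat \<Rightarrow> 'l) \<Rightarrow> bool" where
  "compat n \<chi> blk \<longleftrightarrow> (\<forall>p\<in>{1..n}. \<forall>p'\<in>{1..n}. blk p = blk p' \<longrightarrow> \<chi> p = \<chi> p')"

context yokonuma
begin

definition xs :: "(nat \<Rightarrow> 'l) \<Rightarrow> oper" where
  "xs blk = (\<Sum>w\<in>blk_stab n blk. C (q_indet ^ len n w) * gw r n w)"

text \<open>The element \<open>m_\<lambda>\<close> for an arbitrary labelling; the Garnir argument
  needs it also for merged rows with the character of the original shape.\<close>

definition mm :: "(nat \<Rightarrow> nat) \<Rightarrow> (nat \<Rightarrow> 'l) \<Rightarrow> oper" where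
  "mm \<chi> blk = opU r n \<chi> * xs blk"

lemma xs_YY [simp, intro]: "xs blk \<in> YY"
  unfolding xs_def by (intro YY_sum YY_closed gw_YY coeffs_power coeffs_gens blk_stab_permutes)

lemma mm_YY [simp, intro]: "\<chi> \<in> characters r n \<Longrightarrow> mm \<chi> blk \<in> YY"
  unfolding mm_def by (intro YY_closed) auto

lemma opU_cong:
  assumes "\<And>p. p \<in> {1..n} \<Longrightarrow> \<chi> p = \<psi> p"
  shows "opU r n \<chi> = opU r n \<psi>"
proof -
  have "(\<forall>p\<in>{1..n}. c p = \<chi> p) \<longleftrightarrow> (\<forall>p\<in>{1..n}. c p = \<psi> p)" for c
    by (rule ball_cong) (simp_all only: assms)
  then show ?thesis by (simp only: opU_def)
qed

lemma gw_opU: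
  assumes w: "w permutes {1..n}"
  shows "gw r n w * opU r n \<chi> = opU r n (\<chi> \<circ> w) * gw r n w"
proof -
  have "(\<forall>p\<in>{1..n}. (c \<circ> pinv w) p = \<chi> p) \<longleftrightarrow> (\<forall>p\<in>{1..n}. c p = (\<chi> \<circ> w) p)" for c
  proof safe
    fix p assume *: "\<forall>p\<in>{1..n}. (c \<circ> pinv w) p = \<chi> p" "p \<in> {1..n}"
    then have "w p \<in> {1..n}" using permutes_in_image[OF w] by blast
    with * show "c p = (\<chi> \<circ> w) p"
      by (metis comp_apply permutes_inverses(2)[OF w])
  next
    fix p assume *: "\<forall>p\<in>{1..n}. c p = (\<chi> \<circ> w) p" "p \<in> {1..n}"
    then have "pinv w p \<in> {1..n}" using permutes_in_image[OF permutes_inv[OF w]] by blast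
    with * show "(c \<circ> pinv w) p = \<chi> p"
      by (metis comp_apply permutes_inverses(1)[OF w])
  qed
  then show ?thesis
    unfolding opU_def gw_dg[OF w] by simp
qed

lemma gw_opU_stab:
  assumes "w \<in> blk_stab n blk" "compat n \<chi> blk"
  shows "gw r n w * opU r n \<chi> = opU r n \<chi> * gw r n w"
proof -
  have w: "w permutes {1..n}" using blk_stab_permutes[OF assms(1)] .
  have "\<chi> (w p) = \<chi> p" if p: "p \<in> {1..n}" for p
  proof -
    have "w p \<in> {1..n}" "blk (w p) = blk p"
      using permutes_in_image[OF w, of p] p assms(1) by (auto simp: blk_stab_def)
    then show ?thesis
      using assms(2) p unfolding compat_def by blast
  qed
  then have "opU r n (\<chi> \<circ> w) = opU r n \<chi>"
    by (intro opU_cong) simp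
  then show ?thesis
    by (simp add: gw_opU[OF w])
qed

lemma xs_opU: "compat n \<chi> blk \<Longrightarrow> xs blk * opU r n \<chi> = opU r n \<chi> * xs blk"
  unfolding xs_def sum_distrib_left sum_distrib_right
  by (intro sum.cong refl) (simp only: mult.assoc gw_opU_stab C_left_commute[of "opU r n \<chi>"])

lemma opU_idem: "\<chi> \<in> characters r n \<Longrightarrow> opU r n \<chi> * opU r n \<chi> = opU r n \<chi>"
  by (simp add: opU_opU C_simps)

lemma mm_opU:
  assumes "compat n \<chi> blk" "\<chi> \<in> characters r n"
  shows "mm \<chi> blk * opU r n \<chi> = mm \<chi> blk"
  unfolding mm_def mult.assoc xs_opU[OF assms(1)] by (simp only: mult.assoc[symmetric] opU_idem[OF assms(2)])

lemma st_xs: "st (xs blk) = xs blk"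
proof -
  have "st (xs blk) = (\<Sum>w\<in>blk_stab n blk. C (q_indet ^ len n (pinv w)) * gw r n (pinv w))"
    unfolding xs_def
    by (subst st_sum) (auto intro!: sum.cong YY_closed gw_YY
        simp: st_scale st_gw len_inv dest: blk_stab_permutes)
  also have "\<dots> = xs blk"
    unfolding xs_def
  proof (rule sum.reindex_bij_betw[where h = pinv])
    show "bij_betw pinv (blk_stab n blk) (blk_stab n blk)"
      by (rule bij_betw_byWitness[where f' = pinv])
        (auto intro: blk_stab_inv simp: permutes_inv_inv[OF blk_stab_permutes])
  qed
  finally show ?thesis .
qed

lemma st_mm: "compat n \<chi> blk \<Longrightarrow> \<chi> \<in> characters r n \<Longrightarrow> st (mm \<chi> blk) = mm \<chi> blk"
  unfolding mm_def by (simp add: st_mult st_xs st_opU xs_opU)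

text \<open>Pairing \<open>w\<close> with \<open>s_i \<circ> w\<close> writes the sum over the Young
  subgroup as a combination of \<open>g_w (1 + q g_i)\<close>. When \<open>e_i\<close> acts as 1,
  \<open>(1 + q g_i) g_i = q (1 + q g_i)\<close>.\<close>

lemma mm_opG:
  assumes comp: "compat n \<chi> blk" and i: "1 \<le> i" "i < n" "blk i = blk (Suc i)"
  shows "mm \<chi> blk * opG r i = C q_indet * mm \<chi> blk"
proof -
  let ?W = "blk_stab n blk" and ?s = "s_transp i"
  let ?W1 = "{w \<in> ?W. pinv w i < pinv w (Suc i)}"
  let ?f = "\<lambda>w. C (q_indet ^ len n w) * gw r n w"
  have pw: "w permutes {1..n}" if "w \<in> ?W" for w
    using blk_stab_permutes[OF that] .
  have sW: "?s \<circ> w \<in> ?W" if "w \<in> ?W" for w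
    using blk_stab_comp[OF s_transp_in_blk_stab that] i by blast
  have iw: "pinv (?s \<circ> w) i = pinv w (Suc i)" "pinv (?s \<circ> w) (Suc i) = pinv w i" if "w \<in> ?W" for w
    using inv_s_transp_comp(1)[OF pw[OF that] i(1,2)] by simp_all
  have neq: "pinv w i \<noteq> pinv w (Suc i)" if "w \<in> ?W" for w
    using permutes_neq[OF permutes_inv[OF pw[OF that]], of i "Suc i"] by simp
  have bij: "bij_betw (\<lambda>w. ?s \<circ> w) ?W1 (?W - ?W1)"
  proof (rule bij_betw_byWitness[where f' = "\<lambda>w. ?s \<circ> w"])
    show "(\<lambda>w. ?s \<circ> w) ` ?W1 \<subseteq> ?W - ?W1" "(\<lambda>w. ?s \<circ> w) ` (?W - ?W1) \<subseteq> ?W1"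
      using sW iw neq by (auto simp: not_less nat_less_le)
  qed (simp_all add: s_transp_idem)
  have "xs blk = sum ?f ?W1 + sum ?f (?W - ?W1)"
    unfolding xs_def by (subst sum.subset_diff[of ?W1 ?W]) (auto simp: add.commute)
  also have "sum ?f (?W - ?W1) = (\<Sum>w\<in>?W1. ?f (?s \<circ> w))"
    using sum.reindex_bij_betw[OF bij, of ?f] by simp
  also have "\<dots> = (\<Sum>w\<in>?W1. ?f w * (C q_indet * opG r i))"
  proof (intro sum.cong refl)
    fix w assume "w \<in> ?W1"
    then have w: "w \<in> ?W" "pinv w i < pinv w (Suc i)" by auto
    show "?f (?s \<circ> w) = ?f w * (C q_indet * opG r i)"
      unfolding gw_opG_ascent[OF pw[OF w(1)] i(1,2) w(2), symmetric] len_left_ascent[OF pw[OF w(1)] i(1,2) w(2)]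
      by (simp only: mult.assoc C_left_commute[of "gw r n w"] C_assoc power_Suc mult.commute)
  qed
  finally have xs: "xs blk = (\<Sum>w\<in>?W1. ?f w * (1 + C q_indet * opG r i))"
    by (simp add: sum.distrib distrib_left)
  have trm: "opU r n \<chi> * (?f w * (1 + C q_indet * opG r i)) * opG r i
      = C q_indet * (opU r n \<chi> * (?f w * (1 + C q_indet * opG r i)))" if w: "w \<in> ?W" for w
  proof -
    let ?u = "opU r n \<chi> * gw r n w"
    let ?a = "pinv w i" and ?b = "pinv w (Suc i)"
    have ab: "?a \<in> {1..n}" "?b \<in> {1..n}"
      using permutes_in_image[OF permutes_inv[OF pw[OF w]]] i by simp_all
    have "blk ?a = blk ?b"
      using blk_stab_inv[OF w] i by (simp add: blk_stab_def)
    then have "\<chi> ?a = \<chi> ?b"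
      using comp ab unfolding compat_def by blast
    have "gw r n w * opE r i (Suc i) = opE r ?a ?b * gw r n w"
      unfolding opE_def gw_dg[OF pw[OF w]] by simp
    then have "?u * opE r i (Suc i) = opU r n \<chi> * opE r ?a ?b * gw r n w"
      by (simp only: mult.assoc)
    also have "\<dots> = ?u"
      unfolding opU_opE[OF ab] by (simp add: \<open>\<chi> ?a = \<chi> ?b\<close> C_simps)
    \<comment> \<open>Compatibility in action: moved in front of \<open>g_w\<close>, the factor
      \<open>e_i\<close> joins two positions of one block, where the idempotent absorbs it.\<close>
    finally have e: "?u * opE r i (Suc i) = ?u" .
    have "?u * (1 + C q_indet * opG r i) * opG r i = ?u * opG r i + C q_indet * (?u * (opG r i * opG r i))"
      by (simp add: distrib_left distrib_right mult.assoc C_left_commute)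
    also have "?u * (opG r i * opG r i) = ?u + C qq * (?u * opE r i (Suc i) * opG r i)"
      unfolding opG_quadratic by (simp add: distrib_left mult.assoc C_left_commute)
    also have "?u * opG r i + C q_indet * (?u + C qq * (?u * opE r i (Suc i) * opG r i))
        = C q_indet * ?u + (C 1 + C (q_indet * qq)) * (?u * opG r i)"
      unfolding e by (simp add: distrib_left distrib_right C_assoc C_simps(5) algebra_simps)
    also have "C 1 + C (q_indet * qq) = (C (q_indet * q_indet) :: oper)"
      unfolding C_simps(1) by (simp add: qq_def algebra_simps)
    also have "C q_indet * ?u + C (q_indet * q_indet) * (?u * opG r i) = C q_indet * (?u * (1 + C q_indet * opG r i))"
      by (simp add: distrib_left C_assoc C_left_commute[of ?u])
    finally have 1: "?u * (1 + C q_indet * opG r i) * opG r i = C q_indet * (?u * (1 + C q_indet * opG r i))" .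
    have 2: "opU r n \<chi> * (?f w * y) = C (q_indet ^ len n w) * (?u * y)" for y
      by (simp only: mult.assoc C_left_commute[of "opU r n \<chi>"])
    show ?thesis
      unfolding 2 by (simp only: mult.assoc[of "C (q_indet ^ len n w)"] 1 C_assoc mult.commute)
  qed
  have "mm \<chi> blk * opG r i = (\<Sum>w\<in>?W1. opU r n \<chi> * (?f w * (1 + C q_indet * opG r i)) * opG r i)"
    unfolding mm_def xs sum_distrib_left sum_distrib_right by (simp only: mult.assoc)
  also have "\<dots> = (\<Sum>w\<in>?W1. C q_indet * (opU r n \<chi> * (?f w * (1 + C q_indet * opG r i))))"
    by (intro sum.cong refl trm) simp
  also have "\<dots> = C q_indet * mm \<chi> blk"
    unfolding mm_def xs sum_distrib_left ..
  finally show ?thesis .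
qed

lemma mm_gw_stab:
  assumes c: "convex_blk n blk" and comp: "compat n \<chi> blk"
  shows "v \<in> blk_stab n blk \<Longrightarrow> mm \<chi> blk * gw r n v = C (q_indet ^ len n v) * mm \<chi> blk"
proof (induction "len n v" arbitrary: v)
  case 0
  then have "v = id" using len_0_id[OF blk_stab_permutes] by metis
  then show ?case by (simp only: gw_id len_id) (simp add: C_simps)
next
  case (Suc k)
  have pv: "v permutes {1..n}" using blk_stab_permutes[OF Suc.prems] .
  have "v \<noteq> id"
  proof
    assume "v = id"
    then have "len n v = 0" by (simp only: len_id)
    with Suc.hyps(2) show False by simp
  qed
  then obtain i where i: "1 \<le> i" "i < n" "v (Suc i) < v i"
    using exists_descent[OF pv] by metis
  have blk: "blk i = blk (Suc i)"
    using blk_stab_less[OF c Suc.prems, of i "Suc i"] i by fastforce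
  let ?v = "v \<circ> s_transp i"
  have v': "?v \<in> blk_stab n blk"
    using blk_stab_comp[OF Suc.prems s_transp_in_blk_stab[OF i(1,2) blk]] .
  have l: "len n v = Suc (len n ?v)"
    using len_descent[OF pv i] .
  have IH: "mm \<chi> blk * gw r n ?v = C (q_indet ^ len n ?v) * mm \<chi> blk"
    using Suc.hyps(2) l by (intro Suc.hyps(1) v') simp
  have "len n (id \<circ> s_transp i) = 1"
    using len_ascent[OF permutes_id i(1,2)] by simp
  then have "gw r n (?v \<circ> s_transp i) = opG r i * gw r n ?v"
    using gw_comp[OF s_transp_permutes[OF i(1,2)] blk_stab_permutes[OF v']] l
    by (simp add: s_transp_idem gw_s_transp[OF i(1,2)])
  then have "mm \<chi> blk * gw r n v = mm \<chi> blk * opG r i * gw r n ?v"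
    by (simp only: s_transp_idem mult.assoc)
  also have "\<dots> = C (q_indet ^ len n v) * mm \<chi> blk"
    by (simp only: mm_opG[OF comp i(1,2) blk] mult.assoc IH C_assoc l power_Suc)
  finally show ?case .
qed

lemma mm_gw_incr:
  assumes c: "convex_blk n blk" and comp: "compat n \<chi> blk" and w: "w permutes {1..n}"
  obtains d a where "d \<in> blk_incr n blk" "len n d \<le> len n w" "a \<in> scalars r"
    "mm \<chi> blk * gw r n w = C a * (mm \<chi> blk * gw r n d)"
proof -
  obtain v d where vd: "v \<in> blk_stab n blk" "d \<in> blk_incr n blk" and wd: "w = d \<circ> v"
    using blk_factorization[OF c w] .
  have l: "len n w = len n d + len n v"
    unfolding wd by (rule len_blk_comp[OF c vd])
  have "gw r n w = gw r n v * gw r n d"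
    unfolding wd by (rule gw_comp[OF blk_stab_permutes[OF vd(1)] blk_incr_permutes[OF vd(2)] l[unfolded wd]])
  then have "mm \<chi> blk * gw r n w = C (q_indet ^ len n v) * (mm \<chi> blk * gw r n d)"
    using mm_gw_stab[OF c comp vd(1)] by (simp only: mult.assoc[symmetric])
  from that[OF vd(2) _ _ this] l show thesis
    by simp
qed

text \<open>The length bound is carried along because straightening terminates by decreasing
  length.\<close>

lemma mm_SB:
  assumes c: "convex_blk n blk" and comp: "compat n \<chi> blk" and \<chi>: "\<chi> \<in> characters r n"
    and y: "y \<in> rspan r (SB L)"
  shows "mm \<chi> blk * y \<in> rspan r {mm \<chi> blk * gw r n d | d. d \<in> blk_incr n blk \<and> len n d \<le> L}"
  using y
proof (rule rspan_mult_left)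
  fix s assume "s \<in> SB L"
  then obtain \<psi> w where \<psi>: "\<psi> \<in> characters r n" and w: "w permutes {1..n}" "len n w \<le> L"
    and s: "s = opU r n \<psi> * gw r n w"
    by (auto simp: SB_def)
  obtain d a where d: "d \<in> blk_incr n blk" "len n d \<le> len n w" "a \<in> scalars r"
    and eq: "mm \<chi> blk * gw r n w = C a * (mm \<chi> blk * gw r n d)"
    using mm_gw_incr[OF c comp w(1)] .
  have "mm \<chi> blk * s = mm \<chi> blk * (opU r n \<chi> * opU r n \<psi>) * gw r n w"
    unfolding s by (simp only: mult.assoc[symmetric] mm_opU[OF comp \<chi>])
  also have "\<dots> = C (of_bool (\<chi> = \<psi>)) * (mm \<chi> blk * opU r n \<chi> * gw r n w)"
    by (simp only: opU_opU[OF \<chi> \<psi>] mult.assoc C_left_commute[of "mm \<chi> blk"])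
  also have "\<dots> = C (of_bool (\<chi> = \<psi>) * a) * (mm \<chi> blk * gw r n d)"
    by (simp only: mm_opU[OF comp \<chi>] eq C_assoc)
  finally have *: "mm \<chi> blk * s = C (of_bool (\<chi> = \<psi>) * a) * (mm \<chi> blk * gw r n d)" .
  have "mm \<chi> blk * gw r n d \<in> {mm \<chi> blk * gw r n d | d. d \<in> blk_incr n blk \<and> len n d \<le> L}"
    using d w(2) by (blast intro: order_trans)
  then show "mm \<chi> blk * s \<in> rspan r {mm \<chi> blk * gw r n d | d. d \<in> blk_incr n blk \<and> len n d \<le> L}"
    unfolding * using d(3) by (intro rspan_scale rspan_base) auto
qed

lemma mm_YY_span:
  assumes c: "convex_blk n blk" and comp: "compat n \<chi> blk" and \<chi>: "\<chi> \<in> characters r n"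
    and y: "y \<in> YY"
  shows "mm \<chi> blk * y \<in> rspan r {mm \<chi> blk * gw r n d | d. d \<in> blk_incr n blk}"
  using YY_rspan[OF y]
proof (rule rspan_mult_left)
  fix s assume "s \<in> {opU r n \<chi> * gw r n w |\<chi> w. \<chi> \<in> characters r n \<and> w permutes {1..n}}"
  then obtain L where "s \<in> SB L" unfolding SB_def by blast
  from mm_SB[OF c comp \<chi> rspan_base[OF this]]
  show "mm \<chi> blk * s \<in> rspan r {mm \<chi> blk * gw r n d | d. d \<in> blk_incr n blk}"
    by (rule rspan_mono) blast
qed

text \<open>Length additivity turns the factorization of the larger Young subgroup into a
  factorization of its sum.\<close>

lemma xs_refine:
  assumes c: "convex_blk n blk'"
    and ref: "\<And>a b. a \<in> {1..n} \<Longrightarrow> b \<in> {1..n} \<Longrightarrow> blk' a = blk' b \<Longrightarrow> blk a = blk b"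
  shows "xs blk = xs blk' * (\<Sum>d\<in>blk_stab n blk \<inter> blk_incr n blk'. C (q_indet ^ len n d) * gw r n d)"
proof -
  let ?S = "blk_stab n blk'" and ?D = "blk_stab n blk \<inter> blk_incr n blk'"
  let ?f = "\<lambda>w. C (q_indet ^ len n w) * gw r n w"
  have "xs blk = (\<Sum>(v, d)\<in>?S \<times> ?D. ?f (d \<circ> v))"
  proof -
    have "bij_betw (\<lambda>(v, d). d \<circ> v) (?S \<times> ?D) (blk_stab n blk)"
      by (rule bij_blk_factorization[OF c ref])
    from sum.reindex_bij_betw[OF this, of ?f] show ?thesis
      unfolding xs_def split_beta by (rule sym)
  qed
  also have "\<dots> = (\<Sum>(v, d)\<in>?S \<times> ?D. ?f v * ?f d)"
  proof (intro sum.cong refl, clarify)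
    fix v d assume v: "v \<in> ?S" and d: "d \<in> blk_incr n blk'"
    have l: "len n (d \<circ> v) = len n d + len n v"
      by (rule len_blk_comp[OF c v d])
    show "?f (d \<circ> v) = ?f v * ?f d"
      unfolding gw_comp[OF blk_stab_permutes[OF v] blk_incr_permutes[OF d] l] l
      by (simp only: power_add mult.assoc C_left_commute[of "gw r n v"] C_assoc mult.commute)
  qed
  also have "\<dots> = xs blk' * sum ?f ?D"
    unfolding xs_def sum_product sum.cartesian_product by simp
  finally show ?thesis .
qed

text \<open>The anti-involution fixes both sums, so applying it to \<open>xs_refine\<close> moves
  the cofactor to the left.\<close>

lemma xs_refine_left:
  assumes c: "convex_blk n blk'"
    and ref: "\<And>a b. a \<in> {1..n} \<Longrightarrow> b \<in> {1..n} \<Longrightarrow> blk' a = blk' b \<Longrightarrow> blk a = blk b"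
  obtains h where "h \<in> YY" "xs blk = h * xs blk'"
proof -
  let ?y = "\<Sum>d\<in>blk_stab n blk \<inter> blk_incr n blk'. C (q_indet ^ len n d) * gw r n d"
  have y: "?y \<in> YY"
    by (intro YY_sum YY_closed gw_YY coeffs_power coeffs_gens blk_incr_permutes) auto
  have e: "xs blk = xs blk' * ?y"
    by (rule xs_refine[OF c ref])
  have "xs blk = st (xs blk)"
    by (rule st_xs[symmetric])
  also have "\<dots> = st (xs blk' * ?y)"
    by (rule arg_cong[OF e])
  also have "\<dots> = st ?y * xs blk'"
    using y by (simp add: st_mult st_xs)
  finally show thesis
    using that[OF st_closed[OF y]] by simp
qed

text \<open>Conjugation by \<open>w\<close> carries one Young subgroup to the other and preserves
  length, since \<open>w \<circ> v\<close>, written in both ways as a product with \<open>w\<close>,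
  is length additive. This is what permits rows to be reordered.\<close>

lemma xs_conj:
  assumes c1: "convex_blk n blk1" and c2: "convex_blk n blk2"
    and w1: "w \<in> blk_incr n blk1" and w2: "pinv w \<in> blk_incr n blk2"
    and blk: "\<And>p p'. p \<in> {1..n} \<Longrightarrow> p' \<in> {1..n} \<Longrightarrow> blk1 p = blk1 p' \<longleftrightarrow> blk2 (w p) = blk2 (w p')"
  shows "xs blk1 * gw r n w = gw r n w * xs blk2"
proof -
  have pw: "w permutes {1..n}" using blk_incr_permutes[OF w1] .
  let ?f = "\<lambda>w. C (q_indet ^ len n w) * gw r n w"
  let ?h = "\<lambda>v. w \<circ> v \<circ> pinv w" and ?h' = "\<lambda>v. pinv w \<circ> v \<circ> w"
  have h: "?h v \<in> blk_stab n blk2" if "v \<in> blk_stab n blk1" for v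
    unfolding blk_stab_def
  proof (intro CollectI conjI ballI)
    have pv: "v permutes {1..n}" using blk_stab_permutes[OF that] .
    show "?h v permutes {1..n}"
      using permutes_compose[OF permutes_inv[OF pw] permutes_compose[OF pv pw]] .
    fix p assume "p \<in> {1..n}"
    then have q: "pinv w p \<in> {1..n}"
      using permutes_in_image[OF permutes_inv[OF pw]] by blast
    then have "v (pinv w p) \<in> {1..n}" "blk1 (v (pinv w p)) = blk1 (pinv w p)"
      using permutes_in_image[OF pv, of "pinv w p"] that by (simp_all add: blk_stab_def)
    then show "blk2 (?h v p) = blk2 p"
      using blk[of "v (pinv w p)" "pinv w p"] q by (simp add: permutes_inverses[OF pw])
  qed
  have h': "?h' v \<in> blk_stab n blk1" if "v \<in> blk_stab n blk2" for v
    unfolding blk_stab_def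
  proof (intro CollectI conjI ballI)
    have pv: "v permutes {1..n}" using blk_stab_permutes[OF that] .
    show "?h' v permutes {1..n}"
      using permutes_compose[OF pw permutes_compose[OF pv permutes_inv[OF pw]]] .
    fix p assume p: "p \<in> {1..n}"
    then have wp: "w p \<in> {1..n}"
      using permutes_in_image[OF pw] by blast
    then have "v (w p) \<in> {1..n}" "blk2 (v (w p)) = blk2 (w p)"
      using permutes_in_image[OF pv, of "w p"] that by (simp_all add: blk_stab_def)
    moreover have "pinv w (v (w p)) \<in> {1..n}"
      using permutes_in_image[OF permutes_inv[OF pw]] calculation(1) by blast
    ultimately show "blk1 (?h' v p) = blk1 p"
      using blk[of "pinv w (v (w p))" p] p by (simp add: permutes_inverses[OF pw])
  qed
  have bij: "bij_betw ?h (blk_stab n blk1) (blk_stab n blk2)"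
  proof (rule bij_betw_byWitness[where f' = ?h'])
    show "\<forall>v\<in>blk_stab n blk1. ?h' (?h v) = v" "\<forall>v\<in>blk_stab n blk2. ?h (?h' v) = v"
      by (simp_all add: fun_eq_iff permutes_inverses[OF pw])
    show "?h ` blk_stab n blk1 \<subseteq> blk_stab n blk2" "?h' ` blk_stab n blk2 \<subseteq> blk_stab n blk1"
      using h h' by (simp_all only: image_subset_iff) blast+
  qed
  have trm: "?f v * gw r n w = gw r n w * ?f (?h v)" if v: "v \<in> blk_stab n blk1" for v
  proof -
    note pv = blk_stab_permutes[OF v] and ph = blk_stab_permutes[OF h[OF v]]
    have l1: "len n (w \<circ> v) = len n w + len n v"
      by (rule len_blk_comp[OF c1 v w1])
    have eq: "?h v \<circ> w = w \<circ> v"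
      by (simp add: fun_eq_iff permutes_inverses[OF pw])
    \<comment> \<open>\<open>len_blk_comp\<close> has the coset representative as the outer
      function; here it is the inner one, hence the passage to inverses.\<close>
    have "len n (?h v \<circ> w) = len n (pinv (?h v \<circ> w))"
      by (rule len_inv[OF permutes_compose[OF pw ph], symmetric])
    also have "pinv (?h v \<circ> w) = pinv w \<circ> pinv (?h v)"
      by (rule o_inv_distrib[OF permutes_bij[OF ph] permutes_bij[OF pw]])
    also have "len n (pinv w \<circ> pinv (?h v)) = len n (pinv w) + len n (pinv (?h v))"
      by (rule len_blk_comp[OF c2 blk_stab_inv[OF h[OF v]] w2])
    finally have l2: "len n (?h v \<circ> w) = len n (?h v) + len n w"
      unfolding len_inv[OF pw] len_inv[OF ph] by (simp only: add.commute)
    have "len n v = len n (?h v)"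
      using l1 l2 unfolding eq by linarith
    moreover have "gw r n v * gw r n w = gw r n w * gw r n (?h v)"
      using gw_comp[OF pv pw l1] gw_comp[OF pw ph l2] unfolding eq by simp
    ultimately show ?thesis
      by (simp only: mult.assoc C_left_commute[of "gw r n w"])
  qed
  have "xs blk1 * gw r n w = (\<Sum>v\<in>blk_stab n blk1. gw r n w * ?f (?h v))"
    unfolding xs_def sum_distrib_right by (intro sum.cong refl trm)
  also have "\<dots> = gw r n w * xs blk2"
    unfolding xs_def sum_distrib_left using sum.reindex_bij_betw[OF bij, of "\<lambda>v. gw r n w * ?f v"] by simp
  finally show ?thesis .
qed

end

section \<open>Garnir relations\<close>

text \<open>The cycle \<open>l, l + 1, ..., m\<close> and, below, its inverse, as formulas rather
  than as products of transpositions, so that values are found by case distinction.\<close>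

definition cyc :: "nat \<Rightarrow> nat \<Rightarrow> nat \<Rightarrow> nat" where
  "cyc l m p = (if l \<le> p \<and> p < m then Suc p else if p = m \<and> l \<le> m then l else p)"

definition icyc :: "nat \<Rightarrow> nat \<Rightarrow> nat \<Rightarrow> nat" where
  "icyc l m p = (if l < p \<and> p \<le> m then p - 1 else if p = l \<and> l \<le> m then m else p)"

lemma cyc_icyc: "cyc l m (icyc l m p) = p" "icyc l m (cyc l m p) = p"
  by (auto simp: cyc_def icyc_def)

lemma cyc_permutes: "1 \<le> l \<Longrightarrow> m \<le> n \<Longrightarrow> cyc l m permutes {1..n}"
  unfolding permutes_def
proof (intro conjI allI impI)
  fix y show "\<exists>!x. cyc l m x = y"
    using cyc_icyc by metis
qed (auto simp: cyc_def)

lemma pinv_cyc: "pinv (cyc l m) = icyc l m"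
  by (rule inv_equality) (simp_all add: cyc_icyc)

text \<open>Equal inversion sets make \<open>u\<close> after the inverse of \<open>w\<close>
  increase at neighbours. Used to turn an inclusion of inversion sets into a strict inequality of
  lengths.\<close>

lemma inversions_inj:
  assumes u: "u permutes {1..n}" and w: "w permutes {1..n}" and eq: "inversions n u = inversions n w"
  shows "u = w"
proof -
  have "u (pinv w i) < u (pinv w (Suc i))" if i: "1 \<le> i" "i < n" for i
  proof -
    let ?p = "pinv w i" and ?p' = "pinv w (Suc i)"
    have r: "1 \<le> ?p" "?p \<le> n" "1 \<le> ?p'" "?p' \<le> n"
      using permutes_le_iff[OF permutes_inv[OF w], of i] permutes_le_iff[OF permutes_inv[OF w], of "Suc i"] i
      by simp_all
    have e: "w ?p = i" "w ?p' = Suc i" and ne: "?p \<noteq> ?p'"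
      using permutes_inverses(1)[OF w] permutes_neq[OF permutes_inv[OF w], of i "Suc i"] by simp_all
    have ne': "u ?p \<noteq> u ?p'"
      using permutes_neq[OF u ne] .
    show ?thesis
    proof (cases "?p < ?p'")
      case True
      have "(?p, ?p') \<notin> inversions n w"
        using e by (simp add: inversions_def)
      then have "(?p, ?p') \<notin> inversions n u"
        unfolding eq .
      then have "\<not> u ?p' < u ?p"
        using True r by (simp add: inversions_def)
      then show ?thesis using ne' by linarith
    next
      case False
      then have "(?p', ?p) \<in> inversions n w"
        using e r ne by (simp add: inversions_def)
      then have "(?p', ?p) \<in> inversions n u"
        unfolding eq .
      then show ?thesis
        by (simp add: inversions_def)
    qed
  qed
  then have "u \<circ> pinv w = id"
    by (intro increasing_perm_id[OF permutes_compose[OF permutes_inv[OF w] u]]) simp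
  then have "u (pinv w (w x)) = w x" for x
    by (metis comp_apply id_apply)
  then show ?thesis
    by (simp add: permutes_inverses(2)[OF w] fun_eq_iff)
qed

text \<open>Two consecutive rows, labelled \<open>\<alpha>\<close> and \<open>\<beta>\<close>, of
  lengths \<open>a\<close> and \<open>b\<close>, begin after position \<open>off\<close>.
  \<open>J\<close> stands for the ideal of the strictly dominating shapes; it contains the elements
  of the shapes in which some boxes of the lower row have moved to the upper one.\<close>

locale garnir = yokonuma +
  fixes blk :: "nat \<Rightarrow> 'l" and \<chi> :: "nat \<Rightarrow> nat" and off a b :: nat and \<alpha> \<beta> :: 'l and J :: "oper set"
  assumes conv: "convex_blk n blk" and comp: "compat n \<chi> blk" and chi: "\<chi> \<in> characters r n"
    and row1: "\<And>p. p \<in> {1..n} \<Longrightarrow> blk p = \<alpha> \<longleftrightarrow> off + 1 \<le> p \<and> p \<le> off + a"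
    and row2: "\<And>p. p \<in> {1..n} \<Longrightarrow> blk p = \<beta> \<longleftrightarrow> off + a + 1 \<le> p \<and> p \<le> off + a + b"
    and ba: "b \<le> a" and le_n: "off + a + b \<le> n"
    and J_add: "\<And>x y. x \<in> J \<Longrightarrow> y \<in> J \<Longrightarrow> x + y \<in> J"
    and J_left: "\<And>x y. x \<in> J \<Longrightarrow> y \<in> YY \<Longrightarrow> y * x \<in> J"
    and J_right: "\<And>x y. x \<in> J \<Longrightarrow> y \<in> YY \<Longrightarrow> x * y \<in> J"
    and J_mm: "\<And>s. 1 \<le> s \<Longrightarrow> s \<le> b \<Longrightarrow>
      mm \<chi> (\<lambda>p. if off + a < p \<and> p \<le> off + a + s then \<alpha> else blk p) \<in> J"
begin

text \<open>All of the upper row except its first \<open>f\<close> positions, followed by the first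
  \<open>j\<close> positions of the lower row.\<close>

definition chunk :: "nat \<Rightarrow> nat \<Rightarrow> nat \<Rightarrow> bool" where
  "chunk f j p \<longleftrightarrow> off + f + 1 \<le> p \<and> p \<le> off + a + j"

definition xblk :: "nat \<Rightarrow> nat \<Rightarrow> nat \<Rightarrow> nat" where
  "xblk f j p = (if chunk f j p then 0 else p)"

definition Dset :: "nat \<Rightarrow> nat \<Rightarrow> (nat \<Rightarrow> nat) set" where
  "Dset f j = {d \<in> blk_incr n blk. \<forall>p. \<not> chunk f j p \<longrightarrow> d p = p}"

text \<open>For \<open>j = f + 1\<close> the chunk has \<open>a + 1\<close> positions, one more than
  the upper row, and this is the Garnir sum of column \<open>j\<close>. Its terms belong to the
  shuffles of the two pieces of the chunk.\<close>

definition R :: "nat \<Rightarrow> nat \<Rightarrow> oper" where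
  "R f j = (\<Sum>d\<in>Dset f j. C (q_indet ^ len n d) * (mm \<chi> blk * gw r n d))"

lemma finite_Dset [simp]: "finite (Dset f j)"
  by (simp add: Dset_def)

lemma Dset_permutes: "d \<in> Dset f j \<Longrightarrow> d permutes {1..n}"
  unfolding Dset_def using blk_incr_permutes by blast

lemma convex_xblk: "convex_blk n (xblk f j)"
  by (auto simp: convex_blk_def xblk_def chunk_def)

lemma fix_chunk:
  assumes "d permutes {1..n}" "\<And>p. \<not> chunk f j p \<Longrightarrow> d p = p"
  shows "chunk f j p \<Longrightarrow> chunk f j (d p)" "d \<in> blk_stab n (xblk f j)"
proof -
  show *: "chunk f j (d p)" if "chunk f j p" for p
  proof (rule ccontr)
    assume "\<not> chunk f j (d p)"
    then have "d (d p) = d p" by (rule assms(2))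
    then have "d p = p" using permutes_neq[OF assms(1), of "d p" p] by blast
    with that \<open>\<not> chunk f j (d p)\<close> show False by simp
  qed
  show "d \<in> blk_stab n (xblk f j)"
    using * assms by (auto simp: blk_stab_def xblk_def)
qed

lemma stab_fix:
  assumes "v \<in> blk_stab n (xblk f j)" "\<not> chunk f j p"
  shows "v p = p"
proof (cases "p \<in> {1..n}")
  case True
  then have "xblk f j (v p) = p" "p \<noteq> 0"
    using assms by (auto simp: blk_stab_def xblk_def)
  then show ?thesis
    by (simp add: xblk_def split: if_splits)
qed (use permutes_not_in[OF blk_stab_permutes[OF assms(1)]] in blast)

lemma Dset_chunk: "d \<in> Dset f j \<Longrightarrow> chunk f j p \<Longrightarrow> chunk f j (d p)"
  using fix_chunk(1)[OF Dset_permutes, of d f j f j p] by (simp add: Dset_def)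

lemma Dset_stab: "d \<in> Dset f j \<Longrightarrow> d \<in> blk_stab n (xblk f j)"
  using fix_chunk(2)[OF Dset_permutes, of d f j f j] by (simp add: Dset_def)

lemma J_scale: "x \<in> J \<Longrightarrow> k \<in> scalars r \<Longrightarrow> C k * x \<in> J"
  by (intro J_left YY_closed)

text \<open>For \<open>f = 0\<close> the chunk is an entire row of the merged labelling. Multiplied
  by the sum of the shuffles, the Young sum of the common refinement becomes that of the merged
  labelling, so \<open>R 0 j\<close> is a left multiple of the corresponding element of
  \<open>J\<close>.\<close>

lemma garnir_base:
  assumes j: "1 \<le> j" "j \<le> b"
  shows "R 0 j \<in> J"
proof -
  \<comment> \<open>\<open>blks\<close> merges the first \<open>j\<close> entries of the lower row
    into the upper one. \<open>blk'\<close> refines both \<open>blk\<close> and \<open>blks\<close>: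
    it cuts the lower row after these entries.\<close>
  define blks where "blks = (\<lambda>p. if off + a < p \<and> p \<le> off + a + j then \<alpha> else blk p)"
  define blk' where "blk' = (\<lambda>p. (blk p, off + a < p \<and> p \<le> off + a + j))"
  have C: "\<And>x y z. 1 \<le> x \<Longrightarrow> x < y \<Longrightarrow> y < z \<Longrightarrow> z \<le> n \<Longrightarrow> blk x = blk z \<Longrightarrow> blk y = blk x"
    using conv unfolding convex_blk_def by blast
  have in2: "blk p = \<beta>" if "off + a < p" "p \<le> off + a + j" for p
    using row2[of p] that j le_n by simp
  have blks_\<alpha>: "blks p = \<alpha> \<longleftrightarrow> chunk 0 j p" if "p \<in> {1..n}" for p
    using row1[OF that] that j by (auto simp: blks_def chunk_def)
  have conv': "convex_blk n blk'"
    unfolding convex_blk_def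
  proof (intro allI impI, elim conjE)
    fix x y z assume h: "1 \<le> x" "x < y" "y < z" "z \<le> n" "blk' x = blk' z"
    then have by': "blk y = blk x" using C[of x y z] by (simp add: blk'_def)
    show "blk' y = blk' x"
    proof (cases "off + a < y \<and> y \<le> off + a + j")
      case True
      then have "blk x = \<beta>" using in2[of y] by' by simp
      then have "off + a + 1 \<le> x" using row2[of x] h by simp
      then show ?thesis using True h by' by (simp add: blk'_def)
    next
      case False
      then show ?thesis using h by' by (auto simp: blk'_def)
    qed
  qed
  have convs: "convex_blk n blks"
    unfolding convex_blk_def
  proof (intro allI impI, elim conjE)
    fix x y z assume h: "1 \<le> x" "x < y" "y < z" "z \<le> n" "blks x = blks z"
    show "blks y = blks x"
    proof (cases "blks x = \<alpha>")
      case True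
      then have "chunk 0 j x" "chunk 0 j z" using blks_\<alpha>[of x] blks_\<alpha>[of z] h by simp_all
      then have "chunk 0 j y" using h by (simp add: chunk_def)
      then show ?thesis using blks_\<alpha>[of y] h True by simp
    next
      case False
      then have x: "\<not> chunk 0 j x" "\<not> chunk 0 j z" "blk x = blk z"
        using blks_\<alpha>[of x] blks_\<alpha>[of z] h by (auto simp: blks_def split: if_splits)
      then have by': "blk y = blk x" using C[of x y z] h by simp
      have "\<not> (off + a < y \<and> y \<le> off + a + j)"
      proof
        assume y: "off + a < y \<and> y \<le> off + a + j"
        then have "blk x = \<beta>" using in2[of y] by' by simp
        then have "off + a + 1 \<le> x" using row2[of x] h by simp
        then show False using x(1) y h by (simp add: chunk_def)
      qed
      then show ?thesis using by' x(1) by (auto simp: blks_def chunk_def)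
    qed
  qed
  have ref': "\<And>x y. x \<in> {1..n} \<Longrightarrow> y \<in> {1..n} \<Longrightarrow> blk' x = blk' y \<Longrightarrow> blk x = blk y"
    by (simp add: blk'_def)
  have refs: "\<And>x y. x \<in> {1..n} \<Longrightarrow> y \<in> {1..n} \<Longrightarrow> blk' x = blk' y \<Longrightarrow> blks x = blks y"
    by (auto simp: blk'_def blks_def)
  \<comment> \<open>The shuffles are the distinguished representatives of the refined Young subgroup
    in the merged one.\<close>
  have D_eq: "blk_stab n blks \<inter> blk_incr n blk' = Dset 0 j"
  proof (rule subset_antisym; rule subsetI)
    fix d assume "d \<in> blk_stab n blks \<inter> blk_incr n blk'"
    then have dW: "d \<in> blk_stab n blks" and dD: "d \<in> blk_incr n blk'" by auto
    have pd: "d permutes {1..n}" using blk_stab_permutes[OF dW] .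
    obtain v d1 where v: "v \<in> blk_stab n (xblk 0 j)" and d1: "d1 \<in> blk_incr n (xblk 0 j)" and eq: "d = d1 \<circ> v"
      using blk_factorization[OF convex_xblk pd] .
    have pv: "v permutes {1..n}" using blk_stab_permutes[OF v] .
    have vfix: "v p = p" if "\<not> chunk 0 j p" for p
      using stab_fix[OF v that] .
    have vc: "chunk 0 j (v p)" if "chunk 0 j p" for p
      using fix_chunk(1)[OF pv vfix that] .
    have vW: "v \<in> blk_stab n blks"
      unfolding blk_stab_def
    proof (intro CollectI conjI ballI pv)
      fix p assume p: "p \<in> {1..n}"
      then have "v p \<in> {1..n}" using permutes_in_image[OF pv] by blast
      then show "blks (v p) = blks p"
        using blks_\<alpha>[OF p] blks_\<alpha>[of "v p"] vc[of p] vfix[of p] by (cases "chunk 0 j p") simp_all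
    qed
    have d1_eq: "d1 = d \<circ> pinv v"
      unfolding eq by (simp add: comp_assoc permutes_inv_o(1)[OF pv])
    have d1W: "d1 \<in> blk_stab n blks"
      unfolding d1_eq by (rule blk_stab_comp[OF dW blk_stab_inv[OF vW]])
    \<comment> \<open>\<open>d1\<close> lies in the Young subgroup of \<open>blks\<close> and
      increases on each of its blocks: on the chunk by choice, elsewhere because \<open>d\<close>
      does. So \<open>d = v\<close> moves only the chunk.\<close>
    have "d1 = id"
    proof (rule increasing_perm_id[OF blk_stab_permutes[OF d1W]])
      fix i assume i: "1 \<le> i" "i < n"
      show "d1 i < d1 (Suc i)"
      proof (cases "blks i = blks (Suc i)")
        case False
        then show ?thesis using blk_stab_less[OF convs d1W, of i "Suc i"] i by simp
      next
        case same: True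
        show ?thesis
        proof (cases "chunk 0 j i")
          case True
          then have "chunk 0 j (Suc i)" using same blks_\<alpha>[of i] blks_\<alpha>[of "Suc i"] i by simp
          then show ?thesis using True blk_incrD[OF d1, of i "Suc i"] i by (simp add: xblk_def)
        next
          case False
          then have n2: "\<not> chunk 0 j (Suc i)" using same blks_\<alpha>[of i] blks_\<alpha>[of "Suc i"] i by simp
          have "d1 i = d i" "d1 (Suc i) = d (Suc i)"
            unfolding eq using vfix[OF False] vfix[OF n2] by simp_all
          moreover have "blk' i = blk' (Suc i)"
            using same False n2 by (auto simp: blk'_def blks_def chunk_def split: if_splits)
          ultimately show ?thesis using blk_incrD[OF dD, of i "Suc i"] i by simp
        qed
      qed
    qed
    then have dv: "d = v" unfolding eq by simp
    have "d x < d y" if h: "1 \<le> x" "x < y" "y \<le> n" "blk x = blk y" for x y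
    proof (cases "blk' x = blk' y")
      case True
      then show ?thesis using blk_incrD[OF dD h(1-3)] by simp
    next
      case False
      then have "blk x = \<beta>" using h in2[of x] in2[of y] by (auto simp: blk'_def)
      then have x: "off + a + 1 \<le> x" "off + a + 1 \<le> y" using row2[of x] row2[of y] h by simp_all
      then have "chunk 0 j x" "\<not> chunk 0 j y" using False h by (auto simp: blk'_def chunk_def)
      then have "chunk 0 j (d x)" "d y = y" "\<not> chunk 0 j y"
        using vc vfix unfolding dv by auto
      then show ?thesis using x by (simp add: chunk_def)
    qed
    then show "d \<in> Dset 0 j"
      using pd vfix unfolding Dset_def blk_incr_def dv by simp
  next
    fix d assume d: "d \<in> Dset 0 j"
    have pd: "d permutes {1..n}" using Dset_permutes[OF d] .
    have "d \<in> blk_stab n blks"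
      unfolding blk_stab_def
    proof (intro CollectI conjI ballI pd)
      fix p assume p: "p \<in> {1..n}"
      then have "d p \<in> {1..n}" using permutes_in_image[OF pd] by blast
      then show "blks (d p) = blks p"
        using blks_\<alpha>[OF p] blks_\<alpha>[of "d p"] Dset_chunk[OF d, of p] d
        by (cases "chunk 0 j p") (simp_all add: Dset_def)
    qed
    moreover have "d \<in> blk_incr n blk'"
      using d unfolding Dset_def blk_incr_def blk'_def by simp
    ultimately show "d \<in> blk_stab n blks \<inter> blk_incr n blk'" by blast
  qed
  let ?S = "\<Sum>d\<in>Dset 0 j. C (q_indet ^ len n d) * gw r n d"
  obtain h where h: "h \<in> YY" "xs blk = h * xs blk'"
    using xs_refine_left[OF conv' ref'] .
  have c': "compat n \<chi> blk'"
    using comp unfolding compat_def blk'_def by blast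
  have xsb: "xs blks = xs blk' * ?S"
    unfolding D_eq[symmetric] by (rule xs_refine[OF conv' refs])
  have "R 0 j = mm \<chi> blk * ?S"
    unfolding R_def sum_distrib_left by (simp only: C_left_commute[of "mm \<chi> blk"])
  also have "mm \<chi> blk = h * (xs blk' * opU r n \<chi>)"
    using xs_opU[OF comp] by (simp only: mm_def h(2) mult.assoc)
  also have "\<dots> * ?S = h * mm \<chi> blks"
    unfolding mm_def xsb xs_opU[OF c'] by (simp only: mult.assoc)
  finally show ?thesis
    using J_left[OF J_mm[OF j, folded blks_def] h(1)] by simp
qed

text \<open>
  Merging part of the upper row with the lower one directly would not give a dominating shape.
  The sums \<open>R f j\<close> with \<open>f > 0\<close> are therefore reduced to \<open>R 0\<close>, for which the first \<open>j\<close> entries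
  of the lower row are moved up into the whole upper row.
\<close>

lemma garnir_step:
  assumes f: "Suc f < j" "j \<le> b"
  obtains k y where "k \<in> scalars r" "y \<in> YY" "R (Suc f) j = R f j - C k * (R f (j - 1) * y)"
proof -
  \<comment> \<open>\<open>l\<close> and \<open>m\<close> are the first and the last position of the
    larger chunk; \<open>c\<close> cycles all of it, \<open>s\<close> only its part in the lower
    row.\<close>
  define l m where "l = off + f + 1" and "m = off + a + j"
  define c where "c = cyc l m"
  define s where "s = cyc (off + a + 1) m"
  have lm: "1 \<le> l" "l < off + a + 1" "off + a + 1 < m" "m \<le> n"
    using f ba le_n by (simp_all add: l_def m_def)
  have pc: "c permutes {1..n}" and ps: "s permutes {1..n}"
    unfolding c_def s_def by (rule cyc_permutes, use lm in simp, use lm in simp)+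
  have ch1: "chunk f j p \<longleftrightarrow> l \<le> p \<and> p \<le> m" and ch2: "chunk (Suc f) j p \<longleftrightarrow> l < p \<and> p \<le> m"
    and ch3: "chunk f (j - 1) p \<longleftrightarrow> l \<le> p \<and> p < m" for p
    using f by (auto simp: chunk_def l_def m_def)
  have \<alpha>: "blk p = \<alpha>" if "l \<le> p" "p \<le> off + a" for p
    using row1[of p] that lm by (simp add: l_def)
  have \<beta>: "blk p = \<beta>" if "off + a < p" "p \<le> m" for p
    using row2[of p] that lm f by (simp add: m_def)
  have \<alpha>': "p \<le> off + a" if "blk p = \<alpha>" "p \<in> {1..n}" for p
    using row1[of p] that by simp
  have \<beta>': "off + a < p" if "blk p = \<beta>" "p \<in> {1..n}" for p
    using row2[of p] that by simp
  have rows: "(p' \<le> off + a) = (p \<le> off + a)" if "blk p = blk p'" "l \<le> p" "p \<le> m" "p' \<in> {1..n}" for p p'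
  proof (cases "p \<le> off + a")
    case True
    then show ?thesis using \<alpha>[of p] \<alpha>'[of p'] that by simp
  next
    case False
    then show ?thesis using \<beta>[of p] \<beta>'[of p'] that by simp
  qed
  define E where "E = {d \<in> Dset f j. d l \<noteq> l}"
  have split: "Dset f j = Dset (Suc f) j \<union> E" "Dset (Suc f) j \<inter> E = {}"
    using ch1 ch2 by (auto simp: E_def Dset_def) (metis nat_less_le)
  \<comment> \<open>The smallest value of the chunk occurs at the beginning of one of its two
    increasing pieces. As \<open>d\<close> moves \<open>l\<close>, this is the beginning of the
    lower piece.\<close>
  have E_first: "d (off + a + 1) = l" if "d \<in> E" for d
  proof -
    have d: "d \<in> Dset f j" "d l \<noteq> l" using that by (auto simp: E_def)
    have pd: "d permutes {1..n}" using Dset_permutes[OF d(1)] .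
    let ?p = "pinv d l"
    have dp: "d ?p = l" using permutes_inverses(1)[OF pd] by simp
    have "chunk f j ?p"
    proof (rule ccontr)
      assume "\<not> chunk f j ?p"
      then have "d ?p = ?p" using d(1) by (simp add: Dset_def)
      then show False using d(2) dp by simp
    qed
    then have p: "l \<le> ?p" "?p \<le> m" by (simp_all add: ch1)
    have ge: "l \<le> d x" if "l \<le> x" "x \<le> m" for x
      using Dset_chunk[OF d(1), of x] that by (simp add: ch1)
    have inc: "d x < d y" if "1 \<le> x" "x < y" "y \<le> n" "blk x = blk y" for x y
      using d(1) blk_incrD[OF _ that] by (simp add: Dset_def)
    have "\<not> ?p \<le> off + a"
    proof
      assume "?p \<le> off + a"
      moreover have "?p \<noteq> l" using dp d(2) by metis
      ultimately have "d l < d ?p" using p lm \<alpha>[of l] \<alpha>[of ?p] by (intro inc) auto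
      then show False using ge[of l] dp lm by simp
    qed
    moreover have "\<not> off + a + 1 < ?p"
    proof
      assume "off + a + 1 < ?p"
      then have "d (off + a + 1) < d ?p" using p lm \<beta>[of "off + a + 1"] \<beta>[of ?p] by (intro inc) auto
      then show False using ge[of "off + a + 1"] dp lm by simp
    qed
    ultimately have "?p = off + a + 1" by simp
    then show ?thesis using dp by simp
  qed
  \<comment> \<open>Deleting the value \<open>l\<close> from the lower piece leaves a shuffle of the
    upper piece with \<open>j - 1\<close> lower entries. On functions this removal is undone by
    composing with \<open>c\<close> outside and the inverse of \<open>s\<close> inside.\<close>
  let ?h = "\<lambda>e. c \<circ> e \<circ> icyc (off + a + 1) m" and ?h' = "\<lambda>d. icyc l m \<circ> d \<circ> s"
  have pi: "icyc (off + a + 1) m permutes {1..n}" "icyc l m permutes {1..n}"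
    using permutes_inv[OF ps] permutes_inv[OF pc] by (simp_all only: s_def c_def pinv_cyc)
  have hE: "?h e \<in> E" if e: "e \<in> Dset f (j - 1)" for e
  proof -
    have pe: "e permutes {1..n}" using Dset_permutes[OF e] .
    have efix: "e p = p" if "\<not> (l \<le> p \<and> p < m)" for p
      using e that ch3 by (simp add: Dset_def)
    have ech: "l \<le> e p \<and> e p < m" if "l \<le> p" "p < m" for p
      using Dset_chunk[OF e, of p] that ch3 by simp
    have einc: "e x < e y" if "1 \<le> x" "x < y" "y \<le> n" "blk x = blk y" for x y
      using e blk_incrD[OF _ that] by (simp add: Dset_def)
    have h1: "?h e p = Suc (e p)" if "l \<le> p" "p \<le> off + a" for p
      using that lm ech[of p] by (simp add: icyc_def c_def cyc_def)
    have h2: "?h e p = Suc (e (p - 1))" if "off + a + 1 < p" "p \<le> m" for p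
      using that lm ech[of "p - 1"] by (simp add: icyc_def c_def cyc_def)
    have h3: "?h e (off + a + 1) = l"
      using lm efix[of m] by (simp add: icyc_def c_def cyc_def)
    have h4: "?h e p = p" if "\<not> (l \<le> p \<and> p \<le> m)" for p
      using that lm efix[of p] by (auto simp: icyc_def c_def cyc_def)
    have hr: "l \<le> ?h e p \<and> ?h e p \<le> m" if p: "l \<le> p" "p \<le> m" for p
    proof (cases "p \<le> off + a")
      case True
      then show ?thesis using h1[OF p(1) True] ech[of p] p lm by linarith
    next
      case False
      show ?thesis
      proof (cases "p = off + a + 1")
        case True
        then show ?thesis using h3 lm by (metis le_trans less_imp_le order_refl)
      next
        case neq: False
        then have "l \<le> p - 1" "p - 1 < m" "off + a + 1 < p" using False p lm by linarith+
        then show ?thesis using h2[of p] ech[of "p - 1"] p by linarith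
      qed
    qed
    have "?h e x < ?h e y" if h: "1 \<le> x" "x < y" "y \<le> n" "blk x = blk y" for x y
    proof (cases "l \<le> x \<and> x \<le> m")
      case False
      then have hx: "?h e x = x" by (rule h4)
      show ?thesis
      proof (cases "l \<le> y \<and> y \<le> m")
        case True
        then have "l \<le> ?h e y"
          using hr[of y] by blast
        then show ?thesis using True False h hx by linarith
      qed (use hx h4[of y] h in simp)
    next
      case x: True
      have yr: "(y \<le> off + a) = (x \<le> off + a)" using rows[of x y] x h by simp
      show ?thesis
      proof (cases "y \<le> m")
        case False
        then have "?h e y = y" by (intro h4) simp
        moreover have "?h e x \<le> m"
          using hr[of x] x by blast
        ultimately show ?thesis using False by linarith
      next
        case ym: True
        show ?thesis
        proof (cases "x \<le> off + a")
          case True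
          then show ?thesis using h1[of x] h1[of y] yr x h einc[of x y] by simp
        next
          case False
          have y: "?h e y = Suc (e (y - 1))" using h2[of y] False h ym by simp
          show ?thesis
          proof (cases "x = off + a + 1")
            case True
            then have "l \<le> y - 1" "y - 1 < m" using h ym lm by linarith+
            then have "l < ?h e y" using y ech[of "y - 1"] by linarith
            then show ?thesis using h3 True by metis
          next
            case x2: False
            have "e (x - 1) < e (y - 1)"
              using False x2 h ym x lm \<beta>[of "x - 1"] \<beta>[of "y - 1"] by (intro einc) auto
            then show ?thesis using y h2[of x] False x2 x by simp
          qed
        qed
      qed
    qed
    moreover have "?h e permutes {1..n}"
      using permutes_compose[OF pi(1) permutes_compose[OF pe pc]] .
    moreover have "?h e l \<noteq> l"
      using h1[of l] ech[of l] lm by simp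
    ultimately show ?thesis
      using h4 by (simp add: E_def Dset_def blk_incr_def ch1 del: comp_apply)
  qed
  have hE': "?h' d \<in> Dset f (j - 1)" if dE: "d \<in> E" for d
  proof -
    have d: "d \<in> Dset f j" "d l \<noteq> l" using dE by (auto simp: E_def)
    have pd: "d permutes {1..n}" using Dset_permutes[OF d(1)] .
    have dfix: "d p = p" if "\<not> (l \<le> p \<and> p \<le> m)" for p
      using d(1) that ch1 by (simp add: Dset_def)
    have d0: "d (off + a + 1) = l" using E_first[OF dE] .
    have dch: "l < d p \<and> d p \<le> m" if "l \<le> p" "p \<le> m" "p \<noteq> off + a + 1" for p
      using Dset_chunk[OF d(1), of p] that ch1 permutes_neq[OF pd, of p "off + a + 1"] d0 by auto
    have dinc: "d x < d y" if "1 \<le> x" "x < y" "y \<le> n" "blk x = blk y" for x y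
      using d(1) blk_incrD[OF _ that] by (simp add: Dset_def)
    have h1: "?h' d p = d p - 1" if "l \<le> p" "p \<le> off + a" for p
      using that lm dch[of p] by (simp add: icyc_def s_def cyc_def)
    have h2: "?h' d p = d (Suc p) - 1" if "off + a < p" "p < m" for p
      using that lm dch[of "Suc p"] by (simp add: icyc_def s_def cyc_def)
    have h4: "?h' d p = p" if "\<not> (l \<le> p \<and> p < m)" for p
      using that lm dfix[of p] d0 by (cases "p = m") (auto simp: icyc_def s_def cyc_def)
    have hr: "l \<le> ?h' d p \<and> ?h' d p < m" if p: "l \<le> p" "p < m" for p
    proof (cases "p \<le> off + a")
      case True
      then have "?h' d p = d p - 1" "l < d p \<and> d p \<le> m"
        using h1[OF p(1) True] dch[of p] p by simp_all
      then show ?thesis by linarith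
    next
      case False
      then have "?h' d p = d (Suc p) - 1" "l < d (Suc p) \<and> d (Suc p) \<le> m"
        using h2[of p] dch[of "Suc p"] p by simp_all
      then show ?thesis by linarith
    qed
    have "?h' d x < ?h' d y" if h: "1 \<le> x" "x < y" "y \<le> n" "blk x = blk y" for x y
    proof (cases "l \<le> x \<and> x < m")
      case False
      then have hx: "?h' d x = x" by (rule h4)
      show ?thesis
      proof (cases "l \<le> y \<and> y < m")
        case True
        then have "l \<le> ?h' d y"
          using hr[of y] by blast
        then show ?thesis using True False h hx by linarith
      qed (use hx h4[of y] h in simp)
    next
      case x: True
      have yr: "(y \<le> off + a) = (x \<le> off + a)" using rows[of x y] x h by simp
      show ?thesis
      proof (cases "y < m")
        case False
        then have "?h' d y = y" by (intro h4) simp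
        moreover have "?h' d x < m"
          using hr[of x] x by blast
        ultimately show ?thesis using False by linarith
      next
        case ym: True
        show ?thesis
        proof (cases "x \<le> off + a")
          case True
          then show ?thesis
            using h1[of x] h1[of y] yr x h dinc[of x y] dch[of x] ym by (simp del: comp_apply; linarith)
        next
          case False
          have "d (Suc x) < d (Suc y)"
            using False h ym x lm \<beta>[of "Suc x"] \<beta>[of "Suc y"] by (intro dinc) auto
          then show ?thesis using h2[of x] h2[of y] False x h ym dch[of "Suc x"] by (simp del: comp_apply; linarith)
        qed
      qed
    qed
    moreover have "?h' d permutes {1..n}"
      using permutes_compose[OF ps permutes_compose[OF pd pi(2)]] .
    ultimately show ?thesis
      using h4 unfolding Dset_def blk_incr_def ch3 by (simp del: comp_apply)
  qed
  have bij: "bij_betw ?h (Dset f (j - 1)) E"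
  proof (rule bij_betw_byWitness[where f' = ?h'])
    show "\<forall>e\<in>Dset f (j - 1). ?h' (?h e) = e" "\<forall>d\<in>E. ?h (?h' d) = d"
      by (simp_all add: fun_eq_iff c_def s_def cyc_icyc)
    show "?h ` Dset f (j - 1) \<subseteq> E" "?h' ` E \<subseteq> Dset f (j - 1)"
      using hE hE' by (simp_all only: image_subset_iff) blast+
  qed
  have sW: "s \<in> blk_stab n blk"
    unfolding blk_stab_def
  proof (intro CollectI conjI ballI ps)
    fix p assume "p \<in> {1..n}"
    then show "blk (s p) = blk p"
      using \<beta>[of p] \<beta>[of "s p"] lm by (cases "off + a < p \<and> p \<le> m") (auto simp: s_def cyc_def)
  qed
  have cD: "c \<in> blk_incr n (xblk f (j - 1))"
    using pc unfolding blk_incr_def xblk_def ch3 by (auto simp: c_def cyc_def split: if_splits)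
  \<comment> \<open>The exponent is \<open>len n c - 2 * len n s\<close>: one \<open>len n s\<close>
    comes from comparing the lengths of the two factorizations of \<open>c \<circ> e\<close>, the
    other from \<open>s\<close> being absorbed by \<open>mm \<chi> blk\<close>.\<close>
  define k where "k = q_indet ^ len n c * (inverse q_indet ^ len n s * inverse q_indet ^ len n s)"
  let ?t = "\<lambda>d. C (q_indet ^ len n d) * (mm \<chi> blk * gw r n d)"
  have trm: "?t (?h e) = C k * (?t e * gw r n c)" if e: "e \<in> Dset f (j - 1)" for e
  proof -
    have dE: "?h e \<in> E" by (rule hE[OF e])
    then have dD: "?h e \<in> blk_incr n blk" by (simp add: E_def Dset_def del: comp_apply)
    have pe: "e permutes {1..n}" using Dset_permutes[OF e] .
    have l1: "len n (c \<circ> e) = len n c + len n e"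
      by (rule len_blk_comp[OF convex_xblk Dset_stab[OF e] cD])
    have eq: "?h e \<circ> s = c \<circ> e"
      by (simp add: fun_eq_iff s_def cyc_icyc)
    have l3: "len n (?h e \<circ> s) = len n (?h e) + len n s"
      by (rule len_blk_comp[OF conv sW dD])
    then have l2: "len n (c \<circ> e) = len n (?h e) + len n s"
      unfolding eq .
    have "gw r n e * gw r n c = gw r n s * gw r n (?h e)"
      using gw_comp[OF pe pc l1] gw_comp[OF ps blk_incr_permutes[OF dD] l3] unfolding eq by (rule trans[OF sym])
    then have "mm \<chi> blk * gw r n e * gw r n c = mm \<chi> blk * gw r n s * gw r n (?h e)"
      by (simp only: mult.assoc)
    also have "\<dots> = C (q_indet ^ len n s) * (mm \<chi> blk * gw r n (?h e))"
      by (simp only: mm_gw_stab[OF conv comp sW]) (simp only: mult.assoc)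
    finally have g: "mm \<chi> blk * gw r n e * gw r n c = C (q_indet ^ len n s) * (mm \<chi> blk * gw r n (?h e))" .
    have q1: "inverse q_indet ^ i * q_indet ^ i = 1" for i
      by (simp add: power_mult_distrib[symmetric])
    have q2: "q_indet ^ i * inverse q_indet ^ i = 1" for i
      by (simp add: power_mult_distrib[symmetric])
    have "k * q_indet ^ len n e * q_indet ^ len n s
      = (inverse q_indet ^ len n s * q_indet ^ len n s) * (q_indet ^ (len n c + len n e) * inverse q_indet ^ len n s)"
      by (simp only: k_def power_add ac_simps)
    also have "len n c + len n e = len n (?h e) + len n s"
      using l1 l2 by (rule trans[OF sym])
    also have "(inverse q_indet ^ len n s * q_indet ^ len n s) * (q_indet ^ (len n (?h e) + len n s) * inverse q_indet ^ len n s)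
        = q_indet ^ len n (?h e) * (inverse q_indet ^ len n s * q_indet ^ len n s)"
      by (simp only: q1 q2 power_add mult.assoc mult_1_left)
    also have "\<dots> = q_indet ^ len n (?h e)"
      by (simp only: q1 mult_1_right)
    finally have k: "k * q_indet ^ len n e * q_indet ^ len n s = q_indet ^ len n (?h e)" .
    have "C k * (?t e * gw r n c) = C (k * q_indet ^ len n e) * (mm \<chi> blk * gw r n e * gw r n c)"
      by (simp only: mult.assoc C_assoc)
    also have "\<dots> = ?t (?h e)"
      unfolding g C_assoc k ..
    finally show ?thesis ..
  qed
  have "R f j = R (Suc f) j + sum ?t E"
    unfolding R_def split(1) using split(2) by (intro sum.union_disjoint) (auto simp: E_def)
  also have "sum ?t E = (\<Sum>e\<in>Dset f (j - 1). C k * (?t e * gw r n c))"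
    unfolding sum.reindex_bij_betw[OF bij, of ?t, symmetric] by (intro sum.cong refl trm)
  also have "\<dots> = C k * (R f (j - 1) * gw r n c)"
    unfolding R_def sum_distrib_left sum_distrib_right ..
  finally have "R (Suc f) j = R f j - C k * (R f (j - 1) * gw r n c)"
    by simp
  moreover have "k \<in> scalars r"
    unfolding k_def by (intro coeffs_closed coeffs_power coeffs_gens)
  ultimately show thesis
    using that gw_YY[OF pc] by blast
qed

text \<open>The recursion lowers \<open>f\<close> by one and \<open>j\<close> by at most one, so
  \<open>f < j\<close> persists until \<open>f = 0\<close>.\<close>

lemma garnir_R: "f < j \<Longrightarrow> j \<le> b \<Longrightarrow> R f j \<in> J"
proof (induction f arbitrary: j)
  case 0
  then show ?case by (intro garnir_base) auto
next
  case (Suc f)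
  obtain k y where ky: "k \<in> scalars r" "y \<in> YY" "R (Suc f) j = R f j - C k * (R f (j - 1) * y)"
    using garnir_step[OF Suc.prems] .
  have "R f j \<in> J" "R f (j - 1) \<in> J"
    using Suc by auto
  moreover have "R (Suc f) j = R f j + C (- k) * (R f (j - 1) * y)"
    unfolding ky(3) by (simp add: C_simps(6)[symmetric])
  moreover have "- k \<in> scalars r"
    using ky(1) by blast
  ultimately show ?case
    using J_add J_scale J_right ky(2) by metis
qed

text \<open>The violation makes \<open>z\<close>, the part of \<open>d\<close> inside the chunk, the
  longest shuffle. Solving the Garnir relation for its term leaves shorter shuffles and an element
  of \<open>J\<close>; multiplication by \<open>g_y\<close> then gives the claim for
  \<open>d = y \<circ> z\<close>.\<close>

lemma straighten:
  assumes d: "d \<in> blk_incr n blk" and j: "1 \<le> j" "j \<le> b" and viol: "d (off + a + j) < d (off + j)"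
  shows "mm \<chi> blk * gw r n d \<in> rspan r ({mm \<chi> blk * gw r n d' | d'. d' \<in> blk_incr n blk \<and> len n d' < len n d} \<union> J)"
proof -
  \<comment> \<open>With this \<open>f\<close> the chunk runs from the upper box of column
    \<open>j\<close> to the end of its row and on to the lower box of that column.\<close>
  define f where "f = j - 1"
  have fj: "f < j" using j by (simp add: f_def)
  have pd: "d permutes {1..n}" using blk_incr_permutes[OF d] .
  obtain z y where z: "z \<in> blk_stab n (xblk f j)" and y: "y \<in> blk_incr n (xblk f j)" and dyz: "d = y \<circ> z"
    using blk_factorization[OF convex_xblk pd] .
  have pz: "z permutes {1..n}" and py: "y permutes {1..n}"
    using blk_stab_permutes[OF z] blk_incr_permutes[OF y] .
  have ch: "chunk f j p \<longleftrightarrow> off + j \<le> p \<and> p \<le> off + a + j" for p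
    using j by (auto simp: chunk_def f_def)
  have zfix: "z p = p" if "\<not> chunk f j p" for p
    using stab_fix[OF z that] .
  have zch: "chunk f j (z p)" if "chunk f j p" for p
    using fix_chunk(1)[OF pz zfix that] .
  have chn: "1 \<le> p \<and> p \<le> n" if "chunk f j p" for p
    using that j le_n by (simp add: ch)
  have zd: "z p < z p'" if "chunk f j p" "chunk f j p'" "d p < d p'" for p p'
  proof (rule ccontr)
    assume "\<not> z p < z p'"
    then have "z p' < z p"
      using permutes_neq[OF pz, of p p'] that(3) by fastforce
    then have "y (z p') < y (z p)"
      using zch[OF that(1)] zch[OF that(2)] chn by (intro blk_incrD[OF y]) (simp_all add: xblk_def)
    then show False using that(3) by (simp add: dyz)
  qed
  have different: "u x < u w" if "u \<in> blk_stab n (xblk f j)" "\<not> (chunk f j x \<and> chunk f j w)" "1 \<le> x" "x < w" "w \<le> n" for u x w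
    using that by (intro blk_stab_less[OF convex_xblk that(1)]) (auto simp: xblk_def)
  have zD: "z \<in> Dset f j"
    unfolding Dset_def blk_incr_def
  proof (intro CollectI conjI allI impI pz)
    fix x w assume h: "1 \<le> x \<and> x < w \<and> w \<le> n \<and> blk x = blk w"
    show "z x < z w"
    proof (cases "chunk f j x \<and> chunk f j w")
      case True
      then show ?thesis using zd[of x w] blk_incrD[OF d, of x w] h by blast
    next
      case False
      then show ?thesis using different[OF z] h by blast
    qed
  next
    fix p assume "\<not> chunk f j p"
    then show "z p = p" by (rule zfix)
  qed
  have r1: "blk p = \<alpha>" if "off + j \<le> p" "p \<le> off + a" for p
    using row1[of p] that j le_n by simp
  have r2: "blk p = \<beta>" if "off + a < p" "p \<le> off + a + j" for p
    using row2[of p] that j le_n by simp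
  \<comment> \<open>The violation says that the smallest upper entry of the chunk exceeds the
    largest lower one. So \<open>z\<close> inverts all pairs across the rows, and a shuffle has no
    other inversions.\<close>
  have cross: "inversions n u \<subseteq> inversions n z" if u: "u \<in> Dset f j" for u
  proof
    fix x assume "x \<in> inversions n u"
    then obtain p p' where x: "x = (p, p')" and p: "1 \<le> p" "p < p'" "p' \<le> n" "u p' < u p"
      by (auto simp: inversions_def)
    have c: "chunk f j p" "chunk f j p'"
      using different[OF Dset_stab[OF u], of p p'] p by force+
    have ne: "blk p \<noteq> blk p'"
    proof
      assume "blk p = blk p'"
      then have "u p < u p'" using u p by (intro blk_incrD[of u n blk]) (simp_all add: Dset_def)
      then show False using p by simp
    qed
    have s: "off + j \<le> p" "p \<le> off + a" "off + a < p'" "p' \<le> off + a + j"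
      using c ne p r1[of p] r1[of p'] r2[of p] r2[of p'] by (auto simp: ch not_le) (metis not_le order_trans less_imp_le)+
    have "d (off + j) \<le> d p"
      using blk_incrD[OF d, of "off + j" p] s j le_n r1[of p] r1[of "off + j"] by (cases "off + j = p") auto
    moreover have "d p' \<le> d (off + a + j)"
      using blk_incrD[OF d, of p' "off + a + j"] s j le_n r2[of p'] r2[of "off + a + j"] by (cases "p' = off + a + j") auto
    ultimately have "d p' < d p" using viol by linarith
    then show "x \<in> inversions n z"
      using zd[OF c(2,1)] p x by (simp add: inversions_def)
  qed
  have small: "len n u < len n z" if "u \<in> Dset f j" "u \<noteq> z" for u
  proof -
    have "inversions n u \<noteq> inversions n z"
      using inversions_inj[OF Dset_permutes[OF that(1)] pz] that(2) by blast
    then show ?thesis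
      unfolding len_def using cross[OF that(1)] by (intro psubset_card_mono) auto
  qed
  let ?t = "\<lambda>d. C (q_indet ^ len n d) * (mm \<chi> blk * gw r n d)"
  let ?S = "{mm \<chi> blk * gw r n d' | d'. d' \<in> blk_incr n blk \<and> len n d' < len n d}"
  have ld: "len n d = len n y + len n z"
    unfolding dyz by (rule len_blk_comp[OF convex_xblk z y])
  have gd: "gw r n d = gw r n z * gw r n y"
    using gw_comp[OF pz py] ld unfolding dyz by simp
  have Rz: "R f j = ?t z + sum ?t (Dset f j - {z})"
    unfolding R_def using zD by (intro sum.remove) simp_all
  have q1: "inverse q_indet ^ len n z * q_indet ^ len n z = 1"
    by (simp add: power_mult_distrib[symmetric])
  have "C (inverse q_indet ^ len n z) * ?t z = mm \<chi> blk * gw r n z"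
    unfolding C_assoc q1 by (simp add: C_simps)
  then have mz: "mm \<chi> blk * gw r n z = C (inverse q_indet ^ len n z) * (R f j - sum ?t (Dset f j - {z}))"
    unfolding Rz by simp
  have "mm \<chi> blk * gw r n d = C (inverse q_indet ^ len n z) * (R f j * gw r n y - (\<Sum>u\<in>Dset f j - {z}. ?t u * gw r n y))"
    unfolding gd mult.assoc[symmetric] mz by (simp only: mult.assoc left_diff_distrib sum_distrib_right)
  moreover have "R f j * gw r n y \<in> rspan r (?S \<union> J)"
    using J_right[OF garnir_R[OF fj j(2)] gw_YY[OF py]] by (intro rspan_base) blast
  moreover have "(\<Sum>u\<in>Dset f j - {z}. ?t u * gw r n y) \<in> rspan r (?S \<union> J)"
  proof (rule rspan_sum)
    fix u assume u: "u \<in> Dset f j - {z}"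
    have pu: "u permutes {1..n}" using u Dset_permutes by blast
    have "opU r n \<chi> * gw r n u \<in> SB (len n u)"
      using chi pu unfolding SB_def by blast
    from SB_gw[OF rspan_base[OF this] py]
    have "opU r n \<chi> * gw r n u * gw r n y \<in> rspan r (SB (len n u + len n y))" .
    from mm_SB[OF conv comp chi this]
    have "mm \<chi> blk * (opU r n \<chi> * gw r n u * gw r n y)
      \<in> rspan r {mm \<chi> blk * gw r n d' | d'. d' \<in> blk_incr n blk \<and> len n d' \<le> len n u + len n y}" .
    moreover have "mm \<chi> blk * (opU r n \<chi> * gw r n u * gw r n y) = mm \<chi> blk * gw r n u * gw r n y"
      by (simp only: mult.assoc[symmetric] mm_opU[OF comp chi])
    ultimately have "mm \<chi> blk * gw r n u * gw r n y
      \<in> rspan r {mm \<chi> blk * gw r n d' | d'. d' \<in> blk_incr n blk \<and> len n d' \<le> len n u + len n y}" by simp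
    then have "mm \<chi> blk * gw r n u * gw r n y \<in> rspan r (?S \<union> J)"
    proof (rule rspan_mono)
      \<comment> \<open>\<open>g_u g_y\<close> need not be a single basis element, but the length
        filtration bounds everything that occurs in it.\<close>
      have "len n u + len n y < len n d"
        using small[of u] u ld by simp
      then show "{mm \<chi> blk * gw r n d' | d'. d' \<in> blk_incr n blk \<and> len n d' \<le> len n u + len n y} \<subseteq> ?S \<union> J"
        by (blast intro: le_less_trans)
    qed
    then show "?t u * gw r n y \<in> rspan r (?S \<union> J)"
      unfolding mult.assoc by (intro rspan_scale coeffs_power coeffs_gens)
  qed
  ultimately show ?thesis
    by (simp only:) (intro rspan_scale rspan_diff coeffs_power coeffs_gens)
qed

end

section \<open>Dominance and initial tableaux\<close>

lemma dominates_refl [simp]: "dominates \<mu> \<mu>"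
  by (simp add: dominates_def)

lemma dominates_trans: "dominates \<mu> \<nu> \<Longrightarrow> dominates \<nu> \<kappa> \<Longrightarrow> dominates \<mu> \<kappa>"
  unfolding dominates_def by (meson order_trans)

lemma dominates_iff: "dominates \<mu> \<nu> \<longleftrightarrow> (\<forall>i. sum_list (take i \<nu>) \<le> sum_list (take i \<mu>))"
  unfolding dominates_def
proof (intro iffI allI)
  fix i assume *: "\<forall>i\<ge>1. sum_list (take i \<nu>) \<le> sum_list (take i \<mu>)"
  show "sum_list (take i \<nu>) \<le> sum_list (take i \<mu>)"
    using * by (cases i) auto
qed simp

text \<open>Entries are differences of consecutive partial sums. As partitions have no zero parts,
  equal entries also give equal numbers of parts.\<close>

lemma dominates_antisym:
  assumes "is_partition \<mu>" "is_partition \<nu>" "dominates \<mu> \<nu>" "dominates \<nu> \<mu>"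
  shows "\<mu> = \<nu>"
proof -
  have eq: "sum_list (take i \<mu>) = sum_list (take i \<nu>)" for i
    using assms(3,4) unfolding dominates_iff by (simp add: order_antisym)
  have ent: "(if i < length \<mu> then \<mu> ! i else 0) = (if i < length \<nu> then \<nu> ! i else 0)" for i
    using eq[of i] eq[of "Suc i"] by (auto simp: take_Suc_conv_app_nth split: if_splits)
  have pos: "\<mu> ! i \<noteq> 0" if "i < length \<mu>" for i
    using assms(1) that unfolding is_partition_def by (metis nth_mem)
  have pos': "\<nu> ! i \<noteq> 0" if "i < length \<nu>" for i
    using assms(2) that unfolding is_partition_def by (metis nth_mem)
  have "i < length \<mu> \<longleftrightarrow> i < length \<nu>" for i
    using ent[of i] pos[of i] pos'[of i] by (auto split: if_splits)
  then have "length \<mu> = length \<nu>"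
    by (metis less_irrefl nat_neq_iff)
  then show ?thesis
  proof (rule nth_equalityI)
    fix i assume "i < length \<mu>"
    then show "\<mu> ! i = \<nu> ! i"
      using ent[of i] \<open>length \<mu> = length \<nu>\<close> by simp
  qed
qed

lemma multidominates_trans: "multidominates l m \<Longrightarrow> multidominates m k \<Longrightarrow> multidominates l k"
  unfolding multidominates_def list_all2_conv_all_nth using dominates_trans by metis

lemma multidominates_partial_order:
  "partial_order_on (multipartitions r n) {(l, m). l \<in> multipartitions r n \<and> m \<in> multipartitions r n \<and> multidominates m l}"
  unfolding partial_order_on_def preorder_on_def
proof (intro conjI)
  show "refl_on (multipartitions r n) {(l, m). l \<in> multipartitions r n \<and> m \<in> multipartitions r n \<and> multidominates m l}"
    by (auto simp: refl_on_def multidominates_def list_all2_refl)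
  show "{(l, m). l \<in> multipartitions r n \<and> m \<in> multipartitions r n \<and> multidominates m l} \<subseteq> multipartitions r n \<times> multipartitions r n"
    by auto
  show "trans {(l, m). l \<in> multipartitions r n \<and> m \<in> multipartitions r n \<and> multidominates m l}"
    unfolding trans_def using multidominates_trans by blast
  show "antisym {(l, m). l \<in> multipartitions r n \<and> m \<in> multipartitions r n \<and> multidominates m l}"
  proof (rule antisymI, clarify)
    fix l m assume lm: "l \<in> multipartitions r n" "m \<in> multipartitions r n" "multidominates m l" "multidominates l m"
    then show "l = m"
      unfolding multidominates_def multipartitions_def
      by (rule_tac nth_equalityI) (auto simp: list_all2_conv_all_nth intro!: dominates_antisym)
  qed
qed

lemma multidominates_antisym:
  "l \<in> multipartitions r n \<Longrightarrow> m \<in> multipartitions r n \<Longrightarrow> multidominates l m \<Longrightarrow> multidominates m l \<Longrightarrow> l = m"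
  using multidominates_partial_order[of r n] unfolding partial_order_on_def antisym_def by blast

lemma finite_multipartitions: "finite (multipartitions r n)"
proof -
  let ?A = "{c. set c \<subseteq> {..n} \<and> length c \<le> n}"
  have fin: "finite ?A"
    by (rule finite_lists_length_le) simp
  have len: "length c \<le> sum_list c" if "0 \<notin> set c" for c :: "nat list"
    using that
  proof (induction c)
    case (Cons a c)
    then have "length c \<le> sum_list c" "1 \<le> a" by auto
    then show ?case by simp
  qed simp
  have "multipartitions r n \<subseteq> {l. set l \<subseteq> ?A \<and> length l \<le> r}"
  proof
    fix l assume l: "l \<in> multipartitions r n"
    have "c \<in> ?A" if c: "c \<in> set l" for c
    proof -
      have "sum_list c \<in> set (map sum_list l)"
        using c by simp
      then have "sum_list c \<le> n"
        using l member_le_sum_list[of "sum_list c" "map sum_list l"]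
        by (auto simp: multipartitions_def multicompositions_def)
      moreover have "0 \<notin> set c"
        using l c by (auto simp: multipartitions_def is_partition_def)
      moreover have "x \<le> sum_list c" if "x \<in> set c" for x
        using that by (intro member_le_sum_list) auto
      ultimately show ?thesis using len[of c] by force
    qed
    then show "l \<in> {l. set l \<subseteq> ?A \<and> length l \<le> r}"
      using l by (auto simp: multipartitions_def multicompositions_def)
  qed
  then show ?thesis
    using finite_lists_length_le[OF fin, of r] finite_subset by blast
qed

section \<open>Sorting compositions into partitions\<close>

definition sort_desc :: "nat list \<Rightarrow> nat list" where
  "sort_desc c = rev (sort (filter (\<lambda>x. x \<noteq> 0) c))"

lemma sort_desc_partition: "is_partition (sort_desc c)"
proof -
  have "sorted_wrt (\<ge>) (rev (sort (filter (\<lambda>x. x \<noteq> 0) c)))"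
    by (simp add: sorted_wrt_rev)
  then show ?thesis
    by (simp add: is_partition_def sort_desc_def)
qed

lemma sum_list_filter_pos: "sum_list (filter (\<lambda>x. x \<noteq> 0) c) = sum_list (c :: nat list)"
  by (induction c) auto

lemma sum_list_sort_desc [simp]: "sum_list (sort_desc c) = sum_list c"
  by (metis mset_rev mset_sort sort_desc_def sum_list_filter_pos sum_mset_sum_list)

text \<open>The first entry of \<open>c\<close> is removed from both lists. In \<open>s\<close> it
  stood after larger entries, so putting it in front cannot raise a partial sum of
  \<open>s\<close>.\<close>

lemma sum_take_le_sorted:
  fixes s :: "nat list"
  assumes "sorted_wrt (\<ge>) s" "mset s = mset c"
  shows "sum_list (take m c) \<le> sum_list (take m s)"
  using assms
proof (induction c arbitrary: s m)
  case (Cons x c)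
  then have "x \<in> set s" by (metis list.set_intros(1) mset_eq_setD)
  then obtain u v where s: "s = u @ x # v" by (meson split_list)
  have srt: "sorted_wrt (\<ge>) (u @ v)" and ge: "\<forall>y\<in>set u. y \<ge> x" "\<forall>y\<in>set v. y \<le> x"
    using Cons.prems(1) unfolding s by (auto simp: sorted_wrt_append)
  have IH: "sum_list (take m c) \<le> sum_list (take m (u @ v))" for m
    using Cons.IH[OF srt] Cons.prems(2) s by simp
  show ?case
  proof (cases m)
    case (Suc m')
    have "x + sum_list (take m' (u @ v)) \<le> sum_list (take m s)"
    proof (cases "m' < length u")
      case True
      have "take (Suc m') u = take m' u @ [u ! m']" using True by (rule take_Suc_conv_app_nth)
      moreover have "x \<le> u ! m'" using ge(1) True by simp
      ultimately show ?thesis using True by (simp add: s Suc)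
    next
      case False
      then show ?thesis by (simp add: s Suc Suc_diff_le)
    qed
    then show ?thesis using IH[of m'] Suc by simp
  qed simp
qed simp

lemma sum_take_filter: "sum_list (take m c) \<le> sum_list (take m (filter (\<lambda>x. x \<noteq> 0) (c :: nat list)))"
proof (induction c arbitrary: m)
  case (Cons a c)
  show ?case
  proof (cases m)
    case (Suc m')
    have "sum_list (take m' (filter (\<lambda>x. x \<noteq> 0) c)) \<le> sum_list (take m (filter (\<lambda>x. x \<noteq> 0) c))"
    proof -
      have "take m (filter (\<lambda>x. x \<noteq> 0) c) = take m' (filter (\<lambda>x. x \<noteq> 0) c) @ take 1 (drop m' (filter (\<lambda>x. x \<noteq> 0) c))"
        by (simp add: Suc take_add[symmetric])
      then show ?thesis by simp
    qed
    then show ?thesis using Cons[of m'] Cons[of m] Suc by (cases "a = 0") auto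
  qed simp
qed simp

lemma sort_desc_dominates: "dominates (sort_desc c) c"
  unfolding dominates_iff
proof
  fix i
  have "sum_list (take i (filter (\<lambda>x. x \<noteq> 0) c)) \<le> sum_list (take i (sort_desc c))"
    using sort_desc_partition[of c] unfolding is_partition_def
    by (intro sum_take_le_sorted) (simp_all add: sort_desc_def)
  then show "sum_list (take i c) \<le> sum_list (take i (sort_desc c))"
    using sum_take_filter[of i c] by linarith
qed

lemma sort_desc_bij:
  obtains f where "inj_on f {..<length c}" "\<And>i. i < length c \<Longrightarrow> c ! i \<noteq> 0 \<Longrightarrow> f i < length (sort_desc c)"
    "\<And>i. i < length c \<Longrightarrow> c ! i \<noteq> 0 \<Longrightarrow> sort_desc c ! f i = c ! i"
    "\<And>i'. i' < length (sort_desc c) \<Longrightarrow> \<exists>i<length c. f i = i' \<and> c ! i \<noteq> 0"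
proof -
  let ?z = "filter (\<lambda>x. x = 0) c"
  \<comment> \<open>\<open>sort_desc\<close> drops zero parts; appending them gives a rearrangement
    of \<open>c\<close>.\<close>
  let ?s = "sort_desc c @ ?z"
  have "mset c = mset ?s"
  proof -
    have "mset ?s = mset (filter (\<lambda>x. x \<noteq> 0) c) + mset ?z"
      by (simp add: sort_desc_def)
    also have "\<dots> = mset c"
      using multiset_partition[of "mset c" "\<lambda>x. x \<noteq> 0"] by simp
    finally show ?thesis ..
  qed
  then obtain f where f: "bij_betw f {..<length c} {..<length ?s}" "\<forall>i<length c. c ! i = ?s ! (f i)"
    using permutation_Ex_bij[of c ?s] by auto
  have lt: "f i < length (sort_desc c)" if i: "i < length c" "c ! i \<noteq> 0" for i
  proof (rule ccontr)
    assume "\<not> f i < length (sort_desc c)"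
    moreover have "f i < length ?s" using f(1) i(1) by (auto simp: bij_betw_def)
    ultimately have "f i - length (sort_desc c) < length ?z" "?s ! f i = ?z ! (f i - length (sort_desc c))"
      by (auto simp: nth_append)
    then have "?s ! f i \<in> set ?z"
      using nth_mem by metis
    then have "?s ! f i = 0" by simp
    then show False using f(2) i by auto
  qed
  have eq: "sort_desc c ! f i = c ! i" if i: "i < length c" "c ! i \<noteq> 0" for i
    using f(2) lt[OF i] i by (simp add: nth_append)
  have "\<exists>i<length c. f i = i' \<and> c ! i \<noteq> 0" if i': "i' < length (sort_desc c)" for i'
  proof -
    have "i' \<in> f ` {..<length c}" using f(1) i' by (auto simp: bij_betw_def)
    then obtain i where i: "i < length c" "f i = i'" by auto
    have "sort_desc c ! i' \<in> set (sort_desc c)" using i' by simp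
    then have "sort_desc c ! i' \<noteq> 0" by (auto simp: sort_desc_def)
    then have "c ! i \<noteq> 0" using f(2) i i' by (simp add: nth_append)
    then show ?thesis using i by blast
  qed
  then show thesis
    using that[of f] f(1) lt eq by (auto simp: bij_betw_def)
qed

section \<open>The rows of the initial tableau as intervals\<close>

definition offset :: "nat list list \<Rightarrow> nat \<Rightarrow> nat \<Rightarrow> nat" where
  "offset L k i = sum_list (map sum_list (take k L)) + sum_list (take i (L ! k))"

lemma diagram_iff: "(k, i, j) \<in> diagram L \<longleftrightarrow> k < length L \<and> i < length (L ! k) \<and> j < L ! k ! i"
  by (simp add: diagram_def)

lemma initial_tableau_eq: "(k, i, j) \<in> diagram L \<Longrightarrow> initial_tableau L (k, i, j) = offset L k i + Suc j"
  by (simp add: initial_tableau_def offset_def)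

lemma sum_take_mono: "i \<le> i' \<Longrightarrow> sum_list (take i (c :: nat list)) \<le> sum_list (take i' c)"
  by (metis le_add1 le_add_diff_inverse sum_list_append take_add)

lemma offset_Suc: "i < length (L ! k) \<Longrightarrow> offset L k (Suc i) = offset L k i + L ! k ! i"
  by (simp add: offset_def take_Suc_conv_app_nth)

lemma offset_mono: "i \<le> i' \<Longrightarrow> offset L k i \<le> offset L k i'"
  by (simp add: offset_def sum_take_mono)

lemma offset_comp: "k < length L \<Longrightarrow> k < k' \<Longrightarrow> offset L k i \<le> offset L k' i'"
proof -
  assume k: "k < length L" "k < k'"
  have "sum_list (take i (L ! k)) \<le> sum_list (L ! k)"
    using sum_take_mono[of i "max i (length (L ! k))" "L ! k"] by simp
  then have "offset L k i \<le> sum_list (map sum_list (take (Suc k) L))"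
    using k(1) by (simp add: offset_def take_Suc_conv_app_nth)
  also have "\<dots> \<le> sum_list (map sum_list (take k' L))"
    using sum_take_mono[of "Suc k" k' "map sum_list L"] k(2) by (simp add: take_map)
  finally show ?thesis by (simp add: offset_def)
qed

lemma initial_tableau_less:
  assumes "(k, i, j) \<in> diagram L" "(k', i', j') \<in> diagram L"
    and "k < k' \<or> k = k' \<and> i < i' \<or> k = k' \<and> i = i' \<and> j < j'"
  shows "initial_tableau L (k, i, j) < initial_tableau L (k', i', j')"
proof -
  have d: "k < length L" "i < length (L ! k)" "j < L ! k ! i" using assms(1) by (auto simp: diagram_iff)
  have 1: "offset L k i + Suc j \<le> offset L k (Suc i)" using d by (simp add: offset_Suc)
  show ?thesis
    unfolding initial_tableau_eq[OF assms(1)] initial_tableau_eq[OF assms(2)]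
    using assms(3)
  proof (elim disjE conjE)
    assume "k < k'"
    then show "offset L k i + Suc j < offset L k' i' + Suc j'"
      using offset_comp[OF d(1), of k' "Suc i" i'] 1 by linarith
  next
    assume "k = k'" "i < i'"
    then show "offset L k i + Suc j < offset L k' i' + Suc j'"
      using offset_mono[of "Suc i" i' L k] 1 by simp
  qed simp
qed

lemma diagram_Sigma: "diagram L = (SIGMA k:{..<length L}. SIGMA i:{..<length (L ! k)}. {..<L ! k ! i})"
  by (auto simp: diagram_def)

lemma finite_diagram [simp]: "finite (diagram L)"
  by (simp add: diagram_Sigma)

lemma card_diagram: "card (diagram L) = size_of L"
proof -
  have "card (diagram L) = (\<Sum>k<length L. \<Sum>i<length (L ! k). L ! k ! i)"
    unfolding diagram_Sigma by (simp add: card_SigmaI)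
  also have "\<dots> = (\<Sum>k<length L. sum_list (L ! k))"
    by (simp add: sum_list_sum_nth atLeast0LessThan)
  also have "\<dots> = size_of L"
    by (simp add: size_of_def sum_list_sum_nth atLeast0LessThan)
  finally show ?thesis .
qed

lemma initial_tableau_bij: "bij_betw (initial_tableau L) (diagram L) {1..size_of L}"
proof -
  have inj: "inj_on (initial_tableau L) (diagram L)"
  proof (rule inj_onI)
    fix x y assume xy: "x \<in> diagram L" "y \<in> diagram L" "initial_tableau L x = initial_tableau L y"
    obtain k i j k' i' j' where e: "x = (k, i, j)" "y = (k', i', j')"
      by (cases x; cases y)
    have "\<not> (k < k' \<or> k = k' \<and> i < i' \<or> k = k' \<and> i = i' \<and> j < j')"
        "\<not> (k' < k \<or> k' = k \<and> i' < i \<or> k' = k \<and> i' = i \<and> j' < j)"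
      using initial_tableau_less[of k i j L k' i' j'] initial_tableau_less[of k' i' j' L k i j] xy
      unfolding e by force+
    then have "k = k' \<and> i = i' \<and> j = j'" by (meson linorder_neqE_nat)
    then show "x = y" by (simp add: e)
  qed
  have "initial_tableau L ` diagram L \<subseteq> {1..size_of L}"
  proof clarify
    fix k i j assume d: "(k, i, j) \<in> diagram L"
    have "offset L k i + Suc j \<le> offset L k (Suc i)" using d by (simp add: offset_Suc diagram_iff)
    also have "\<dots> \<le> offset L (length L) 0"
      using d by (intro offset_comp) (simp_all add: diagram_iff)
    also have "\<dots> = size_of L" by (simp add: offset_def size_of_def)
    finally show "initial_tableau L (k, i, j) \<in> {1..size_of L}"
      by (simp add: initial_tableau_eq[OF d])
  qed
  then have "initial_tableau L ` diagram L = {1..size_of L}"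
    by (intro card_subset_eq) (simp_all add: card_image[OF inj] card_diagram)
  with inj show ?thesis by (simp add: bij_betw_def)
qed

definition box_of :: "nat list list \<Rightarrow> nat \<Rightarrow> box" where
  "box_of L = inv_into (diagram L) (initial_tableau L)"

text \<open>The labelling of positions that belongs to a shape. Its first coordinate is the
  component, from which the character \<open>chi_of\<close> is read off.\<close>

definition row_of :: "nat list list \<Rightarrow> nat \<Rightarrow> nat \<times> nat" where
  "row_of L p = (fst (box_of L p), fst (snd (box_of L p)))"

lemma box_of_initial [simp]: "x \<in> diagram L \<Longrightarrow> box_of L (initial_tableau L x) = x"
  unfolding box_of_def by (rule inv_into_f_f[OF bij_betw_imp_inj_on[OF initial_tableau_bij]])

lemma initial_range: "x \<in> diagram L \<Longrightarrow> initial_tableau L x \<in> {1..size_of L}"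
  using initial_tableau_bij[of L] bij_betwE by blast

lemma position_cases:
  assumes "p \<in> {1..size_of L}"
  obtains k i j where "(k, i, j) \<in> diagram L" "p = initial_tableau L (k, i, j)"
  using assms initial_tableau_bij[of L] unfolding bij_betw_def by (metis imageE prod_cases3)

lemma row_of_initial [simp]: "(k, i, j) \<in> diagram L \<Longrightarrow> row_of L (initial_tableau L (k, i, j)) = (k, i)"
  by (simp add: row_of_def)

lemma convex_row_of: "convex_blk (size_of L) (row_of L)"
  unfolding convex_blk_def
proof (intro allI impI, elim conjE)
  fix a b c assume h: "1 \<le> a" "a < b" "b < c" "c \<le> size_of L" "row_of L a = row_of L c"
  have "a \<in> {1..size_of L}" "b \<in> {1..size_of L}" "c \<in> {1..size_of L}" using h by auto
  then obtain k i j k' i' j' k'' i'' j'' where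
    d: "(k, i, j) \<in> diagram L" "(k', i', j') \<in> diagram L" "(k'', i'', j'') \<in> diagram L"
    and p: "a = initial_tableau L (k, i, j)" "b = initial_tableau L (k', i', j')" "c = initial_tableau L (k'', i'', j'')"
    by (metis position_cases)
  have eq: "k'' = k" "i'' = i" using h(5) d by (simp_all add: p)
  have "\<not> (k' < k \<or> k' = k \<and> i' < i)" "\<not> (k < k' \<or> k = k' \<and> i < i')"
    using initial_tableau_less[OF d(2,1)] initial_tableau_less[OF d(3,2)] h(2,3) unfolding p eq
    by (metis less_asym)+
  then have "k' = k" "i' = i" by auto
  then show "row_of L b = row_of L a" using d by (simp add: p)
qed

lemma row_of_iff:
  assumes p: "p \<in> {1..size_of L}" and ki: "k < length L" "i < length (L ! k)"
  shows "row_of L p = (k, i) \<longleftrightarrow> offset L k i + 1 \<le> p \<and> p \<le> offset L k i + L ! k ! i"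
proof
  assume row: "row_of L p = (k, i)"
  obtain k' i' j where d: "(k', i', j) \<in> diagram L" "p = initial_tableau L (k', i', j)"
    using position_cases[OF p] .
  then have "k' = k" "i' = i" using row by simp_all
  then show "offset L k i + 1 \<le> p \<and> p \<le> offset L k i + L ! k ! i"
    using d by (simp add: initial_tableau_eq) (simp add: diagram_iff)
next
  assume h: "offset L k i + 1 \<le> p \<and> p \<le> offset L k i + L ! k ! i"
  let ?j = "p - offset L k i - 1"
  have d: "(k, i, ?j) \<in> diagram L" using h ki by (auto simp: diagram_iff)
  have "p = initial_tableau L (k, i, ?j)" using h unfolding initial_tableau_eq[OF d] by simp
  then show "row_of L p = (k, i)" using row_of_initial[OF d] by simp
qed

lemma row_of_valid:
  assumes "p \<in> {1..size_of L}" "row_of L p = (k, i)"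
  shows "k < length L" "i < length (L ! k)"
proof -
  obtain k' i' j where d: "(k', i', j) \<in> diagram L" "p = initial_tableau L (k', i', j)"
    using position_cases[OF assms(1)] .
  then show "k < length L" "i < length (L ! k)" using assms(2) by (auto simp: diagram_iff)
qed

section \<open>Tableaux and permutations\<close>

lemma d_perm_props:
  assumes t: "t \<in> multitableaux L"
  shows "d_perm L t permutes {1..size_of L}" "\<And>x. x \<in> diagram L \<Longrightarrow> d_perm L t (initial_tableau L x) = t x"
    "t = tableau_act L (initial_tableau L) (d_perm L t)"
proof -
  let ?N = "{1..size_of L}" and ?p = "initial_tableau L"
  have tb: "bij_betw t (diagram L) ?N" and te: "t \<in> extensional (diagram L)"
    using t by (auto simp: multitableaux_def)
  define w where "w = (\<lambda>p. if p \<in> ?N then t (box_of L p) else p)"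
  have "bij_betw (box_of L) ?N (diagram L)"
    unfolding box_of_def by (rule bij_betw_inv_into[OF initial_tableau_bij])
  then have "bij_betw (t \<circ> box_of L) ?N ?N"
    by (rule bij_betw_trans[OF _ tb])
  then have "bij_betw w ?N ?N"
    by (rule bij_betw_cong[THEN iffD1, rotated]) (simp add: w_def del: atLeastAtMost_iff)
  then have wp: "w permutes ?N"
    by (rule bij_imp_permutes) (simp add: w_def del: atLeastAtMost_iff)
  have wx: "w (?p x) = t x" if "x \<in> diagram L" for x
    using that initial_range[OF that] by (simp add: w_def del: atLeastAtMost_iff)
  have act: "t = tableau_act L ?p w"
    unfolding tableau_act_def using te wx by (auto simp: extensional_def restrict_def fun_eq_iff)
  have "d_perm L t = w"
    unfolding d_perm_def
  proof (rule the_equality)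
    show "w permutes ?N \<and> t = tableau_act L ?p w" using wp act by simp
    fix v assume v: "v permutes ?N \<and> t = tableau_act L ?p v"
    show "v = w"
    proof
      fix p show "v p = w p"
      proof (cases "p \<in> ?N")
        case True
        then obtain k i j where d: "(k, i, j) \<in> diagram L" "p = ?p (k, i, j)" by (rule position_cases)
        have "t (k, i, j) = v p"
          using d v by (simp add: tableau_act_def)
        then show ?thesis using wx[OF d(1)] d(2) by simp
      next
        case False
        then show ?thesis using v wp permutes_not_in by metis
      qed
    qed
  qed
  then show "d_perm L t permutes ?N" "\<And>x. x \<in> diagram L \<Longrightarrow> d_perm L t (?p x) = t x" "t = tableau_act L ?p (d_perm L t)"
    using wp wx act by simp_all
qed

lemma tableau_act_props:
  assumes d: "d permutes {1..size_of L}"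
  shows "tableau_act L (initial_tableau L) d \<in> multitableaux L" (is "?t \<in> _") "d_perm L (tableau_act L (initial_tableau L) d) = d"
proof -
  have "bij_betw (d \<circ> initial_tableau L) (diagram L) {1..size_of L}"
    by (rule bij_betw_trans[OF initial_tableau_bij permutes_imp_bij[OF d]])
  then have "bij_betw ?t (diagram L) {1..size_of L}"
    by (rule bij_betw_cong[THEN iffD1, rotated]) (simp add: tableau_act_def)
  then show t: "?t \<in> multitableaux L"
    by (simp add: multitableaux_def tableau_act_def)
  show "d_perm L ?t = d"
  proof
    fix p show "d_perm L ?t p = d p"
    proof (cases "p \<in> {1..size_of L}")
      case True
      then obtain k i j where x: "(k, i, j) \<in> diagram L" "p = initial_tableau L (k, i, j)" by (rule position_cases)
      then show ?thesis using d_perm_props(2)[OF t x(1)] by (simp add: tableau_act_def)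
    next
      case False
      then show ?thesis using d d_perm_props(1)[OF t] permutes_not_in by metis
    qed
  qed
qed

text \<open>The bridge between tableaux and distinguished representatives: entries along a row of
  the tableau are the values of \<open>d_perm\<close> on an interval of positions.\<close>

lemma row_standard_iff:
  assumes t: "t \<in> multitableaux L"
  shows "t \<in> row_standard L \<longleftrightarrow> d_perm L t \<in> blk_incr (size_of L) (row_of L)"
proof
  assume rs: "t \<in> row_standard L"
  show "d_perm L t \<in> blk_incr (size_of L) (row_of L)"
    unfolding blk_incr_def
  proof (intro CollectI conjI allI impI d_perm_props(1)[OF t], elim conjE)
    fix a b assume h: "1 \<le> a" "a < b" "b \<le> size_of L" "row_of L a = row_of L b"
    have "a \<in> {1..size_of L}" "b \<in> {1..size_of L}" using h by auto
    then obtain k i j k' i' j' where d: "(k, i, j) \<in> diagram L" "(k', i', j') \<in> diagram L"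
      and p: "a = initial_tableau L (k, i, j)" "b = initial_tableau L (k', i', j')"
      by (metis position_cases)
    have eq: "k' = k" "i' = i" using h(4) d by (simp_all add: p)
    have "j < j'"
      using h(2) d unfolding p eq by (simp add: initial_tableau_eq)
    then have "t (k, i, j) < t (k', i', j')"
      using rs d unfolding eq row_standard_def by blast
    then show "d_perm L t a < d_perm L t b"
      using d_perm_props(2)[OF t d(1)] d_perm_props(2)[OF t d(2)] by (simp add: p)
  qed
next
  assume b: "d_perm L t \<in> blk_incr (size_of L) (row_of L)"
  show "t \<in> row_standard L"
    unfolding row_standard_def
  proof (intro CollectI conjI allI impI t, elim conjE)
    fix k i j j' assume d: "(k, i, j) \<in> diagram L" "(k, i, j') \<in> diagram L" "j < j'"
    have "d_perm L t (initial_tableau L (k, i, j)) < d_perm L t (initial_tableau L (k, i, j'))"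
      using initial_range[OF d(1)] initial_range[OF d(2)] d initial_tableau_less[OF d(1,2)]
      by (intro blk_incrD[OF b]) simp_all
    then show "t (k, i, j) < t (k, i, j')"
      using d_perm_props(2)[OF t d(1)] d_perm_props(2)[OF t d(2)] by simp
  qed
qed

text \<open>The columns of a partition have no gaps, so an order violation in a column already
  occurs between vertical neighbours.\<close>

lemma nonstandard_violation:
  assumes part: "\<forall>\<mu>\<in>set L. is_partition \<mu>" and t: "t \<in> row_standard L" "t \<notin> Std L"
  obtains k i j where "(k, i, j) \<in> diagram L" "(k, Suc i, j) \<in> diagram L" "t (k, Suc i, j) < t (k, i, j)"
proof (rule ccontr)
  assume nt: "\<not> thesis"
  note rule = that
  have no: "\<not> t (k, Suc i, j) < t (k, i, j)" if "(k, i, j) \<in> diagram L" "(k, Suc i, j) \<in> diagram L" for k i j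
    using rule[OF that] nt by blast
  have inj: "inj_on t (diagram L)"
    using t(1) by (auto simp: row_standard_def multitableaux_def bij_betw_def)
  have down: "(k, i, j) \<in> diagram L" if "(k, i', j) \<in> diagram L" "i \<le> i'" for k i i' j
  proof -
    have s: "sorted_wrt (\<ge>) (L ! k)" using part that by (auto simp: is_partition_def diagram_iff)
    have "L ! k ! i' \<le> L ! k ! i"
      using sorted_wrt_nth_less[OF s, of i i'] that by (cases "i = i'") (auto simp: diagram_iff)
    then show ?thesis using that by (auto simp: diagram_iff)
  qed
  have step: "t (k, i, j) < t (k, Suc i, j)" if "(k, Suc i, j) \<in> diagram L" for k i j
  proof -
    have d: "(k, i, j) \<in> diagram L" using down[OF that] by simp
    have "t (k, i, j) \<noteq> t (k, Suc i, j)" using inj_onD[OF inj _ d that] by auto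
    then show ?thesis using no[OF d that] by linarith
  qed
  have "t (k, i, j) < t (k, i', j)" if "i < i'" "(k, i', j) \<in> diagram L" for k i i' j
    using that
  proof (induction i')
    case (Suc i')
    show ?case
    proof (cases "i = i'")
      case True
      then show ?thesis using step Suc.prems by simp
    next
      case False
      then have "t (k, i, j) < t (k, i', j)" using Suc.IH down[OF Suc.prems(2), of i'] Suc.prems(1) by simp
      then show ?thesis using step[OF Suc.prems(2)] by simp
    qed
  qed simp
  then have "t \<in> Std L"
    using t(1) unfolding Std_def by blast
  then show False using t(2) by simp
qed

lemma finite_Std [simp]: "finite (Std L)"
proof (rule finite_subset)
  show "Std L \<subseteq> (diagram L \<rightarrow>\<^sub>E {1..size_of L})"
    by (auto simp: Std_def row_standard_def multitableaux_def PiE_def bij_betw_def)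
qed (intro finite_PiE; simp)

section \<open>Spanning by standard tableaux\<close>

lemma size_of_multi: "L \<in> multicompositions r n \<Longrightarrow> size_of L = n"
  by (simp add: multicompositions_def size_of_def)

context yokonuma
begin

lemma xs_cong:
  assumes "\<And>p p'. p \<in> {1..n} \<Longrightarrow> p' \<in> {1..n} \<Longrightarrow> blk1 p = blk1 p' \<longleftrightarrow> blk2 p = blk2 p'"
  shows "xs blk1 = xs blk2"
proof -
  have "blk_stab n blk1 = blk_stab n blk2"
    unfolding blk_stab_def
  proof (rule Collect_cong, rule conj_cong[OF refl], rule ball_cong[OF refl])
    fix w p assume "w permutes {1..n}" "p \<in> {1..n}"
    then show "blk1 (w p) = blk1 p \<longleftrightarrow> blk2 (w p) = blk2 p"
      using assms[of "w p" p] permutes_in_image[of w "{1..n}" p] by blast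
  qed
  then show ?thesis by (simp add: xs_def)
qed

text \<open>The component with index \<open>k\<close> goes with \<open>u_ik\<close> for the second
  index \<open>k + 1\<close>, hence with the colour \<open>k + 1\<close> modulo \<open>r\<close>;
  the last component has colour 0.\<close>

definition chi_of :: "nat list list \<Rightarrow> nat \<Rightarrow> nat" where
  "chi_of L = restrict (\<lambda>p. Suc (fst (row_of L p)) mod r) {1..n}"

definition M :: "nat list list \<Rightarrow> oper" where
  "M L = mm (chi_of L) (row_of L)"

lemma chi_of_char [simp]: "chi_of L \<in> characters r n"
  using r1 by (auto simp: chi_of_def characters_def)

lemma chi_of_compat: "compat n (chi_of L) (row_of L)"
  by (auto simp: compat_def chi_of_def)

lemma chi_of_eq: "p \<in> {1..n} \<Longrightarrow> chi_of L p = Suc (fst (row_of L p)) mod r"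
  by (simp add: chi_of_def)

lemma convex_row: "L \<in> multicompositions r n \<Longrightarrow> convex_blk n (row_of L)"
  using convex_row_of[of L] by (simp add: size_of_multi)

lemma M_YY [simp, intro]: "M L \<in> YY"
  unfolding M_def by (intro mm_YY chi_of_char)

lemma st_M: "st (M L) = M L"
  unfolding M_def by (intro st_mm chi_of_compat chi_of_char)

definition two_sided :: "oper \<Rightarrow> oper set" where
  "two_sided m = {x * m * y | x y. x \<in> YY \<and> y \<in> YY}"

text \<open>\<open>two_sided\<close> is only a set of products; the span makes this the two-sided
  ideal, over the coefficient ring, of the strictly dominating shapes.\<close>

definition Jset :: "nat list list \<Rightarrow> oper set" where
  "Jset L = rspan r (\<Union>\<mu>\<in>{\<mu> \<in> multipartitions r n. multidominates \<mu> L \<and> \<mu> \<noteq> L}. two_sided (M \<mu>))"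

lemma rspan_YY: "x \<in> rspan r S \<Longrightarrow> (\<And>s. s \<in> S \<Longrightarrow> s \<in> YY) \<Longrightarrow> x \<in> YY"
  by (induction rule: rspan.induct) (blast intro: YY_closed)+

lemma two_sided_YY: "v \<in> two_sided (M \<mu>) \<Longrightarrow> v \<in> YY"
  unfolding two_sided_def by (auto intro: YY_closed)

lemma Jset_YY: "v \<in> Jset L \<Longrightarrow> v \<in> YY"
  unfolding Jset_def by (erule rspan_YY) (use two_sided_YY in blast)

lemma Jset_left: "x \<in> Jset L \<Longrightarrow> y \<in> YY \<Longrightarrow> y * x \<in> Jset L"
  unfolding Jset_def
proof (erule rspan_mult_left)
  fix s assume y: "y \<in> YY" and "s \<in> (\<Union>\<mu>\<in>{\<mu> \<in> multipartitions r n. multidominates \<mu> L \<and> \<mu> \<noteq> L}. two_sided (M \<mu>))"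
  then obtain \<mu> a b where \<mu>: "\<mu> \<in> multipartitions r n" "multidominates \<mu> L" "\<mu> \<noteq> L" "a \<in> YY" "b \<in> YY" "s = a * M \<mu> * b"
    unfolding two_sided_def by blast
  then have "y * s = (y * a) * M \<mu> * b" by (simp only: mult.assoc)
  then have "y * s \<in> two_sided (M \<mu>)"
    unfolding two_sided_def using \<mu> YY_closed(5)[OF y \<mu>(4)] by blast
  then show "y * s \<in> rspan r (\<Union>\<mu>\<in>{\<mu> \<in> multipartitions r n. multidominates \<mu> L \<and> \<mu> \<noteq> L}. two_sided (M \<mu>))"
    using \<mu> by (intro rspan_base) blast
qed

lemma Jset_right: "x \<in> Jset L \<Longrightarrow> y \<in> YY \<Longrightarrow> x * y \<in> Jset L"
  unfolding Jset_def
proof (erule rspan_mult_right)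
  fix s assume y: "y \<in> YY" and "s \<in> (\<Union>\<mu>\<in>{\<mu> \<in> multipartitions r n. multidominates \<mu> L \<and> \<mu> \<noteq> L}. two_sided (M \<mu>))"
  then obtain \<mu> a b where \<mu>: "\<mu> \<in> multipartitions r n" "multidominates \<mu> L" "\<mu> \<noteq> L" "a \<in> YY" "b \<in> YY" "s = a * M \<mu> * b"
    unfolding two_sided_def by blast
  then have "s * y = a * M \<mu> * (b * y)" by (simp only: mult.assoc)
  then have "s * y \<in> two_sided (M \<mu>)"
    unfolding two_sided_def using \<mu> YY_closed(5)[OF \<mu>(5) y] by blast
  then show "s * y \<in> rspan r (\<Union>\<mu>\<in>{\<mu> \<in> multipartitions r n. multidominates \<mu> L \<and> \<mu> \<noteq> L}. two_sided (M \<mu>))"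
    using \<mu> by (intro rspan_base) blast
qed

text \<open>Matching the nonempty rows of \<open>A\<close> with rows of \<open>B\<close> of the same
  length and component gives a permutation \<open>w\<close> of the positions that increases on rows
  in both directions. Then \<open>M A * g_w = g_w * M B\<close>, and \<open>g_w\<close> is
  invertible.\<close>

lemma M_rows_conj:
  assumes A: "A \<in> multicompositions r n" and B: "B \<in> multicompositions r n"
    and \<sigma>: "\<And>k i. k < r \<Longrightarrow> i < length (A ! k) \<Longrightarrow> A ! k ! i \<noteq> 0 \<Longrightarrow> \<sigma> k i < length (B ! k) \<and> B ! k ! \<sigma> k i = A ! k ! i"
    and inj: "\<And>k. k < r \<Longrightarrow> inj_on (\<sigma> k) {..<length (A ! k)}"
  shows "M A \<in> two_sided (M B)"
proof -
  let ?pA = "initial_tableau A" and ?pB = "initial_tableau B"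
  have sA: "size_of A = n" "length A = r" and sB: "size_of B = n" "length B = r"
    using A B size_of_multi by (auto simp: multicompositions_def)
  \<comment> \<open>A box changes its row by \<open>\<sigma>\<close> and keeps component and
    column.\<close>
  define \<beta> where "\<beta> = (\<lambda>(k, i, j). (k, \<sigma> k i, j :: nat))"
  have \<beta>d: "\<beta> (k, i, j) \<in> diagram B" if "(k, i, j) \<in> diagram A" for k i j
    using that \<sigma>[of k i] sA sB by (auto simp: \<beta>_def diagram_iff)
  define w where "w = (\<lambda>p. if p \<in> {1..n} then ?pB (\<beta> (box_of A p)) else p)"
  have wp: "w (?pA (k, i, j)) = ?pB (k, \<sigma> k i, j)" if "(k, i, j) \<in> diagram A" for k i j
    using that initial_range[OF that] by (simp add: w_def sA \<beta>_def del: atLeastAtMost_iff)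
  have pos: "\<exists>k i j. (k, i, j) \<in> diagram A \<and> p = ?pA (k, i, j)" if "p \<in> {1..n}" for p
    using position_cases[of p A] that unfolding sA by metis
  have \<sigma>inj: "i = i'" if "(k, i, j) \<in> diagram A" "(k, i', j') \<in> diagram A" "\<sigma> k i = \<sigma> k i'" for k i i' j j'
    using that inj[of k] sA by (auto simp: diagram_iff dest: inj_onD)
  have w_in: "w p \<in> {1..n}" if hp: "p \<in> {1..n}" for p
  proof -
    obtain k i j where d: "(k, i, j) \<in> diagram A" "p = ?pA (k, i, j)" using pos[OF hp] by blast
    show ?thesis
      using initial_range[OF \<beta>d[OF d(1)]] wp[OF d(1)] unfolding sB d(2) by (simp add: \<beta>_def)
  qed
  have w_inj: "inj_on w {1..n}"
  proof (rule inj_onI)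
    fix p p' assume h: "p \<in> {1..n}" "p' \<in> {1..n}" "w p = w p'"
    obtain k i j k' i' j' where d: "(k, i, j) \<in> diagram A" "p = ?pA (k, i, j)"
      "(k', i', j') \<in> diagram A" "p' = ?pA (k', i', j')"
      using pos[OF h(1)] pos[OF h(2)] by blast
    have "?pB (\<beta> (k, i, j)) = ?pB (\<beta> (k', i', j'))"
      using h(3) wp d by (simp add: \<beta>_def)
    then have "\<beta> (k, i, j) = \<beta> (k', i', j')"
      using inj_onD[OF bij_betw_imp_inj_on[OF initial_tableau_bij]] \<beta>d d by blast
    then show "p = p'" using \<sigma>inj[of k i j i' j'] d by (auto simp: \<beta>_def)
  qed
  have wperm: "w permutes {1..n}"
  proof (rule bij_imp_permutes)
    show "bij_betw w {1..n} {1..n}"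
      using w_in w_inj by (intro bij_betw_imageI endo_inj_surj) auto
  qed (simp add: w_def del: atLeastAtMost_iff)
  have row_w: "row_of B (w (?pA (k, i, j))) = (k, \<sigma> k i)" if "(k, i, j) \<in> diagram A" for k i j
    using \<beta>d[OF that] wp[OF that] by (simp add: \<beta>_def)
  have blk: "row_of A p = row_of A p' \<longleftrightarrow> row_of B (w p) = row_of B (w p')" if h: "p \<in> {1..n}" "p' \<in> {1..n}" for p p'
  proof -
    obtain k i j k' i' j' where d: "(k, i, j) \<in> diagram A" "p = ?pA (k, i, j)"
      "(k', i', j') \<in> diagram A" "p' = ?pA (k', i', j')"
      using pos[OF h(1)] pos[OF h(2)] by blast
    show ?thesis
      unfolding d(2,4) row_w[OF d(1)] row_w[OF d(3)] row_of_initial[OF d(1)] row_of_initial[OF d(3)]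
      using \<sigma>inj[of k i j i' j'] d by auto
  qed
  have incr: "w p < w p' \<longleftrightarrow> p < p'" if h: "p \<in> {1..n}" "p' \<in> {1..n}" "row_of A p = row_of A p'" for p p'
  proof -
    obtain k i j k' i' j' where d: "(k, i, j) \<in> diagram A" "p = ?pA (k, i, j)"
      "(k', i', j') \<in> diagram A" "p' = ?pA (k', i', j')"
      using pos[OF h(1)] pos[OF h(2)] by blast
    have eq: "k' = k" "i' = i" using h(3) d by simp_all
    have B: "(k, \<sigma> k i, j) \<in> diagram B" "(k, \<sigma> k i, j') \<in> diagram B"
      using \<beta>d[OF d(1)] \<beta>d[OF d(3)] unfolding eq by (simp_all add: \<beta>_def)
    have "w p = offset B k (\<sigma> k i) + Suc j" "w p' = offset B k (\<sigma> k i) + Suc j'"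
      using wp[OF d(1)] wp[OF d(3)] initial_tableau_eq[OF B(1)] initial_tableau_eq[OF B(2)]
      by (simp_all only: d(2,4) eq)
    moreover have "p = offset A k i + Suc j" "p' = offset A k i + Suc j'"
      using initial_tableau_eq[OF d(1)] initial_tableau_eq[OF d(3)] by (simp_all only: d(2,4) eq)
    ultimately show ?thesis by simp
  qed
  have w1: "w \<in> blk_incr n (row_of A)"
    using wperm incr by (simp add: blk_incr_def)
  have w2: "pinv w \<in> blk_incr n (row_of B)"
    unfolding blk_incr_def
  proof (intro CollectI conjI allI impI permutes_inv[OF wperm], elim conjE)
    fix a b assume h: "1 \<le> a" "a < b" "b \<le> n" "row_of B a = row_of B b"
    have r: "pinv w a \<in> {1..n}" "pinv w b \<in> {1..n}"
      using permutes_in_image[OF permutes_inv[OF wperm]] h by simp_all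
    have e: "w (pinv w a) = a" "w (pinv w b) = b"
      using permutes_inverses(1)[OF wperm] by simp_all
    have "row_of A (pinv w a) = row_of A (pinv w b)"
      using blk[OF r] h(4) unfolding e by simp
    then show "pinv w a < pinv w b"
      using incr[OF r] h(2) unfolding e by simp
  qed
  have x: "xs (row_of A) * gw r n w = gw r n w * xs (row_of B)"
    by (rule xs_conj[OF convex_row[OF A] convex_row[OF B] w1 w2 blk])
  have "opU r n (chi_of B \<circ> w) = opU r n (chi_of A)"
  proof (rule opU_cong)
    fix p assume p: "p \<in> {1..n}"
    then obtain k i j where d: "(k, i, j) \<in> diagram A" "p = ?pA (k, i, j)" using pos by blast
    show "(chi_of B \<circ> w) p = chi_of A p"
      using w_in[OF p] p row_w[OF d(1)] row_of_initial[OF d(1)] unfolding d(2)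
      by (simp add: chi_of_eq del: atLeastAtMost_iff)
  qed
  then have "gw r n w * opU r n (chi_of B) = opU r n (chi_of A) * gw r n w"
    by (simp add: gw_opU[OF wperm])
  then have MA: "M A * gw r n w = gw r n w * M B"
    unfolding M_def mm_def mult.assoc x by (simp only: mult.assoc[symmetric])
  obtain y where y: "y \<in> YY" "gw r n w * y = 1"
    using gw_invertible[OF wperm] by blast
  have "M A = M A * (gw r n w * y)" by (simp add: y(2))
  also have "\<dots> = gw r n w * M B * y" by (simp only: mult.assoc[symmetric] MA)
  finally show ?thesis
    unfolding two_sided_def using y(1) gw_YY[OF wperm] by blast
qed

text \<open>The Garnir relations produce compositions; this brings them back to multipartitions.
  Sorting only raises partial sums, so dominance is kept.\<close>

lemma M_sorted:
  assumes A: "A \<in> multicompositions r n"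
  shows "M A \<in> two_sided (M (map sort_desc A))" "map sort_desc A \<in> multipartitions r n"
    "multidominates (map sort_desc A) A"
proof -
  have l: "length A = r" using A by (simp add: multicompositions_def)
  have "map sum_list (map sort_desc A) = map sum_list A" by (rule nth_equalityI) simp_all
  then show part: "map sort_desc A \<in> multipartitions r n"
    using A sort_desc_partition unfolding multipartitions_def multicompositions_def by (auto simp del: map_map)
  show "multidominates (map sort_desc A) A"
    by (simp add: multidominates_def list_all2_conv_all_nth sort_desc_dominates)
  have "\<exists>f. inj_on f {..<length c} \<and> (\<forall>i<length c. c ! i \<noteq> 0 \<longrightarrow> f i < length (sort_desc c) \<and> sort_desc c ! f i = c ! i)" for c
    using sort_desc_bij[of c] by metis
  then obtain F where F: "\<And>c. inj_on (F c) {..<length c}"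
    "\<And>c i. i < length c \<Longrightarrow> c ! i \<noteq> 0 \<Longrightarrow> F c i < length (sort_desc c) \<and> sort_desc c ! F c i = c ! i"
    by metis
  show "M A \<in> two_sided (M (map sort_desc A))"
  proof (rule M_rows_conj[OF A, where \<sigma> = "\<lambda>k. F (A ! k)"])
    show "map sort_desc A \<in> multicompositions r n"
      using part by (simp add: multipartitions_def)
  qed (simp_all add: F l)
qed

lemma multipartitions_subset: "L \<in> multipartitions r n \<Longrightarrow> L \<in> multicompositions r n"
  by (simp add: multipartitions_def)

text \<open>The merged labelling is the row labelling of the composition \<open>N\<close> obtained
  by moving \<open>s\<close> boxes from one row to the row above. The components are unchanged, so
  the character is too, and sorting \<open>N\<close> gives a strictly dominating
  multipartition.\<close>

lemma garnir_shape:
  assumes L: "L \<in> multipartitions r n" and ki: "k < r" "Suc i < length (L ! k)" and s: "1 \<le> s" "s \<le> L ! k ! Suc i"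
  shows "mm (chi_of L) (\<lambda>p. if offset L k i + L ! k ! i < p \<and> p \<le> offset L k i + L ! k ! i + s then (k, i) else row_of L p) \<in> Jset L"
proof -
  let ?a = "L ! k ! i" and ?b = "L ! k ! Suc i"
  have Lc: "L \<in> multicompositions r n" using multipartitions_subset[OF L] .
  have lL: "length L = r" and nL: "size_of L = n" using Lc size_of_multi by (auto simp: multicompositions_def)
  define c where "c = (L ! k)[i := ?a + s, Suc i := ?b - s]"
  define N where "N = L[k := c]"
  have lc: "length c = length (L ! k)" by (simp add: c_def)
  have lN: "length N = r" using lL by (simp add: N_def)
  have Nk: "N ! k = c" and Nk': "\<And>k'. k' \<noteq> k \<Longrightarrow> N ! k' = L ! k'"
    using ki lL by (simp_all add: N_def)
  have split: "L ! k = take i (L ! k) @ ?a # ?b # drop (Suc (Suc i)) (L ! k)"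
    using ki by (simp add: Cons_nth_drop_Suc Suc_lessD)
  have c_split: "c = take i (L ! k) @ (?a + s) # (?b - s) # drop (Suc (Suc i)) (L ! k)"
  proof -
    have "length (take i (L ! k)) = i" using ki by simp
    then show ?thesis
      unfolding c_def by (subst split) (simp add: list_update_append)
  qed
  \<comment> \<open>Only the partial sum that ends between the two rows changes.\<close>
  have sums: "sum_list (take m c) = sum_list (take m (L ! k)) + (if m = Suc i then s else 0)" for m
  proof -
    have li: "length (take i (L ! k)) = i" using ki by simp
    consider "m \<le> i" | "m = Suc i" | "Suc (Suc i) \<le> m" by linarith
    then show ?thesis
    proof cases
      case 1
      then show ?thesis by (simp add: c_def)
    next
      case 2
      show ?thesis using li ki unfolding 2 c_split by (subst (2) split) simp
    next
      case 3
      then obtain m' where m': "m = Suc (Suc i) + m'" using le_Suc_ex by blast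
      show ?thesis using li s ki unfolding m' c_split by (subst (2) split) simp
    qed
  qed
  have sum_c: "sum_list c = sum_list (L ! k)"
    using sums[of "length (L ! k)"] lc ki by simp
  have map_sum: "map sum_list N = map sum_list L"
    using sum_c ki lL by (intro nth_equalityI) (auto simp: N_def nth_list_update)
  have Nc: "N \<in> multicompositions r n"
    using Lc lN unfolding multicompositions_def by (simp only: mem_Collect_eq map_sum)
  have nN: "size_of N = n" using size_of_multi[OF Nc] .
  have off: "offset N k' i' = offset L k' i' + (if k' = k \<and> i' = Suc i then s else 0)" for k' i'
  proof -
    have "map sum_list (take k' N) = map sum_list (take k' L)"
      using map_sum by (metis take_map)
    then show ?thesis
      using sums[of i'] Nk Nk'[of k'] by (cases "k' = k"; cases "i' = Suc i") (simp_all add: offset_def)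
  qed
  have offS: "offset L k (Suc i) = offset L k i + ?a"
    using ki by (simp add: offset_Suc)
  have rows: "row_of N p = (if offset L k i + ?a < p \<and> p \<le> offset L k i + ?a + s then (k, i) else row_of L p)"
    if p: "p \<in> {1..n}" for p
  proof -
    obtain k' i' where row: "row_of L p = (k', i')" by (cases "row_of L p")
    have v: "k' < r" "i' < length (L ! k')"
      using row_of_valid[OF _ row] p nL lL by simp_all
    then have range: "offset L k' i' + 1 \<le> p \<and> p \<le> offset L k' i' + L ! k' ! i'"
      using row_of_iff[of p L k' i'] row p nL lL by simp
    have iff: "row_of N p = (k1, i1) \<longleftrightarrow> offset N k1 i1 + 1 \<le> p \<and> p \<le> offset N k1 i1 + N ! k1 ! i1"
      if "k1 < r" "i1 < length (N ! k1)" for k1 i1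
      using row_of_iff[of p N k1 i1] p nN lN that by simp
    show ?thesis
    proof (cases "offset L k i + ?a < p \<and> p \<le> offset L k i + ?a + s")
      case True
      have "row_of N p = (k, i)"
        using True ki lc by (subst iff) (auto simp: Nk off c_def)
      then show ?thesis using True by simp
    next
      case False
      have "row_of N p = (k', i')"
      proof (cases "k' = k")
        case k: True
        consider "i' = i" | "i' = Suc i" | "i' \<noteq> i" "i' \<noteq> Suc i" by blast
        then show ?thesis
        proof cases
          case 1
          then show ?thesis using range v lc ki unfolding k by (subst iff) (auto simp: Nk off c_def)
        next
          case 2
          then show ?thesis using range v lc ki False s offS unfolding k by (subst iff) (auto simp: Nk off c_def)
        next
          case 3
          then show ?thesis using range v lc ki unfolding k by (subst iff) (auto simp: Nk off c_def)
        qed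
      next
        case k: False
        then show ?thesis using range v by (subst iff) (auto simp: Nk' off)
      qed
      then show ?thesis unfolding row if_not_P[OF False] .
    qed
  qed
  have comp_eq: "fst (row_of N p) = fst (row_of L p)" if p: "p \<in> {1..n}" for p
  proof (cases "offset L k i + ?a < p \<and> p \<le> offset L k i + ?a + s")
    case True
    then have "row_of L p = (k, Suc i)"
      using row_of_iff[of p L k "Suc i"] p nL lL ki s offS by simp
    then show ?thesis using rows[OF p] True by simp
  next
    case False
    show ?thesis unfolding rows[OF p] if_not_P[OF False] by (rule refl)
  qed
  have "opU r n (chi_of L) = opU r n (chi_of N)"
    by (rule opU_cong) (simp add: chi_of_eq comp_eq del: atLeastAtMost_iff)
  moreover have "xs (\<lambda>p. if offset L k i + ?a < p \<and> p \<le> offset L k i + ?a + s then (k, i) else row_of L p) = xs (row_of N)"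
    by (rule xs_cong) (simp only: rows)
  ultimately have eq: "mm (chi_of L) (\<lambda>p. if offset L k i + ?a < p \<and> p \<le> offset L k i + ?a + s then (k, i) else row_of L p) = M N"
    unfolding M_def mm_def by (simp only:)
  let ?\<mu> = "map sort_desc N"
  have ND: "multidominates N L"
    unfolding multidominates_def list_all2_conv_all_nth
  proof (intro conjI allI impI)
    show "length N = length L" using lN lL by simp
    fix k' assume "k' < length N"
    then show "dominates (N ! k') (L ! k')"
      using Nk Nk'[of k'] sums by (cases "k' = k") (simp_all add: dominates_def)
  qed
  \<comment> \<open>\<open>N\<close> has a larger partial sum than \<open>L\<close> after row
    \<open>i\<close>, and sorting cannot lower it.\<close>
  have "?\<mu> \<noteq> L"
  proof
    assume "?\<mu> = L"
    then have "L ! k = map sort_desc N ! k" by (rule arg_cong[OF sym])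
    then have "sort_desc c = L ! k" using Nk ki lN by simp
    then have "sum_list (take (Suc i) c) \<le> sum_list (take (Suc i) (L ! k))"
      using sort_desc_dominates[of c] unfolding dominates_iff by simp
    then show False using sums[of "Suc i"] s by simp
  qed
  moreover have "multidominates ?\<mu> L"
    using multidominates_trans[OF M_sorted(3)[OF Nc] ND] .
  ultimately show ?thesis
    unfolding eq Jset_def using M_sorted(1,2)[OF Nc] by (intro rspan_base) blast
qed

abbreviation Mg :: "nat list list \<Rightarrow> (nat \<Rightarrow> nat) \<Rightarrow> oper" where
  "Mg L d \<equiv> M L * gw r n d"

text \<open>Induction on the length of \<open>d\<close>: a violated column is removed by the Garnir
  relation, which leaves shorter permutations modulo the ideal.\<close>

lemma straighten_tableau:
  assumes L: "L \<in> multipartitions r n"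
  shows "d \<in> blk_incr n (row_of L) \<Longrightarrow> Mg L d \<in> rspan r (Mg L ` d_perm L ` Std L \<union> Jset L)"
proof (induction "len n d" arbitrary: d rule: less_induct)
  case less
  have Lc: "L \<in> multicompositions r n" using multipartitions_subset[OF L] .
  have lL: "length L = r" and nL: "size_of L = n" using Lc size_of_multi by (auto simp: multicompositions_def)
  have pd: "d permutes {1..n}" using blk_incr_permutes[OF less.prems] .
  let ?t = "tableau_act L (initial_tableau L) d"
  have t: "?t \<in> multitableaux L" "d_perm L ?t = d"
    using tableau_act_props[of d L] pd nL by simp_all
  have trs: "?t \<in> row_standard L"
    using row_standard_iff[OF t(1)] t(2) less.prems nL by simp
  show ?case
  proof (cases "?t \<in> Std L")
    case True
    then have "Mg L d \<in> Mg L ` d_perm L ` Std L" using t(2) by (metis imageI)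
    then show ?thesis by (intro rspan_base) blast
  next
    case False
    have part: "\<forall>\<mu>\<in>set L. is_partition \<mu>" using L by (simp add: multipartitions_def)
    obtain k i j where v: "(k, i, j) \<in> diagram L" "(k, Suc i, j) \<in> diagram L" "?t (k, Suc i, j) < ?t (k, i, j)"
      using nonstandard_violation[OF part trs False] .
    have ki: "k < r" "Suc i < length (L ! k)" "j < L ! k ! Suc i" using v lL by (auto simp: diagram_iff)
    have srt: "sorted_wrt (\<ge>) (L ! k)" using part ki lL by (auto simp: is_partition_def)
    have offS: "offset L k (Suc i) = offset L k i + L ! k ! i"
      using ki by (simp add: offset_Suc)
    have "offset L k (Suc (Suc i)) \<le> size_of L"
      using offset_comp[of k L "length L" "Suc (Suc i)" 0] ki lL by (simp add: offset_def size_of_def)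
    then have le: "offset L k i + L ! k ! i + L ! k ! Suc i \<le> n"
      using ki by (simp add: offset_Suc nL)
    interpret garnir r n "row_of L" "chi_of L" "offset L k i" "L ! k ! i" "L ! k ! Suc i" "(k, i)" "(k, Suc i)" "Jset L"
    proof
      show "convex_blk n (row_of L)" by (rule convex_row[OF Lc])
      show "compat n (chi_of L) (row_of L)" by (rule chi_of_compat)
      show "L ! k ! Suc i \<le> L ! k ! i" using sorted_wrt_nth_less[OF srt, of i "Suc i"] ki by simp
      show "offset L k i + L ! k ! i + L ! k ! Suc i \<le> n" by (rule le)
      show "x + y \<in> Jset L" if "x \<in> Jset L" "y \<in> Jset L" for x y
        using that unfolding Jset_def by (rule rspan_add)
      fix p assume p: "p \<in> {1..n}"
      show "(row_of L p = (k, i)) = (offset L k i + 1 \<le> p \<and> p \<le> offset L k i + L ! k ! i)"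
        using row_of_iff[of p L k i] p nL lL ki by simp
      show "(row_of L p = (k, Suc i)) = (offset L k i + L ! k ! i + 1 \<le> p \<and> p \<le> offset L k i + L ! k ! i + L ! k ! Suc i)"
        using row_of_iff[of p L k "Suc i"] p nL lL ki offS by simp
    next
      fix s assume "1 \<le> s" "s \<le> L ! k ! Suc i"
      then show "mm (chi_of L) (\<lambda>p. if offset L k i + L ! k ! i < p \<and> p \<le> offset L k i + L ! k ! i + s then (k, i) else row_of L p) \<in> Jset L"
        by (rule garnir_shape[OF L ki(1,2)])
    qed (use Jset_left Jset_right in \<open>auto simp: r1\<close>)
    have "d (initial_tableau L (k, Suc i, j)) < d (initial_tableau L (k, i, j))"
      using v by (simp add: tableau_act_def)
    \<comment> \<open>Columns of boxes are counted from 0, the column index in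
      \<open>straighten\<close> from 1.\<close>
    then have viol: "d (offset L k i + L ! k ! i + Suc j) < d (offset L k i + Suc j)"
      unfolding initial_tableau_eq[OF v(1)] initial_tableau_eq[OF v(2)] offS .
    have "Mg L d \<in> rspan r ({mm (chi_of L) (row_of L) * gw r n d' | d'. d' \<in> blk_incr n (row_of L) \<and> len n d' < len n d} \<union> Jset L)"
      unfolding M_def using ki by (intro straighten[OF less.prems _ _ viol]) auto
    then show ?thesis
    proof (rule rspan_subset)
      fix s assume "s \<in> {mm (chi_of L) (row_of L) * gw r n d' | d'. d' \<in> blk_incr n (row_of L) \<and> len n d' < len n d} \<union> Jset L"
      then consider d' where "s = Mg L d'" "d' \<in> blk_incr n (row_of L)" "len n d' < len n d" | "s \<in> Jset L"
        unfolding M_def by blast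
      then show "s \<in> rspan r (Mg L ` d_perm L ` Std L \<union> Jset L)"
      proof cases
        case 1
        then show ?thesis using less.hyps by simp
      qed (intro rspan_base, blast)
    qed
  qed
qed

lemma M_YY_std:
  assumes L: "L \<in> multipartitions r n" and y: "y \<in> YY"
  shows "M L * y \<in> rspan r (Mg L ` d_perm L ` Std L \<union> Jset L)"
proof -
  have "M L * y \<in> rspan r {M L * gw r n d | d. d \<in> blk_incr n (row_of L)}"
    unfolding M_def by (intro mm_YY_span convex_row chi_of_compat chi_of_char y multipartitions_subset[OF L])
  then show ?thesis
  proof (rule rspan_subset)
    fix s assume "s \<in> {M L * gw r n d | d. d \<in> blk_incr n (row_of L)}"
    then obtain d where "s = Mg L d" "d \<in> blk_incr n (row_of L)" by blast
    then show "s \<in> rspan r (Mg L ` d_perm L ` Std L \<union> Jset L)"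
      using straighten_tableau[OF L] by simp
  qed
qed

text \<open>By \<open>st_gw\<close> the left factor is the image of \<open>g_d(s)\<close> under the
  anti-involution.\<close>

definition Mst :: "nat list list \<Rightarrow> tableau \<Rightarrow> tableau \<Rightarrow> oper" where
  "Mst L s t = gw r n (pinv (d_perm L s)) * M L * gw r n (d_perm L t)"

definition Mspan :: "nat list list set \<Rightarrow> oper set" where
  "Mspan S = rspan r {Mst L s t | L s t. L \<in> S \<and> s \<in> Std L \<and> t \<in> Std L}"

lemma d_perm_permutes:
  assumes "L \<in> multipartitions r n" "t \<in> Std L"
  shows "d_perm L t permutes {1..n}"
  using d_perm_props(1)[of t L] assms size_of_multi[OF multipartitions_subset[OF assms(1)]]
  by (simp add: Std_def row_standard_def)

lemma Mspan_mono: "x \<in> Mspan S \<Longrightarrow> S \<subseteq> T \<Longrightarrow> x \<in> Mspan T"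
  unfolding Mspan_def by (erule rspan_mono) blast

abbreviation above :: "nat list list \<Rightarrow> nat list list set" where
  "above L \<equiv> {\<mu> \<in> multipartitions r n. multidominates \<mu> L}"

text \<open>Induction on the number of shapes above \<open>L\<close>, which drops for every shape
  strictly above, so the ideal \<open>Jset\<close> is covered. Right multiples of \<open>M L\<close>
  are straightened directly, left multiples through the anti-involution, which fixes
  \<open>M L\<close>.\<close>

lemma two_sided_Mspan:
  "L \<in> multipartitions r n \<Longrightarrow> x \<in> two_sided (M L) \<Longrightarrow> x \<in> Mspan (above L)"
proof (induction "card (above L)" arbitrary: L x rule: less_induct)
  case less
  have J: "z \<in> Mspan (above L)" if "z \<in> Jset L" for z
    using that unfolding Jset_def Mspan_def
  proof (rule rspan_subset)
    fix s assume "s \<in> (\<Union>\<mu>\<in>{\<mu> \<in> multipartitions r n. multidominates \<mu> L \<and> \<mu> \<noteq> L}. two_sided (M \<mu>))"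
    then obtain \<mu> where \<mu>: "\<mu> \<in> multipartitions r n" "multidominates \<mu> L" "\<mu> \<noteq> L" "s \<in> two_sided (M \<mu>)"
      by blast
    have "L \<in> above L"
      using less.prems(1) by (simp add: multidominates_def list_all2_refl)
    moreover have "L \<notin> above \<mu>"
      using multidominates_antisym[OF \<mu>(1) less.prems(1) \<mu>(2)] \<mu>(3) by blast
    moreover have "above \<mu> \<subseteq> above L"
      using multidominates_trans[OF _ \<mu>(2)] by blast
    ultimately have sub: "above \<mu> \<subset> above L"
      by blast
    then have "card (above \<mu>) < card (above L)"
      using finite_multipartitions[of r n] by (intro psubset_card_mono) auto
    from less.hyps[OF this \<mu>(1,4)] have "s \<in> Mspan (above \<mu>)" .
    from Mspan_mono[OF this psubset_imp_subset[OF sub]] have "s \<in> Mspan (above L)" .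
    then show "s \<in> rspan r {Mst \<mu> s t |\<mu> s t. \<mu> \<in> above L \<and> s \<in> Std \<mu> \<and> t \<in> Std \<mu>}"
      unfolding Mspan_def .
  qed
  obtain a b where ab: "a \<in> YY" "b \<in> YY" "x = a * M L * b"
    using less.prems(2) unfolding two_sided_def by blast
  have LL: "L \<in> above L" using less.prems(1) by (simp add: multidominates_def list_all2_refl)
  let ?S = "Mg L ` d_perm L ` Std L \<union> Jset L"
  have "a * (M L * b) \<in> Mspan (above L)"
    unfolding Mspan_def
    using M_YY_std[OF less.prems(1) ab(2)]
  proof (rule rspan_mult_left)
    fix s assume "s \<in> ?S"
    then consider t where "t \<in> Std L" "s = Mg L (d_perm L t)" | "s \<in> Jset L" by blast
    then have "a * s \<in> Mspan (above L)"
    proof cases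
      case 1
      let ?g = "gw r n (d_perm L t)"
      have g: "?g \<in> YY" using gw_YY[OF d_perm_permutes[OF less.prems(1) 1(1)]] .
      \<comment> \<open>The left factor becomes a right factor, to which \<open>M_YY_std\<close>
        applies.\<close>
      have "a * M L = st (M L * st a)"
        using ab(1) by (simp add: st_mult st_M)
      moreover have "st (M L * st a) * ?g \<in> Mspan (above L)"
        unfolding Mspan_def
      proof (rule rspan_map[of "M L * st a" r ?S "\<lambda>z. st z * ?g"])
        show "M L * st a \<in> rspan r ?S" by (rule M_YY_std[OF less.prems(1) st_closed[OF ab(1)]])
        fix s' assume "s' \<in> ?S"
        then consider t' where "t' \<in> Std L" "s' = Mg L (d_perm L t')" | "s' \<in> Jset L" by blast
        then have "st s' * ?g \<in> Mspan (above L)"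
        proof cases
          case t': 1
          note p = d_perm_permutes[OF less.prems(1) t'(1)]
          have "st s' * ?g = Mst L t' t"
            unfolding t'(2) Mst_def by (simp only: st_mult[OF M_YY gw_YY[OF p]] st_M st_gw[OF p])
          then show ?thesis
            unfolding Mspan_def using LL t'(1) 1(1) by (intro rspan_base) blast
        next
          case 2
          have "st s' \<in> Jset L"
            using 2 unfolding Jset_def
          proof (rule rspan_map)
            fix u assume "u \<in> (\<Union>\<mu>\<in>{\<mu> \<in> multipartitions r n. multidominates \<mu> L \<and> \<mu> \<noteq> L}. two_sided (M \<mu>))"
            then obtain \<mu> c d where \<mu>: "\<mu> \<in> multipartitions r n" "multidominates \<mu> L" "\<mu> \<noteq> L" "c \<in> YY" "d \<in> YY" "u = c * M \<mu> * d"
              unfolding two_sided_def by blast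
            have "st u = st d * M \<mu> * st c"
              using \<mu> by (simp add: st_mult st_M YY_closed mult.assoc)
            then have "st u \<in> two_sided (M \<mu>)"
              unfolding two_sided_def using \<mu> by blast
            then show "st u \<in> rspan r (\<Union>\<mu>\<in>{\<mu> \<in> multipartitions r n. multidominates \<mu> L \<and> \<mu> \<noteq> L}. two_sided (M \<mu>))"
              using \<mu> by (intro rspan_base) blast
          next
            fix k u z
            assume k: "k \<in> scalars r" and u: "u \<in> (\<Union>\<mu>\<in>{\<mu> \<in> multipartitions r n. multidominates \<mu> L \<and> \<mu> \<noteq> L}. two_sided (M \<mu>))"
              and z: "z \<in> rspan r (\<Union>\<mu>\<in>{\<mu> \<in> multipartitions r n. multidominates \<mu> L \<and> \<mu> \<noteq> L}. two_sided (M \<mu>))"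
            have "z \<in> YY" by (rule rspan_YY[OF z]) (use two_sided_YY in blast)
            moreover have "u \<in> YY" using u two_sided_YY by blast
            ultimately show "st (C k * u + z) = C k * st u + st z"
              using k by (simp add: st_add st_scale YY_closed)
          qed simp
          then show ?thesis using J Jset_right[OF _ g] by blast
        qed
        then show "st s' * ?g \<in> rspan r {Mst \<mu> s t |\<mu> s t. \<mu> \<in> above L \<and> s \<in> Std \<mu> \<and> t \<in> Std \<mu>}"
          unfolding Mspan_def .
      next
        fix k u z assume k: "k \<in> scalars r" and u: "u \<in> ?S" and z: "z \<in> rspan r ?S"
        have sub: "v \<in> YY" if "v \<in> ?S" for v
          using that Jset_YY YY_closed(5)[OF M_YY gw_YY[OF d_perm_permutes[OF less.prems(1)]]] by blast
        have "z \<in> YY" by (rule rspan_YY[OF z sub])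
        then show "st (C k * u + z) * ?g = C k * (st u * ?g) + st z * ?g"
          using k sub[OF u] by (simp add: st_add st_scale YY_closed distrib_right mult.assoc)
      qed simp
      ultimately show ?thesis
        unfolding 1(2) by (simp only: mult.assoc[symmetric])
    next
      case 2
      then show ?thesis using J Jset_left[OF _ ab(1)] by blast
    qed
    then show "a * s \<in> rspan r {Mst \<mu> s t |\<mu> s t. \<mu> \<in> above L \<and> s \<in> Std \<mu> \<and> t \<in> Std \<mu>}"
      unfolding Mspan_def .
  qed
  then show ?case
    unfolding ab(3) by (simp only: mult.assoc)
qed

lemma Jset_Mspan:
  assumes L: "L \<in> multipartitions r n" and x: "x \<in> Jset L"
  shows "x \<in> Mspan (above L - {L})"
  using x unfolding Jset_def Mspan_def
proof (rule rspan_subset)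
  fix s assume "s \<in> (\<Union>\<mu>\<in>{\<mu> \<in> multipartitions r n. multidominates \<mu> L \<and> \<mu> \<noteq> L}. two_sided (M \<mu>))"
  then obtain \<mu> where \<mu>: "\<mu> \<in> multipartitions r n" "multidominates \<mu> L" "\<mu> \<noteq> L" "s \<in> two_sided (M \<mu>)"
    by blast
  have "above \<mu> \<subseteq> above L - {L}"
    using multidominates_trans[OF _ \<mu>(2)] multidominates_antisym[OF \<mu>(1) L \<mu>(2)] \<mu>(3) by auto
  from Mspan_mono[OF two_sided_Mspan[OF \<mu>(1,4)] this]
  show "s \<in> rspan r {Mst \<mu> s t |\<mu> s t. \<mu> \<in> above L - {L} \<and> s \<in> Std \<mu> \<and> t \<in> Std \<mu>}"
    unfolding Mspan_def .
qed

text \<open>The idempotents \<open>opU\<close> come from the multipartitions all of whose components are columns.\<close>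

lemma opU_two_sided:
  assumes \<chi>: "\<chi> \<in> characters r n"
  obtains L where "L \<in> multipartitions r n" "opU r n \<chi> \<in> two_sided (M L)"
proof -
  \<comment> \<open>\<open>A k\<close> collects the positions whose colour is that of component
    \<open>k\<close>; this component becomes a column with \<open>card (A k)\<close> boxes.\<close>
  define A where "A = (\<lambda>k. {p \<in> {1..n}. \<chi> p = Suc k mod r})"
  define L where "L = map (\<lambda>k. replicate (card (A k)) (1 :: nat)) [0..<r]"
  have lL: "length L = r" and Lk: "\<And>k. k < r \<Longrightarrow> L ! k = replicate (card (A k)) 1"
    by (simp_all add: L_def)
  have Suc_inj: "k = k'" if "k < r" "k' < r" "Suc k mod r = Suc k' mod r" for k k'
    using that by (metis Suc_lessI less_SucE mod_less mod_self nat.inject zero_less_Suc gr0_conv_Suc less_not_refl2)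
  have Suc_surj: "\<exists>k<r. c = Suc k mod r" if "c < r" for c
    using that by (cases c) (auto intro: exI[of _ "r - 1"] exI[of _ "c - 1"])
  have union: "(\<Union>k<r. A k) = {1..n}"
  proof -
    have "\<exists>k\<in>{..<r}. \<chi> p = Suc k mod r" if "p \<in> {1..n}" for p
    proof -
      have "\<chi> p < r" using PiE_mem[OF \<chi>[unfolded characters_def] that] by simp
      then show ?thesis using Suc_surj[of "\<chi> p"] by blast
    qed
    then show ?thesis unfolding A_def by blast
  qed
  have disj: "k = k'" if "k < r" "k' < r" "p \<in> A k" "p \<in> A k'" for k k' p
    using that Suc_inj[of k k'] by (simp add: A_def)
  have finA: "finite (A k)" for k by (simp add: A_def)
  have "(\<Sum>k<r. card (A k)) = card (\<Union>k<r. A k)"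
    using finA disj by (intro card_UN_disjoint[symmetric]) blast+
  then have total: "(\<Sum>k<r. card (A k)) = n" by (simp add: union)
  have "sum_list (map sum_list L) = (\<Sum>k<r. card (A k))"
    by (simp add: L_def comp_def sum_list_replicate interv_sum_list_conv_sum_set_nat atLeast0LessThan)
  then have L: "L \<in> multipartitions r n"
    using total by (auto simp: multipartitions_def multicompositions_def L_def is_partition_def sorted_wrt_iff_nth_less)
  have Lc: "L \<in> multicompositions r n" and nL: "size_of L = n"
    using multipartitions_subset[OF L] size_of_multi by auto
  have d0: "j = 0" "k < r" "i < card (A k)" if "(k, i, j) \<in> diagram L" for k i j
    using that lL Lk[of k] by (auto simp: diagram_iff)
  have row_inj: "p = p'" if p: "p \<in> {1..n}" "p' \<in> {1..n}" "row_of L p = row_of L p'" for p p'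
  proof -
    have "p \<in> {1..size_of L}" "p' \<in> {1..size_of L}" using p nL by simp_all
    then obtain k i j k' i' j' where d: "(k, i, j) \<in> diagram L" "p = initial_tableau L (k, i, j)"
      "(k', i', j') \<in> diagram L" "p' = initial_tableau L (k', i', j')"
      by (metis position_cases)
    then show ?thesis using p(3) d0[OF d(1)] d0[OF d(3)] by simp
  qed
  \<comment> \<open>All rows have one box, so the Young subgroup is trivial and \<open>M L\<close>
    is just an idempotent, conjugate to \<open>opU r n \<chi>\<close>.\<close>
  have "blk_stab n (row_of L) = {id}"
  proof (intro equalityI subsetI)
    fix v assume v: "v \<in> blk_stab n (row_of L)"
    have pv: "v permutes {1..n}" using blk_stab_permutes[OF v] .
    have "v p = p" for p
    proof (cases "p \<in> {1..n}")
      case True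
      then have "v p \<in> {1..n}" using permutes_in_image[OF pv] by blast
      then show ?thesis using row_inj[of "v p" p] True v by (simp add: blk_stab_def)
    qed (use permutes_not_in[OF pv] in blast)
    then show "v \<in> {id}" by (simp add: fun_eq_iff)
  qed simp
  then have xs1: "xs (row_of L) = 1"
    unfolding xs_def by (simp del: id_apply) (simp add: C_simps)
  have "\<exists>h. bij_betw h (A k) {..<card (A k)}" for k
    using ex_bij_betw_finite_nat[OF finA[of k]] by (simp add: atLeast0LessThan)
  then obtain h where h: "\<And>k. bij_betw (h k) (A k) {..<card (A k)}" by metis
  have "\<exists>k. k < r \<and> p \<in> A k" if "p \<in> {1..n}" for p
    using that union by blast
  then obtain kk where kk: "\<And>p. p \<in> {1..n} \<Longrightarrow> kk p < r \<and> p \<in> A (kk p)" by metis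
  \<comment> \<open>Sends the positions of each colour bijectively to the column of that
    colour.\<close>
  define w where "w = (\<lambda>p. if p \<in> {1..n} then initial_tableau L (kk p, h (kk p) p, 0) else p)"
  have dp: "(kk p, h (kk p) p, 0) \<in> diagram L" if "p \<in> {1..n}" for p
    using kk[OF that] bij_betwE[OF h[of "kk p"]] Lk[of "kk p"] lL by (auto simp: diagram_iff)
  have wv: "w p = initial_tableau L (kk p, h (kk p) p, 0)" if "p \<in> {1..n}" for p
    using that by (simp add: w_def del: atLeastAtMost_iff)
  have w_in: "w p \<in> {1..n}" if "p \<in> {1..n}" for p
    using initial_range[OF dp[OF that]] wv[OF that] nL by simp
  have w_inj: "inj_on w {1..n}"
  proof (rule inj_onI)
    fix p p' assume p: "p \<in> {1..n}" "p' \<in> {1..n}" "w p = w p'"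
    then have "initial_tableau L (kk p, h (kk p) p, 0) = initial_tableau L (kk p', h (kk p') p', 0)"
      by (simp only: wv)
    from inj_onD[OF bij_betw_imp_inj_on[OF initial_tableau_bij] this dp[OF p(1)] dp[OF p(2)]]
    have "kk p = kk p'" "h (kk p) p = h (kk p) p'" by auto
    then show "p = p'"
      using inj_onD[OF bij_betw_imp_inj_on[OF h[of "kk p"]]] kk[OF p(1)] kk[OF p(2)] by simp
  qed
  have wperm: "w permutes {1..n}"
  proof (rule bij_imp_permutes)
    show "bij_betw w {1..n} {1..n}"
      using w_in w_inj by (intro bij_betw_imageI endo_inj_surj) auto
  qed (simp add: w_def del: atLeastAtMost_iff)
  have "opU r n (chi_of L \<circ> w) = opU r n \<chi>"
  proof (rule opU_cong)
    fix p assume p: "p \<in> {1..n}"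
    have "row_of L (w p) = (kk p, h (kk p) p)"
      unfolding wv[OF p] by (rule row_of_initial[OF dp[OF p]])
    then show "(chi_of L \<circ> w) p = \<chi> p"
      using w_in[OF p] kk[OF p] by (simp add: chi_of_eq A_def del: atLeastAtMost_iff)
  qed
  then have eq: "gw r n w * M L = opU r n \<chi> * gw r n w"
    unfolding M_def mm_def xs1 by (simp add: gw_opU[OF wperm])
  obtain y where y: "y \<in> YY" "gw r n w * y = 1"
    using gw_invertible[OF wperm] by blast
  have "opU r n \<chi> = opU r n \<chi> * (gw r n w * y)" by (simp add: y(2))
  also have "\<dots> = gw r n w * M L * y" by (simp only: mult.assoc[symmetric] eq)
  finally have "opU r n \<chi> \<in> two_sided (M L)"
    unfolding two_sided_def using y(1) gw_YY[OF wperm] by blast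
  with L show thesis by (rule that)
qed

lemma YY_Mspan:
  assumes x: "x \<in> YY"
  shows "x \<in> Mspan (multipartitions r n)"
proof -
  have "x = (\<Sum>\<chi>\<in>characters r n. opU r n \<chi> * x)"
    unfolding sum_distrib_right[symmetric] sum_opU by simp
  moreover have "opU r n \<chi> * x \<in> Mspan (multipartitions r n)" if \<chi>: "\<chi> \<in> characters r n" for \<chi>
  proof -
    obtain L where L: "L \<in> multipartitions r n" "opU r n \<chi> \<in> two_sided (M L)"
      using opU_two_sided[OF \<chi>] .
    then obtain a b where ab: "a \<in> YY" "b \<in> YY" "opU r n \<chi> = a * M L * b"
      unfolding two_sided_def by blast
    then have "opU r n \<chi> * x = a * M L * (b * x)" by (simp only: mult.assoc)
    then have "opU r n \<chi> * x \<in> two_sided (M L)"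
      unfolding two_sided_def using ab YY_closed(5)[OF ab(2) x] by blast
    from Mspan_mono[OF two_sided_Mspan[OF L(1) this]] show ?thesis by blast
  qed
  ultimately show ?thesis
    unfolding Mspan_def by (metis (no_types, lifting) rspan_sum)
qed

lemma st_Mst:
  assumes "L \<in> multipartitions r n" "s \<in> Std L" "t \<in> Std L"
  shows "st (Mst L s t) = Mst L t s"
proof -
  note p = d_perm_permutes[OF assms(1,2)] d_perm_permutes[OF assms(1,3)]
  have "st (Mst L s t) = st (gw r n (d_perm L t)) * (st (M L) * st (gw r n (pinv (d_perm L s))))"
    unfolding Mst_def
    by (simp only: st_mult[OF YY_closed(5)[OF gw_YY[OF permutes_inv[OF p(1)]] M_YY] gw_YY[OF p(2)]]
        st_mult[OF gw_YY[OF permutes_inv[OF p(1)]] M_YY])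
  then show ?thesis
    unfolding Mst_def st_M st_gw[OF p(2)] st_gw[OF permutes_inv[OF p(1)]] permutes_inv_inv[OF p(1)]
    by (simp only: mult.assoc)
qed

end

section \<open>Counting pairs of standard tableaux\<close>

text \<open>
  The shapes of size \<open>n\<close> form the levels of an \<open>r\<close>-differential poset: every shape has \<open>r\<close> more
  addable than removable boxes.
\<close>

definition down :: "box set \<Rightarrow> bool" where
  "down D \<longleftrightarrow> (\<forall>k i j i' j'. (k, i, j) \<in> D \<and> i' \<le> i \<and> j' \<le> j \<longrightarrow> (k, i', j') \<in> D)"

definition addable :: "nat \<Rightarrow> box set \<Rightarrow> box set" where
  "addable r D = {c. c \<notin> D \<and> fst c < r \<and> down (insert c D)}"

definition removable :: "box set \<Rightarrow> box set" where
  "removable D = {c \<in> D. down (D - {c})}"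

text \<open>Multipartitions as finite order ideals of boxes: adding or removing a box becomes
  insertion or deletion in a set, without bookkeeping of lists of parts.\<close>

definition shapes :: "nat \<Rightarrow> nat \<Rightarrow> box set set" where
  "shapes r n = {D. finite D \<and> card D = n \<and> down D \<and> (\<forall>c\<in>D. fst c < r)}"

definition rowlen :: "box set \<Rightarrow> nat \<Rightarrow> nat \<Rightarrow> nat" where
  "rowlen D k i = card {j. (k, i, j) \<in> D}"

lemma downD: "down D \<Longrightarrow> (k, i, j) \<in> D \<Longrightarrow> i' \<le> i \<Longrightarrow> j' \<le> j \<Longrightarrow> (k, i', j') \<in> D"
  unfolding down_def by blast

lemma mem_iff_rowlen:
  assumes "finite D" "down D"
  shows "(k, i, j) \<in> D \<longleftrightarrow> j < rowlen D k i"
proof -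
  let ?R = "{j. (k, i, j) \<in> D}"
  have fin: "finite ?R"
  proof (rule finite_subset)
    show "?R \<subseteq> (snd \<circ> snd) ` D" by force
  qed (use assms in simp)
  show ?thesis
  proof
    assume "(k, i, j) \<in> D"
    then have "{..j} \<subseteq> ?R" using downD[OF assms(2)] by auto
    then have "card {..j} \<le> card ?R" by (rule card_mono[OF fin])
    then show "j < rowlen D k i" by (simp add: rowlen_def)
  next
    assume j: "j < rowlen D k i"
    show "(k, i, j) \<in> D"
    proof (rule ccontr)
      assume n: "(k, i, j) \<notin> D"
      have "?R \<subseteq> {..<j}"
      proof
        fix x assume x: "x \<in> ?R"
        then have "\<not> j \<le> x" using downD[OF assms(2), of k i x i j] n by auto
        then show "x \<in> {..<j}" by simp
      qed
      then have "card ?R \<le> j" using card_mono[of "{..<j}" ?R] by simp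
      then show False using j by (simp add: rowlen_def)
    qed
  qed
qed

lemma rowlen_antimono:
  assumes "finite D" "down D" "i \<le> i'"
  shows "rowlen D k i' \<le> rowlen D k i"
proof (rule ccontr)
  assume "\<not> rowlen D k i' \<le> rowlen D k i"
  then have "(k, i', rowlen D k i) \<in> D" using mem_iff_rowlen[OF assms(1,2)] by simp
  then have "(k, i, rowlen D k i) \<in> D" using downD[OF assms(2)] assms(3) by blast
  then show False using mem_iff_rowlen[OF assms(1,2)] by simp
qed

lemma addable_iff:
  assumes D: "finite D" "down D"
  shows "(k, i, j) \<in> addable r D \<longleftrightarrow> k < r \<and> j = rowlen D k i \<and> (i = 0 \<or> rowlen D k i < rowlen D k (i - 1))"
proof
  note mem = mem_iff_rowlen[OF D]
  assume a: "(k, i, j) \<in> addable r D"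
  then have nd: "(k, i, j) \<notin> D" and k: "k < r" and dn: "down (insert (k, i, j) D)" by (auto simp: addable_def)
  have j: "j = rowlen D k i"
  proof (rule ccontr)
    assume "j \<noteq> rowlen D k i"
    then have "rowlen D k i < j" using nd mem[of k i j] by simp
    then have "(k, i, rowlen D k i) \<in> insert (k, i, j) D" using downD[OF dn, of k i j i "rowlen D k i"] by simp
    then show False using \<open>j \<noteq> _\<close> mem[of k i "rowlen D k i"] by simp
  qed
  have "rowlen D k i < rowlen D k (i - 1)" if "i \<noteq> 0"
  proof -
    have "(k, i - 1, j) \<in> insert (k, i, j) D" using downD[OF dn, of k i j "i - 1" j] by simp
    then show ?thesis using that mem[of k "i - 1" j] j by auto
  qed
  then show "k < r \<and> j = rowlen D k i \<and> (i = 0 \<or> rowlen D k i < rowlen D k (i - 1))" using k j by blast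
next
  note mem = mem_iff_rowlen[OF D]
  assume h: "k < r \<and> j = rowlen D k i \<and> (i = 0 \<or> rowlen D k i < rowlen D k (i - 1))"
  have "down (insert (k, i, j) D)"
    unfolding down_def
  proof (intro allI impI, elim conjE)
    fix k' i1 j1 i2 j2 assume x: "(k', i1, j1) \<in> insert (k, i, j) D" "i2 \<le> i1" "j2 \<le> j1"
    show "(k', i2, j2) \<in> insert (k, i, j) D"
    proof (cases "(k', i1, j1) = (k, i, j)")
      case True
      then have e: "k' = k" "i2 \<le> i" "j2 \<le> j" using x by auto
      consider "i2 = i \<and> j2 = j" | "i2 = i" "j2 < j" | "i2 < i" using e by linarith
      then show ?thesis
      proof cases
        case 2
        then show ?thesis using mem[of k i j2] h e by simp
      next
        case 3
        then have "i \<noteq> 0" "i2 \<le> i - 1" by linarith+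
        then have "rowlen D k i < rowlen D k i2"
          using h rowlen_antimono[OF D, of i2 "i - 1" k] by linarith
        then show ?thesis using mem[of k i2 j2] h e by simp
      qed (simp add: e)
    qed (use x downD[OF D(2)] in blast)
  qed
  then show "(k, i, j) \<in> addable r D"
    using h mem[of k i j] by (simp add: addable_def)
qed

lemma removable_iff:
  assumes D: "finite D" "down D"
  shows "(k, i, j) \<in> removable D \<longleftrightarrow> rowlen D k i = Suc j \<and> rowlen D k (Suc i) < rowlen D k i"
proof
  note mem = mem_iff_rowlen[OF D]
  assume a: "(k, i, j) \<in> removable D"
  then have d: "(k, i, j) \<in> D" and dn: "down (D - {(k, i, j)})" by (auto simp: removable_def)
  have 1: "(k, i, Suc j) \<notin> D"
    using downD[OF dn, of k i "Suc j" i j] by auto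
  have 2: "(k, Suc i, j) \<notin> D"
    using downD[OF dn, of k "Suc i" j i j] by auto
  show "rowlen D k i = Suc j \<and> rowlen D k (Suc i) < rowlen D k i"
    using d 1 2 unfolding mem by simp
next
  note mem = mem_iff_rowlen[OF D]
  assume h: "rowlen D k i = Suc j \<and> rowlen D k (Suc i) < rowlen D k i"
  have "down (D - {(k, i, j)})"
    unfolding down_def
  proof (intro allI impI, elim conjE)
    fix k' i1 j1 i2 j2 assume x: "(k', i1, j1) \<in> D - {(k, i, j)}" "i2 \<le> i1" "j2 \<le> j1"
    have "(k', i2, j2) \<in> D" using x downD[OF D(2)] by blast
    moreover have "(k', i2, j2) \<noteq> (k, i, j)"
    proof
      assume e: "(k', i2, j2) = (k, i, j)"
      have "i1 = i"
      proof (rule ccontr)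
        assume "i1 \<noteq> i"
        then have "(k, Suc i, j) \<in> D" using x e downD[OF D(2), of k i1 j1 "Suc i" j] by simp
        then show False using h unfolding mem by simp
      qed
      then have "(k, i, j1) \<in> D" "j < j1" using x e by (auto simp: le_less)
      then show False using h unfolding mem by simp
    qed
    ultimately show "(k', i2, j2) \<in> D - {(k, i, j)}" by blast
  qed
  then show "(k, i, j) \<in> removable D"
    using h mem[of k i j] by (simp add: removable_def)
qed

lemma finite_removable: "finite D \<Longrightarrow> finite (removable D)"
  by (simp add: removable_def)

text \<open>Each removable box yields the addable box at the end of the next row, and these are all
  the addable boxes outside the first rows. Each of the \<open>r\<close> components has one more, in
  its first row.\<close>

lemma card_addable:
  assumes D: "D \<in> shapes r n"
  shows "finite (addable r D)" "card (addable r D) = card (removable D) + r"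
proof -
  have fd: "finite D" "down D" and k: "\<And>c. c \<in> D \<Longrightarrow> fst c < r" using D by (auto simp: shapes_def)
  let ?f = "\<lambda>k. (k, 0 :: nat, rowlen D k 0)" and ?g = "\<lambda>(k, i, j :: nat). (k, Suc i, rowlen D k (Suc i))"
  have eq: "addable r D = ?f ` {..<r} \<union> ?g ` removable D"
  proof (rule Set.set_eqI, rule iffI)
    fix c assume c: "c \<in> addable r D"
    obtain k i j where e: "c = (k, i, j)" by (cases c)
    have h: "k < r" "j = rowlen D k i" "i = 0 \<or> rowlen D k i < rowlen D k (i - 1)"
      using c addable_iff[OF fd, of k i j r] unfolding e by auto
    show "c \<in> ?f ` {..<r} \<union> ?g ` removable D"
    proof (cases i)
      case 0
      then show ?thesis using h unfolding e by auto
    next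
      case (Suc i')
      then have "(k, i', rowlen D k i' - 1) \<in> removable D"
        using h removable_iff[OF fd, of k i' "rowlen D k i' - 1"] by simp
      from imageI[OF this, of ?g] have "c \<in> ?g ` removable D"
        using h Suc by (simp add: e)
      then show ?thesis by blast
    qed
  next
    fix c assume "c \<in> ?f ` {..<r} \<union> ?g ` removable D"
    then consider k where "k < r" "c = ?f k" | k i j where "(k, i, j) \<in> removable D" "c = (k, Suc i, rowlen D k (Suc i))"
      by auto
    then show "c \<in> addable r D"
    proof cases
      case 1
      then show ?thesis using addable_iff[OF fd, of k 0 "rowlen D k 0" r] by simp
    next
      case 2
      have "k < r" using k[of "(k, i, j)"] 2(1) by (simp add: removable_def)
      then show ?thesis
        using 2 addable_iff[OF fd, of k "Suc i" "rowlen D k (Suc i)" r] removable_iff[OF fd, of k i j] by simp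
    qed
  qed
  have fr: "finite (removable D)" by (rule finite_removable[OF fd(1)])
  then show "finite (addable r D)" unfolding eq by simp
  have inj: "inj_on ?g (removable D)"
  proof (rule inj_onI)
    fix x y assume xy: "x \<in> removable D" "y \<in> removable D" "?g x = ?g y"
    obtain k i j k' i' j' where e: "x = (k, i, j)" "y = (k', i', j')" by (cases x; cases y)
    then show "x = y"
      using xy removable_iff[OF fd, of k i j] removable_iff[OF fd, of k' i' j'] by auto
  qed
  have "card (addable r D) = card (?f ` {..<r}) + card (?g ` removable D)"
    unfolding eq using fr by (intro card_Un_disjoint) auto
  also have "card (?f ` {..<r}) = r" by (subst card_image) (auto intro: inj_onI)
  also have "card (?g ` removable D) = card (removable D)" by (rule card_image[OF inj])
  finally show "card (addable r D) = card (removable D) + r" by simp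
qed

lemma insert_shapes: "D \<in> shapes r n \<Longrightarrow> c \<in> addable r D \<Longrightarrow> insert c D \<in> shapes r (Suc n) \<and> c \<in> removable (insert c D)"
  by (auto simp: shapes_def addable_def removable_def)

lemma remove_shapes: "D \<in> shapes r (Suc n) \<Longrightarrow> c \<in> removable D \<Longrightarrow> D - {c} \<in> shapes r n \<and> c \<in> addable r (D - {c})"
  by (auto simp: shapes_def addable_def removable_def insert_absorb)

lemma shapes_0: "shapes r 0 = {{}}"
  by (auto simp: shapes_def down_def)

text \<open>The number of ways to empty the shape by removing one box at a time.\<close>

fun paths :: "nat \<Rightarrow> box set \<Rightarrow> nat" where
  "paths 0 D = 1"
| "paths (Suc n) D = (\<Sum>c\<in>removable D. paths n (D - {c}))"

text \<open>Adding and removing different boxes commute. The down-set conditions combine because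
  intersections and unions of down-sets are down-sets.\<close>

lemma exchange:
  assumes D: "D \<in> shapes r n" and ne: "c \<noteq> c'"
  shows "c \<in> addable r D \<and> c' \<in> removable (insert c D) \<longleftrightarrow> c' \<in> removable D \<and> c \<in> addable r (D - {c'})"
proof -
  have dn: "down D" using D by (simp add: shapes_def)
  have eq: "insert c D - {c'} = insert c (D - {c'})" using ne by auto
  show ?thesis
  proof
    assume h: "c \<in> addable r D \<and> c' \<in> removable (insert c D)"
    then have c: "c \<notin> D" "fst c < r" "c' \<in> D" "down (insert c (D - {c'}))"
      using ne unfolding eq[symmetric] by (auto simp: addable_def removable_def)
    have "down (D - {c'})"
      unfolding down_def
    proof (intro allI impI, elim conjE)
      fix k i j i' j' assume x: "(k, i, j) \<in> D - {c'}" "i' \<le> i" "j' \<le> j"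
      have "(k, i', j') \<in> insert c (D - {c'})" using downD[OF c(4)] x by blast
      moreover have "(k, i', j') \<in> D" using downD[OF dn] x by blast
      ultimately show "(k, i', j') \<in> D - {c'}" using c(1) by auto
    qed
    then show "c' \<in> removable D \<and> c \<in> addable r (D - {c'})"
      using c by (simp add: addable_def removable_def)
  next
    assume h: "c' \<in> removable D \<and> c \<in> addable r (D - {c'})"
    then have c: "c' \<in> D" "c \<notin> D" "fst c < r" "down (insert c (D - {c'}))" "down (D - {c'})"
      using ne by (auto simp: addable_def removable_def)
    have "down (insert c D)"
      unfolding down_def
    proof (intro allI impI, elim conjE)
      fix k i j i' j' assume x: "(k, i, j) \<in> insert c D" "i' \<le> i" "j' \<le> j"
      then show "(k, i', j') \<in> insert c D"
        using downD[OF c(4), of k i j i' j'] downD[OF dn, of k i j i' j'] by auto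
    qed
    then show "c \<in> addable r D \<and> c' \<in> removable (insert c D)"
      using c eq by (simp add: addable_def removable_def)
  qed
qed

text \<open>The relation \<open>DU - UD = r\<close> of differential posets applied to path counts.
  Adding \<open>c\<close> and then removing \<open>c'\<close> splits into \<open>c' = c\<close>,
  which contributes one term for each addable box, and \<open>c' \<noteq> c\<close>, where the order
  of the two moves can be exchanged and induction applies. The difference of \<open>r\<close>
  between addable and removable boxes gives the new summand.\<close>

lemma sum_paths_addable:
  "D \<in> shapes r n \<Longrightarrow> (\<Sum>c\<in>addable r D. paths (Suc n) (insert c D)) = r * Suc n * paths n D"
proof (induction n arbitrary: D)
  case 0
  then have D: "D = {}" by (simp add: shapes_0)
  have "paths (Suc 0) (insert c D) = 1" if "c \<in> addable r D" for c
  proof -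
    have "removable (insert c D) = {c}" unfolding D by (auto simp: removable_def down_def)
    then show ?thesis by simp
  qed
  then have "(\<Sum>c\<in>addable r D. paths (Suc 0) (insert c D)) = card (addable r D)" by simp
  also have "\<dots> = r" using card_addable(2)[OF 0] by (simp add: D removable_def)
  finally show ?case by simp
next
  case (Suc n)
  let ?n = "Suc n" and ?A = "addable r D" and ?R = "removable D"
  have fd: "finite D" using Suc.prems by (simp add: shapes_def)
  note fin = card_addable(1)[OF Suc.prems] finite_removable[OF fd]
  have fR: "finite (removable (insert c D))" for c by (rule finite_removable) (use fd in simp)
  have fA: "finite (addable r (D - {c'}))" if "c' \<in> ?R" for c'
    using card_addable(1) remove_shapes[OF Suc.prems that] by blast
  have up: "c \<in> removable (insert c D)" "insert c D - {c} = D" if "c \<in> ?A" for c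
    using insert_shapes[OF Suc.prems that] that by (auto simp: addable_def)
  have "(\<Sum>c\<in>?A. paths (Suc ?n) (insert c D)) = (\<Sum>c\<in>?A. \<Sum>c'\<in>removable (insert c D). paths ?n (insert c D - {c'}))"
    by (subst paths.simps) (rule refl)
  \<comment> \<open>Here the return to \<open>D\<close> itself, the case \<open>c' = c\<close>, is
    split off.\<close>
  also have "\<dots> = (\<Sum>c\<in>?A. paths ?n D + (\<Sum>c'\<in>removable (insert c D) - {c}. paths ?n (insert c D - {c'})))"
  proof (rule sum.cong[OF refl])
    fix c assume c: "c \<in> ?A"
    show "(\<Sum>c'\<in>removable (insert c D). paths ?n (insert c D - {c'}))
        = paths ?n D + (\<Sum>c'\<in>removable (insert c D) - {c}. paths ?n (insert c D - {c'}))"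
      by (subst sum.remove[OF fR up(1)[OF c]], subst up(2)[OF c]) (rule refl)
  qed
  also have "\<dots> = card ?A * paths ?n D + (\<Sum>c\<in>?A. \<Sum>c'\<in>removable (insert c D) - {c}. paths ?n (insert c D - {c'}))"
    by (simp only: sum.distrib sum_constant of_nat_id)
  also have "(\<Sum>c\<in>?A. \<Sum>c'\<in>removable (insert c D) - {c}. paths ?n (insert c D - {c'}))
      = (\<Sum>(c, c')\<in>(SIGMA c:?A. removable (insert c D) - {c}). paths ?n (insert c D - {c'}))"
    using fin fR by (intro sum.Sigma) auto
  also have "\<dots> = (\<Sum>(c', c)\<in>(SIGMA c':?R. addable r (D - {c'}) - {c'}). paths ?n (insert c (D - {c'})))"
  proof (rule sum.reindex_bij_witness[where i = "\<lambda>(c', c). (c, c')" and j = "\<lambda>(c, c'). (c', c)"])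
    fix x assume "x \<in> (SIGMA c:?A. removable (insert c D) - {c})"
    then obtain c c' where x: "x = (c, c')" "c \<in> ?A" "c' \<in> removable (insert c D)" "c \<noteq> c'" by (elim SigmaE DiffE) simp
    then show "(case x of (c, c') \<Rightarrow> (c', c)) \<in> (SIGMA c':?R. addable r (D - {c'}) - {c'})"
      using exchange[OF Suc.prems x(4)] by auto
    have "insert c (D - {c'}) = insert c D - {c'}" using x(4) by auto
    then show "(case case x of (c, c') \<Rightarrow> (c', c) of (c', c) \<Rightarrow> paths ?n (insert c (D - {c'})))
        = (case x of (c, c') \<Rightarrow> paths ?n (insert c D - {c'}))"
      by (simp only: x prod.case)
  next
    fix x assume "x \<in> (SIGMA c':?R. addable r (D - {c'}) - {c'})"
    then obtain c c' where x: "x = (c', c)" "c' \<in> ?R" "c \<in> addable r (D - {c'})" "c \<noteq> c'" by (elim SigmaE DiffE) simp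
    then show "(case x of (c', c) \<Rightarrow> (c, c')) \<in> (SIGMA c:?A. removable (insert c D) - {c})"
      using exchange[OF Suc.prems x(4)] by auto
  qed auto
  also have "\<dots> = (\<Sum>c'\<in>?R. \<Sum>c\<in>addable r (D - {c'}) - {c'}. paths ?n (insert c (D - {c'})))"
    using fin fA by (intro sum.Sigma[symmetric]) auto
  finally have 1: "(\<Sum>c\<in>?A. paths (Suc ?n) (insert c D)) = card ?A * paths ?n D +
      (\<Sum>c'\<in>?R. \<Sum>c\<in>addable r (D - {c'}) - {c'}. paths ?n (insert c (D - {c'})))" .
  \<comment> \<open>The induction hypothesis at \<open>D - {c'}\<close> sums over all addable boxes;
    its term for \<open>c'\<close> leads back to \<open>D\<close> and is accounted for
    separately.\<close>
  have 2: "(\<Sum>c\<in>addable r (D - {c'}) - {c'}. paths ?n (insert c (D - {c'}))) + paths ?n D = r * Suc n * paths n (D - {c'})"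
    if c': "c' \<in> ?R" for c'
  proof -
    have s: "D - {c'} \<in> shapes r n" "c' \<in> addable r (D - {c'})" using remove_shapes[OF Suc.prems c'] by auto
    have "insert c' (D - {c'}) = D" using c' by (auto simp: removable_def)
    then have "(\<Sum>c\<in>addable r (D - {c'}). paths ?n (insert c (D - {c'}))) =
      paths ?n D + (\<Sum>c\<in>addable r (D - {c'}) - {c'}. paths ?n (insert c (D - {c'})))"
      using sum.remove[OF fA[OF c'] s(2), of "\<lambda>c. paths ?n (insert c (D - {c'}))"] by (simp only:)
    then show ?thesis using Suc.IH[OF s(1)] by linarith
  qed
  have "(\<Sum>c'\<in>?R. \<Sum>c\<in>addable r (D - {c'}) - {c'}. paths ?n (insert c (D - {c'}))) + card ?R * paths ?n D
      = (\<Sum>c'\<in>?R. r * Suc n * paths n (D - {c'}))"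
    unfolding sum_constant[symmetric, where 'a = nat, unfolded of_nat_id] sum.distrib[symmetric]
    by (intro sum.cong refl 2)
  also have "\<dots> = r * Suc n * paths ?n D"
    unfolding paths.simps sum_distrib_left ..
  finally show ?case
    unfolding 1 using card_addable(2)[OF Suc.prems] by (simp only: add_mult_distrib add_mult_distrib2 mult_Suc_right mult_Suc)
qed

lemma finite_shapes: "finite (shapes r n)"
proof (induction n)
  case (Suc n)
  have "shapes r (Suc n) \<subseteq> (\<lambda>(D, c). insert c D) ` (SIGMA D:shapes r n. addable r D)"
  proof
    fix D assume D: "D \<in> shapes r (Suc n)"
    then have fd: "finite D" "down D" "D \<noteq> {}" by (auto simp: shapes_def)
    have "removable D \<noteq> {}"
    proof -
      \<comment> \<open>A box with maximal sum of row and column index has nothing to its right or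
        below it, so it is removable.\<close>
      obtain c where c: "c \<in> D" "\<And>d. d \<in> D \<Longrightarrow> fst (snd d) + snd (snd d) \<le> fst (snd c) + snd (snd c)"
        using Max_in[of "(\<lambda>d. fst (snd d) + snd (snd d)) ` D"] Max_ge[of "(\<lambda>d. fst (snd d) + snd (snd d)) ` D"] fd(1,3)
        by (metis (no_types, lifting) finite_imageI image_iff image_is_empty)
      obtain k i j where e: "c = (k, i, j)" by (cases c)
      have "(k, i, Suc j) \<notin> D" "(k, Suc i, j) \<notin> D"
        using c(2)[of "(k, i, Suc j)"] c(2)[of "(k, Suc i, j)"] unfolding e by auto
      then have "c \<in> removable D"
        using c(1) unfolding e removable_iff[OF fd(1,2)] mem_iff_rowlen[OF fd(1,2)] by simp
      then show ?thesis by blast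
    qed
    then obtain c where c: "c \<in> removable D" by blast
    then have "(D - {c}, c) \<in> (SIGMA D:shapes r n. addable r D)" "insert c (D - {c}) = D"
      using remove_shapes[OF D c] by (auto simp: removable_def)
    then show "D \<in> (\<lambda>(D, c). insert c D) ` (SIGMA D:shapes r n. addable r D)"
      by (intro image_eqI[where x = "(D - {c}, c)"]) simp_all
  qed
  moreover have "finite (SIGMA D:shapes r n. addable r D)"
    using Suc card_addable(1) by (intro finite_SigmaI) blast+
  ultimately show ?case using finite_subset by blast
qed (simp add: shapes_0)

text \<open>Expanding one factor by the last removed box and summing over the smaller shape instead
  of the larger one turns the sum into \<open>r (n + 1)\<close> times the previous sum.\<close>

lemma sum_paths_squares: "(\<Sum>D\<in>shapes r n. paths n D * paths n D) = r ^ n * fact n"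
proof (induction n)
  case (Suc n)
  have fr: "finite (removable D)" if "D \<in> shapes r (Suc n)" for D
    using that by (intro finite_removable) (simp add: shapes_def)
  have "(\<Sum>D\<in>shapes r (Suc n). paths (Suc n) D * paths (Suc n) D)
      = (\<Sum>D\<in>shapes r (Suc n). \<Sum>c\<in>removable D. paths (Suc n) D * paths n (D - {c}))"
    by (simp only: paths.simps(2) sum_distrib_left[symmetric])
  also have "\<dots> = (\<Sum>(D, c)\<in>(SIGMA D:shapes r (Suc n). removable D). paths (Suc n) D * paths n (D - {c}))"
    using finite_shapes fr by (intro sum.Sigma) auto
  also have "\<dots> = (\<Sum>(D, c)\<in>(SIGMA D:shapes r n. addable r D). paths (Suc n) (insert c D) * paths n D)"
  proof (rule sum.reindex_bij_witness[where i = "\<lambda>(D, c). (insert c D, c)" and j = "\<lambda>(D, c). (D - {c}, c)"])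
    fix x assume "x \<in> (SIGMA D:shapes r (Suc n). removable D)"
    then obtain D c where x: "x = (D, c)" "D \<in> shapes r (Suc n)" "c \<in> removable D" by auto
    have i: "insert c (D - {c}) = D" using x(3) by (auto simp: removable_def)
    then show "(case case x of (D, c) \<Rightarrow> (D - {c}, c) of (D, c) \<Rightarrow> (insert c D, c)) = x"
      by (simp add: x)
    show "(case x of (D, c) \<Rightarrow> (D - {c}, c)) \<in> (SIGMA D:shapes r n. addable r D)"
      using remove_shapes[OF x(2,3)] by (simp add: x)
    show "(case case x of (D, c) \<Rightarrow> (D - {c}, c) of (D, c) \<Rightarrow> paths (Suc n) (insert c D) * paths n D)
        = (case x of (D, c) \<Rightarrow> paths (Suc n) D * paths n (D - {c}))"
      by (simp only: x prod.case i)
  next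
    fix x assume "x \<in> (SIGMA D:shapes r n. addable r D)"
    then obtain D c where x: "x = (D, c)" "D \<in> shapes r n" "c \<in> addable r D" by auto
    have "insert c D - {c} = D" using x(3) by (auto simp: addable_def)
    then show "(case case x of (D, c) \<Rightarrow> (insert c D, c) of (D, c) \<Rightarrow> (D - {c}, c)) = x"
      by (simp add: x)
    show "(case x of (D, c) \<Rightarrow> (insert c D, c)) \<in> (SIGMA D:shapes r (Suc n). removable D)"
      using insert_shapes[OF x(2,3)] by (simp add: x)
  qed
  also have "\<dots> = (\<Sum>D\<in>shapes r n. \<Sum>c\<in>addable r D. paths (Suc n) (insert c D) * paths n D)"
    using finite_shapes card_addable(1) by (intro sum.Sigma[symmetric]) blast+
  also have "\<dots> = (\<Sum>D\<in>shapes r n. r * Suc n * paths n D * paths n D)"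
    unfolding sum_distrib_right[symmetric] by (intro sum.cong refl) (simp only: sum_paths_addable)
  also have "\<dots> = r * Suc n * (\<Sum>D\<in>shapes r n. paths n D * paths n D)"
    by (simp only: sum_distrib_left mult.assoc)
  also have "\<dots> = r ^ Suc n * fact (Suc n)"
    unfolding Suc by (simp add: algebra_simps)
  finally show ?case .
qed (simp add: shapes_0)

section \<open>Standard tableaux as linear extensions\<close>

definition box_less :: "box \<Rightarrow> box \<Rightarrow> bool" where
  "box_less = (\<lambda>(k, i, j) (k', i', j'). k = k' \<and> i \<le> i' \<and> j \<le> j' \<and> (i, j) \<noteq> (i', j'))"

definition lin_ext :: "nat \<Rightarrow> box set \<Rightarrow> tableau set" where
  "lin_ext n D = {t \<in> extensional D. bij_betw t D {1..n} \<and> (\<forall>x\<in>D. \<forall>y\<in>D. box_less x y \<longrightarrow> t x < t y)}"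

lemma finite_lin_ext: "finite D \<Longrightarrow> finite (lin_ext n D)"
proof (rule finite_subset)
  show "lin_ext n D \<subseteq> (D \<rightarrow>\<^sub>E {1..n})"
    by (auto simp: lin_ext_def PiE_def bij_betw_def)
qed (intro finite_PiE; simp)

text \<open>The largest entry sits in a removable box, and restricting a linear extension to the
  other boxes loses no information once this box is known. An upper bound is enough for the
  dimension count.\<close>

lemma card_lin_ext: "D \<in> shapes r n \<Longrightarrow> card (lin_ext n D) \<le> paths n D"
proof (induction n arbitrary: D)
  case 0
  then have "lin_ext 0 D \<subseteq> {\<lambda>x. undefined}"
    by (auto simp: shapes_0 lin_ext_def)
  then have "card (lin_ext 0 D) \<le> card {\<lambda>x :: box. undefined :: nat}"
    by (intro card_mono) simp_all
  then show ?case by simp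
next
  case (Suc n)
  have fd: "finite D" "down D" using Suc.prems by (auto simp: shapes_def)
  let ?S = "\<lambda>c. {t \<in> lin_ext (Suc n) D. t c = Suc n}"
  have fin: "finite (lin_ext (Suc n) D)" by (rule finite_lin_ext[OF fd(1)])
  have sub: "lin_ext (Suc n) D \<subseteq> (\<Union>c\<in>removable D. ?S c)"
  proof
    fix t assume t: "t \<in> lin_ext (Suc n) D"
    then have b: "bij_betw t D {1..Suc n}" and m: "\<And>x y. x \<in> D \<Longrightarrow> y \<in> D \<Longrightarrow> box_less x y \<Longrightarrow> t x < t y"
      by (auto simp: lin_ext_def)
    have "Suc n \<in> t ` D" using b by (simp add: bij_betw_def)
    then obtain c where c: "c \<in> D" "t c = Suc n" by auto
    obtain k i j where e: "c = (k, i, j)" by (cases c)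
    have "\<not> box_less c d" if "d \<in> D" for d
    proof
      assume "box_less c d"
      then have "Suc n < t d" using m[OF c(1) that] c(2) by simp
      moreover have "t d \<le> Suc n" using bij_betwE[OF b] that by auto
      ultimately show False by simp
    qed
    then have "(k, i, Suc j) \<notin> D" "(k, Suc i, j) \<notin> D"
      unfolding e box_less_def by fastforce+
    then have "c \<in> removable D"
      using c(1) unfolding e removable_iff[OF fd] mem_iff_rowlen[OF fd] by simp
    then show "t \<in> (\<Union>c\<in>removable D. ?S c)" using t c by blast
  qed
  have card: "card (?S c) \<le> paths n (D - {c})" if c: "c \<in> removable D" for c
  proof -
    have cD: "c \<in> D" using c by (simp add: removable_def)
    have s: "D - {c} \<in> shapes r n" using remove_shapes[OF Suc.prems c] by blast
    have "inj_on (\<lambda>t. restrict t (D - {c})) (?S c)"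
    proof (rule inj_onI)
      fix t u assume tu: "t \<in> ?S c" "u \<in> ?S c" "restrict t (D - {c}) = restrict u (D - {c})"
      show "t = u"
      proof
        fix x
        have tu': "t \<in> extensional D" "t c = Suc n" "u \<in> extensional D" "u c = Suc n"
          using tu by (simp_all add: lin_ext_def)
        consider "x \<in> D - {c}" | "x = c" | "x \<notin> D" by blast
        then show "t x = u x"
        proof cases
          case 1
          have "restrict t (D - {c}) x = restrict u (D - {c}) x" by (rule fun_cong[OF tu(3)])
          with 1 show ?thesis by (simp only: restrict_apply if_True)
        next
          case 2
          show ?thesis unfolding 2 tu'(2,4) ..
        next
          case 3
          show ?thesis using extensional_arb[OF tu'(1) 3] extensional_arb[OF tu'(3) 3] by (rule trans[OF _ sym])
        qed
      qed
    qed
    moreover have "(\<lambda>t. restrict t (D - {c})) ` ?S c \<subseteq> lin_ext n (D - {c})"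
    proof
      fix u assume "u \<in> (\<lambda>t. restrict t (D - {c})) ` ?S c"
      then obtain t where t: "t \<in> lin_ext (Suc n) D" "t c = Suc n" "u = restrict t (D - {c})" by blast
      have "bij_betw t (D - {c}) ({1..Suc n} - {Suc n})"
      proof -
        have "inj_on t D" "t ` D = {1..Suc n}" using t(1) by (simp_all add: lin_ext_def bij_betw_def)
        then show ?thesis
          unfolding bij_betw_def using inj_on_image_set_diff[of t D D "{c}"] cD t(2) inj_on_diff[of t D "{c}"] by simp
      qed
      then have "bij_betw t (D - {c}) {1..n}"
      proof -
        have "{1..Suc n} - {Suc n} = {1..n}" by auto
        with \<open>bij_betw t (D - {c}) ({1..Suc n} - {Suc n})\<close> show ?thesis by (simp only:)
      qed
      moreover have "bij_betw u (D - {c}) {1..n} = bij_betw t (D - {c}) {1..n}"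
        unfolding t(3) by (rule bij_betw_cong) simp
      ultimately have "bij_betw u (D - {c}) {1..n}" by simp
      then show "u \<in> lin_ext n (D - {c})"
        using t by (simp add: lin_ext_def)
    qed
    ultimately have "card (?S c) \<le> card (lin_ext n (D - {c}))"
      using fd by (intro card_inj_on_le finite_lin_ext) auto
    also have "\<dots> \<le> paths n (D - {c})" by (rule Suc.IH[OF s])
    finally show ?thesis .
  qed
  have "card (lin_ext (Suc n) D) \<le> card (\<Union>c\<in>removable D. ?S c)"
    using sub fin finite_removable[OF fd(1)] by (intro card_mono) auto
  also have "\<dots> \<le> (\<Sum>c\<in>removable D. card (?S c))"
    by (rule card_UN_le[OF finite_removable[OF fd(1)]])
  also have "\<dots> \<le> paths (Suc n) D"
    unfolding paths.simps by (intro sum_mono card)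
  finally show ?case .
qed

lemma partition_sorted: "is_partition \<mu> \<Longrightarrow> i \<le> i' \<Longrightarrow> i' < length \<mu> \<Longrightarrow> \<mu> ! i' \<le> \<mu> ! i"
  unfolding is_partition_def using sorted_wrt_nth_less[of "(\<ge>)" \<mu> i i'] by (cases "i = i'") auto

lemma diagram_shapes:
  assumes L: "L \<in> multipartitions r n"
  shows "diagram L \<in> shapes r n"
proof -
  have l: "length L = r" "size_of L = n" "\<And>k. k < r \<Longrightarrow> is_partition (L ! k)"
    using L by (auto simp: multipartitions_def multicompositions_def size_of_def)
  have "down (diagram L)"
    unfolding down_def diagram_iff
  proof (intro allI impI, elim conjE, intro conjI)
    fix k i j i' j' assume h: "k < length L" "i < length (L ! k)" "j < L ! k ! i" "i' \<le> i" "j' \<le> j"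
    show "k < length L" "i' < length (L ! k)" using h by simp_all
    show "j' < L ! k ! i'" using partition_sorted[OF l(3), of k i' i] h l(1) by simp
  qed
  then show ?thesis
    using l by (auto simp: shapes_def card_diagram diagram_iff)
qed

lemma diagram_inj: "inj_on diagram (multipartitions r n)"
proof (rule inj_onI)
  fix L N assume L: "L \<in> multipartitions r n" "N \<in> multipartitions r n" and eq: "diagram L = diagram N"
  have l: "length L = r" "length N = r" "\<And>k. k < r \<Longrightarrow> is_partition (L ! k) \<and> is_partition (N ! k)"
    using L by (auto simp: multipartitions_def multicompositions_def)
  show "L = N"
  proof (rule nth_equalityI)
    fix k assume "k < length L"
    then have k: "k < r" using l by simp
    have e: "i < length (L ! k) \<and> j < L ! k ! i \<longleftrightarrow> i < length (N ! k) \<and> j < N ! k ! i" for i j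
    proof -
      have "(k, i, j) \<in> diagram L \<longleftrightarrow> (k, i, j) \<in> diagram N" using eq by simp
      then show ?thesis using k l by (simp add: diagram_iff)
    qed
    have nz: "i < length (L ! k) \<Longrightarrow> 0 < L ! k ! i" "i < length (N ! k) \<Longrightarrow> 0 < N ! k ! i" for i
      using l(3)[OF k] unfolding is_partition_def by (metis gr0I nth_mem)+
    have len: "i < length (L ! k) \<longleftrightarrow> i < length (N ! k)" for i
      using e[of i 0] nz[of i] by auto
    show "L ! k = N ! k"
    proof (rule nth_equalityI)
      show "length (L ! k) = length (N ! k)" using len by (metis less_irrefl nat_neq_iff)
      fix i assume i: "i < length (L ! k)"
      then have "j < L ! k ! i \<longleftrightarrow> j < N ! k ! i" for j using e[of i j] len by simp
      then show "L ! k ! i = N ! k ! i" by (metis less_irrefl nat_neq_iff)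
    qed
  qed (simp add: l)
qed

lemma Std_lin_ext:
  assumes L: "L \<in> multipartitions r n"
  shows "Std L \<subseteq> lin_ext n (diagram L)"
proof
  fix t assume t: "t \<in> Std L"
  have n: "size_of L = n" using L by (simp add: multipartitions_def multicompositions_def size_of_def)
  have dn: "down (diagram L)" using diagram_shapes[OF L] by (simp add: shapes_def)
  have "t x < t y" if h: "x \<in> diagram L" "y \<in> diagram L" "box_less x y" for x y
  proof -
    obtain k i j i' j' where e: "x = (k, i, j)" "y = (k, i', j')" and le: "i \<le> i'" "j \<le> j'" "(i, j) \<noteq> (i', j')"
      using h(3) by (cases x; cases y) (auto simp: box_less_def)
    have m: "(k, i, j') \<in> diagram L" using downD[OF dn, of k i' j' i j'] h(2) le unfolding e by simp
    have "t (k, i, j) < t (k, i, j')" if "j < j'"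
      using t h(1) m that unfolding e Std_def row_standard_def by blast
    moreover have "t (k, i, j') < t (k, i', j')" if "i < i'"
      using t h(2) m that unfolding e Std_def by blast
    ultimately show ?thesis using le unfolding e by (cases "i = i'"; cases "j = j'") auto
  qed
  then show "t \<in> lin_ext n (diagram L)"
    using t n by (simp add: lin_ext_def Std_def row_standard_def multitableaux_def)
qed

lemma card_pairs_Std:
  "card (SIGMA L:multipartitions r n. Std L \<times> Std L) \<le> r ^ n * fact n"
proof -
  have le: "card (Std L) \<le> paths n (diagram L)" if L: "L \<in> multipartitions r n" for L
    using card_mono[OF finite_lin_ext[OF finite_diagram] Std_lin_ext[OF L]] card_lin_ext[OF diagram_shapes[OF L]]
    by simp
  have "card (SIGMA L:multipartitions r n. Std L \<times> Std L) = (\<Sum>L\<in>multipartitions r n. card (Std L) * card (Std L))"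
    using finite_multipartitions by (subst card_SigmaI) (auto simp: card_cartesian_product)
  also have "\<dots> \<le> (\<Sum>L\<in>multipartitions r n. paths n (diagram L) * paths n (diagram L))"
    by (intro sum_mono mult_le_mono le)
  also have "\<dots> = (\<Sum>D\<in>diagram ` multipartitions r n. paths n D * paths n D)"
    by (simp add: sum.reindex[OF diagram_inj])
  also have "\<dots> \<le> (\<Sum>D\<in>shapes r n. paths n D * paths n D)"
    using diagram_shapes finite_shapes by (intro sum_mono2) auto
  also have "\<dots> = r ^ n * fact n" by (rule sum_paths_squares)
  finally show ?thesis .
qed

section \<open>The quotient algebra as an algebra of operators\<close>

lemma prod_of_bool: "finite A \<Longrightarrow> (\<Prod>a\<in>A. of_bool (P a)) = (of_bool (\<forall>a\<in>A. P a) :: 'a :: comm_semiring_1)"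
  by (induction A rule: finite_induct) (simp_all add: of_bool_conj)

context yokonuma
begin

abbreviation YH :: "(scalar, free set) module" where "YH \<equiv> yokonuma_hecke r n"
abbreviation qcls :: "free \<Rightarrow> free set" where "qcls \<equiv> yh_class r n"

definition qrep :: "free set \<Rightarrow> free" where
  "qrep K = (SOME x. x \<in> FA r n \<and> K = qcls x)"

text \<open>The isomorphism of the quotient with \<open>YY\<close>. By \<open>psi_eq_iff\<close>
  identities in the quotient are checked among operators.\<close>

definition psi :: "free set \<Rightarrow> oper" where
  "psi K = phi r (qrep K)"

lemma cls_eq: "qcls x = (\<lambda>i. i + x) ` yh_ideal r n"
  by (auto simp: yh_class_def a_r_coset_def')

lemma cls_eq_iff:
  assumes x: "x \<in> FA r n" and y: "y \<in> FA r n"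
  shows "qcls x = qcls y \<longleftrightarrow> phi r x = phi r y"
proof
  assume "qcls x = qcls y"
  moreover have "0 + x \<in> qcls x" unfolding cls_eq by (rule imageI) simp
  ultimately obtain i where "i \<in> yh_ideal r n" "x = i + y" unfolding cls_eq by auto
  then show "phi r x = phi r y" using phi_yh_ideal[OF r1] by simp
next
  have sub: "qcls x \<subseteq> qcls y" if h: "x \<in> FA r n" "y \<in> FA r n" "phi r x = phi r y" for x y
  proof -
    have i: "x - y \<in> yh_ideal r n" using phi_eq_0_iff[of "x - y"] h by simp
    have "i + x \<in> qcls y" if "i \<in> yh_ideal r n" for i
    proof -
      have "i + x = (i + (x - y)) + y" by simp
      then show ?thesis unfolding cls_eq using yh_ideal_add[OF that i] by blast
    qed
    then show ?thesis unfolding cls_eq[of x] by blast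
  qed
  assume "phi r x = phi r y"
  then show "qcls x = qcls y" using sub[OF x y] sub[OF y x] by auto
qed

lemma qrep_qcls: "x \<in> FA r n \<Longrightarrow> qrep (qcls x) \<in> FA r n \<and> qcls x = qcls (qrep (qcls x))"
  unfolding qrep_def by (rule someI[of "\<lambda>z. z \<in> FA r n \<and> qcls x = qcls z" x]) simp

lemma psi_cls: "x \<in> FA r n \<Longrightarrow> psi (qcls x) = phi r x"
  unfolding psi_def using qrep_qcls[of x] cls_eq_iff[of x "qrep (qcls x)"] by simp

lemma YH_carrier: "carrier YH = qcls ` FA r n"
  by (auto simp: yokonuma_hecke_def ring.defs module.defs FactRing_def A_RCOSETS_def' yh_class_def)

lemma qcls_carrier [simp, intro]: "x \<in> FA r n \<Longrightarrow> qcls x \<in> carrier YH"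
  by (simp add: YH_carrier)

lemma YH_ops:
  "x \<in> FA r n \<Longrightarrow> y \<in> FA r n \<Longrightarrow> qcls x \<oplus>\<^bsub>YH\<^esub> qcls y = qcls (x + y)"
  "x \<in> FA r n \<Longrightarrow> y \<in> FA r n \<Longrightarrow> qcls x \<otimes>\<^bsub>YH\<^esub> qcls y = qcls (x * y)"
  "\<one>\<^bsub>YH\<^esub> = qcls 1" "\<zero>\<^bsub>YH\<^esub> = qcls 0"
proof -
  have ops: "add YH = set_add (free_algebra r n)" "monoid.mult YH = rcoset_mult (free_algebra r n) (yh_ideal r n)"
    "ring.zero YH = yh_ideal r n" "monoid.one YH = qcls 1"
    by (simp_all add: yokonuma_hecke_def ring.defs module.defs FactRing_def yh_class_def)
  show "\<one>\<^bsub>YH\<^esub> = qcls 1" by (rule ops)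
  show "\<zero>\<^bsub>YH\<^esub> = qcls 0" unfolding ops cls_eq by simp
  show "qcls x \<oplus>\<^bsub>YH\<^esub> qcls y = qcls (x + y)" if "x \<in> FA r n" "y \<in> FA r n"
    using ideal.a_rcos_sum[OF yh_ideal_ideal, of x r n y] that unfolding ops yh_class_def by simp
  show "qcls x \<otimes>\<^bsub>YH\<^esub> qcls y = qcls (x * y)" if "x \<in> FA r n" "y \<in> FA r n"
    using ideal.rcoset_mult_add[OF yh_ideal_ideal, of x r n y] that unfolding ops yh_class_def by simp
qed

text \<open>The scalar multiplication of the quotient is a union over all representatives; they all
  give the same coset, so the union collapses.\<close>

lemma YH_smult: "a \<in> scalars r \<Longrightarrow> x \<in> FA r n \<Longrightarrow> a \<odot>\<^bsub>YH\<^esub> qcls x = qcls (sc a * x)"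
proof -
  assume a: "a \<in> scalars r" and x: "x \<in> FA r n"
  have "a \<odot>\<^bsub>YH\<^esub> qcls x = (\<Union>y\<in>qcls x. qcls (sc a * y))"
    by (simp add: yokonuma_hecke_def ring.defs module.defs)
  also have "\<dots> = (\<Union>y\<in>qcls x. qcls (sc a * x))"
  proof (rule SUP_cong[OF refl])
    fix y assume "y \<in> qcls x"
    then obtain i where i: "i \<in> yh_ideal r n" "y = i + x" unfolding cls_eq by auto
    then have "y \<in> FA r n" using yh_ideal_FA x by auto
    moreover have "phi r y = phi r x" using i phi_yh_ideal[OF r1] by simp
    ultimately show "qcls (sc a * y) = qcls (sc a * x)"
      using a x by (subst cls_eq_iff) auto
  qed
  also have "\<dots> = qcls (sc a * x)" unfolding cls_eq[of x] using yh_ideal_0 by auto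
  finally show ?thesis .
qed

lemma YH_cases: assumes "K \<in> carrier YH" obtains x where "x \<in> FA r n" "K = qcls x"
  using assms by (auto simp: YH_carrier)

lemma YH_closed [simp, intro]:
  "K \<in> carrier YH \<Longrightarrow> Y \<in> carrier YH \<Longrightarrow> K \<oplus>\<^bsub>YH\<^esub> Y \<in> carrier YH"
  "K \<in> carrier YH \<Longrightarrow> Y \<in> carrier YH \<Longrightarrow> K \<otimes>\<^bsub>YH\<^esub> Y \<in> carrier YH"
  "\<one>\<^bsub>YH\<^esub> \<in> carrier YH" "\<zero>\<^bsub>YH\<^esub> \<in> carrier YH"
  "a \<in> scalars r \<Longrightarrow> K \<in> carrier YH \<Longrightarrow> a \<odot>\<^bsub>YH\<^esub> K \<in> carrier YH"
  by (auto simp: YH_ops YH_smult elim!: YH_cases)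

lemma psi_simps [simp]:
  "K \<in> carrier YH \<Longrightarrow> Y \<in> carrier YH \<Longrightarrow> psi (K \<oplus>\<^bsub>YH\<^esub> Y) = psi K + psi Y"
  "K \<in> carrier YH \<Longrightarrow> Y \<in> carrier YH \<Longrightarrow> psi (K \<otimes>\<^bsub>YH\<^esub> Y) = psi K * psi Y"
  "psi \<one>\<^bsub>YH\<^esub> = 1" "psi \<zero>\<^bsub>YH\<^esub> = 0"
  "a \<in> scalars r \<Longrightarrow> K \<in> carrier YH \<Longrightarrow> psi (a \<odot>\<^bsub>YH\<^esub> K) = C a * psi K"
  by (auto simp: YH_ops YH_smult psi_cls elim!: YH_cases)

lemma psi_eq_iff: "K \<in> carrier YH \<Longrightarrow> Y \<in> carrier YH \<Longrightarrow> K = Y \<longleftrightarrow> psi K = psi Y"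
  by (elim YH_cases) (simp add: psi_cls cls_eq_iff)

lemma psi_YY [simp, intro]: "K \<in> carrier YH \<Longrightarrow> psi K \<in> YY"
  by (erule YH_cases) (simp add: psi_cls YY_I)

lemma inj_on_psi: "S \<subseteq> carrier YH \<Longrightarrow> inj_on psi S"
  using psi_eq_iff by (auto intro!: inj_onI)

lemma YH_ring: "ring YH"
proof (rule ringI)
  show "abelian_group YH"
  proof (rule abelian_groupI)
    fix K assume K: "K \<in> carrier YH"
    then obtain x where x: "x \<in> FA r n" "K = qcls x" by (rule YH_cases)
    then have "qcls (- x) \<oplus>\<^bsub>YH\<^esub> K = \<zero>\<^bsub>YH\<^esub>" by (simp add: YH_ops)
    then show "\<exists>Y\<in>carrier YH. Y \<oplus>\<^bsub>YH\<^esub> K = \<zero>\<^bsub>YH\<^esub>" using x by auto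
  qed (simp_all add: psi_eq_iff add_ac)
  show "monoid YH" by (rule monoidI) (simp_all add: psi_eq_iff mult.assoc)
qed (simp_all add: psi_eq_iff distrib_left distrib_right)

lemma YH_algebra: "assoc_algebra (coeff_ring r) YH"
  unfolding assoc_algebra_def
proof (intro conjI ballI)
  show "module (coeff_ring r) YH"
    by (rule moduleI)
      (use coeff_ring_domain ring.is_abelian_group[OF YH_ring] in
        \<open>simp_all add: domain_def psi_eq_iff vs.scale_left_distrib vs.scale_right_distrib\<close>)
  fix a K Y assume h: "a \<in> scalars r" "K \<in> carrier YH" "Y \<in> carrier YH"
  show "a \<odot>\<^bsub>YH\<^esub> (K \<otimes>\<^bsub>YH\<^esub> Y) = a \<odot>\<^bsub>YH\<^esub> K \<otimes>\<^bsub>YH\<^esub> Y" using h by (simp add: psi_eq_iff mult.assoc)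
  show "a \<odot>\<^bsub>YH\<^esub> (K \<otimes>\<^bsub>YH\<^esub> Y) = K \<otimes>\<^bsub>YH\<^esub> (a \<odot>\<^bsub>YH\<^esub> Y)"
    using h C_left_commute[of "psi K" a "psi Y"] by (simp add: psi_eq_iff)
qed (rule YH_ring)

lemma YH_minus:
  assumes K: "K \<in> carrier YH" and Y: "Y \<in> carrier YH"
  shows "K \<ominus>\<^bsub>YH\<^esub> Y \<in> carrier YH" "psi (K \<ominus>\<^bsub>YH\<^esub> Y) = psi K - psi Y"
proof -
  interpret Y: ring YH by (rule YH_ring)
  show *: "K \<ominus>\<^bsub>YH\<^esub> Y \<in> carrier YH" using K Y by (rule Y.minus_closed)
  have "(K \<ominus>\<^bsub>YH\<^esub> Y) \<oplus>\<^bsub>YH\<^esub> Y = K" using K Y by (simp add: Y.minus_eq Y.a_assoc Y.l_neg)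
  then have "psi (K \<ominus>\<^bsub>YH\<^esub> Y) + psi Y = psi K" using psi_simps(1)[OF * Y] by simp
  then show "psi (K \<ominus>\<^bsub>YH\<^esub> Y) = psi K - psi Y" by (simp add: eq_diff_eq)
qed

lemma psi_finsum:
  assumes "finite A" "\<And>a. a \<in> A \<Longrightarrow> f a \<in> carrier YH"
  shows "finsum YH f A \<in> carrier YH \<and> psi (finsum YH f A) = (\<Sum>a\<in>A. psi (f a))"
proof -
  interpret Y: ring YH by (rule YH_ring)
  from assms show ?thesis
    by (induction A rule: finite_induct) (simp_all add: Y.finsum_insert Pi_def)
qed

lemma dg_one: "dg r (\<lambda>c. 1) = 1"
  by (simp add: dg_def diag_one)

text \<open>The ring is not commutative, so the library's rules for \<open>finprod\<close> do not
  apply. The factors map to colour operators, which commute; hence every order of folding has the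
  same image under \<open>psi\<close>, and \<open>psi\<close> is injective.\<close>

lemma psi_finprod:
  assumes "finite A" and f: "\<And>a. a \<in> A \<Longrightarrow> f a \<in> carrier YH \<and> psi (f a) = dg r (F a)"
  shows "finprod YH f A \<in> carrier YH \<and> psi (finprod YH f A) = dg r (\<lambda>c. \<Prod>a\<in>A. F a c)"
proof -
  let ?D = "foldSetD (carrier YH) ((\<otimes>\<^bsub>YH\<^esub>) \<circ> f) \<one>\<^bsub>YH\<^esub>"
  define P where "P B K \<longleftrightarrow> (B \<subseteq> A \<longrightarrow> K \<in> carrier YH \<and> psi K = dg r (\<lambda>c. \<Prod>a\<in>B. F a c))" for B K
  have "dg r (\<lambda>c. \<Prod>a\<in>{}. F a c) = 1" by (simp only: prod.empty dg_one)
  then have P0: "P {} \<one>\<^bsub>YH\<^esub>" unfolding P_def by simp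
  have PS: "P (insert a B) (f a \<otimes>\<^bsub>YH\<^esub> K)" if "a \<notin> B" "finite B" "P B K" for a B K
    unfolding P_def
  proof
    assume "insert a B \<subseteq> A"
    then have aB: "a \<in> A" "B \<subseteq> A" by blast+
    have K: "K \<in> carrier YH" "psi K = dg r (\<lambda>c. \<Prod>a\<in>B. F a c)"
      using that(3) aB(2) unfolding P_def by blast+
    have fa: "f a \<in> carrier YH" "psi (f a) = dg r (F a)" using f[OF aB(1)] by blast+
    show "f a \<otimes>\<^bsub>YH\<^esub> K \<in> carrier YH \<and>
        psi (f a \<otimes>\<^bsub>YH\<^esub> K) = dg r (\<lambda>c. \<Prod>a\<in>insert a B. F a c)"
      using YH_closed(2)[OF fa(1) K(1)] psi_simps(2)[OF fa(1) K(1)]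
      by (simp only: K(2) fa(2) dg_simps prod.insert[OF that(2,1)])
  qed
  have "P B K" if "(B, K) \<in> ?D" for B K
    using that
  proof (rule foldSetD.induct)
    show "P (insert a B) (((\<otimes>\<^bsub>YH\<^esub>) \<circ> f) a K)" if "a \<notin> B" "(B, K) \<in> ?D" "P B K" for a B K
      using PS[OF that(1) foldSetD_imp_finite[OF that(2)] that(3)] by (simp only: comp_apply)
  qed (rule P0)
  then have val: "K \<in> carrier YH \<and> psi K = dg r (\<lambda>c. \<Prod>a\<in>B. F a c)" if "(B, K) \<in> ?D" "B \<subseteq> A" for B K
    using that unfolding P_def by blast
  obtain K where K: "(A, K) \<in> ?D"
    using finite_imp_foldSetD[of A "\<one>\<^bsub>YH\<^esub>" "carrier YH" "(\<otimes>\<^bsub>YH\<^esub>) \<circ> f"] assms by auto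
  \<comment> \<open>\<open>foldD\<close> is a definite description, so the value must be shown to be
    unique.\<close>
  have "foldD (carrier YH) ((\<otimes>\<^bsub>YH\<^esub>) \<circ> f) \<one>\<^bsub>YH\<^esub> A = K"
    unfolding foldD_def
  proof (rule the_equality)
    fix Z assume "(A, Z) \<in> ?D"
    then show "Z = K" using val[OF K order_refl] val[of A Z] psi_eq_iff[of Z K] by simp
  qed (rule K)
  then show ?thesis using val[OF K order_refl] assms(1) by (simp add: finprod_def)
qed

lemma yh_gens:
  "1 \<le> i \<Longrightarrow> i < n \<Longrightarrow> yh_g r n i \<in> carrier YH \<and> psi (yh_g r n i) = opG r i"
  "1 \<le> i \<Longrightarrow> i \<le> n \<Longrightarrow> yh_t r n i \<in> carrier YH \<and> psi (yh_t r n i) = opT r i"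
  "1 \<le> i \<Longrightarrow> i \<le> n \<Longrightarrow> 1 \<le> j \<Longrightarrow> j \<le> n \<Longrightarrow> yh_e r n i j \<in> carrier YH \<and> psi (yh_e r n i j) = opE r i j"
  "1 \<le> i \<Longrightarrow> i \<le> n \<Longrightarrow> yh_u r n i k \<in> carrier YH \<and> psi (yh_u r n i k) = opU1 r i k"
  using psi_cls[OF FA_fg, of i] psi_cls[OF FA_ft, of i] psi_cls[OF FA_fe, of i j] psi_cls[OF FA_fu, of i k] r1
  by (simp_all add: yh_g_def yh_t_def yh_e_def yh_u_def phi_fe phi_fu C_simps)

lemma psi_yh_gw:
  assumes "w permutes {1..n}"
  shows "yh_gw r n w \<in> carrier YH" "psi (yh_gw r n w) = gw r n w"
proof -
  let ?f = "\<lambda>is. foldr (\<lambda>i x. yh_g r n i \<otimes>\<^bsub>YH\<^esub> x) is \<one>\<^bsub>YH\<^esub>"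
  have *: "is \<in> lists {1..<n} \<Longrightarrow> ?f is \<in> carrier YH \<and> psi (?f is) = gword r is" for "is"
    by (induction "is") (auto simp: yh_gens)
  have "red_word n w \<in> lists {1..<n}"
    using reduced_red_word[OF assms] by (simp add: reduced_word_def)
  from *[OF this] show "yh_gw r n w \<in> carrier YH" "psi (yh_gw r n w) = gw r n w"
    unfolding yh_gw_def gw_def red_word_def by auto
qed

lemma psi_E_block:
  assumes "I \<subseteq> {1..n}"
  shows "E_block r n I \<in> carrier YH \<and> psi (E_block r n I) = dg r (\<lambda>c. of_bool (\<forall>i\<in>I. \<forall>j\<in>I. c i = c j))"
proof -
  let ?A = "{(i, j). i \<in> I \<and> j \<in> I \<and> i < j}"
  have fin: "finite ?A" by (rule finite_subset[of _ "{1..n} \<times> {1..n}"]) (use assms in auto)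
  have e: "(\<forall>x\<in>?A. c (fst x) = c (snd x)) \<longleftrightarrow> (\<forall>i\<in>I. \<forall>j\<in>I. c i = c j)" for c :: "nat \<Rightarrow> nat"
  proof (intro iffI ballI)
    fix i j assume h: "\<forall>x\<in>?A. c (fst x) = c (snd x)" and ij: "i \<in> I" "j \<in> I"
    have lt: "c a = c b" if "a \<in> I" "b \<in> I" "a < b" for a b
      using bspec[OF h, of "(a, b)"] that by simp
    consider "i < j" | "i = j" | "j < i" by linarith
    then show "c i = c j"
      by cases (simp_all only: lt[OF ij] lt[OF ij(2,1)])
  next
    fix x assume h: "\<forall>i\<in>I. \<forall>j\<in>I. c i = c j" and "x \<in> ?A"
    then have "fst x \<in> I" "snd x \<in> I" by auto
    from bspec[OF bspec[OF h this(1)] this(2)] show "c (fst x) = c (snd x)" .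
  qed
  have "E_block r n I \<in> carrier YH \<and> psi (E_block r n I) = dg r (\<lambda>c. \<Prod>x\<in>?A. of_bool (c (fst x) = c (snd x)))"
    unfolding E_block_def
  proof (rule psi_finprod[OF fin])
    fix x assume "x \<in> ?A"
    then obtain i j where x: "x = (i, j)" "i \<in> {1..n}" "j \<in> {1..n}" using assms by blast
    then show "(case x of (i, j) \<Rightarrow> yh_e r n i j) \<in> carrier YH \<and>
        psi (case x of (i, j) \<Rightarrow> yh_e r n i j) = dg r (\<lambda>c. of_bool (c (fst x) = c (snd x)))"
      using yh_gens(3)[of i j] by (simp add: opE_def)
  qed
  then show ?thesis by (simp only: prod_of_bool[OF fin] e)
qed

context
  fixes L assumes L: "L \<in> multipartitions r n"
begin

lemma size_len: "size_of L = n" "length L = r"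
  using L by (auto simp: multipartitions_def multicompositions_def size_of_def)

lemma component_entries_eq: "component_entries L k = {p \<in> {1..n}. fst (row_of L p) = k}"
proof (rule Set.set_eqI)
  fix p
  show "p \<in> component_entries L k \<longleftrightarrow> p \<in> {p \<in> {1..n}. fst (row_of L p) = k}"
  proof
    assume "p \<in> component_entries L k"
    then obtain i j where "(k, i, j) \<in> diagram L" "p = initial_tableau L (k, i, j)"
      by (auto simp: component_entries_def)
    then show "p \<in> {p \<in> {1..n}. fst (row_of L p) = k}"
      using initial_range[of "(k, i, j)" L] size_len by simp
  next
    assume h: "p \<in> {p \<in> {1..n}. fst (row_of L p) = k}"
    then have "p \<in> {1..size_of L}" by (simp add: size_len)
    then obtain k' i j where "(k', i, j) \<in> diagram L" "p = initial_tableau L (k', i, j)"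
      by (rule position_cases)
    then show "p \<in> component_entries L k" using h by (auto simp: component_entries_def)
  qed
qed

lemma row_entries_eq: "row_entries L k i = {p \<in> {1..n}. row_of L p = (k, i)}"
proof (rule Set.set_eqI)
  fix p
  show "p \<in> row_entries L k i \<longleftrightarrow> p \<in> {p \<in> {1..n}. row_of L p = (k, i)}"
  proof
    assume "p \<in> row_entries L k i"
    then obtain j where "(k, i, j) \<in> diagram L" "p = initial_tableau L (k, i, j)"
      by (auto simp: row_entries_def)
    then show "p \<in> {p \<in> {1..n}. row_of L p = (k, i)}"
      using initial_range[of "(k, i, j)" L] size_len by simp
  next
    assume h: "p \<in> {p \<in> {1..n}. row_of L p = (k, i)}"
    then have "p \<in> {1..size_of L}" by (simp add: size_len)
    then obtain k' i' j where "(k', i', j) \<in> diagram L" "p = initial_tableau L (k', i', j)"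
      by (rule position_cases)
    then show "p \<in> row_entries L k i" using h by (auto simp: row_entries_def)
  qed
qed

lemma component_lt: "p \<in> {1..n} \<Longrightarrow> fst (row_of L p) < r"
proof -
  assume "p \<in> {1..n}"
  then have "p \<in> {1..size_of L}" by (simp add: size_len)
  then obtain k i j where "(k, i, j) \<in> diagram L" "p = initial_tableau L (k, i, j)"
    by (rule position_cases)
  then show ?thesis using size_len by (simp add: diagram_iff)
qed

lemma row_stabilizer_eq: "row_stabilizer L = blk_stab n (row_of L)"
proof (rule Set.set_eqI)
  fix w
  have "(\<forall>k i. w ` row_entries L k i = row_entries L k i) \<longleftrightarrow> (\<forall>p\<in>{1..n}. row_of L (w p) = row_of L p)"
    if w: "w permutes {1..n}"
  proof (intro iffI ballI allI)
    fix p assume h: "\<forall>k i. w ` row_entries L k i = row_entries L k i" and p: "p \<in> {1..n}"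
    obtain k i where ki: "row_of L p = (k, i)" by (cases "row_of L p")
    have "w p \<in> w ` row_entries L k i" unfolding row_entries_eq using p ki by blast
    then have "w p \<in> row_entries L k i" using h by simp
    then show "row_of L (w p) = row_of L p" using ki by (simp add: row_entries_eq)
  next
    fix k i assume h: "\<forall>p\<in>{1..n}. row_of L (w p) = row_of L p"
    have "w ` row_entries L k i \<subseteq> row_entries L k i"
      unfolding row_entries_eq using h permutes_in_image[OF w] by auto
    moreover have "inj_on w (row_entries L k i)" using permutes_inj_on[OF w] .
    moreover have "finite (row_entries L k i)" by (simp add: row_entries_eq)
    ultimately show "w ` row_entries L k i = row_entries L k i" by (rule endo_inj_surj[rotated])
  qed
  then show "w \<in> row_stabilizer L \<longleftrightarrow> w \<in> blk_stab n (row_of L)"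
    by (auto simp: row_stabilizer_def blk_stab_def size_len)
qed

lemma psi_E_elem:
  "E_elem r n L \<in> carrier YH \<and> psi (E_elem r n L) =
     dg r (\<lambda>c. of_bool (\<forall>k<r. \<forall>i\<in>component_entries L k. \<forall>j\<in>component_entries L k. c i = c j))"
proof -
  have fin: "finite (A_blocks L)" by (simp add: A_blocks_def)
  have e: "(\<forall>I\<in>A_blocks L. \<forall>i\<in>I. \<forall>j\<in>I. c i = c j) \<longleftrightarrow>
      (\<forall>k<r. \<forall>i\<in>component_entries L k. \<forall>j\<in>component_entries L k. c i = c j)" for c :: "nat \<Rightarrow> nat"
  proof (intro iffI ballI allI impI)
    fix k i j assume h: "\<forall>I\<in>A_blocks L. \<forall>i\<in>I. \<forall>j\<in>I. c i = c j" "k < r"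
      "i \<in> component_entries L k" "j \<in> component_entries L k"
    then have "component_entries L k \<in> A_blocks L" by (auto simp: A_blocks_def size_len)
    from bspec[OF bspec[OF bspec[OF h(1) this] h(3)] h(4)] show "c i = c j" .
  next
    fix I i j assume h: "\<forall>k<r. \<forall>i\<in>component_entries L k. \<forall>j\<in>component_entries L k. c i = c j"
      "I \<in> A_blocks L" "i \<in> I" "j \<in> I"
    then obtain k where "k < r" "I = component_entries L k" by (auto simp: A_blocks_def size_len)
    then show "c i = c j" using h by blast
  qed
  have "E_elem r n L \<in> carrier YH \<and> psi (E_elem r n L) =
      dg r (\<lambda>c. \<Prod>I\<in>A_blocks L. of_bool (\<forall>i\<in>I. \<forall>j\<in>I. c i = c j))"
    unfolding E_elem_def E_partition_def
    proof (rule psi_finprod[OF fin psi_E_block])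
    fix I assume "I \<in> A_blocks L"
    then obtain k where "I = component_entries L k" by (auto simp: A_blocks_def)
    then show "I \<subseteq> {1..n}" unfolding component_entries_eq by blast
  qed
  then show ?thesis by (simp only: prod_of_bool[OF fin] e)
qed

lemma psi_U_elem:
  "U_elem r n L \<in> carrier YH \<and> psi (U_elem r n L) =
     dg r (\<lambda>c. of_bool (\<forall>k<r. component_entries L k \<noteq> {} \<longrightarrow>
       c (SOME i. i \<in> component_entries L k) = Suc k mod r))"
proof -
  let ?P = "\<lambda>c k. component_entries L k \<noteq> {} \<longrightarrow> c (SOME i. i \<in> component_entries L k) = Suc k mod r"
  have "U_elem r n L \<in> carrier YH \<and> psi (U_elem r n L) = dg r (\<lambda>c. \<Prod>k\<in>{..<r}. of_bool (?P c k))"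
    unfolding U_elem_def
  proof (rule psi_finprod)
    fix k
    show "(if component_entries L k = {} then \<one>\<^bsub>YH\<^esub> else yh_u r n (SOME i. i \<in> component_entries L k) (Suc k)) \<in> carrier YH \<and>
      psi (if component_entries L k = {} then \<one>\<^bsub>YH\<^esub> else yh_u r n (SOME i. i \<in> component_entries L k) (Suc k)) =
        dg r (\<lambda>c. of_bool (?P c k))"
    proof (cases "component_entries L k = {}")
      case True
      then show ?thesis by (simp add: dg_one)
    next
      case False
      then have "(SOME i. i \<in> component_entries L k) \<in> component_entries L k" by (simp add: some_in_eq)
      then have "1 \<le> (SOME i. i \<in> component_entries L k)" "(SOME i. i \<in> component_entries L k) \<le> n"
        unfolding component_entries_eq by auto
      from yh_gens(4)[OF this] False show ?thesis by (simp add: opU1_def)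
    qed
  qed simp
  then show ?thesis by (simp only: prod_of_bool[OF finite_lessThan] Ball_def lessThan_iff)
qed

text \<open>\<open>E\<close> makes the colours constant on each component and \<open>U\<close>
  prescribes the colour at one entry of each nonempty component. Together they fix all
  colours.\<close>

lemma psi_U_E: "psi (U_elem r n L) * psi (E_elem r n L) = opU r n (chi_of L)"
proof -
  let ?K = "component_entries L"
  have "(\<forall>k<r. ?K k \<noteq> {} \<longrightarrow> c (SOME i. i \<in> ?K k) = Suc k mod r) \<and> (\<forall>k<r. \<forall>i\<in>?K k. \<forall>j\<in>?K k. c i = c j) \<longleftrightarrow>
      (\<forall>p\<in>{1..n}. c p = chi_of L p)" (is "?A \<and> ?B \<longleftrightarrow> ?C") for c
  proof (intro iffI conjI)
    assume h: "?A \<and> ?B"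
    show ?C
    proof
      fix p assume p: "p \<in> {1..n}"
      let ?k = "fst (row_of L p)"
      have pk: "p \<in> ?K ?k" using p by (simp add: component_entries_eq)
      then have "(SOME i. i \<in> ?K ?k) \<in> ?K ?k" by (rule someI)
      then have "c p = c (SOME i. i \<in> ?K ?k)" using h pk component_lt[OF p] by blast
      also have "\<dots> = Suc ?k mod r" using h pk component_lt[OF p] by blast
      finally show "c p = chi_of L p" by (simp only: chi_of_eq[OF p])
    qed
  next
    assume c: ?C
    have v: "c i = Suc k mod r" if "i \<in> ?K k" for i k
    proof -
      have i: "i \<in> {1..n}" "fst (row_of L i) = k" using that by (auto simp: component_entries_eq)
      show ?thesis using bspec[OF c i(1)] chi_of_eq[OF i(1), of L] i(2) by simp
    qed
    show ?A
    proof (intro allI impI)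
      fix k assume "?K k \<noteq> {}"
      then have "(SOME i. i \<in> ?K k) \<in> ?K k" by (simp add: some_in_eq)
      then show "c (SOME i. i \<in> ?K k) = Suc k mod r" by (rule v)
    qed
    show ?B using v by metis
  qed
  then show ?thesis
    unfolding opU_def conjunct2[OF psi_U_elem] conjunct2[OF psi_E_elem] dg_simps
    by (simp only: of_bool_conj[symmetric])
qed

lemma psi_x_elem: "x_elem r n L \<in> carrier YH \<and> psi (x_elem r n L) = xs (row_of L)"
proof -
  have w: "w permutes {1..n}" if "w \<in> blk_stab n (row_of L)" for w using that by (rule blk_stab_permutes)
  have "x_elem r n L \<in> carrier YH \<and> psi (x_elem r n L) =
      (\<Sum>w\<in>blk_stab n (row_of L). psi (q_indet ^ perm_length n w \<odot>\<^bsub>YH\<^esub> yh_gw r n w))"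
    unfolding x_elem_def row_stabilizer_eq
    by (rule psi_finsum) (auto intro!: YH_closed(5) psi_yh_gw w)
  also have "(\<Sum>w\<in>blk_stab n (row_of L). psi (q_indet ^ perm_length n w \<odot>\<^bsub>YH\<^esub> yh_gw r n w)) = xs (row_of L)"
    unfolding xs_def by (rule sum.cong[OF refl]) (simp add: psi_yh_gw[OF w] perm_length_eq[OF w])
  finally show ?thesis .
qed

lemma psi_m_elem: "m_elem r n L \<in> carrier YH \<and> psi (m_elem r n L) = M L"
  unfolding m_elem_def M_def mm_def
  using psi_U_elem[THEN conjunct1] psi_E_elem[THEN conjunct1] psi_x_elem by (simp add: psi_U_E)

end

section \<open>The anti-automorphism of the quotient\<close>

lemma anti_automorphism_unique:
  assumes f: "anti_automorphism (coeff_ring r) YH f" and g: "anti_automorphism (coeff_ring r) YH g"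
    and fg: "\<And>i. i \<in> {1..<n} \<Longrightarrow> f (yh_g r n i) = g (yh_g r n i)"
    and ft: "\<And>k. k \<in> {1..n} \<Longrightarrow> f (yh_t r n k) = g (yh_t r n k)"
    and K: "K \<in> carrier YH"
  shows "f K = g K"
proof -
  note aa = f[unfolded anti_automorphism_def] g[unfolded anti_automorphism_def]
  have word: "f (qcls (mon w 1)) = g (qcls (mon w 1))" if "w \<in> lists (gens n)" for w
    using that
  proof (induction w)
    case Nil
    have "qcls (mon [] 1) = \<one>\<^bsub>YH\<^esub>" unfolding YH_ops(3) one_eq_mono ..
    then show "f (qcls (mon [] 1)) = g (qcls (mon [] 1))" using aa by simp
  next
    case (Cons x w)
    then have xw: "mon [x] 1 \<in> FA r n" "mon w 1 \<in> FA r n" "x \<in> gens n" by auto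
    have "qcls (mon (x # w) 1) = qcls (mon [x] 1) \<otimes>\<^bsub>YH\<^esub> qcls (mon w 1)"
      unfolding YH_ops(2)[OF xw(1,2)] by (simp add: mono_mult)
    moreover have "f (qcls (mon [x] 1)) = g (qcls (mon [x] 1))"
      using xw(3) fg ft unfolding gens_def yh_g_def yh_t_def by blast
    moreover have "f (qcls (mon w 1)) = g (qcls (mon w 1))" using Cons by simp
    ultimately show "f (qcls (mon (x # w) 1)) = g (qcls (mon (x # w) 1))"
      using aa xw by simp
  qed
  obtain x where x: "x \<in> FA r n" "K = qcls x" using K by (rule YH_cases)
  from x(1) have "f (qcls x) = g (qcls x)"
  proof (induction rule: FA_induct)
    case zero
    \<comment> \<open>That zero is preserved follows from compatibility with the scalar 0.\<close>
    have "qcls 0 = 0 \<odot>\<^bsub>YH\<^esub> qcls 0" by (simp add: YH_smult)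
    moreover have "f (0 \<odot>\<^bsub>YH\<^esub> qcls 0) = \<zero>\<^bsub>YH\<^esub>" if h: "anti_automorphism (coeff_ring r) YH f" for f
    proof -
      have "f (qcls 0) \<in> carrier YH" using h unfolding anti_automorphism_def bij_betw_def by auto
      moreover have "f (0 \<odot>\<^bsub>YH\<^esub> qcls 0) = 0 \<odot>\<^bsub>YH\<^esub> f (qcls 0)" using h unfolding anti_automorphism_def by simp
      ultimately show ?thesis by (simp add: psi_eq_iff C_simps)
    qed
    ultimately show "f (qcls 0) = g (qcls 0)" using f g by metis
  next
    case (add w a x)
    then have w: "mon w 1 \<in> FA r n" by auto
    have "qcls (mon w a + x) = (a \<odot>\<^bsub>YH\<^esub> qcls (mon w 1)) \<oplus>\<^bsub>YH\<^esub> qcls x"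
      using add w by (simp add: YH_smult YH_ops) (simp add: sc_def mono_mult)
    then show "f (qcls (mon w a + x)) = g (qcls (mon w a + x))"
      using aa add w word[of w] by simp
  qed
  then show ?thesis by (simp add: x)
qed

text \<open>Restricted to the carrier because the description in \<open>yh_star\<close> asks for an
  extensional function.\<close>

definition star :: "free set \<Rightarrow> free set" where
  "star = restrict (\<lambda>K. qcls (frev (qrep K))) (carrier YH)"

lemma rep_FA: "K \<in> carrier YH \<Longrightarrow> qrep K \<in> FA r n"
  using qrep_qcls by (auto elim!: YH_cases)

lemma star_carrier [simp, intro]: "K \<in> carrier YH \<Longrightarrow> star K \<in> carrier YH"
  by (simp add: star_def rep_FA frev_FA)

lemma psi_star: "K \<in> carrier YH \<Longrightarrow> psi (star K) = st (psi K)"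
  using rep_FA[of K] by (simp add: star_def psi_cls frev_FA st_phi psi_def[of K])

lemma anti_automorphism_star: "anti_automorphism (coeff_ring r) YH star"
  unfolding anti_automorphism_def
proof (intro conjI ballI)
  show "bij_betw star (carrier YH) (carrier YH)"
    by (rule bij_betw_byWitness[where f' = star]) (auto simp: psi_eq_iff psi_star)
  fix K H assume h: "K \<in> carrier YH" "H \<in> carrier YH"
  show "star (K \<oplus>\<^bsub>YH\<^esub> H) = star K \<oplus>\<^bsub>YH\<^esub> star H" using h by (simp add: psi_eq_iff psi_star st_add)
  show "star (K \<otimes>\<^bsub>YH\<^esub> H) = star H \<otimes>\<^bsub>YH\<^esub> star K" using h by (simp add: psi_eq_iff psi_star st_mult)
qed (simp_all add: psi_eq_iff psi_star st_scale)

lemma star_gens: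
  "i \<in> {1..<n} \<Longrightarrow> star (yh_g r n i) = yh_g r n i"
  "k \<in> {1..n} \<Longrightarrow> star (yh_t r n k) = yh_t r n k"
  using yh_gens(1)[of i] yh_gens(2)[of k] by (simp_all add: psi_eq_iff psi_star st_opG st_opT)

lemma yh_star_eq: "yh_star r n = star"
proof -
  let ?P = "\<lambda>f. f \<in> extensional (carrier YH) \<and> anti_automorphism (coeff_ring r) YH f \<and>
     (\<forall>i\<in>{1..<n}. f (yh_g r n i) = yh_g r n i) \<and> (\<forall>k\<in>{1..n}. f (yh_t r n k) = yh_t r n k)"
  have ext: "star \<in> extensional (carrier YH)" unfolding star_def by (rule restrict_extensional)
  have P: "?P star"
    by (intro conjI ballI ext anti_automorphism_star star_gens)
  have uniq: "f = star" if f: "?P f" for f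
  proof (rule extensionalityI)
    show "f \<in> extensional (carrier YH)" using f by (elim conjE)
    fix K assume K: "K \<in> carrier YH"
    show "f K = star K"
    proof (rule anti_automorphism_unique[OF _ anti_automorphism_star _ _ K])
      show "anti_automorphism (coeff_ring r) YH f" using f by (elim conjE)
      show "f (yh_g r n i) = star (yh_g r n i)" if "i \<in> {1..<n}" for i
        using f that star_gens(1)[OF that] by metis
      show "f (yh_t r n k) = star (yh_t r n k)" if "k \<in> {1..n}" for k
        using f that star_gens(2)[OF that] by metis
    qed
  qed (rule ext)
  show ?thesis unfolding yh_star_def by (rule the_equality[of ?P star, OF P uniq])
qed

section \<open>The Murphy elements: basis and cellularity\<close>

lemma psi_murphy:
  assumes L: "L \<in> multipartitions r n" and s: "s \<in> Std L" and t: "t \<in> Std L"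
  shows "murphy r n L s t \<in> carrier YH" "psi (murphy r n L s t) = Mst L s t"
proof -
  note gs = psi_yh_gw[OF d_perm_permutes[OF L s]] and gt = psi_yh_gw[OF d_perm_permutes[OF L t]]
  note m = psi_m_elem[OF L, THEN conjunct1] psi_m_elem[OF L, THEN conjunct2]
  have e: "murphy r n L s t = star (yh_gw r n (d_perm L s)) \<otimes>\<^bsub>YH\<^esub> m_elem r n L \<otimes>\<^bsub>YH\<^esub> yh_gw r n (d_perm L t)"
    unfolding murphy_def yh_star_eq ..
  show "murphy r n L s t \<in> carrier YH"
    unfolding e by (intro YH_closed star_carrier gs gt m)
  have "psi (murphy r n L s t) = psi (star (yh_gw r n (d_perm L s))) * psi (m_elem r n L) * psi (yh_gw r n (d_perm L t))"
    unfolding e by (subst psi_simps(2), intro YH_closed star_carrier gs m, rule gt, subst psi_simps(2))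
      (intro star_carrier gs, rule m, rule refl)
  also have "\<dots> = Mst L s t"
    unfolding Mst_def psi_star[OF gs(1)] gs(2) gt(2) m(2) st_gw[OF d_perm_permutes[OF L s]] ..
  finally show "psi (murphy r n L s t) = Mst L s t" .
qed

text \<open>Existence of coefficients comes from spanning over the coefficient ring, their
  uniqueness from independence over the field that contains it.\<close>

lemma module_basisI:
  assumes B: "finite B" "B \<subseteq> carrier YH" and ind: "vs.independent (psi ` B)"
    and span: "\<And>x. x \<in> YY \<Longrightarrow> x \<in> rspan r (psi ` B)"
  shows "module_basis (coeff_ring r) YH B"
  unfolding module_basis_def
proof (intro conjI ballI)
  show "module (coeff_ring r) YH" using YH_algebra by (simp add: assoc_algebra_def)
  have inj: "inj_on psi B" by (rule inj_on_psi[OF B(2)])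
  have lin: "(\<Oplus>\<^bsub>YH\<^esub>b\<in>{b \<in> B. a b \<noteq> 0}. a b \<odot>\<^bsub>YH\<^esub> b) \<in> carrier YH"
    "psi (\<Oplus>\<^bsub>YH\<^esub>b\<in>{b \<in> B. a b \<noteq> 0}. a b \<odot>\<^bsub>YH\<^esub> b) = (\<Sum>b\<in>B. C (a b) * psi b)"
    if a: "a \<in> B \<rightarrow> scalars r" for a
  proof -
    have m: "\<And>b. b \<in> B \<Longrightarrow> a b \<in> scalars r \<and> b \<in> carrier YH" using a B by auto
    have *: "(\<Oplus>\<^bsub>YH\<^esub>b\<in>{b \<in> B. a b \<noteq> 0}. a b \<odot>\<^bsub>YH\<^esub> b) \<in> carrier YH \<and>
      psi (\<Oplus>\<^bsub>YH\<^esub>b\<in>{b \<in> B. a b \<noteq> 0}. a b \<odot>\<^bsub>YH\<^esub> b) = (\<Sum>b\<in>{b \<in> B. a b \<noteq> 0}. psi (a b \<odot>\<^bsub>YH\<^esub> b))"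
      by (rule psi_finsum) (use B m in auto)
    then show "(\<Oplus>\<^bsub>YH\<^esub>b\<in>{b \<in> B. a b \<noteq> 0}. a b \<odot>\<^bsub>YH\<^esub> b) \<in> carrier YH" by blast
    have "(\<Sum>b\<in>{b \<in> B. a b \<noteq> 0}. psi (a b \<odot>\<^bsub>YH\<^esub> b)) = (\<Sum>b\<in>{b \<in> B. a b \<noteq> 0}. C (a b) * psi b)"
      using m by (intro sum.cong refl) simp
    also have "\<dots> = (\<Sum>b\<in>B. C (a b) * psi b)"
      using B(1) by (intro sum.mono_neutral_left) (auto simp: C_simps)
    finally show "psi (\<Oplus>\<^bsub>YH\<^esub>b\<in>{b \<in> B. a b \<noteq> 0}. a b \<odot>\<^bsub>YH\<^esub> b) = (\<Sum>b\<in>B. C (a b) * psi b)" using * by simp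
  qed
  fix K assume K: "K \<in> carrier YH"
  obtain a where a: "\<And>b. a b \<in> scalars r" "psi K = (\<Sum>b\<in>B. C (a b) * psi b)"
    using rspan_finite[OF span[OF psi_YY[OF K]] B(1)] by blast
  let ?Q = "\<lambda>a. a \<in> B \<rightarrow>\<^sub>E scalars r \<and> finite {b \<in> B. a b \<noteq> \<zero>\<^bsub>coeff_ring r\<^esub>} \<and>
    K = (\<Oplus>\<^bsub>YH\<^esub>b\<in>{b \<in> B. a b \<noteq> \<zero>\<^bsub>coeff_ring r\<^esub>}. a b \<odot>\<^bsub>YH\<^esub> b)"
  show "\<exists>!a. ?Q a"
  proof (rule ex1I)
    let ?a = "restrict a B"
    have "?a \<in> B \<rightarrow> scalars r" using a(1) by auto
    note l = lin[OF this]
    have "psi K = (\<Sum>b\<in>B. C (?a b) * psi b)" unfolding a(2) by (rule sum.cong) auto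
    then show "?Q ?a" using l K B(1) a(1) by (simp add: psi_eq_iff)
  next
    fix a' assume a': "?Q a'"
    then have p: "a' \<in> B \<rightarrow> scalars r" by auto
    have "psi K = (\<Sum>b\<in>B. C (a' b) * psi b)" using lin(2)[OF p] a' by simp
    then have 0: "(\<Sum>b\<in>B. C (a' b - a b) * psi b) = 0"
      using a(2) by (simp add: vs.scale_left_diff_distrib sum_subtractf)
    have "(\<Sum>v\<in>psi ` B. C (a' (inv_into B psi v) - a (inv_into B psi v)) * v) = 0"
      using 0 by (simp add: sum.reindex[OF inj] inv_into_f_f[OF inj])
    then have "a' b - a b = 0" if "b \<in> B" for b
      using vs.independentD[OF ind finite_imageI[OF B(1)] order_refl, of "\<lambda>v. a' (inv_into B psi v) - a (inv_into B psi v)" "psi b"]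
        that by (simp add: inv_into_f_f[OF inj])
    then have "a' b = restrict a B b" for b
      using a' by (cases "b \<in> B") (auto simp: PiE_def extensional_def)
    then show "a' = restrict a B" by (rule ext)
  qed
qed (rule B)

lemma module_spanI:
  assumes S: "S \<subseteq> carrier YH" and K: "K \<in> carrier YH" "psi K \<in> rspan r (psi ` S)"
  shows "K \<in> module_span (coeff_ring r) YH S"
  unfolding module_span_def
proof (intro InterI, elim CollectE conjE)
  fix N assume N: "submodule N (coeff_ring r) YH" "S \<subseteq> N"
  have "module (coeff_ring r) YH" using YH_algebra by (simp add: assoc_algebra_def)
  note sub = module.submoduleE[OF this N(1)]
  from K(2) have "\<exists>Z\<in>N. psi Z = psi K"
  proof (induction rule: rspan.induct)
    case rspan_0
    obtain Z where "Z \<in> N" using sub(2) by blast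
    then have "0 \<odot>\<^bsub>YH\<^esub> Z \<in> N" "psi (0 \<odot>\<^bsub>YH\<^esub> Z) = 0" using sub(1,4) by (auto simp: C_simps subset_iff)
    then show "\<exists>Z\<in>N. psi Z = 0" by blast
  next
    case (rspan_step a s x)
    then obtain Z T where "Z \<in> N" "psi Z = x" "T \<in> S" "s = psi T" by blast
    moreover from this have "a \<odot>\<^bsub>YH\<^esub> T \<oplus>\<^bsub>YH\<^esub> Z \<in> N" using rspan_step(1) sub(4,5) N(2) by auto
    moreover have "psi (a \<odot>\<^bsub>YH\<^esub> T \<oplus>\<^bsub>YH\<^esub> Z) = C a * s + x"
      using calculation rspan_step(1) S sub(1) by (simp add: subset_iff)
    ultimately show "\<exists>Z\<in>N. psi Z = C a * s + x" by blast
  qed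
  then obtain Z where Z: "Z \<in> N" "psi Z = psi K" by blast
  then have "Z = K" using psi_eq_iff[of Z K] K(1) sub(1) by auto
  then show "K \<in> N" using Z by simp
qed

text \<open>The coefficients \<open>\<rho>\<close> are found before any left factor is applied.
  Therefore the same \<open>\<rho>\<close> serves all \<open>s\<close> in the cellular
  condition.\<close>

lemma M_expansion:
  assumes L: "L \<in> multipartitions r n" and y: "y \<in> YY"
  obtains \<rho> j where "\<rho> \<in> Std L \<rightarrow> scalars r" "j \<in> Jset L"
    "M L * y = (\<Sum>v\<in>Std L. C (\<rho> v) * (M L * gw r n (d_perm L v))) + j"
proof -
  let ?f = "\<lambda>v. M L * gw r n (d_perm L v)"
  have "M L * y \<in> rspan r (?f ` Std L \<union> Jset L)"
    using M_YY_std[OF L y] by (simp add: image_image)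
  then have "\<exists>\<rho> j. \<rho> \<in> Std L \<rightarrow> scalars r \<and> j \<in> Jset L \<and> M L * y = (\<Sum>v\<in>Std L. C (\<rho> v) * ?f v) + j"
  proof (induction rule: rspan.induct)
    case rspan_0
    have "(\<lambda>v. 0) \<in> Std L \<rightarrow> scalars r" "0 \<in> Jset L" unfolding Jset_def by (auto intro: rspan.rspan_0)
    moreover have "0 = (\<Sum>v\<in>Std L. C 0 * ?f v) + 0" by (simp add: C_simps)
    ultimately show "\<exists>\<rho> j. \<rho> \<in> Std L \<rightarrow> scalars r \<and> j \<in> Jset L \<and> 0 = (\<Sum>v\<in>Std L. C (\<rho> v) * ?f v) + j" by blast
  next
    case (rspan_step a s x)
    then obtain \<rho> j where h: "\<rho> \<in> Std L \<rightarrow> scalars r" "j \<in> Jset L" "x = (\<Sum>v\<in>Std L. C (\<rho> v) * ?f v) + j" by blast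
    from rspan_step(2) show "\<exists>\<rho> j. \<rho> \<in> Std L \<rightarrow> scalars r \<and> j \<in> Jset L \<and> C a * s + x = (\<Sum>v\<in>Std L. C (\<rho> v) * ?f v) + j"
    proof
      assume "s \<in> Jset L"
      then have "C a * s + j \<in> Jset L" using h(2) rspan_step(1) unfolding Jset_def by (intro rspan_add rspan_scale)
      moreover have "C a * s + x = (\<Sum>v\<in>Std L. C (\<rho> v) * ?f v) + (C a * s + j)" unfolding h(3) by (simp add: add_ac)
      ultimately show ?thesis using h(1) by blast
    next
      assume "s \<in> ?f ` Std L"
      then obtain u where u: "u \<in> Std L" "s = ?f u" by blast
      let ?\<rho> = "\<lambda>v. \<rho> v + (if v = u then a else 0)"
      have "?\<rho> \<in> Std L \<rightarrow> scalars r" using h(1) rspan_step(1) by auto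
      moreover have "C a * s + x = (\<Sum>v\<in>Std L. C (?\<rho> v) * ?f v) + j"
      proof -
        have "(\<Sum>v\<in>Std L. C (?\<rho> v) * ?f v) = (\<Sum>v\<in>Std L. C (\<rho> v) * ?f v + (if v = u then C a * ?f u else 0))"
          by (rule sum.cong) (auto simp: vs.scale_left_distrib)
        also have "\<dots> = (\<Sum>v\<in>Std L. C (\<rho> v) * ?f v) + C a * ?f u"
          using u(1) finite_Std by (simp add: sum.distrib)
        finally show ?thesis unfolding h(3) u(2) by (simp add: add_ac)
      qed
      ultimately show ?thesis using h(2) by blast
    qed
  qed
  then show thesis using that by blast
qed

abbreviation murphy_index :: "(nat list list \<times> tableau \<times> tableau) set" where
  "murphy_index \<equiv> SIGMA L:multipartitions r n. Std L \<times> Std L"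

lemma finite_murphy_index: "finite murphy_index"
  using finite_multipartitions finite_Std by blast

text \<open>The elements span everything, in particular the \<open>u_\<chi> g_w\<close>, and there
  are at most \<open>r^n n!\<close> index triples by \<open>card_pairs_Std\<close>.\<close>

lemma Mst_independent:
  "inj_on (\<lambda>(L, s, t). Mst L s t) murphy_index" "vs.independent ((\<lambda>(L, s, t). Mst L s t) ` murphy_index)"
proof -
  let ?f = "\<lambda>(L, s, t). Mst L s t"
  have im: "{Mst L s t | L s t. L \<in> multipartitions r n \<and> s \<in> Std L \<and> t \<in> Std L} = ?f ` murphy_index"
    by force
  have "x \<in> vs.span (?f ` murphy_index)" if "x \<in> YY" for x
    using rspan_subset_span[OF YY_Mspan[OF that, unfolded Mspan_def im]] .
  then have "std_elem r n ` std_index r n \<subseteq> vs.span (?f ` murphy_index)"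
    using std_elem_YY by blast
  moreover have "card murphy_index \<le> card (std_elem r n ` std_index r n)"
    using card_pairs_Std[where r = r and n = n] card_image[OF std_elem_independent(1)] card_std_index by simp
  ultimately show "inj_on ?f murphy_index" "vs.independent (?f ` murphy_index)"
    using spanning_family_independent[where f = ?f, OF finite_murphy_index std_elem_independent(2)] by blast+
qed

lemma psi_murphy_image: "psi ` (\<lambda>(L, s, t). murphy r n L s t) ` I = (\<lambda>(L, s, t). Mst L s t) ` I"
  if "I \<subseteq> murphy_index" for I
  unfolding image_image by (rule image_cong[OF refl]) (use that psi_murphy in auto)

lemma murphy_basis_eq: "murphy_basis r n = (\<lambda>(L, s, t). murphy r n L s t) ` murphy_index"
  unfolding murphy_basis_def by force

lemma module_basis_murphy: "module_basis (coeff_ring r) YH (murphy_basis r n)"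
  unfolding murphy_basis_eq
proof (rule module_basisI)
  show "(\<lambda>(L, s, t). murphy r n L s t) ` murphy_index \<subseteq> carrier YH" using psi_murphy by auto
  show "vs.independent (psi ` (\<lambda>(L, s, t). murphy r n L s t) ` murphy_index)"
    unfolding psi_murphy_image[OF order_refl] by (rule Mst_independent)
  fix x assume "x \<in> YY"
  then show "x \<in> rspan r (psi ` (\<lambda>(L, s, t). murphy r n L s t) ` murphy_index)"
    unfolding psi_murphy_image[OF order_refl]
    by (intro rspan_mono[OF YY_Mspan[unfolded Mspan_def]]) force+
qed (simp add: finite_murphy_index)

lemma inj_on_murphy: "inj_on (\<lambda>(L, s, t). murphy r n L s t) murphy_index"
proof (rule inj_onI)
  fix x y assume x: "x \<in> murphy_index" and y: "y \<in> murphy_index"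
    and eq: "(\<lambda>(L, s, t). murphy r n L s t) x = (\<lambda>(L, s, t). murphy r n L s t) y"
  have p: "psi ((\<lambda>(L, s, t). murphy r n L s t) z) = (\<lambda>(L, s, t). Mst L s t) z" if "z \<in> murphy_index" for z
    using that psi_murphy by auto
  show "x = y"
    by (rule inj_onD[OF Mst_independent(1) _ x y]) (use p[OF x] p[OF y] eq in simp)
qed

text \<open>Multiplying the expansion of \<open>M L\<close> by the left factor of
  \<open>Mst L s t\<close> only changes the remainder inside the ideal, and
  \<open>Jset_Mspan\<close> rewrites it by strictly dominating Murphy elements.\<close>

lemma murphy_mult:
  assumes L: "L \<in> multipartitions r n" and t: "t \<in> Std L" and a: "a \<in> carrier YH"
  shows "\<exists>\<rho>\<in>Std L \<rightarrow> scalars r. \<forall>s\<in>Std L.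
    (murphy r n L s t \<otimes>\<^bsub>YH\<^esub> a) \<ominus>\<^bsub>YH\<^esub> (\<Oplus>\<^bsub>YH\<^esub>v\<in>Std L. \<rho> v \<odot>\<^bsub>YH\<^esub> murphy r n L s v) \<in>
      module_span (coeff_ring r) YH {murphy r n m u v | m u v.
        m \<in> multipartitions r n \<and> multidominates m L \<and> m \<noteq> L \<and> u \<in> Std m \<and> v \<in> Std m}"
    (is "\<exists>\<rho>\<in>_. \<forall>s\<in>_. ?d \<rho> s \<in> module_span _ _ ?S")
proof -
  have "gw r n (d_perm L t) * psi a \<in> YY" using a by (intro YY_closed gw_YY d_perm_permutes[OF L t] psi_YY)
  then obtain \<rho> j where \<rho>: "\<rho> \<in> Std L \<rightarrow> scalars r" "j \<in> Jset L"
    "M L * (gw r n (d_perm L t) * psi a) = (\<Sum>v\<in>Std L. C (\<rho> v) * (M L * gw r n (d_perm L v))) + j"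
    by (rule M_expansion[OF L])
  have S: "?S \<subseteq> carrier YH" using psi_murphy by blast
  have "?d \<rho> s \<in> module_span (coeff_ring r) YH ?S" if s: "s \<in> Std L" for s
  proof -
    let ?g = "gw r n (pinv (d_perm L s))"
    have g: "?g \<in> YY" by (intro gw_YY permutes_inv d_perm_permutes[OF L s])
    have \<rho>': "\<rho> v \<in> scalars r" if "v \<in> Std L" for v using \<rho>(1) that by auto
    note sum = psi_finsum[OF finite_Std, of L "\<lambda>v. \<rho> v \<odot>\<^bsub>YH\<^esub> murphy r n L s v"]
    have c: "\<rho> v \<odot>\<^bsub>YH\<^esub> murphy r n L s v \<in> carrier YH" if "v \<in> Std L" for v
      using \<rho>'[OF that] psi_murphy(1)[OF L s that] by simp
    have sum: "(\<Oplus>\<^bsub>YH\<^esub>v\<in>Std L. \<rho> v \<odot>\<^bsub>YH\<^esub> murphy r n L s v) \<in> carrier YH"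
      "psi (\<Oplus>\<^bsub>YH\<^esub>v\<in>Std L. \<rho> v \<odot>\<^bsub>YH\<^esub> murphy r n L s v) = (\<Sum>v\<in>Std L. C (\<rho> v) * Mst L s v)"
      using psi_finsum[OF finite_Std c] psi_murphy[OF L s] \<rho>' by (simp_all cong: sum.cong)
    have ma: "murphy r n L s t \<otimes>\<^bsub>YH\<^esub> a \<in> carrier YH" "psi (murphy r n L s t \<otimes>\<^bsub>YH\<^esub> a) = Mst L s t * psi a"
      using psi_murphy[OF L s t] a by simp_all
    have "Mst L s t * psi a = ?g * (M L * (gw r n (d_perm L t) * psi a))"
      by (simp only: Mst_def mult.assoc)
    also have "\<dots> = (\<Sum>v\<in>Std L. ?g * (C (\<rho> v) * (M L * gw r n (d_perm L v)))) + ?g * j"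
      unfolding \<rho>(3) by (simp only: distrib_left sum_distrib_left)
    also have "(\<Sum>v\<in>Std L. ?g * (C (\<rho> v) * (M L * gw r n (d_perm L v)))) = (\<Sum>v\<in>Std L. C (\<rho> v) * Mst L s v)"
      by (rule sum.cong[OF refl]) (simp only: Mst_def mult.assoc C_left_commute[of ?g])
    finally have "psi (?d \<rho> s) = ?g * j"
      using YH_minus(2)[OF ma(1) sum(1)] ma(2) sum(2) by simp
    then have "psi (?d \<rho> s) \<in> Mspan (above L - {L})"
      using Jset_Mspan[OF L Jset_left[OF \<rho>(2) g]] by simp
    then have "psi (?d \<rho> s) \<in> rspan r (psi ` ?S)"
      unfolding Mspan_def
    proof (rule rspan_mono, intro subsetI)
      fix x assume "x \<in> {Mst K u v | K u v. K \<in> above L - {L} \<and> u \<in> Std K \<and> v \<in> Std K}"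
      then obtain K u v where x: "x = Mst K u v" "K \<in> above L - {L}" "u \<in> Std K" "v \<in> Std K" by blast
      then have "x = psi (murphy r n K u v)" "murphy r n K u v \<in> ?S" using psi_murphy(2)[of K u v] by auto
      then show "x \<in> psi ` ?S" by blast
    qed
    then show ?thesis by (rule module_spanI[OF S YH_minus(1)[OF ma(1) sum(1)]])
  qed
  then show ?thesis using \<rho>(1) by blast
qed

lemma cellular_basis_murphy:
  "cellular_basis (coeff_ring r) YH (multipartitions r n) multidominates Std (murphy r n) (yh_star r n)"
  unfolding cellular_basis_def
proof (intro conjI)
  show "module_basis (coeff_ring r) YH {murphy r n l s t | l s t. l \<in> multipartitions r n \<and> s \<in> Std l \<and> t \<in> Std l}"
    using module_basis_murphy unfolding murphy_basis_def .
  show "\<forall>l\<in>multipartitions r n. finite (Std l)" by (simp add: finite_Std)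
  show "anti_automorphism (coeff_ring r) YH (yh_star r n)"
    unfolding yh_star_eq by (rule anti_automorphism_star)
  show "\<forall>l\<in>multipartitions r n. \<forall>s\<in>Std l. \<forall>t\<in>Std l. yh_star r n (murphy r n l s t) = murphy r n l t s"
    unfolding yh_star_eq by (simp add: psi_eq_iff psi_star psi_murphy st_Mst)
  show "\<forall>l\<in>multipartitions r n. \<forall>t\<in>Std l. \<forall>a\<in>carrier YH. \<exists>\<rho>\<in>Std l \<rightarrow> scalars r. \<forall>s\<in>Std l.
        (murphy r n l s t \<otimes>\<^bsub>YH\<^esub> a) \<ominus>\<^bsub>YH\<^esub> (\<Oplus>\<^bsub>YH\<^esub>v\<in>Std l. \<rho> v \<odot>\<^bsub>YH\<^esub> murphy r n l s v)
          \<in> module_span (coeff_ring r) YH {murphy r n m u v | m u v.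
              m \<in> multipartitions r n \<and> multidominates m l \<and> m \<noteq> l \<and> u \<in> Std m \<and> v \<in> Std m}"
    using murphy_mult by blast
qed (rule coeff_ring_domain YH_algebra multidominates_partial_order inj_on_murphy)+

end

theorem theorem33:
  fixes r n :: nat
  assumes "r \<ge> 1" and "n \<ge> 1"
  shows "module_basis (coeff_ring r) (yokonuma_hecke r n) (murphy_basis r n) \<and>
    cellular_basis (coeff_ring r) (yokonuma_hecke r n)
      (multipartitions r n) multidominates Std (murphy r n) (yh_star r n)"
proof -
  interpret yokonuma r n by standard (rule assms(1))
  show ?thesis using module_basis_murphy cellular_basis_murphy by blast
qed

end
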